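(* Let $d\ge1$ be an integer and $A=\binom{d+2}{2}-1$. Let $P$ be a finite set of points in $\mathbb{C}^2$ and $L$ a finite set of algebraic curves in $\mathbb{C}^2$ of degree at most $d$ such that any two distinct curves in $L$ (i) do not share a common irreducible component, and (ii) intersect transversally at smooth points. Then for every $\epsilon>0$, \[ |\mathcal{I}(P,L)|\le C_{\epsilon,d}\left(|P|^{\frac{A}{2A-1}+\epsilon}|L|^{\frac{2A-2}{2A-1}}+|P|+|L|\right) \] and \[ |\mathcal{I}(P,L)|\le C_{\epsilon,d}\left(|P|^{\frac{A}{2A-1}}|L|^{\frac{2A-2}{2A-1}+\epsilon}+|P|+|L|\right), \] where $C_{\epsilon,d}$ is a constant depending only on $\epsilon$ and $d$.
   Context: $\mathcal{I}(P,L)=\{(p,l)\in P\times L: p\in l\}$ is the set of incidences. *)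

theory Defs
  imports "HOL-Computational_Algebra.Computational_Algebra"
begin

text \<open>Bivariate complex polynomials f(x,y) are represented as univariate polynomials
  in x whose coefficients are univariate polynomials in y.\<close>

type_synonym bipoly = "complex poly poly"

definition eval2 :: "bipoly \<Rightarrow> complex \<times> complex \<Rightarrow> complex" where
  "eval2 f p = poly (map_poly (\<lambda>c. poly c (snd p)) f) (fst p)"

definition tdeg :: "bipoly \<Rightarrow> nat" where
  "tdeg f = Max {i + degree (coeff f i) | i. i \<le> degree f}"

definition dx :: "bipoly \<Rightarrow> bipoly" where
  "dx f = pderiv f"

definition dy :: "bipoly \<Rightarrow> bipoly" where
  "dy f = map_poly pderiv f"

definition zset :: "bipoly \<Rightarrow> (complex \<times> complex) set" where
  "zset f = {p. eval2 f p = 0}"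

text \<open>An algebraic curve of degree at most d, given by a reduced (squarefree)
  nonconstant defining polynomial.\<close>
definition is_curve :: "nat \<Rightarrow> bipoly \<Rightarrow> bool" where
  "is_curve d f \<longleftrightarrow> squarefree f \<and> 1 \<le> tdeg f \<and> tdeg f \<le> d"

definition smooth_point :: "bipoly \<Rightarrow> complex \<times> complex \<Rightarrow> bool" where
  "smooth_point f p \<longleftrightarrow> eval2 f p = 0 \<and> (eval2 (dx f) p \<noteq> 0 \<or> eval2 (dy f) p \<noteq> 0)"

definition no_common_component :: "bipoly \<Rightarrow> bipoly \<Rightarrow> bool" where
  "no_common_component f g \<longleftrightarrow> \<not> (\<exists>h. irreducible h \<and> h dvd f \<and> h dvd g)"

definition transversal :: "bipoly \<Rightarrow> bipoly \<Rightarrow> bool" where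
  "transversal f g \<longleftrightarrow> (\<forall>p \<in> zset f \<inter> zset g.
      smooth_point f p \<and> smooth_point g p \<and>
      eval2 (dx f) p * eval2 (dy g) p - eval2 (dy f) p * eval2 (dx g) p \<noteq> 0)"

definition incidences :: "(complex \<times> complex) set \<Rightarrow> bipoly set \<Rightarrow> ((complex \<times> complex) \<times> bipoly) set" where
  "incidences P L = {(p, l) \<in> P \<times> L. p \<in> zset l}"

end

theory Submission
  imports Defs "HOL-Homology.Homology" "HOL-Analysis.Analysis" "HOL-Library.Function_Algebras"
begin

text \<open>
  The proof follows Solymosi and Tao: partition the points by real polynomials into a constant number \<open>M\<close> of cells, such that
  every curve meets only \<open>O(sqrt M)\<close> of them, and induct on the number of points; the loss in the constant is absorbed by \<open>\<epsilon>\<close>.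

  In \<open>\<complex>\<^sup>2 = \<real>\<^sup>4\<close> a complex curve is a surface, which gives the bound \<open>O(sqrt M)\<close>. A point on a cell wall is a regular zero of one of
  boundedly many real polynomials \<open>Q\<close>. By transversality at most one curve through such a point is singular there or has its complex
  tangent line inside the real tangent space of \<open>Q = 0\<close>; every other curve meets the wall in a smooth real curve. These are
  projected generically to \<open>\<complex> = \<real>\<^sup>2\<close> and partitioned once more, and now a wall is met in \<open>O(1)\<close> points by each curve, apart from at
  most one curve through each point.

  Curves with more than \<open>(d + 1)\<^sup>4\<close> points are determined by at most \<open>A\<close> of them, so that there are at most \<open>|P| ^ A\<close> such curves, and
  the linear term in \<open>|L|\<close> is dominated by the main term. The second inequality follows from the first since at most
  \<open>O(|L|\<^sup>2)\<close> points lie on two curves.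
\<close>

section \<open>The Borsuk-Ulam theorem for Lipschitz maps\<close>

text \<open>Both partitions have constant size, fixed by d and \<epsilon>, so every degree in the
  proof is a constant and bounds exponential in the degree are affordable; only the number of cells
  met by a curve must have the right order. In \<real>^4 the figures are \<open>2 ^ (4 * T)\<close>
  cells, degree sum \<open>O(2 ^ T)\<close> and \<open>O(2 ^ (2 * T))\<close> cells met; in the
  plane they are \<open>2 ^ (2 * T)\<close>, \<open>O(2 ^ T)\<close> and \<open>O(2 ^ T)\<close>.
  Cells are sign vectors of the partitioning polynomials. Counting those that occur on a curve
  replaces counting the components of the curve: a generic linear change of coordinates makes the
  curve a finite covering of a plane or a line, and components are counted only in the base, by
  critical points of a perturbed polynomial. The exponents \<alpha> of |P| and \<beta> of |L| are
  fixed by two relations: \<alpha> + \<beta> / 2 = 1 makes the sum over the cells scale invariant up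
  to \<epsilon>, and A * (1 - \<beta>) = \<alpha> turns |L| \<le> |P| ^ A into |L| \<le> |P| powr
  \<alpha> * |L| powr \<beta>.\<close>

definition usph :: "nat \<Rightarrow> (nat \<Rightarrow> real) set" where
  "usph n = {x. (\<Sum>i\<le>n. (x i)\<^sup>2) = 1 \<and> (\<forall>i>n. x i = 0)}"

lemma nsphere_usph: "nsphere n = top_of_set (usph n)"
proof -
  have "{x. (\<forall>i\<ge>Suc n. x i = 0)} \<inter> {x::nat \<Rightarrow> real. (\<Sum>i\<le>n. (x i)\<^sup>2) = 1} = usph n"
    by (auto simp: usph_def Suc_le_eq)
  then show ?thesis
    by (simp add: nsphere_def Euclidean_space_def subtopology_subtopology euclidean_product_topology)
qed

lemma topspace_nsphere: "topspace (nsphere n) = usph n"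
  by (simp add: nsphere_usph)

section \<open>Lipschitz functions on the sphere\<close>

text \<open>On \<open>usph n\<close> all coordinates beyond n vanish, so the sum is the full l1
  distance. This form makes sums of functions and restrictions to smaller spheres immediate.\<close>

definition lip_on :: "nat \<Rightarrow> ((nat \<Rightarrow> real) \<Rightarrow> real) \<Rightarrow> bool" where
  "lip_on n g \<longleftrightarrow> (\<exists>B. \<forall>x\<in>usph n. \<forall>y\<in>usph n. \<bar>g x - g y\<bar> \<le> B * (\<Sum>j\<le>n. \<bar>x j - y j\<bar>))"

lemma isCont_coord: "isCont (\<lambda>x::nat \<Rightarrow> real. x i) x"
  by (rule continuous_on_interior[OF continuous_on_product_coordinates]) simp

lemma lip_on_continuous:
  assumes "lip_on n g" shows "continuous_on (usph n) g"
proof -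
  obtain B where B: "\<And>x y. x \<in> usph n \<Longrightarrow> y \<in> usph n \<Longrightarrow> \<bar>g x - g y\<bar> \<le> B * (\<Sum>j\<le>n. \<bar>x j - y j\<bar>)"
    using assms unfolding lip_on_def by blast
  show ?thesis
    unfolding continuous_on_def
  proof
    fix a assume a: "a \<in> usph n"
    have coord: "((\<lambda>x. x j) \<longlongrightarrow> a j) (at a within usph n)" for j
      using isCont_coord[where x=a and i=j] unfolding isCont_def by (rule tendsto_within_subset) simp
    have "((\<lambda>x. B * (\<Sum>j\<le>n. \<bar>x j - a j\<bar>)) \<longlongrightarrow> B * (\<Sum>j\<le>n. \<bar>a j - a j\<bar>)) (at a within usph n)"
      by (intro tendsto_intros coord)
    then have lim: "((\<lambda>x. B * (\<Sum>j\<le>n. \<bar>x j - a j\<bar>)) \<longlongrightarrow> 0) (at a within usph n)"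
      by simp
    have "eventually (\<lambda>x. norm (g x - g a) \<le> B * (\<Sum>j\<le>n. \<bar>x j - a j\<bar>)) (at a within usph n)"
      unfolding eventually_at using B a by (auto intro!: exI[of _ 1])
    from Lim_null_comparison[OF this lim]
    show "(g \<longlongrightarrow> g a) (at a within usph n)"
      by (rule LIM_zero_cancel)
  qed
qed

lemma compact_usph: "compact (usph n)"
proof -
  have "closed (usph n)"
  proof -
    have "usph n = (\<lambda>x. \<Sum>i\<le>n. (x i)\<^sup>2) -` {1} \<inter> (\<Inter>i\<in>{n<..}. (\<lambda>x. x i) -` {0})"
      by (auto simp: usph_def)
    moreover have "closed ((\<lambda>x::nat\<Rightarrow>real. \<Sum>i\<le>n. (x i)\<^sup>2) -` {1})"
      by (intro continuous_closed_vimage continuous_intros) (rule isCont_coord)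
    moreover have "closed ((\<lambda>x::nat\<Rightarrow>real. x i) -` {0})" for i
      by (intro continuous_closed_vimage isCont_coord) auto
    ultimately show ?thesis by (auto intro!: closed_Int closed_INT)
  qed
  moreover have "compact (PiE UNIV (\<lambda>i::nat. {-1..1::real}))"
    by (metis compactin_PiE compactin_euclidean_iff compact_Icc euclidean_product_topology)
  moreover have "usph n \<subseteq> PiE UNIV (\<lambda>i::nat. {-1..1::real})"
  proof
    fix x assume x: "x \<in> usph n"
    have "x i \<in> {-1..1}" for i
    proof (cases "i \<le> n")
      case True
      have "(x i)\<^sup>2 \<le> (\<Sum>i\<le>n. (x i)\<^sup>2)"
        using True by (intro member_le_sum) auto
      then have "\<bar>x i\<bar> \<le> 1" using x by (simp add: usph_def abs_square_le_1)
      then show ?thesis by auto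
    next
      case False then show ?thesis using x by (auto simp: usph_def)
    qed
    then show "x \<in> PiE UNIV (\<lambda>i::nat. {-1..1::real})" by auto
  qed
  ultimately show ?thesis
    by (metis compact_Int_closed inf.absorb_iff2)
qed

lemma usph_abs_le:
  assumes "x \<in> usph n" shows "\<bar>x i\<bar> \<le> 1"
proof (cases "i \<le> n")
  case True
  have "(x i)\<^sup>2 \<le> (\<Sum>i\<le>n. (x i)\<^sup>2)"
    using True by (intro member_le_sum) auto
  then show ?thesis using assms by (simp add: usph_def abs_square_le_1)
next
  case False then show ?thesis using assms by (auto simp: usph_def)
qed

lemma usph_uminus: "x \<in> usph n \<Longrightarrow> (\<lambda>i. - x i) \<in> usph n"
  by (auto simp: usph_def)

lemma usph_nonempty: "(\<lambda>i. if i = k then 1 else 0) \<in> usph n" if "k \<le> n"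
  using that by (auto simp: usph_def if_distrib[of "\<lambda>x. x^2"] cong: if_cong)

lemma usph_Suc: "x \<in> usph n \<longleftrightarrow> x \<in> usph (Suc n) \<and> x (Suc n) = 0"
  by (auto simp: usph_def) (metis Suc_lessI)

lemma usph_mono: "m \<le> n \<Longrightarrow> usph m \<subseteq> usph n"
proof (induction n)
  case (Suc n) then show ?case using usph_Suc by (metis le_Suc_eq subset_iff)
qed auto

lemma L2_set_usph: "x \<in> usph n \<Longrightarrow> L2_set x {..n} = 1"
  by (simp add: usph_def L2_set_def)

lemma L2_set_diff: "\<bar>L2_set x A - L2_set y A\<bar> \<le> (\<Sum>i\<in>A. \<bar>x i - y i\<bar>)"
proof -
  have 1: "L2_set x A \<le> L2_set y A + (\<Sum>i\<in>A. \<bar>x i - y i\<bar>)" for x y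
  proof -
    have "L2_set x A \<le> L2_set y A + L2_set (\<lambda>i. x i - y i) A"
      using L2_set_triangle_ineq[of y "\<lambda>i. x i - y i" A] by simp
    then show ?thesis using L2_set_le_sum_abs[of "\<lambda>i. x i - y i" A] by linarith
  qed
  show ?thesis using 1[of x y] 1[of y x] by (simp add: abs_minus_commute)
qed

lemma lip_onI: "(\<And>x y. x \<in> usph n \<Longrightarrow> y \<in> usph n \<Longrightarrow> \<bar>g x - g y\<bar> \<le> B * (\<Sum>j\<le>n. \<bar>x j - y j\<bar>)) \<Longrightarrow> lip_on n g"
  unfolding lip_on_def by blast

lemma lip_onE:
  assumes "lip_on n g"
  obtains B where "B \<ge> 0" "\<And>x y. x \<in> usph n \<Longrightarrow> y \<in> usph n \<Longrightarrow> \<bar>g x - g y\<bar> \<le> B * (\<Sum>j\<le>n. \<bar>x j - y j\<bar>)"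
proof -
  obtain B where B: "\<And>x y. x \<in> usph n \<Longrightarrow> y \<in> usph n \<Longrightarrow> \<bar>g x - g y\<bar> \<le> B * (\<Sum>j\<le>n. \<bar>x j - y j\<bar>)"
    using assms unfolding lip_on_def by blast
  show ?thesis
  proof (rule that[of "\<bar>B\<bar>"])
    fix x y assume "x \<in> usph n" "y \<in> usph n"
    then have "\<bar>g x - g y\<bar> \<le> B * (\<Sum>j\<le>n. \<bar>x j - y j\<bar>)" by (rule B)
    also have "\<dots> \<le> \<bar>B\<bar> * (\<Sum>j\<le>n. \<bar>x j - y j\<bar>)"
      by (intro mult_right_mono sum_nonneg) auto
    finally show "\<bar>g x - g y\<bar> \<le> \<bar>B\<bar> * (\<Sum>j\<le>n. \<bar>x j - y j\<bar>)" .
  qed auto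
qed

lemma lip_on_add: "lip_on n f \<Longrightarrow> lip_on n g \<Longrightarrow> lip_on n (\<lambda>x. f x + g x)"
proof -
  assume *: "lip_on n f" "lip_on n g"
  obtain B where B: "B \<ge> 0" "\<And>x y. x \<in> usph n \<Longrightarrow> y \<in> usph n \<Longrightarrow> \<bar>f x - f y\<bar> \<le> B * (\<Sum>j\<le>n. \<bar>x j - y j\<bar>)"
    using lip_onE[OF *(1)] by blast
  obtain C where C: "C \<ge> 0" "\<And>x y. x \<in> usph n \<Longrightarrow> y \<in> usph n \<Longrightarrow> \<bar>g x - g y\<bar> \<le> C * (\<Sum>j\<le>n. \<bar>x j - y j\<bar>)"
    using lip_onE[OF *(2)] by blast
  show ?thesis
  proof (rule lip_onI[of _ _ "B + C"])
    fix x y assume xy: "x \<in> usph n" "y \<in> usph n"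
    then show "\<bar>f x + g x - (f y + g y)\<bar> \<le> (B + C) * (\<Sum>j\<le>n. \<bar>x j - y j\<bar>)"
      using B(2)[OF xy] C(2)[OF xy] by (simp add: distrib_right abs_if split: if_splits)
  qed
qed

lemma lip_on_cmult: "lip_on n f \<Longrightarrow> lip_on n (\<lambda>x. c * f x)"
proof -
  assume *: "lip_on n f"
  obtain B where B: "B \<ge> 0" "\<And>x y. x \<in> usph n \<Longrightarrow> y \<in> usph n \<Longrightarrow> \<bar>f x - f y\<bar> \<le> B * (\<Sum>j\<le>n. \<bar>x j - y j\<bar>)"
    using lip_onE[OF *] by blast
  show ?thesis
  proof (rule lip_onI[of _ _ "\<bar>c\<bar> * B"])
    fix x y assume xy: "x \<in> usph n" "y \<in> usph n"
    have "\<bar>c * f x - c * f y\<bar> = \<bar>c\<bar> * \<bar>f x - f y\<bar>"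
      by (simp add: abs_mult right_diff_distrib[symmetric])
    also have "\<dots> \<le> \<bar>c\<bar> * (B * (\<Sum>j\<le>n. \<bar>x j - y j\<bar>))"
      by (intro mult_left_mono B xy) auto
    finally show "\<bar>c * f x - c * f y\<bar> \<le> \<bar>c\<bar> * B * (\<Sum>j\<le>n. \<bar>x j - y j\<bar>)" by simp
  qed
qed

lemma lip_on_const: "lip_on n (\<lambda>x. c)"
  by (rule lip_onI[of _ _ 0]) auto

lemma lip_on_sum: "finite A \<Longrightarrow> (\<And>a. a \<in> A \<Longrightarrow> lip_on n (f a)) \<Longrightarrow> lip_on n (\<lambda>x. \<Sum>a\<in>A. f a x)"
  by (induction A rule: finite_induct) (auto intro: lip_on_add lip_on_const)

lemma lip_on_coord: "j \<le> n \<Longrightarrow> lip_on n (\<lambda>x. x j)"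
  by (rule lip_onI[of _ _ 1]) (auto intro!: member_le_sum)

lemma lip_on_compose:
  assumes "lip_on n f" "\<And>s t::real. \<bar>\<phi> s - \<phi> t\<bar> \<le> C * \<bar>s - t\<bar>"
  shows "lip_on n (\<lambda>x. \<phi> (f x) :: real)"
proof -
  obtain B where B: "B \<ge> 0" "\<And>x y. x \<in> usph n \<Longrightarrow> y \<in> usph n \<Longrightarrow> \<bar>f x - f y\<bar> \<le> B * (\<Sum>j\<le>n. \<bar>x j - y j\<bar>)"
    using lip_onE[OF assms(1)] by blast
  have C: "C \<ge> 0" using assms(2)[of 0 1] by auto
  show ?thesis
  proof (rule lip_onI[of _ _ "C * B"])
    fix x y assume xy: "x \<in> usph n" "y \<in> usph n"
    have "\<bar>\<phi> (f x) - \<phi> (f y)\<bar> \<le> C * \<bar>f x - f y\<bar>" by (rule assms)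
    also have "\<dots> \<le> C * (B * (\<Sum>j\<le>n. \<bar>x j - y j\<bar>))"
      using C by (intro mult_left_mono B xy) auto
    finally show "\<bar>\<phi> (f x) - \<phi> (f y)\<bar> \<le> C * B * (\<Sum>j\<le>n. \<bar>x j - y j\<bar>)" by simp
  qed
qed

lemma lip_on_subset:
  assumes "lip_on n f" "m \<le> n" shows "lip_on m f"
proof -
  obtain B where B: "B \<ge> 0" "\<And>x y. x \<in> usph n \<Longrightarrow> y \<in> usph n \<Longrightarrow> \<bar>f x - f y\<bar> \<le> B * (\<Sum>j\<le>n. \<bar>x j - y j\<bar>)"
    using lip_onE[OF assms(1)] by blast
  show ?thesis
  proof (rule lip_onI[of _ _ B])
    fix x y assume xy: "x \<in> usph m" "y \<in> usph m"
    have "(\<Sum>j\<le>n. \<bar>x j - y j\<bar>) = (\<Sum>j\<le>m. \<bar>x j - y j\<bar>)"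
      using xy assms(2) by (intro sum.mono_neutral_right) (auto simp: usph_def)
    moreover have "x \<in> usph n" "y \<in> usph n" using xy usph_mono[OF assms(2)] by auto
    ultimately show "\<bar>f x - f y\<bar> \<le> B * (\<Sum>j\<le>m. \<bar>x j - y j\<bar>)"
      using B(2)[of x y] by simp
  qed
qed

text \<open>The norm of F is continuous and positive on a compact sphere, hence bounded below by
  some c > 0, and dividing by it costs a factor of order 1 / c in the Lipschitz constant.\<close>

lemma lip_on_normalise:
  fixes F :: "(nat \<Rightarrow> real) \<Rightarrow> nat \<Rightarrow> real" and k :: nat
  assumes lip: "\<And>i. i \<le> k \<Longrightarrow> lip_on n (\<lambda>x. F x i)"
    and nz: "\<And>x. x \<in> usph n \<Longrightarrow> \<exists>i\<le>k. F x i \<noteq> 0"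
    and i: "i \<le> k"
  shows "lip_on n (\<lambda>x. F x i / L2_set (F x) {..k})"
proof -
  have "\<exists>B. B \<ge> 0 \<and> (\<forall>x\<in>usph n. \<forall>y\<in>usph n. \<bar>F x i - F y i\<bar> \<le> B * (\<Sum>j\<le>n. \<bar>x j - y j\<bar>))" if "i \<le> k" for i
    using lip_onE[OF lip[OF that]] by metis
  then have "\<forall>i\<in>{..k}. \<exists>B. B \<ge> 0 \<and> (\<forall>x\<in>usph n. \<forall>y\<in>usph n. \<bar>F x i - F y i\<bar> \<le> B * (\<Sum>j\<le>n. \<bar>x j - y j\<bar>))"
    by blast
  from bchoice[OF this] obtain B where B0: "\<And>i. i \<le> k \<Longrightarrow> B i \<ge> 0" 
    and B: "\<And>i x y. i \<le> k \<Longrightarrow> x \<in> usph n \<Longrightarrow> y \<in> usph n \<Longrightarrow> \<bar>F x i - F y i\<bar> \<le> B i * (\<Sum>j\<le>n. \<bar>x j - y j\<bar>)"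
    by (auto simp: atMost_iff)
  have cont: "continuous_on (usph n) (\<lambda>x. L2_set (F x) {..k})"
    unfolding L2_set_def by (intro continuous_intros lip_on_continuous lip) auto
  have ne: "usph n \<noteq> {}" using usph_nonempty[of 0 n] by auto
  obtain x0 where x0: "x0 \<in> usph n" "\<And>x. x \<in> usph n \<Longrightarrow> L2_set (F x0) {..k} \<le> L2_set (F x) {..k}"
    using continuous_attains_inf[OF compact_usph ne cont] by auto
  define c where "c = L2_set (F x0) {..k}"
  have pos: "L2_set (F x) {..k} > 0" if "x \<in> usph n" for x
    proof -
    have "L2_set (F x) {..k} \<noteq> 0" using nz[OF that] L2_set_eq_0_iff[of "{..k}" "F x"] by auto
    then show ?thesis using L2_set_nonneg[of "F x" "{..k}"] by linarith
  qed
  have c: "c > 0" "\<And>x. x \<in> usph n \<Longrightarrow> c \<le> L2_set (F x) {..k}"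
    using x0 pos unfolding c_def by auto
  define S where "S = (\<Sum>j\<le>k. B j)"
  have S: "(\<Sum>j\<le>k. \<bar>F x j - F y j\<bar>) \<le> S * (\<Sum>j\<le>n. \<bar>x j - y j\<bar>)" if "x \<in> usph n" "y \<in> usph n" for x y
    unfolding S_def sum_distrib_right by (intro sum_mono B that) auto
  show ?thesis
  proof (rule lip_onI[of _ _ "2 * S / c"])
    fix x y assume xy: "x \<in> usph n" "y \<in> usph n"
    define a where "a = L2_set (F x) {..k}"
    define b where "b = L2_set (F y) {..k}"
    define D where "D = (\<Sum>j\<le>k. \<bar>F x j - F y j\<bar>)"
    have ab: "a \<ge> c" "b \<ge> c" using c xy by (auto simp: a_def b_def)
    have ab0: "a > 0" "b > 0" using ab c by auto
    have D: "\<bar>a - b\<bar> \<le> D" unfolding a_def b_def D_def by (rule L2_set_diff)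
    have Di: "\<bar>F x i - F y i\<bar> \<le> D" unfolding D_def using i by (intro member_le_sum) auto
    have Fb: "\<bar>F y i\<bar> \<le> b" unfolding b_def using i
      using member_le_L2_set[of "{..k}" i "\<lambda>i. \<bar>F y i\<bar>"] by (simp add: L2_set_def)
    have eq: "F x i / a - F y i / b = (F x i - F y i) / a + F y i / b * ((b - a) / a)"
      using ab0 by (simp add: field_simps)
    have "\<bar>F x i / a - F y i / b\<bar> \<le> \<bar>F x i - F y i\<bar> / a + \<bar>F y i\<bar> / b * (\<bar>b - a\<bar> / a)"
      unfolding eq using ab0 by (intro order_trans[OF abs_triangle_ineq]) (simp add: abs_mult)
    also have "\<dots> \<le> D / a + 1 * (D / a)"
      using Di Fb D ab0 by (intro add_mono mult_mono divide_right_mono) (auto simp: abs_minus_commute)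
    also have "\<dots> = 2 * D / a" by simp
    also have "\<dots> \<le> 2 * D / c"
      using ab c ab0 by (intro divide_left_mono) (auto simp: D_def sum_nonneg)
    also have "\<dots> \<le> 2 * (S * (\<Sum>j\<le>n. \<bar>x j - y j\<bar>)) / c"
      using S[OF xy] c by (intro divide_right_mono) (auto simp: D_def)
    finally show "\<bar>F x i / L2_set (F x) {..k} - F y i / L2_set (F y) {..k}\<bar> \<le> 2 * S / c * (\<Sum>j\<le>n. \<bar>x j - y j\<bar>)"
      by (simp add: a_def b_def)
  qed
qed

lemma lip_on_coord_all: "lip_on n (\<lambda>x. x j)"
proof (cases "j \<le> n")
  case False
  show ?thesis by (rule lip_onI[of _ _ 0]) (use False in \<open>auto simp: usph_def\<close>)
qed (rule lip_on_coord)

lemma lip_on_cong: "lip_on n f \<Longrightarrow> (\<And>x. x \<in> usph n \<Longrightarrow> f x = g x) \<Longrightarrow> lip_on n g"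
  unfolding lip_on_def by metis

text \<open>R is the reflection in the hyperplane orthogonal to v - e, where e is the pole. It is an
  involution that swaps v and e, and being linear it commutes with negation and preserves
  coordinatewise Lipschitz maps. For v = e the vector u is zero and the formula gives the
  identity.\<close>

lemma usph_rotate_to_pole:
  assumes v: "v \<in> usph n"
  obtains R where "\<And>x. x \<in> usph n \<Longrightarrow> R x \<in> usph n" "\<And>x. x \<in> usph n \<Longrightarrow> R (R x) = x"
    "\<And>x. R (\<lambda>i. - x i) = (\<lambda>i. - R x i)" "R v = (\<lambda>i. if i = n then 1 else 0)"
    "\<And>m (f :: (nat \<Rightarrow> real) \<Rightarrow> nat \<Rightarrow> real) i. (\<And>i. lip_on m (\<lambda>x. f x i)) \<Longrightarrow> lip_on m (\<lambda>x. R (f x) i)"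
proof -
  define e where "e = (\<lambda>i. if i = n then 1 else (0::real))"
  define u where "u = (\<lambda>i. v i - e i)"
  define q where "q = (\<Sum>i\<le>n. (u i)\<^sup>2)"
  define R where "R = (\<lambda>(x::nat\<Rightarrow>real) i. x i - 2 * (\<Sum>j\<le>n. x j * u j) / q * u i)"
  have usup: "u i = 0" if "i > n" for i using that v by (auto simp: u_def e_def usph_def)
  have sve: "(\<Sum>j\<le>n. v j * e j) = v n" unfolding e_def by (simp add: if_distrib[of "\<lambda>x. _ * x"] cong: if_cong)
  have see: "(\<Sum>j\<le>n. e j * e j) = 1" unfolding e_def by (simp add: if_distrib[of "\<lambda>x. _ * x"] cong: if_cong)
  have svv: "(\<Sum>j\<le>n. v j * v j) = 1" using v by (simp add: usph_def power2_eq_square)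
  have su: "(\<Sum>j\<le>n. v j * u j) = 1 - v n"
    unfolding u_def using svv sve by (simp add: right_diff_distrib sum_subtractf)
  have q: "q = 2 - 2 * v n"
  proof -
    have "q = (\<Sum>i\<le>n. v i * v i - 2 * (v i * e i) + e i * e i)"
      unfolding q_def u_def by (intro sum.cong) (auto simp: power2_eq_square algebra_simps)
    also have "\<dots> = 1 - 2 * v n + 1"
      unfolding sum.distrib sum_subtractf sum_distrib_left[symmetric] using svv sve see by simp
    finally show ?thesis by simp
  qed
  have q0: "u = (\<lambda>i. 0)" if "q = 0"
  proof
    fix i show "u i = 0"
    proof (cases "i \<le> n")
      case True
      then show ?thesis using that unfolding q_def by (simp add: sum_nonneg_eq_0_iff)
    qed (use usup in auto)
  qed
  define s where "s = (\<lambda>x. \<Sum>j\<le>n. x j * u j)"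
  have sy: "s y = (\<Sum>j\<le>n. y j * u j)" for y by (simp add: s_def)
  have R: "R x i = x i - 2 * s x / q * u i" for x i by (simp add: R_def s_def)
  have sR: "s (R x) = - s x" if "q \<noteq> 0" for x
  proof -
    have "s (R x) = (\<Sum>j\<le>n. x j * u j - 2 * s x / q * (u j)\<^sup>2)"
      unfolding sy[of "R x"] R by (intro sum.cong) (auto simp: algebra_simps power2_eq_square)
    also have "\<dots> = s x - 2 * s x / q * q"
      unfolding q_def[symmetric] sum_subtractf sum_distrib_left[symmetric] by (simp add: s_def)
    finally show ?thesis using that by simp
  qed
  show ?thesis
  proof (rule that[of R])
    fix x assume x: "x \<in> usph n"
    show "R (R x) = x"
    proof (cases "q = 0")
      case False
      show ?thesis by (rule ext) (simp add: R[of "R x"] sR[OF False] R[of x])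
    next
      case True
      show ?thesis by (rule ext) (simp add: R True)
    qed
    show "R x \<in> usph n"
    proof (cases "q = 0")
      case True
      then have "R x = x" by (auto simp: R)
      then show ?thesis using x by simp
    next
      case False
      have "(\<Sum>i\<le>n. (R x i)\<^sup>2) = (\<Sum>i\<le>n. (x i)\<^sup>2 - 4 * s x / q * (x i * u i) + (2 * s x / q)\<^sup>2 * (u i)\<^sup>2)"
        unfolding R by (intro sum.cong) (auto simp: power2_eq_square algebra_simps)
      also have "\<dots> = 1 - 4 * s x / q * s x + (2 * s x / q)\<^sup>2 * q"
        unfolding sum.distrib sum_subtractf sum_distrib_left[symmetric]
        using x by (simp add: q_def[symmetric] sy[symmetric] usph_def)
      also have "\<dots> = 1" using False by (simp add: power2_eq_square field_simps)
      finally show ?thesis using x usup by (auto simp: usph_def R)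
    qed
  next
    fix x show "R (\<lambda>i. - x i) = (\<lambda>i. - R x i)"
      by (rule ext) (simp add: R_def sum_negf)
  next
    show "R v = (\<lambda>i. if i = n then 1 else 0)"
    proof (cases "q = 0")
      case True
      then have "u = (\<lambda>i. 0)" by (rule q0)
      then have "v = e" by (auto simp: u_def fun_eq_iff)
      then show ?thesis using True by (auto simp: R e_def fun_eq_iff)
    next
      case False
      have "2 * s v / q = 1" using False su q by (simp add: s_def)
      then have "R v = e" by (auto simp: R u_def)
      then show ?thesis by (simp add: e_def)
    qed
  next
    fix m i and f :: "(nat \<Rightarrow> real) \<Rightarrow> nat \<Rightarrow> real"
    assume f: "\<And>i. lip_on m (\<lambda>x. f x i)"
    have eq: "(\<lambda>x. R (f x) i) = (\<lambda>x. f x i + (\<Sum>j\<le>n. (- 2 / q * u i * u j) * f x j))"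
    proof
      fix x
      have "(\<Sum>j\<le>n. (- 2 / q * u i * u j) * f x j) = - 2 / q * u i * (\<Sum>j\<le>n. f x j * u j)"
        unfolding sum_distrib_left by (intro sum.cong) auto
      then show "R (f x) i = f x i + (\<Sum>j\<le>n. (- 2 / q * u i * u j) * f x j)"
        by (simp add: R_def)
    qed
    show "lip_on m (\<lambda>x. R (f x) i)"
      unfolding eq by (intro lip_on_add f lip_on_sum lip_on_cmult) auto
  qed
qed

section \<open>Lipschitz images of spheres of lower dimension\<close>

text \<open>The numbers s and t are the norms of the points s x and t y, so they differ by at most
  the l1 distance of these points. Consequently the radial extension s x \<mapsto> s g(x) of a
  bounded Lipschitz function to the cone over the sphere is again Lipschitz, near the origin
  too.\<close>

lemma cone_difference_bound:
  assumes x: "x \<in> usph m" and y: "y \<in> usph m" and s: "s \<ge> 0" and t: "t \<ge> 0"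
    and B: "B \<ge> 0" "\<bar>g x - g y\<bar> \<le> B * (\<Sum>j\<le>m. \<bar>x j - y j\<bar>)" and g: "\<bar>g x\<bar> \<le> 1"
  shows "\<bar>s * g x - t * g y\<bar> \<le> (1 + B * real (m + 2)) * (\<Sum>j\<le>m. \<bar>s * x j - t * y j\<bar>)"
proof -
  define \<Delta> where "\<Delta> = (\<Sum>j\<le>m. \<bar>s * x j - t * y j\<bar>)"
  have \<Delta>0: "\<Delta> \<ge> 0" by (simp add: \<Delta>_def sum_nonneg)
  have "L2_set (\<lambda>j. s * x j) {..m} = s" "L2_set (\<lambda>j. t * y j) {..m} = t"
    using L2_set_usph[OF x] L2_set_usph[OF y] s t by (simp_all add: L2_set_right_distrib[symmetric])
  then have st: "\<bar>s - t\<bar> \<le> \<Delta>"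
    using L2_set_diff[of "\<lambda>j. s * x j" "{..m}" "\<lambda>j. t * y j"] by (simp add: \<Delta>_def)
  have "t * \<bar>x j - y j\<bar> \<le> \<bar>s * x j - t * y j\<bar> + \<bar>s - t\<bar>" for j
  proof -
    have "t * \<bar>x j - y j\<bar> = \<bar>(s * x j - t * y j) - (s - t) * x j\<bar>"
      using t by (simp add: algebra_simps abs_mult_pos')
    also have "\<dots> \<le> \<bar>s * x j - t * y j\<bar> + \<bar>s - t\<bar> * \<bar>x j\<bar>"
      using abs_triangle_ineq4[of "s * x j - t * y j" "(s - t) * x j"] by (simp add: abs_mult)
    also have "\<dots> \<le> \<bar>s * x j - t * y j\<bar> + \<bar>s - t\<bar> * 1"
      using usph_abs_le[OF x] by (intro add_left_mono mult_left_mono) auto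
    finally show ?thesis by simp
  qed
  then have "(\<Sum>j\<le>m. t * \<bar>x j - y j\<bar>) \<le> (\<Sum>j\<le>m. \<bar>s * x j - t * y j\<bar> + \<bar>s - t\<bar>)"
    by (rule sum_mono)
  also have "\<dots> \<le> \<Delta> + real (m + 1) * \<Delta>"
    using st by (simp add: sum.distrib \<Delta>_def[symmetric] mult_left_mono)
  finally have 1: "t * (\<Sum>j\<le>m. \<bar>x j - y j\<bar>) \<le> real (m + 2) * \<Delta>"
    by (simp add: sum_distrib_left algebra_simps)
  have "\<bar>s * g x - t * g y\<bar> = \<bar>(s - t) * g x + t * (g x - g y)\<bar>" by (simp add: algebra_simps)
  also have "\<dots> \<le> \<bar>s - t\<bar> * \<bar>g x\<bar> + t * \<bar>g x - g y\<bar>"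
    using abs_triangle_ineq[of "(s - t) * g x" "t * (g x - g y)"] t by (simp add: abs_mult)
  also have "\<dots> \<le> \<Delta> * 1 + t * (B * (\<Sum>j\<le>m. \<bar>x j - y j\<bar>))"
    using st g B t \<Delta>0 by (intro add_mono mult_mono mult_left_mono) auto
  also have "\<dots> = \<Delta> + B * (t * (\<Sum>j\<le>m. \<bar>x j - y j\<bar>))" by simp
  also have "\<dots> \<le> \<Delta> + B * (real (m + 2) * \<Delta>)"
    using 1 B by (intro add_left_mono mult_left_mono) auto
  finally show ?thesis by (simp add: \<Delta>_def algebra_simps)
qed

text \<open>A merely continuous map could be space-filling; the Lipschitz hypothesis is what makes the image a null set.\<close>

lemma lipschitz_not_surj_usph:
  assumes lip: "\<And>i. lip_on m (\<lambda>x. f x i)" and f: "\<And>x. x \<in> usph m \<Longrightarrow> f x \<in> usph (Suc m)"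
  obtains v where "v \<in> usph (Suc m)" "v \<notin> f ` usph m"
proof (rule ccontr)
  assume "\<not> thesis"
  then have surj: "\<And>v. v \<in> usph (Suc m) \<Longrightarrow> \<exists>x\<in>usph m. f x = v" using that by blast
  define N where "N = Suc m"
  have "\<forall>i\<in>{..N}. \<exists>B. B \<ge> 0 \<and> (\<forall>x\<in>usph m. \<forall>y\<in>usph m. \<bar>f x i - f y i\<bar> \<le> B * (\<Sum>j\<le>m. \<bar>x j - y j\<bar>))"
    by (metis lip_onE[OF lip])
  from bchoice[OF this] obtain B0 where B0: "\<And>i. i \<le> N \<Longrightarrow> B0 i \<ge> 0"
    and B0': "\<And>i x y. i \<le> N \<Longrightarrow> x \<in> usph m \<Longrightarrow> y \<in> usph m \<Longrightarrow> \<bar>f x i - f y i\<bar> \<le> B0 i * (\<Sum>j\<le>m. \<bar>x j - y j\<bar>)"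
    by (auto simp: atMost_iff)
  define B where "B = (\<Sum>i\<le>N. B0 i)"
  have Bge: "B0 i \<le> B" if "i \<le> N" for i unfolding B_def using that B0 by (intro member_le_sum) auto
  have B: "B \<ge> 0" unfolding B_def by (intro sum_nonneg) (use B0 in auto)
  have Bf: "\<bar>f x i - f y i\<bar> \<le> B * (\<Sum>j\<le>m. \<bar>x j - y j\<bar>)" if "i \<le> N" "x \<in> usph m" "y \<in> usph m" for i x y
    using B0'[OF that] Bge[OF that(1)] by (meson mult_right_mono order_trans sum_nonneg abs_ge_zero)
  define C where "C = (1 + B * real (m + 2)) * real (m + 1)"
  have C: "C > 0" using B unfolding C_def by (intro mult_pos_pos add_pos_nonneg) auto
  obtain c :: nat where c: "real c > C * real (m + 2)" "c > 0"
    proof -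
    obtain c where c: "C * real (m + 2) < real c" using reals_Archimedean2 by blast
    have "0 < C * real (m + 2)" using C by (intro mult_pos_pos) auto
    with c have "0 < real c" by linarith
    with c show ?thesis using that[of c] by simp
  qed
  \<comment> \<open>K exceeds the factor lost in the final pigeonhole count: K ^ (m + 2) grid points
    against at most K ^ (m + 1) * (3 * c) ^ (m + 1) cells.\<close>
  define K where "K = (3 * c) ^ (m + 1) + 1"
  have K: "K \<ge> 1" by (simp add: K_def)
  define T where "T = K * c"
  have T: "T \<ge> 1" using K c unfolding T_def by simp
  define grid where "grid = (\<Pi>\<^sub>E i\<in>{..N}. {1..K})"
  define pt where "pt = (\<lambda>(g::nat\<Rightarrow>nat) i. if i \<le> N then real (g i) / (real K * real (m + 2)) else 0)"
  \<comment> \<open>Every grid point is s times a unit vector, and by surjectivity this unit vector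
    is a value of f. The division by m + 2, the number of coordinates, keeps the grid inside the
    unit ball.\<close>
  have "\<exists>s x. s \<ge> 0 \<and> s \<le> 1 \<and> x \<in> usph m \<and> (\<forall>i\<le>N. pt g i = s * f x i)" if g: "g \<in> grid" for g
  proof -
    define s where "s = L2_set (pt g) {..N}"
    have gi: "g i \<in> {1..K}" if "i \<le> N" for i using g that by (auto simp: grid_def PiE_iff)
    have pos: "pt g i > 0" if "i \<le> N" for i
      using gi[OF that] that K by (auto simp: pt_def)
    have le: "pt g i \<le> 1 / real (m + 2)" if "i \<le> N" for i
      proof -
      have "real (g i) / real K \<le> 1" using gi[OF that] K by simp
      then have "real (g i) / real K / real (m + 2) \<le> 1 / real (m + 2)" by (rule divide_right_mono) simp
      then show ?thesis using that by (simp add: pt_def)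
    qed
    have s0: "s > 0"
    proof -
      have "s \<noteq> 0" unfolding s_def using pos[of 0] L2_set_eq_0_iff[of "{..N}" "pt g"] by auto
      then show ?thesis using L2_set_nonneg[of "pt g" "{..N}"] unfolding s_def by linarith
    qed
    have s1: "s \<le> 1"
    proof -
      have "s \<le> (\<Sum>i\<le>N. \<bar>pt g i\<bar>)" unfolding s_def by (rule L2_set_le_sum_abs)
      also have "\<dots> \<le> (\<Sum>i\<le>N. 1 / real (m + 2))"
        by (intro sum_mono) (use pos le in \<open>force\<close>)
      also have "\<dots> = 1" by (simp add: N_def)
      finally show ?thesis .
    qed
    define v where "v = (\<lambda>i. pt g i / s)"
    have "(\<Sum>i\<le>N. (pt g i)\<^sup>2) = s\<^sup>2" unfolding s_def L2_set_def by (simp add: sum_nonneg)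
    then have "(\<Sum>i\<le>N. (v i)\<^sup>2) = 1"
      using s0 by (simp add: v_def power_divide sum_divide_distrib[symmetric])
    then have "v \<in> usph (Suc m)" by (auto simp: usph_def N_def[symmetric] v_def pt_def)
    then obtain x where x: "x \<in> usph m" "f x = v" using surj by blast
    show ?thesis
      by (rule exI[of _ s], rule exI[of _ x]) (use s0 s1 x in \<open>auto simp: v_def\<close>)
  qed
  then obtain s x where sx: "\<And>g. g \<in> grid \<Longrightarrow> s g \<ge> 0" "\<And>g. g \<in> grid \<Longrightarrow> s g \<le> 1" "\<And>g. g \<in> grid \<Longrightarrow> x g \<in> usph m"
    "\<And>g i. g \<in> grid \<Longrightarrow> i \<le> N \<Longrightarrow> pt g i = s g * f (x g) i"
    by metis
  \<comment> \<open>Grid points in one cell come from points of the cone within 1 / T in each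
    coordinate, so they differ by at most C / T, which is less than the mesh 1 / (K * (m + 2)) by
    the choice of c. The cells live in one dimension less than the grid.\<close>
  define cell where "cell = (\<lambda>g. restrict (\<lambda>j. \<lfloor>real T * (s g * x g j)\<rfloor>) {..m})"
  define cells where "cells = (\<Pi>\<^sub>E j\<in>{..m}. {- int T..int T})"
  have "cell ` grid \<subseteq> cells"
  proof
    fix h assume "h \<in> cell ` grid"
    then obtain g where g: "g \<in> grid" "h = cell g" by auto
    have "\<lfloor>real T * (s g * x g j)\<rfloor> \<in> {- int T..int T}" for j
    proof -
      have "\<bar>s g * x g j\<bar> \<le> 1"
        using sx[OF g(1)] usph_abs_le[OF sx(3)[OF g(1)], of j] by (simp add: abs_mult mult_le_one)
      then have b: "s g * x g j \<le> 1" "- 1 \<le> s g * x g j" by auto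
      have "real T * (s g * x g j) \<le> real T * 1" "real T * (-1) \<le> real T * (s g * x g j)"
        by (rule mult_left_mono[OF b(1)], simp, rule mult_left_mono[OF b(2)], simp)
      then show ?thesis by (auto simp: le_floor_iff floor_le_iff)
    qed
    then show "h \<in> cells" by (auto simp: g cell_def cells_def)
  qed
  moreover have "inj_on cell grid"
  proof (rule inj_onI)
    fix g h assume gh: "g \<in> grid" "h \<in> grid" "cell g = cell h"
    have fl: "\<bar>s g * x g j - s h * x h j\<bar> \<le> 1 / real T" if "j \<le> m" for j
    proof -
      have "\<lfloor>real T * (s g * x g j)\<rfloor> = \<lfloor>real T * (s h * x h j)\<rfloor>"
        using fun_cong[OF gh(3), of j] that by (simp add: cell_def)
      then have "\<bar>real T * (s g * x g j) - real T * (s h * x h j)\<bar> \<le> 1"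
        by linarith
      then have "real T * \<bar>s g * x g j - s h * x h j\<bar> \<le> 1"
        by (simp add: right_diff_distrib[symmetric] abs_mult)
      then show ?thesis using T by (simp add: field_simps)
    qed
    have "g i = h i" if i: "i \<le> N" for i
    proof (rule ccontr)
      assume ne: "g i \<noteq> h i"
      have "\<bar>f (x g) i\<bar> \<le> 1" using usph_abs_le[OF f[OF sx(3)[OF gh(1)]]] .
      then have "\<bar>s g * f (x g) i - s h * f (x h) i\<bar> \<le> (1 + B * real (m + 2)) * (\<Sum>j\<le>m. \<bar>s g * x g j - s h * x h j\<bar>)"
        using sx gh B Bf[OF i] by (intro cone_difference_bound) auto
      also have "\<dots> \<le> (1 + B * real (m + 2)) * (\<Sum>j\<le>m. 1 / real T)"
        using B fl by (intro mult_left_mono sum_mono) auto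
      also have "\<dots> = C / real T" by (simp add: C_def)
      finally have "\<bar>pt g i - pt h i\<bar> \<le> C / real T" using sx(4) gh i by auto
      moreover have "\<bar>pt g i - pt h i\<bar> = \<bar>real (g i) - real (h i)\<bar> / (real K * real (m + 2))"
        using i by (simp add: pt_def diff_divide_distrib[symmetric])
      moreover have "\<bar>real (g i) - real (h i)\<bar> \<ge> 1" using ne by linarith
      ultimately have "1 / (real K * real (m + 2)) \<le> C / real T"
        by (smt (verit) divide_right_mono mult_nonneg_nonneg of_nat_0_le_iff)
      moreover define W where "W = real K * real (m + 2)"
      ultimately have "1 / W \<le> C / real T" by simp
      moreover have "W > 0" using K by (simp add: W_def)
      ultimately have "real T \<le> C * W"
        using T by (simp add: field_simps)
      then have "real T \<le> C * (real K * real (m + 2))" by (simp add: W_def)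
      then have "real K * real c \<le> real K * (C * real (m + 2))" by (simp add: T_def algebra_simps)
      then show False using c K by (simp add: mult_le_cancel_left)
    qed
    then show "g = h" using gh by (auto simp: grid_def intro: PiE_ext)
  qed
  moreover have "finite cells" by (auto simp: cells_def intro: finite_PiE)
  ultimately have "card grid \<le> card cells" by (metis card_inj_on_le)
  moreover have "card grid = K ^ (m + 2)" by (simp add: grid_def card_PiE N_def)
  moreover have "card cells = (2 * T + 1) ^ (m + 1)"
  proof -
    have "nat (int T + 1 - - int T) = 2 * T + 1" by linarith
    then show ?thesis by (simp only: cells_def card_PiE finite_atMost card_atLeastAtMost_int prod_constant card_atMost) simp
  qed
  ultimately have "K ^ (m + 2) \<le> (2 * T + 1) ^ (m + 1)" by simp
  also have "\<dots> \<le> (3 * T) ^ (m + 1)" using T by (intro power_mono) auto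
  also have "\<dots> = K ^ (m + 1) * (3 * c) ^ (m + 1)" by (simp add: T_def power_mult_distrib mult.commute mult.left_commute)
  finally have "K ^ (m + 2) \<le> K ^ (m + 1) * (3 * c) ^ (m + 1)" .
  moreover have "K ^ (m + 2) = K ^ (m + 1) * K" by simp
  ultimately have "K ^ (m + 1) * K \<le> K ^ (m + 1) * (3 * c) ^ (m + 1)" by (simp only:)
  moreover have "0 < K ^ (m + 1)" using K by (intro zero_less_power) auto
  ultimately have "K \<le> (3 * c) ^ (m + 1)" using mult_le_cancel1[of "K ^ (m + 1)" K "(3 * c) ^ (m + 1)"] by blast
  then show False unfolding K_def by simp
qed

section \<open>Odd maps have odd degree\<close>

definition oddmap :: "nat \<Rightarrow> ((nat \<Rightarrow> real) \<Rightarrow> nat \<Rightarrow> real) \<Rightarrow> bool" where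
  "oddmap n f \<longleftrightarrow> (\<forall>x\<in>usph n. f (\<lambda>i. - x i) = (\<lambda>i. - f x i))"

definition lipmap :: "nat \<Rightarrow> ((nat \<Rightarrow> real) \<Rightarrow> nat \<Rightarrow> real) \<Rightarrow> bool" where
  "lipmap n f \<longleftrightarrow> (\<forall>i. lip_on n (\<lambda>x. f x i))"

lemma lipmap_continuous: "lipmap n f \<Longrightarrow> continuous_on (usph n) f"
  unfolding lipmap_def by (intro continuous_on_coordinatewise_then_product lip_on_continuous) auto

lemma lipmap_continuous_map:
  assumes "lipmap n f" "f \<in> usph n \<rightarrow> usph n" shows "continuous_map (nsphere n) (nsphere n) f"
  unfolding nsphere_usph using assms lipmap_continuous by auto

text \<open>The last coordinate of f is multiplied by \<open>1 - t * (1 - (x n)\<^sup>2)\<close> and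
  the result is normalised. At t = 1 the factor is \<open>(x n)\<^sup>2\<close>, which vanishes on
  the equator; it is even in x, so oddness survives. For 0 \<le> t \<le> 1 the factor can vanish
  only on the equator, where \<open>miss\<close> supplies another nonzero coordinate, so the
  homotopy never meets the origin.\<close>

lemma push_to_equator:
  assumes n: "n = Suc m" and lip: "lipmap n f" and f: "f \<in> usph n \<rightarrow> usph n" and odd: "oddmap n f"
    and miss: "\<And>x. x \<in> usph m \<Longrightarrow> \<exists>i\<le>m. f x i \<noteq> 0"
  obtains h where "continuous_map (nsphere n) (nsphere n) h" "oddmap n h" "lipmap m h"
    "h \<in> usph m \<rightarrow> usph m" "Brouwer_degree2 n h = Brouwer_degree2 n f"
proof -
  define g where "g = (\<lambda>t x i. f x i - (if i = n then t * (1 - (x n)\<^sup>2) * f x n else 0))"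
  define H where "H = (\<lambda>t x i. g t x i / L2_set (g t x) {..n})"
  have gi: "g t x i = f x i" if "i \<noteq> n" for t x i using that by (simp add: g_def)
  have gn: "g t x n = f x n * (1 - t * (1 - (x n)\<^sup>2))" for t x by (simp add: g_def algebra_simps)
  have nz: "L2_set (g t x) {..n} > 0" if x: "x \<in> usph n" and t: "0 \<le> t" "t \<le> 1" for t x
  proof -
    have "\<exists>i\<le>n. g t x i \<noteq> 0"
    proof (rule ccontr)
      assume "\<not> ?thesis"
      then have z: "g t x i = 0" if "i \<le> n" for i using that by auto
      have fz: "f x i = 0" if "i \<le> m" for i using z[of i] gi[of i t x] that n by auto
      have "f x \<in> usph n" using f x by auto
      then have "(\<Sum>i\<le>n. (f x i)\<^sup>2) = 1" by (simp add: usph_def)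
      then have "f x n \<noteq> 0" using fz n by (auto simp: atMost_Suc)
      moreover have "f x n * (1 - t * (1 - (x n)\<^sup>2)) = 0" using z[of n] unfolding gn by blast
      ultimately have eq: "1 - t * (1 - (x n)\<^sup>2) = 0" using mult_eq_0_iff by blast
      show False
      proof (cases "x n = 0")
        case True
        then have "x \<in> usph m" using x n usph_Suc[of x m] by blast
        then show False using miss fz by blast
      next
        case False
        have "(x n)\<^sup>2 \<le> 1" using usph_abs_le[OF x, of n] by (simp add: abs_square_le_1)
        then have "t * (1 - (x n)\<^sup>2) \<le> 1 * (1 - (x n)\<^sup>2)" using t by (intro mult_right_mono) auto
        moreover have "(x n)\<^sup>2 > 0" using False by simp
        moreover have "t * (1 - (x n)\<^sup>2) = 1" using eq by (simp only: right_minus_eq)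
        ultimately have "1 \<le> 1 * (1 - (x n)\<^sup>2)" "(x n)\<^sup>2 > 0" by simp_all
        then show False by simp
      qed
    qed
    then have "L2_set (g t x) {..n} \<noteq> 0" using L2_set_eq_0_iff[of "{..n}" "g t x"] by auto
    then show ?thesis using L2_set_nonneg[of "g t x" "{..n}"] by linarith
  qed
  have fsup: "f x i = 0" if "x \<in> usph n" "i > n" for x i using f that by (auto simp: usph_def Pi_iff)
  have Hsph: "H t x \<in> usph n" if x: "x \<in> usph n" and t: "0 \<le> t" "t \<le> 1" for t x
  proof -
    have "(\<Sum>i\<le>n. (g t x i)\<^sup>2) = (L2_set (g t x) {..n})\<^sup>2" by (simp add: L2_set_def sum_nonneg)
    then have "(\<Sum>i\<le>n. (H t x i)\<^sup>2) = 1"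
      using nz[OF x t] by (simp add: H_def power_divide sum_divide_distrib[symmetric])
    then show ?thesis using fsup[OF x] by (auto simp: usph_def H_def g_def)
  qed
  have contf: "continuous_on (usph n) (\<lambda>x. f x i)" for i
    using lip lip_on_continuous by (auto simp: lipmap_def)
  have contH: "continuous_on ({0..1} \<times> usph n) (\<lambda>p. H (fst p) (snd p))"
  proof (intro continuous_on_coordinatewise_then_product)
    fix i
    have c1: "continuous_on ({0..1} \<times> usph n) (\<lambda>p. f (snd p) j)" for j
      by (rule continuous_on_compose2[OF contf continuous_on_snd[OF continuous_on_id]]) auto
    have c2: "continuous_on ({0..1::real} \<times> usph n) (\<lambda>p. snd p j)" for j
      by (rule continuous_on_compose2[OF continuous_on_product_coordinates continuous_on_snd[OF continuous_on_id]]) auto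
    have c3: "continuous_on ({0..1} \<times> usph n) (\<lambda>p. g (fst p) (snd p) j)" for j
      unfolding g_def by (cases "j = n") (auto intro!: continuous_intros c1 c2)
    show "continuous_on ({0..1} \<times> usph n) (\<lambda>p. H (fst p) (snd p) i)"
      unfolding H_def L2_set_def
      by (intro continuous_intros c3) (use nz in \<open>force simp: L2_set_def\<close>)
  qed
  have H0: "H 0 x = f x" if x: "x \<in> usph n" for x
  proof -
    have "g 0 x = f x" by (rule ext) (simp add: g_def)
    moreover have "L2_set (f x) {..n} = 1" using f x by (intro L2_set_usph) auto
    ultimately show ?thesis by (simp add: H_def)
  qed
  have conth: "continuous_on (usph n) (H 1)"
  proof -
    have "continuous_on (usph n) (\<lambda>x. H (fst (1::real, x)) (snd (1::real, x)))"
      by (rule continuous_on_compose2[OF contH, of _ "\<lambda>x. (1, x)"]) (auto intro!: continuous_intros)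
    then show ?thesis by simp
  qed
  have "homotopic_with (\<lambda>x. True) (nsphere n) (nsphere n) f (H 1)"
  proof -
    have "homotopic_with (\<lambda>x. True) (nsphere n) (nsphere n) (H 0) (H 1)"
      unfolding homotopic_with_def nsphere_usph
      by (rule exI[of _ "\<lambda>p. H (fst p) (snd p)"]) (use contH Hsph in auto)
    then show ?thesis
      by (rule homotopic_with_eq) (auto simp: topspace_nsphere H0)
  qed
  then have deg: "Brouwer_degree2 n (H 1) = Brouwer_degree2 n f"
    using Brouwer_degree2_homotopic by metis
  have g1: "g 1 x i = (if i = n then 0 else f x i)" if "x \<in> usph m" for x i
    using that n by (auto simp: g_def usph_def)
  show ?thesis
  proof (rule that[of "H 1"])
    show "continuous_map (nsphere n) (nsphere n) (H 1)"
      unfolding nsphere_usph using conth Hsph by auto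
    show "oddmap n (H 1)"
      unfolding oddmap_def
    proof
      fix x assume x: "x \<in> usph n"
      have "g 1 (\<lambda>i. - x i) = (\<lambda>i. - g 1 x i)"
        using odd x by (auto simp: oddmap_def g_def fun_eq_iff)
      then show "H 1 (\<lambda>i. - x i) = (\<lambda>i. - H 1 x i)"
        by (simp add: H_def L2_set_def)
    qed
    show "lipmap m (H 1)"
      unfolding lipmap_def
    proof
      fix i
      have lg: "lip_on m (\<lambda>x. g 1 x j)" for j
      proof (rule lip_on_cong)
        show "lip_on m (\<lambda>x. if j = n then 0 else f x j)"
          using lip n by (cases "j = n") (auto simp: lipmap_def intro: lip_on_const lip_on_subset)
      qed (simp add: g1)
      show "lip_on m (\<lambda>x. H 1 x i)"
      proof (cases "i \<le> n")
        case True
        show ?thesis unfolding H_def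
        proof (rule lip_on_normalise[OF lg _ True])
          fix x assume x: "x \<in> usph m"
          then obtain i where "i \<le> m" "f x i \<noteq> 0" using miss by blast
          then show "\<exists>i\<le>n. g 1 x i \<noteq> 0" using x n by (intro exI[of _ i]) (auto simp: g1)
        qed
      next
        case False
        show ?thesis
          by (rule lip_on_cong[OF lip_on_const[of _ 0]])
            (use False fsup usph_mono[of m n] n in \<open>auto simp: H_def g_def\<close>)
      qed
    qed
    show "H 1 \<in> usph m \<rightarrow> usph m"
    proof
      fix x assume x: "x \<in> usph m"
      then have "H 1 x \<in> usph n" using Hsph usph_mono[of m n] n by auto
      moreover have "H 1 x n = 0" using g1[OF x] by (simp add: H_def)
      ultimately show "H 1 x \<in> usph m" using n usph_Suc[of "H 1 x" m] by blast
    qed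
    show "Brouwer_degree2 n (H 1) = Brouwer_degree2 n f" by (rule deg)
  qed
qed

text \<open>By \<open>Borsuk_odd_mapping_degree_step\<close> the parity of the degree is that of the restriction to the equator,
  once the map has been deformed so as to preserve the equator.\<close>

theorem Borsuk_odd_degree:
  assumes "lipmap n f" "f \<in> usph n \<rightarrow> usph n" "oddmap n f"
  shows "odd (Brouwer_degree2 n f)"
  using assms
proof (induction n arbitrary: f)
  \<comment> \<open>The 0-sphere consists of e and - e, and an odd self-map of it is the identity or
    the reflection, of degree 1 or - 1.\<close>
  case 0
  define e where "e = (\<lambda>i::nat. if i = 0 then 1 else (0::real))"
  have u0: "x \<in> usph 0 \<longleftrightarrow> x = e \<or> x = (\<lambda>i. - e i)" for x
    by (auto simp: usph_def e_def fun_eq_iff power2_eq_1_iff)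
  have "f e = e \<or> f e = (\<lambda>i. - e i)" using 0(2) u0 by (metis PiE)
  then show ?case
  proof
    assume "f e = e"
    then have "f x = id x" if "x \<in> usph 0" for x
      using that 0(3) u0 by (auto simp: oddmap_def)
    then have "Brouwer_degree2 0 f = Brouwer_degree2 0 id"
      by (intro Brouwer_degree2_eq) (auto simp: topspace_nsphere)
    then show ?thesis by simp
  next
    assume "f e = (\<lambda>i. - e i)"
    then have "f x = (\<lambda>i. if i = 0 then - x i else x i)" if "x \<in> usph 0" for x
    proof -
      have "f x = (\<lambda>i. - x i)"
        using u0[of x] that 0(3) u0[of e] \<open>f e = _\<close> by (auto simp: oddmap_def)
      then show ?thesis using that by (auto simp: usph_def)
    qed
    then have "Brouwer_degree2 0 f = Brouwer_degree2 0 (\<lambda>x i. if i = 0 then - x i else x i)"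
      by (intro Brouwer_degree2_eq) (auto simp: topspace_nsphere)
    then show ?thesis by (simp add: Brouwer_degree2_reflection)
  qed
next
  case (Suc m)
  define n where "n = Suc m"
  note f = Suc.prems[folded n_def]
  have sub: "usph m \<subseteq> usph n" by (simp add: n_def usph_mono)
  \<comment> \<open>The restriction of f to the equator misses some v. Once v is moved to the pole,
    the image of the equator avoids both poles, since an odd map with value - v also has value
    v.\<close>
  obtain v where v: "v \<in> usph n" "v \<notin> f ` usph m"
  proof (rule lipschitz_not_surj_usph[of m f])
    show "lip_on m (\<lambda>x. f x i)" for i
      using f(1) by (auto simp: lipmap_def n_def intro: lip_on_subset)
    show "f x \<in> usph (Suc m)" if "x \<in> usph m" for x
      using f(2) sub that by (auto simp: n_def)
  qed (use n_def in auto)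
  obtain R where R: "\<And>x. x \<in> usph n \<Longrightarrow> R x \<in> usph n" "\<And>x. x \<in> usph n \<Longrightarrow> R (R x) = x"
    "\<And>x. R (\<lambda>i. - x i) = (\<lambda>i. - R x i)" "R v = (\<lambda>i. if i = n then 1 else 0)"
    and Rl: "\<And>m (f :: (nat \<Rightarrow> real) \<Rightarrow> nat \<Rightarrow> real) i. (\<And>i. lip_on m (\<lambda>x. f x i)) \<Longrightarrow> lip_on m (\<lambda>x. R (f x) i)"
    using usph_rotate_to_pole[OF v(1)] by blast
  have Rlip: "lipmap n R" unfolding lipmap_def using Rl[of n "\<lambda>x. x"] lip_on_coord_all by blast
  have cR: "continuous_map (nsphere n) (nsphere n) R"
    by (rule lipmap_continuous_map[OF Rlip]) (use R in auto)
  have cf: "continuous_map (nsphere n) (nsphere n) f"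
    by (rule lipmap_continuous_map[OF f(1,2)])
  define F where "F = R \<circ> f"
  have Fdeg: "Brouwer_degree2 n F = Brouwer_degree2 n R * Brouwer_degree2 n f"
    unfolding F_def by (rule Brouwer_degree2_compose[OF cf cR])
  have Flip: "lipmap n F" using Rl[of n f] f(1) by (auto simp: lipmap_def F_def)
  have Fsph: "F \<in> usph n \<rightarrow> usph n" using R(1) funcset_mem[OF f(2)] by (simp add: F_def)
  have Fodd: "oddmap n F" using f(3) R(3) by (auto simp: oddmap_def F_def)
  have miss: "\<exists>i\<le>m. F x i \<noteq> 0" if x: "x \<in> usph m" for x
  proof (rule ccontr)
    assume "\<not> ?thesis"
    then have z: "F x i = 0" if "i \<le> m" for i using that by auto
    have xn: "x \<in> usph n" using x sub by auto
    have Fx: "F x \<in> usph n" using Fsph xn by auto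
    have z': "F x i = 0" if "i \<noteq> n" for i
      using z[of i] Fx that by (cases "i \<le> m") (auto simp: usph_def n_def)
    have "(F x n)\<^sup>2 = 1" using Fx z by (simp add: usph_def n_def atMost_Suc)
    then have "F x n = 1 \<or> F x n = -1" by (simp add: power2_eq_1_iff)
    then have "F x = R v \<or> F x = (\<lambda>i. - R v i)"
      using z' R(4) by (auto simp: fun_eq_iff)
    moreover have fx: "f x \<in> usph n" using f(2) xn by auto
    ultimately have "f x = v \<or> f x = (\<lambda>i. - v i)"
    proof (elim disjE)
      assume "F x = R v"
      then have "R (R (f x)) = R (R v)" by (simp add: F_def)
      then show ?thesis using R(2) fx v by metis
    next
      assume "F x = (\<lambda>i. - R v i)"
      then have "R (R (f x)) = R (R (\<lambda>i. - v i))" by (simp add: F_def R(3))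
      then show ?thesis using R(2) fx v usph_uminus by metis
    qed
    then show False
    proof
      assume "f x = v" then show False using v x by auto
    next
      assume "f x = (\<lambda>i. - v i)"
      then have "f (\<lambda>i. - x i) = v" using f(3) xn by (simp add: oddmap_def)
      then show False using v usph_uminus[OF x] by auto
    qed
  qed
  obtain h where h: "continuous_map (nsphere n) (nsphere n) h" "oddmap n h" "lipmap m h"
    "h \<in> usph m \<rightarrow> usph m" "Brouwer_degree2 n h = Brouwer_degree2 n F"
    using push_to_equator[OF n_def Flip Fsph Fodd miss] by blast
  have "even (Brouwer_degree2 n h - Brouwer_degree2 (n - Suc 0) h)"
    by (rule Borsuk_odd_mapping_degree_step[OF h(1)])
      (use h(2,4) in \<open>auto simp: topspace_nsphere oddmap_def n_def\<close>)
  moreover have "odd (Brouwer_degree2 m h)"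
    by (rule Suc.IH[OF h(3,4)]) (use h(2) sub in \<open>auto simp: oddmap_def\<close>)
  ultimately have "odd (Brouwer_degree2 n F)" using h(5) by (simp add: n_def)
  then show ?case unfolding Fdeg by (simp add: n_def)
qed

text \<open>If G had no zero, normalising it and padding with a last coordinate 0 would give an odd
  self-map of \<open>usph n\<close> that misses the pole. Its degree would be 0 because it is not
  surjective, yet odd by \<open>Borsuk_odd_degree\<close>.\<close>

theorem Borsuk_Ulam_lipschitz:
  fixes G :: "(nat \<Rightarrow> real) \<Rightarrow> nat \<Rightarrow> real"
  assumes lip: "\<And>i. i < n \<Longrightarrow> lip_on n (\<lambda>x. G x i)"
    and odd: "\<And>x i. x \<in> usph n \<Longrightarrow> i < n \<Longrightarrow> G (\<lambda>i. - x i) i = - G x i"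
  obtains x where "x \<in> usph n" "\<And>i. i < n \<Longrightarrow> G x i = 0"
proof (cases "n = 0")
  case True
  then show ?thesis using that usph_nonempty[of 0 0] by auto
next
  case n0: False
  note outer = that
  show ?thesis
  proof (rule ccontr)
    assume "\<not> thesis"
    then have nz: "\<exists>i<n. G x i \<noteq> 0" if "x \<in> usph n" for x using that outer by blast
    define F where "F = (\<lambda>x i. if i < n then G x i else 0)"
    have lF: "lip_on n (\<lambda>x. F x i)" for i
      using lip by (cases "i < n") (auto simp: F_def intro: lip_on_const)
    have nzF: "\<exists>i\<le>n. F x i \<noteq> 0" if "x \<in> usph n" for x
      using nz[OF that] by (auto simp: F_def intro: less_imp_le)
    define h where "h = (\<lambda>x i. F x i / L2_set (F x) {..n})"
    have lh: "lipmap n h" unfolding lipmap_def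
    proof
      fix i show "lip_on n (\<lambda>x. h x i)"
      proof (cases "i \<le> n")
        case True then show ?thesis unfolding h_def using lip_on_normalise[OF lF nzF] by blast
      next
        case False then show ?thesis by (auto simp: h_def F_def intro: lip_on_const)
      qed
    qed
    have hs: "h x \<in> usph n" if x: "x \<in> usph n" for x
    proof -
      have "L2_set (F x) {..n} \<noteq> 0" using nzF[OF x] L2_set_eq_0_iff[of "{..n}" "F x"] by auto
      moreover have "(\<Sum>i\<le>n. (F x i)\<^sup>2) = (L2_set (F x) {..n})\<^sup>2" by (simp add: L2_set_def sum_nonneg)
      ultimately have "(\<Sum>i\<le>n. (h x i)\<^sup>2) = 1"
        by (simp add: h_def power_divide sum_divide_distrib[symmetric])
      then show ?thesis by (auto simp: usph_def h_def F_def)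
    qed
    have ho: "oddmap n h" unfolding oddmap_def
    proof
      fix x assume x: "x \<in> usph n"
      have "F (\<lambda>i. - x i) = (\<lambda>i. - F x i)" using odd[OF x] by (auto simp: F_def)
      then show "h (\<lambda>i. - x i) = (\<lambda>i. - h x i)" by (simp add: h_def L2_set_def)
    qed
    have "odd (Brouwer_degree2 n h)"
      by (rule Borsuk_odd_degree[OF lh _ ho]) (use hs in auto)
    moreover have "Brouwer_degree2 n h = 0"
    proof (rule Brouwer_degree2_nonsurjective)
      show "continuous_map (nsphere n) (nsphere n) h"
        by (rule lipmap_continuous_map[OF lh]) (use hs in auto)
      have "(\<lambda>i. if i = n then 1 else 0) \<notin> h ` usph n"
      proof
        assume "(\<lambda>i. if i = n then 1 else 0) \<in> h ` usph n"
        then obtain x where "h x = (\<lambda>i. if i = n then 1 else 0)" by auto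
        then have "h x n = 1" by simp
        then show False by (simp add: h_def F_def)
      qed
      then show "h ` topspace (nsphere n) \<noteq> topspace (nsphere n)"
        using usph_nonempty[of n n] by (auto simp: topspace_nsphere)
    qed
    ultimately show False by simp
  qed
qed

section \<open>Polynomial functions\<close>

text \<open>The index is an upper bound for the degree, not the exact degree.\<close>

inductive polyd :: "nat \<Rightarrow> ('a::euclidean_space \<Rightarrow> 'k::real_normed_field) \<Rightarrow> bool" where
  polyd_const: "polyd 0 (\<lambda>_. c)"
| polyd_lin: "polyd k h \<Longrightarrow> bounded_linear g \<Longrightarrow> polyd (Suc k) (\<lambda>p. g p * h p)"
| polyd_add: "polyd k h \<Longrightarrow> polyd k h' \<Longrightarrow> polyd k (\<lambda>p. h p + h' p)"
| polyd_Suc: "polyd k h \<Longrightarrow> polyd (Suc k) h"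

lemma polyd_mono: "polyd j h \<Longrightarrow> j \<le> k \<Longrightarrow> polyd k h"
proof (induction k)
  case (Suc k) then show ?case by (cases "j = Suc k") (auto intro: polyd_Suc)
qed auto

lemma polyd_const': "polyd k (\<lambda>_. c)"
  using polyd_mono[OF polyd_const] by simp

lemma polyd_cmult: "polyd k h \<Longrightarrow> polyd k (\<lambda>p. c * h p)"
proof (induction rule: polyd.induct)
  case (polyd_lin k h g)
  show ?case using polyd.polyd_lin[OF polyd_lin.IH polyd_lin.hyps(2)] by (simp add: mult.left_commute)
qed (auto simp: distrib_left intro: polyd.intros)

lemma polyd_mult:
  assumes "polyd j f" "polyd k g" shows "polyd (j + k) (\<lambda>p. f p * g p)"
  using assms
proof (induction rule: polyd.induct)
  case (polyd_const c) then show ?case by (simp add: polyd_cmult)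
next
  case (polyd_lin j h l)
  show ?case using polyd.polyd_lin[OF polyd_lin.IH[OF polyd_lin.prems] polyd_lin.hyps(2)] by (simp add: mult.assoc)
next
  case (polyd_add k h h') then show ?case by (auto simp: distrib_right intro: polyd.polyd_add)
next
  case (polyd_Suc k h) then show ?case by (auto intro: polyd.polyd_Suc)
qed

lemma polyd_linear: "bounded_linear g \<Longrightarrow> polyd 1 g"
  using polyd_lin[OF polyd_const[of 1]] by simp

lemma polyd_uminus: "polyd k h \<Longrightarrow> polyd k (\<lambda>p. - h p)"
  using polyd_cmult[of k h "-1"] by simp

lemma polyd_diff: "polyd k h \<Longrightarrow> polyd k h' \<Longrightarrow> polyd k (\<lambda>p. h p - h' p)"
  using polyd_add[of k h "\<lambda>p. - h' p"] polyd_uminus[of k h'] by simp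

lemma polyd_sum: "(\<And>i. i \<in> I \<Longrightarrow> polyd k (f i)) \<Longrightarrow> polyd k (\<lambda>p. \<Sum>i\<in>I. f i p)"
  by (induction I rule: infinite_finite_induct) (auto intro: polyd_const' polyd_add)

lemma polyd_prod: "(\<And>i. i \<in> I \<Longrightarrow> polyd (k i) (f i)) \<Longrightarrow> polyd (\<Sum>i\<in>I. k i) (\<lambda>p. \<Prod>i\<in>I. f i p)"
  by (induction I rule: infinite_finite_induct) (auto intro: polyd_const' polyd_mult)

lemma polyd_power: "polyd k h \<Longrightarrow> polyd (n * k) (\<lambda>p. h p ^ n)"
  by (induction n) (auto intro: polyd_const' polyd_mult)

lemma polyd_compose_linear:
  assumes "polyd k h" "bounded_linear T" shows "polyd k (\<lambda>p. h (T p))"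
  using assms
proof (induction rule: polyd.induct)
  case (polyd_lin k h g)
  show ?case
    using polyd.polyd_lin[OF polyd_lin.IH[OF polyd_lin.prems] bounded_linear_compose[OF polyd_lin.hyps(2) polyd_lin.prems]] .
qed (auto intro: polyd.intros)

lemma polyd_of_real: "polyd k h \<Longrightarrow> polyd k (\<lambda>p. of_real (h p) :: 'k::real_normed_field)"
proof (induction rule: polyd.induct)
  case (polyd_lin k h g)
  have "bounded_linear (\<lambda>p. of_real (g p) :: 'k)"
    using bounded_linear_compose[OF bounded_linear_of_real polyd_lin.hyps(2)] .
  from polyd.polyd_lin[OF polyd_lin.IH this] show ?case by simp
qed (auto intro: polyd.intros)

lemma polyd_Re_Im:
  fixes h :: "'a::euclidean_space \<Rightarrow> complex"
  assumes "polyd k h" shows "polyd k (\<lambda>p. Re (h p)) \<and> polyd k (\<lambda>p. Im (h p))"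
  using assms
proof (induction k h rule: polyd.induct)
  case (polyd_lin k h g)
  have g: "bounded_linear (\<lambda>p. Re (g p))" "bounded_linear (\<lambda>p. Im (g p))"
    using polyd_lin.hyps(2) by (auto intro: bounded_linear_compose bounded_linear_Re bounded_linear_Im)
  show ?case
    using polyd_lin.IH g by (auto intro!: polyd_add polyd_diff polyd.polyd_lin)
qed (auto intro: polyd.intros)

lemmas polyd_Re = polyd_Re_Im[THEN conjunct1] and polyd_Im = polyd_Re_Im[THEN conjunct2]

lemma polyd_cnj:
  assumes "polyd k h" shows "polyd k (\<lambda>p. cnj (h p))"
proof -
  have "polyd k (\<lambda>p. of_real (Re (h p)) - \<i> * of_real (Im (h p)))"
    by (intro polyd_diff polyd_cmult polyd_of_real polyd_Re polyd_Im assms)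
  moreover have "of_real (Re (h p)) - \<i> * of_real (Im (h p)) = cnj (h p)" for p
    by (simp add: complex_eq_iff)
  ultimately show ?thesis by simp
qed

lemma polyd_continuous: "polyd k h \<Longrightarrow> continuous_on S h"
proof (induction rule: polyd.induct)
  case (polyd_lin k h g)
  show ?case by (rule continuous_on_mult[OF linear_continuous_on[OF polyd_lin.hyps(2)] polyd_lin.IH])
qed (auto intro: continuous_on_add)

lemma polyd_isCont: "polyd k h \<Longrightarrow> isCont h x"
  using polyd_continuous[of k h UNIV] continuous_on_eq_continuous_at[of UNIV h] by auto

section \<open>Derivatives of polynomial functions\<close>

text \<open>For k = 0 the truncated degree k - 1 is again 0 and would lose the information that the
  derivative vanishes. The last conjunct keeps it; the product rule needs it in the step from degree
  0 to degree 1, where g * D would otherwise count as degree 1.\<close>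

lemma polyd_has_derivative_aux:
  "polyd k h \<Longrightarrow> \<exists>D. (\<forall>p. (h has_derivative D p) (at p)) \<and> (\<forall>v. polyd (k - 1) (\<lambda>p. D p v)) \<and> (k = 0 \<longrightarrow> (\<forall>p v. D p v = 0))"
proof (induction rule: polyd.induct)
  case (polyd_const c)
  show ?case by (rule exI[of _ "\<lambda>p v. 0"]) (auto intro: polyd_const')
next
  case (polyd_lin k h g)
  then obtain D where D: "\<And>p. (h has_derivative D p) (at p)" "\<And>v. polyd (k - 1) (\<lambda>p. D p v)"
    "k = 0 \<Longrightarrow> \<forall>p v. D p v = 0" by blast
  have "polyd k (\<lambda>p. g p * D p v + g v * h p)" for v
  proof (intro polyd_add polyd_cmult polyd_lin.hyps(1))
    show "polyd k (\<lambda>p. g p * D p v)"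
    proof (cases k)
      case 0 then show ?thesis using D(3) by (simp add: polyd_const')
    next
      case (Suc j) then show ?thesis using polyd.polyd_lin[OF D(2)[of v] polyd_lin.hyps(2)] by simp
    qed
  qed
  moreover have "((\<lambda>p. g p * h p) has_derivative (\<lambda>v. g p * D p v + g v * h p)) (at p)" for p
    using has_derivative_mult[OF bounded_linear_imp_has_derivative[OF polyd_lin.hyps(2)] D(1)] .
  ultimately show ?case by (intro exI[of _ "\<lambda>p v. g p * D p v + g v * h p"]) auto
next
  case (polyd_add k h h')
  then obtain D D' where D: "\<And>p. (h has_derivative D p) (at p)" "\<And>v. polyd (k - 1) (\<lambda>p. D p v)"
    "k = 0 \<Longrightarrow> \<forall>p v. D p v = 0" "\<And>p. (h' has_derivative D' p) (at p)" "\<And>v. polyd (k - 1) (\<lambda>p. D' p v)"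
    "k = 0 \<Longrightarrow> \<forall>p v. D' p v = 0" by metis
  then show ?case
    by (intro exI[of _ "\<lambda>p v. D p v + D' p v"]) (auto intro: polyd.polyd_add has_derivative_add)
next
  case (polyd_Suc k h)
  then show ?case using polyd_mono[of "k - 1" _ k] by (metis diff_Suc_1 diff_le_self nat.discI)
qed

text \<open>The direction may be any vector, not just a basis vector; for polynomial functions the
  value is real-linear in it, also when the function is complex-valued.\<close>

definition pd :: "'a \<Rightarrow> ('a::euclidean_space \<Rightarrow> 'k::real_normed_field) \<Rightarrow> 'a \<Rightarrow> 'k" where
  "pd v h p = frechet_derivative h (at p) v"

lemma
  assumes "polyd k h"
  shows pd_has_derivative: "(h has_derivative (\<lambda>v. pd v h p)) (at p)"
    and polyd_pd: "polyd (k - 1) (pd v h)"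
    and pd_0: "k = 0 \<Longrightarrow> pd v h p = 0"
proof -
  obtain D where D: "\<And>p. (h has_derivative D p) (at p)" "\<And>v. polyd (k - 1) (\<lambda>p. D p v)"
    "k = 0 \<Longrightarrow> \<forall>p v. D p v = 0" using polyd_has_derivative_aux[OF assms] by blast
  have pd: "pd v h p = D p v" for v p
    unfolding pd_def using frechet_derivative_at[OF D(1)] by metis
  show "(h has_derivative (\<lambda>v. pd v h p)) (at p)" using D(1) by (simp add: pd)
  have "pd v h = (\<lambda>p. D p v)" by (rule ext) (rule pd)
  then show "polyd (k - 1) (pd v h)" using D(2) by simp
  show "k = 0 \<Longrightarrow> pd v h p = 0" using D(3) pd by auto
qed

lemma pd_bounded_linear: "polyd k h \<Longrightarrow> bounded_linear (\<lambda>v. pd v h p)"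
  using pd_has_derivative has_derivative_bounded_linear by blast

lemma polyd_line:
  assumes "polyd k h" shows "\<exists>q. degree q \<le> k \<and> (\<forall>t. h (y + t *\<^sub>R v) = poly q (of_real t))"
  using assms
proof (induction rule: polyd.induct)
  case (polyd_const c) show ?case by (rule exI[of _ "[:c:]"]) auto
next
  case (polyd_lin k h g)
  then obtain q where q: "degree q \<le> k" "\<And>t. h (y + t *\<^sub>R v) = poly q (of_real t)" by blast
  have "degree ([:g y, g v:] * q) \<le> Suc k"
    using degree_mult_le[of "[:g y, g v:]" q] q(1) by (auto split: if_splits)
  moreover have "g (y + t *\<^sub>R v) * h (y + t *\<^sub>R v) = poly ([:g y, g v:] * q) (of_real t)" for t
    using q(2)[of t] bounded_linear.linear[OF polyd_lin.hyps(2)]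
    by (simp add: linear_add linear_scale scaleR_conv_of_real algebra_simps)
  ultimately show ?case by blast
next
  case (polyd_add k h h')
  then obtain q q' where "degree q \<le> k" "\<forall>t. h (y + t *\<^sub>R v) = poly q (of_real t)" "degree q' \<le> k" "\<forall>t. h' (y + t *\<^sub>R v) = poly q' (of_real t)"
    by blast
  then show ?case by (intro exI[of _ "q + q'"]) (auto intro: degree_add_le)
next
  case (polyd_Suc k h) then show ?case using le_SucI by blast
qed

section \<open>Linear algebra in spaces of functions\<close>

text \<open>The abstract theory of dimension becomes available for functions with pointwise
  operations, for polynomials as well as for arrays of coefficients.\<close>

interpretation fs: vector_space "\<lambda>(c::'k::field) (f::'a \<Rightarrow> 'k) p. c * f p"
  by unfold_locales (auto simp: fun_eq_iff algebra_simps plus_fun_def)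

lemma fs_sum_apply: "(\<Sum>i\<in>I. f i) p = (\<Sum>i\<in>I. f i p)"
  for f :: "'i \<Rightarrow> 'a \<Rightarrow> 'k::comm_monoid_add"
  by (induction I rule: infinite_finite_induct) (auto simp: plus_fun_def zero_fun_def)

text \<open>Independence is a property of sets, so a repeated member of the family is treated on its
  own: it yields the relation with coefficients 1 and - 1.\<close>

lemma linear_relation_in_span:
  fixes g :: "'i \<Rightarrow> 'a \<Rightarrow> 'k::field"
  assumes I: "finite I" and H: "finite H" and card: "card H < card I" and g: "\<And>i. i \<in> I \<Longrightarrow> g i \<in> fs.span H"
  obtains c where "\<exists>i\<in>I. c i \<noteq> 0" "\<And>p. (\<Sum>i\<in>I. c i * g i p) = 0"
proof (cases "inj_on g I")
  case False
  then obtain i j where ij: "i \<in> I" "j \<in> I" "i \<noteq> j" "g i = g j" by (auto simp: inj_on_def)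
  define c where "c = (\<lambda>k. if k = i then 1 else if k = j then -1 else (0::'k))"
  have "(\<Sum>k\<in>I. c k * g k p) = (\<Sum>k\<in>{i,j}. c k * g k p)" for p
    using ij I by (intro sum.mono_neutral_right) (auto simp: c_def)
  then have "(\<Sum>k\<in>I. c k * g k p) = 0" for p using ij by (simp add: c_def)
  moreover have "\<exists>k\<in>I. c k \<noteq> 0" using ij(1) by (auto simp: c_def)
  ultimately show ?thesis using that[of c] by blast
next
  case True
  have "fs.dependent (g ` I)"
  proof (rule ccontr)
    assume "\<not> ?thesis"
    then have "card (g ` I) \<le> card H"
      using fs.independent_span_bound[OF H, of "g ` I"] g by auto
    then show False using card card_image[OF True] by simp
  qed
  then obtain u v where uv: "v \<in> g ` I" "u v \<noteq> 0" "(\<Sum>v\<in>g ` I. (\<lambda>p. u v * v p)) = 0"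
    using fs.dependent_finite[of "g ` I"] I by auto
  have "(\<Sum>i\<in>I. u (g i) * g i p) = 0" for p
  proof -
    have "(\<Sum>i\<in>I. u (g i) * g i p) = (\<Sum>v\<in>g ` I. u v * v p)"
      by (simp add: sum.reindex[OF True])
    also have "\<dots> = (\<Sum>v\<in>g ` I. (\<lambda>p. u v * v p)) p" by (simp add: fs_sum_apply)
    finally show ?thesis using uv(3) by (simp add: zero_fun_def)
  qed
  then show ?thesis using that[of "u \<circ> g"] uv by auto
qed

lemma fs_span_explicit:
  assumes "finite H" "h \<in> fs.span H"
  obtains u where "\<And>p. h p = (\<Sum>v\<in>H. u v * v p)"
proof -
  obtain u where "h = (\<Sum>v\<in>H. (\<lambda>p. u v * v p))"
    using assms(2) unfolding fs.span_finite[OF assms(1)] by auto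
  then show ?thesis using that[of u] by (simp add: fs_sum_apply)
qed

lemma fs_span_addI: "f \<in> fs.span H \<Longrightarrow> g \<in> fs.span H \<Longrightarrow> (\<lambda>p. f p + g p) \<in> fs.span H"
  using fs.span_add[of f H g] by (simp add: plus_fun_def)

lemma fs_span_sumI: "(\<And>i. i \<in> I \<Longrightarrow> f i \<in> fs.span H) \<Longrightarrow> (\<lambda>p. \<Sum>i\<in>I. f i p) \<in> fs.span H"
proof -
  assume "\<And>i. i \<in> I \<Longrightarrow> f i \<in> fs.span H"
  then have "(\<Sum>i\<in>I. f i) \<in> fs.span H" by (rule fs.span_sum)
  moreover have "(\<Sum>i\<in>I. f i) = (\<lambda>p. \<Sum>i\<in>I. f i p)" by (rule ext) (rule fs_sum_apply)
  ultimately show ?thesis by simp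
qed

lemma fs_span_mult:
  assumes "h \<in> fs.span H" "\<And>v. v \<in> H \<Longrightarrow> (\<lambda>p. g p * v p) \<in> fs.span H'"
  shows "(\<lambda>p. g p * h p) \<in> fs.span H'"
  using assms(1)
proof (induction rule: fs.span_induct_alt)
  case base show ?case using fs.span_zero[of H'] by (simp add: zero_fun_def)
next
  case (step c x y)
  have "(\<lambda>p. c * (g p * x p) + g p * y p) \<in> fs.span H'"
    by (intro fs_span_addI fs.span_scale assms(2) step)
  then show ?case by (simp add: plus_fun_def algebra_simps)
qed

text \<open>A product over q of affine functions, each equal to 1 at p0 and to 0 at q.\<close>

lemma interpolation_polyd:
  fixes p0 :: "'a::euclidean_space"
  assumes "finite S"
  shows "\<exists>k (h::'a \<Rightarrow> 'k::real_normed_field). polyd k h \<and> h p0 = 1 \<and> (\<forall>q\<in>S - {p0}. h q = 0)"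
proof -
  define l where "l = (\<lambda>q p. of_real ((p \<bullet> (p0 - q) - q \<bullet> (p0 - q)) / ((p0 - q) \<bullet> (p0 - q))) :: 'k)"
  have "polyd 1 (l q)" for q
  proof -
    have "polyd 1 (\<lambda>p. (1 / ((p0 - q) \<bullet> (p0 - q))) * (p \<bullet> (p0 - q) - q \<bullet> (p0 - q)))"
      by (intro polyd_cmult polyd_diff polyd_linear polyd_const' bounded_linear_inner_left)
    from polyd_of_real[OF this, where 'k='k] show ?thesis by (simp add: l_def field_simps)
  qed
  then have "polyd (\<Sum>q\<in>S - {p0}. 1) (\<lambda>p. \<Prod>q\<in>S - {p0}. l q p)"
    by (intro polyd_prod)
  moreover have "(\<Prod>q\<in>S - {p0}. l q p0) = 1"
    by (intro prod.neutral) (auto simp: l_def inner_diff_left[symmetric])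
  moreover have "(\<Prod>q\<in>S - {p0}. l q r) = 0" if "r \<in> S - {p0}" for r
    using that assms by (intro prod_zero bexI[of _ r]) (auto simp: l_def)
  ultimately show ?thesis by blast
qed

text \<open>By interpolation the restrictions of polynomials fill the space of all functions on S.
  If |H| < |S|, the vectors of values of the \<open>v j\<close> satisfy a linear relation c over the
  points of S. Every polynomial then satisfies it too, which fails for one that is 1 at a point with
  nonzero c and 0 at the others.\<close>

lemma card_le_of_polyd_span:
  fixes S :: "'a::euclidean_space set" and v :: "'j \<Rightarrow> 'a \<Rightarrow> 'k::real_normed_field"
  assumes S: "finite S" and H: "finite H"
    and span: "\<And>k (h::'a \<Rightarrow> 'k). polyd k h \<Longrightarrow> \<exists>u. \<forall>p\<in>S. h p = (\<Sum>j\<in>H. u j * v j p)"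
  shows "card S \<le> card H"
proof (rule ccontr)
  assume "\<not> ?thesis"
  then have less: "card H < card S" by simp
  define g where "g = (\<lambda>p j. if j \<in> H then v j p else 0)"
  define ind where "ind = (\<lambda>(i::'j) (j::'j). if j = i then 1 else (0::'k))"
  have sp: "g p \<in> fs.span (ind ` H)" for p
  proof -
    have "(\<lambda>j. \<Sum>i\<in>H. v i p * ind i j) \<in> fs.span (ind ` H)"
      by (intro fs_span_sumI fs.span_scale fs.span_base) auto
    moreover have "g p = (\<lambda>j. \<Sum>i\<in>H. v i p * ind i j)"
      using H by (auto simp: g_def ind_def fun_eq_iff if_distrib[of "\<lambda>x. _ * x"] cong: if_cong)
    ultimately show ?thesis by simp
  qed
  have cl: "card (ind ` H) < card S" using card_image_le[OF H, of ind] less by simp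
  obtain c where c: "\<exists>p\<in>S. c p \<noteq> 0" "\<And>j. (\<Sum>p\<in>S. c p * g p j) = 0"
    using linear_relation_in_span[of S "ind ` H" g, OF S finite_imageI[OF H] cl sp] by blast
  then obtain p0 where p0: "p0 \<in> S" "c p0 \<noteq> 0" by blast
  obtain k and h :: "'a \<Rightarrow> 'k" where h: "polyd k h" "h p0 = 1" "\<forall>q\<in>S - {p0}. h q = 0"
    using interpolation_polyd[OF S, of p0] by blast
  obtain u where u: "\<forall>p\<in>S. h p = (\<Sum>j\<in>H. u j * v j p)" using span[OF h(1)] by blast
  have "(\<Sum>p\<in>S. c p * h p) = (\<Sum>p\<in>S. \<Sum>j\<in>H. u j * (c p * v j p))"
    using u by (intro sum.cong) (auto simp: sum_distrib_left mult_ac)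
  also have "\<dots> = (\<Sum>j\<in>H. u j * (\<Sum>p\<in>S. c p * v j p))"
    unfolding sum_distrib_left by (rule sum.swap)
  also have "\<dots> = 0"
  proof (intro sum.neutral ballI)
    fix j assume "j \<in> H" then show "u j * (\<Sum>p\<in>S. c p * v j p) = 0" using c(2)[of j] by (simp add: g_def)
  qed
  finally have "(\<Sum>p\<in>S. c p * h p) = 0" .
  moreover have "(\<Sum>p\<in>S. c p * h p) = (\<Sum>p\<in>{p0}. c p * h p)"
    using p0 h S by (intro sum.mono_neutral_right) auto
  ultimately show False using h p0 by simp
qed

section \<open>Monomials and dimension counts\<close>

definition pmon :: "('a \<Rightarrow> nat) \<Rightarrow> 'a::euclidean_space \<Rightarrow> 'k::real_normed_field" where
  "pmon \<alpha> p = (\<Prod>b\<in>Basis. of_real (p \<bullet> b) ^ \<alpha> b)"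

text \<open>Each exponent is bounded separately, rather than the total degree; the number of such
  monomials is then a pure power, which keeps the dimension counts simple.\<close>

definition MI :: "nat \<Rightarrow> ('a::euclidean_space \<Rightarrow> nat) set" where
  "MI N = (\<Pi>\<^sub>E b\<in>Basis. {..<N})"

lemma finite_MI [simp]: "finite (MI N)"
  by (simp add: MI_def finite_PiE)

lemma card_MI: "card (MI N :: ('a::euclidean_space \<Rightarrow> nat) set) = N ^ DIM('a)"
  by (simp add: MI_def card_PiE)

lemma pmon_remove:
  assumes "b \<in> Basis"
  shows "(pmon \<alpha> p :: 'k::real_normed_field) = of_real (p \<bullet> b) ^ \<alpha> b * (\<Prod>i\<in>Basis - {b}. of_real (p \<bullet> i) ^ \<alpha> i)"
  unfolding pmon_def using prod.remove[OF finite_Basis assms] .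

lemma pmon_upd:
  assumes "b \<in> Basis"
  shows "(pmon (\<alpha>(b := n)) p :: 'k::real_normed_field) = of_real (p \<bullet> b) ^ n * (\<Prod>i\<in>Basis - {b}. of_real (p \<bullet> i) ^ \<alpha> i)"
proof -
  have "(\<Prod>i\<in>Basis - {b}. of_real (p \<bullet> i) ^ (\<alpha>(b := n)) i) = (\<Prod>i\<in>Basis - {b}. of_real (p \<bullet> i) ^ \<alpha> i :: 'k)"
    by (intro prod.cong) auto
  then show ?thesis unfolding pmon_remove[OF assms, of "\<alpha>(b := n)"] by simp
qed

lemma pmon_upd_Suc:
  assumes "b \<in> Basis"
  shows "(pmon (\<alpha>(b := Suc (\<alpha> b))) p :: 'k::real_normed_field) = of_real (p \<bullet> b) * pmon \<alpha> p"
  unfolding pmon_upd[OF assms] pmon_remove[OF assms, of \<alpha>] by simp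

lemma pmon_upd_0:
  assumes "b \<in> Basis"
  shows "(pmon \<alpha> p :: 'k::real_normed_field) = of_real (p \<bullet> b) ^ \<alpha> b * pmon (\<alpha>(b := 0)) p"
  unfolding pmon_upd[OF assms] pmon_remove[OF assms, of \<alpha>] by simp

lemma bounded_linear_of_real_inner: "bounded_linear (\<lambda>p. of_real (p \<bullet> b) :: 'k::real_normed_field)"
  using bounded_linear_compose[OF bounded_linear_of_real bounded_linear_inner_left] .

lemma polyd_pmon: "polyd (\<Sum>b\<in>Basis. \<alpha> b) (pmon \<alpha> :: 'a::euclidean_space \<Rightarrow> 'k::real_normed_field)"
proof -
  have "polyd (\<alpha> b * 1) (\<lambda>p. of_real (p \<bullet> b) ^ \<alpha> b :: 'k)" for b :: 'a
    by (intro polyd_power polyd_linear bounded_linear_of_real_inner)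
  then have "polyd (\<Sum>b\<in>Basis. \<alpha> b) (\<lambda>p. \<Prod>b\<in>Basis. of_real (p \<bullet> b) ^ \<alpha> b :: 'k)"
    by (intro polyd_prod) simp
  then show ?thesis by (simp add: pmon_def[abs_def])
qed

lemma linear_expand:
  fixes g :: "'a::euclidean_space \<Rightarrow> 'k::real_normed_field"
  assumes "bounded_linear g" shows "g p = (\<Sum>b\<in>Basis. g b * of_real (p \<bullet> b))"
proof -
  have "g p = g (\<Sum>b\<in>Basis. (p \<bullet> b) *\<^sub>R b)" by (simp add: euclidean_representation)
  also have "\<dots> = (\<Sum>b\<in>Basis. g b * of_real (p \<bullet> b))"
    using bounded_linear.linear[OF assms]
    by (simp add: linear_sum linear_scale scaleR_conv_of_real mult.commute)
  finally show ?thesis .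
qed

lemma polyd_in_span_pmon: "polyd k h \<Longrightarrow> h \<in> fs.span (pmon ` MI (Suc k))"
proof (induction rule: polyd.induct)
  case (polyd_const c)
  have 1: "(\<lambda>b\<in>(Basis :: 'a set). 0) \<in> MI (Suc 0)" by (auto simp: MI_def)
  have "(\<lambda>p::'a. c * pmon (\<lambda>b\<in>Basis. 0) p) \<in> fs.span (pmon ` MI (Suc 0))"
    by (intro fs.span_scale fs.span_base imageI 1)
  moreover have "(pmon (\<lambda>b\<in>Basis. 0) p :: 'b) = 1" for p :: 'a by (simp add: pmon_def)
  ultimately show ?case by simp
next
  case (polyd_lin k h g)
  show ?case
  proof (rule fs_span_mult[OF polyd_lin.IH])
    fix v :: "'a \<Rightarrow> 'b" assume "v \<in> pmon ` MI (Suc k)"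
    then obtain \<alpha> where \<alpha>: "\<alpha> \<in> MI (Suc k)" "v = pmon \<alpha>" by auto
    have upd: "\<alpha>(b := Suc (\<alpha> b)) \<in> MI (Suc (Suc k))" if "b \<in> Basis" for b
      using \<alpha>(1) that by (auto simp: MI_def PiE_iff extensional_def)
    have "(\<lambda>p. \<Sum>b\<in>Basis. g b * pmon (\<alpha>(b := Suc (\<alpha> b))) p) \<in> fs.span (pmon ` MI (Suc (Suc k)))"
      by (rule fs_span_sumI[OF fs.span_scale[OF fs.span_base[OF imageI[OF upd]]]])
    moreover have "(\<lambda>p. g p * v p) = (\<lambda>p. \<Sum>b\<in>Basis. g b * pmon (\<alpha>(b := Suc (\<alpha> b))) p)"
    proof
      fix p
      show "g p * v p = (\<Sum>b\<in>Basis. g b * pmon (\<alpha>(b := Suc (\<alpha> b))) p)"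
        by (subst linear_expand[OF polyd_lin.hyps(2)]) (simp add: \<alpha>(2) sum_distrib_right pmon_upd_Suc mult.assoc del: fun_upd_apply)
    qed
    ultimately show "(\<lambda>p. g p * v p) \<in> fs.span (pmon ` MI (Suc (Suc k)))" by simp
  qed
next
  case (polyd_add k h h') then show ?case by (intro fs_span_addI)
next
  case (polyd_Suc k h)
  have "pmon ` MI (Suc k) \<subseteq> (pmon ` MI (Suc (Suc k)) :: ('a \<Rightarrow> 'b) set)"
    unfolding MI_def by (intro image_mono PiE_mono) auto
  then show ?case using polyd_Suc.IH fs.span_mono by blast
qed

text \<open>Induction on the variables: with the others fixed, the sum is a polynomial in the
  remaining variable that vanishes at all reals, so its coefficients vanish, and these are sums of
  the same kind.\<close>

lemma monomials_independent_PiE: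
  fixes c :: "('i \<Rightarrow> nat) \<Rightarrow> 'k::real_normed_field"
  assumes "finite B" "\<And>x::'i \<Rightarrow> real. (\<Sum>\<alpha>\<in>PiE B (\<lambda>_. {..<N}). c \<alpha> * (\<Prod>b\<in>B. of_real (x b) ^ \<alpha> b)) = 0"
    "\<alpha> \<in> PiE B (\<lambda>_. {..<N})"
  shows "c \<alpha> = 0"
  using assms
proof (induction B arbitrary: c \<alpha> rule: finite_induct)
  case empty then show ?case by simp
next
  case (insert b B)
  define J where "J = PiE B (\<lambda>_::'i. {..<N})"
  have finJ: "finite J" using insert.hyps by (simp add: J_def finite_PiE)
  have J: "PiE (insert b B) (\<lambda>_. {..<N}) = (\<lambda>(y, g). g(b := y)) ` ({..<N} \<times> J)"
    by (simp add: PiE_insert_eq J_def)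
  have inj: "inj_on (\<lambda>(y, g). g(b := y)) ({..<N} \<times> J)"
    unfolding J_def using inj_combinator[OF insert.hyps(2), of "\<lambda>_. {..<N}"] .
  define a where "a = (\<lambda>y x. \<Sum>g\<in>J. c (g(b := y)) * (\<Prod>i\<in>B. of_real (x i) ^ g i))"
  have a0: "a y x = 0" if y: "y < N" for y x
  proof -
    define q where "q = (\<Sum>y<N. Polynomial.monom (a y x) y)"
    have "poly q (of_real t) = 0" for t :: real
    proof -
      have pr: "(\<Prod>i\<in>insert b B. of_real ((x(b := t)) i) ^ (g(b := y)) i) = of_real t ^ y * (\<Prod>i\<in>B. of_real (x i) ^ g i :: 'k)" for g y
        using insert.hyps by (simp) (intro disjI2 prod.cong, auto)
      have "0 = (\<Sum>\<alpha>\<in>PiE (insert b B) (\<lambda>_. {..<N}). c \<alpha> * (\<Prod>i\<in>insert b B. of_real ((x(b := t)) i) ^ \<alpha> i))"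
        using insert.prems(1)[of "x(b := t)"] by simp
      also have "\<dots> = (\<Sum>(y,g)\<in>{..<N} \<times> J. c (g(b := y)) * (of_real t ^ y * (\<Prod>i\<in>B. of_real (x i) ^ g i)))"
        unfolding J sum.reindex[OF inj] by (intro sum.cong) (auto simp: pr simp del: fun_upd_apply)
      also have "\<dots> = (\<Sum>y<N. \<Sum>g\<in>J. c (g(b := y)) * (of_real t ^ y * (\<Prod>i\<in>B. of_real (x i) ^ g i)))"
        by (simp add: sum.cartesian_product)
      also have "\<dots> = poly q (of_real t)"
        by (simp add: q_def poly_sum poly_monom a_def sum_distrib_left sum_distrib_right mult_ac)
      finally show ?thesis by simp
    qed
    then have "range (of_real :: real \<Rightarrow> 'k) \<subseteq> {z. poly q z = 0}" by auto
    moreover have "infinite (range (of_real :: real \<Rightarrow> 'k))"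
      using infinite_UNIV_char_0 finite_imageD[of "of_real :: real \<Rightarrow> 'k" UNIV] inj_of_real by blast
    ultimately have "q = 0" using poly_roots_finite[of q] finite_subset by blast
    then have "poly.coeff q y = 0" by simp
    moreover have "poly.coeff q y = a y x" using y by (simp add: q_def coeff_sum)
    ultimately show ?thesis by simp
  qed
  obtain y g where yg: "y < N" "g \<in> J" "\<alpha> = g(b := y)" using insert.prems(2) unfolding J by auto
  have "c (g(b := y)) = 0"
    by (rule insert.IH[of "\<lambda>g. c (g(b := y))" g]) (use a0[OF yg(1)] yg(2) in \<open>auto simp: a_def J_def\<close>)
  then show ?case by (simp only: yg(3))
qed

lemma pmon_independent:
  fixes c :: "('a::euclidean_space \<Rightarrow> nat) \<Rightarrow> 'k::real_normed_field"
  assumes "\<And>p. (\<Sum>\<alpha>\<in>MI N. c \<alpha> * pmon \<alpha> p) = 0" "\<alpha> \<in> MI N"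
  shows "c \<alpha> = 0"
proof (rule monomials_independent_PiE[where B=Basis and N=N and c=c and \<alpha>=\<alpha>])
  fix x :: "'a \<Rightarrow> real"
  define p where "p = (\<Sum>b\<in>Basis. x b *\<^sub>R b)"
  have "p \<bullet> b = x b" if "b \<in> Basis" for b
    using that by (simp add: p_def inner_sum_left inner_Basis if_distrib[of "\<lambda>y. _ * y"] cong: if_cong)
  then show "(\<Sum>\<alpha>\<in>PiE Basis (\<lambda>_. {..<N}). c \<alpha> * (\<Prod>b\<in>Basis. of_real (x b) ^ \<alpha> b)) = 0"
    using assms(1)[of p] by (simp add: pmon_def MI_def)
qed (use assms(2) in \<open>auto simp: MI_def\<close>)

text \<open>The equations rewrite the power \<open>(p \<bullet> b) ^ m\<close> to lower degree, so the monomials with all exponents below \<open>m\<close>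
  span all functions on \<open>Z\<close>.\<close>

lemma dominant_powers_card:
  fixes G :: "'a::euclidean_space \<Rightarrow> 'a \<Rightarrow> real"
  assumes Z: "finite Z" and m: "m \<ge> 1" and G: "\<And>b. b \<in> Basis \<Longrightarrow> polyd (m - 1) (G b)"
    and eq: "\<And>p b. p \<in> Z \<Longrightarrow> b \<in> Basis \<Longrightarrow> (p \<bullet> b) ^ m + G b p = 0"
  shows "card Z \<le> m ^ DIM('a)"
proof -
  \<comment> \<open>Functions are set to 0 off Z, so that equality on Z becomes equality of
    functions and spans can be used.\<close>
  define rs where "rs = (\<lambda>(f::'a \<Rightarrow> real) p. if p \<in> Z then f p else 0)"
  define R where "R = (\<lambda>k. rs ` pmon ` {\<alpha> \<in> MI m. (\<Sum>b\<in>Basis. \<alpha> b) \<le> k})"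
  have Rmono: "R j \<subseteq> R k" if "j \<le> k" for j k
    unfolding R_def using that by (intro image_mono) auto
  \<comment> \<open>A double induction: \<open>outer\<close> is the hypothesis for smaller degrees,
    and within it the polynomial is built up along \<open>polyd\<close>.\<close>
  have step: "k \<le> K \<longrightarrow> rs h \<in> fs.span (R k)"
    if outer: "\<And>j h. j < K \<Longrightarrow> polyd j h \<Longrightarrow> rs h \<in> fs.span (R j)" and h: "polyd k h" for K k h
    using h
  proof (induction rule: polyd.induct)
    case (polyd_const c)
    have 1: "(\<lambda>b\<in>Basis. 0) \<in> {\<alpha> \<in> MI m. (\<Sum>b\<in>Basis. \<alpha> b) \<le> 0}" using m by (auto simp: MI_def)
    have "(\<lambda>p. c * rs (pmon (\<lambda>b\<in>Basis. 0)) p) \<in> fs.span (R 0)"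
      unfolding R_def by (intro fs.span_scale fs.span_base imageI 1)
    moreover have "(\<lambda>p. c * rs (pmon (\<lambda>b\<in>Basis. 0)) p) = rs (\<lambda>_. c)"
      by (auto simp: rs_def pmon_def)
    ultimately show ?case by simp
  next
    case (polyd_lin k h g)
    show ?case
    proof
      assume K: "Suc k \<le> K"
      have "(\<lambda>p. g p * rs h p) \<in> fs.span (R (Suc k))"
      proof (rule fs_span_mult)
        show "rs h \<in> fs.span (R k)" using polyd_lin.IH K by simp
        fix v assume "v \<in> R k"
        then obtain \<alpha> where \<alpha>: "\<alpha> \<in> MI m" "(\<Sum>b\<in>Basis. \<alpha> b) \<le> k" "v = rs (pmon \<alpha>)" by (auto simp: R_def)
        have "rs (\<lambda>p. (p \<bullet> b) * pmon \<alpha> p) \<in> fs.span (R (Suc k))" if b: "b \<in> Basis" for b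
        proof (cases "Suc (\<alpha> b) < m")
          case True
          have "(\<Sum>i\<in>Basis. (\<alpha>(b := Suc (\<alpha> b))) i) = Suc (\<Sum>i\<in>Basis. \<alpha> i)"
            using b by (simp add: sum.remove[of Basis b])
          then have "\<alpha>(b := Suc (\<alpha> b)) \<in> {\<alpha> \<in> MI m. (\<Sum>b\<in>Basis. \<alpha> b) \<le> Suc k}"
            using \<alpha> b True by (auto simp: MI_def PiE_iff extensional_def)
          then have "rs (pmon (\<alpha>(b := Suc (\<alpha> b)))) \<in> R (Suc k)" unfolding R_def by blast
          moreover have "pmon (\<alpha>(b := Suc (\<alpha> b))) = (\<lambda>p. (p \<bullet> b) * pmon \<alpha> p)"
            using pmon_upd_Suc[OF b, of \<alpha>, where 'k=real] by auto
          ultimately show ?thesis using fs.span_base by auto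
        next
          \<comment> \<open>The exponent of b is maximal. One more factor
            \<open>p \<bullet> b\<close> completes the m-th power, which equals
            \<open>- G b p\<close> on Z; the total degree drops to at most k, so
            \<open>outer\<close> applies.\<close>
          case False
          have "\<alpha> b < m" using \<alpha>(1) b by (auto simp: MI_def)
          then have ab: "\<alpha> b = m - 1" using False by simp
          define \<beta> where "\<beta> = \<alpha>(b := 0)"
          have s: "(\<Sum>i\<in>Basis. \<alpha> i) = (m - 1) + (\<Sum>i\<in>Basis. \<beta> i)"
            using b ab by (simp add: sum.remove[of Basis b] \<beta>_def)
          have "polyd ((m - 1) + (\<Sum>i\<in>Basis. \<beta> i)) (\<lambda>p. - G b p * pmon \<beta> p)"
            by (intro polyd_mult polyd_uminus G b polyd_pmon)
          then have "polyd k (\<lambda>p. - G b p * pmon \<beta> p)" using s \<alpha>(2) polyd_mono by auto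
          then have "rs (\<lambda>p. - G b p * pmon \<beta> p) \<in> fs.span (R k)" using outer[of k] K by simp
          moreover have "rs (\<lambda>p. - G b p * pmon \<beta> p) = rs (\<lambda>p. (p \<bullet> b) * pmon \<alpha> p)"
          proof
            fix p
            have "(p \<bullet> b) * (p \<bullet> b) ^ (m - 1) = - G b p" if "p \<in> Z"
              using eq[OF that b] m by (cases m) auto
            then show "rs (\<lambda>p. - G b p * pmon \<beta> p) p = rs (\<lambda>p. (p \<bullet> b) * pmon \<alpha> p) p"
              using pmon_upd_0[OF b, of \<alpha> p, where 'k=real] by (simp add: rs_def \<beta>_def ab mult.assoc[symmetric])
          qed
          ultimately show ?thesis using fs.span_mono[OF Rmono[of k "Suc k"]] by auto
        qed
        then have "(\<lambda>p. \<Sum>b\<in>Basis. g b * rs (\<lambda>p. (p \<bullet> b) * pmon \<alpha> p) p) \<in> fs.span (R (Suc k))"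
          by (intro fs_span_sumI fs.span_scale)
        moreover have "(\<lambda>p. \<Sum>b\<in>Basis. g b * rs (\<lambda>p. (p \<bullet> b) * pmon \<alpha> p) p) = (\<lambda>p. g p * v p)"
        proof
          fix p
          show "(\<Sum>b\<in>Basis. g b * rs (\<lambda>p. (p \<bullet> b) * pmon \<alpha> p) p) = g p * v p"
            by (subst linear_expand[OF polyd_lin.hyps(2), of p]) (simp add: rs_def \<alpha>(3) sum_distrib_right mult.assoc)
        qed
        ultimately show "(\<lambda>p. g p * v p) \<in> fs.span (R (Suc k))" by simp
      qed
      moreover have "(\<lambda>p. g p * rs h p) = rs (\<lambda>p. g p * h p)" by (auto simp: rs_def)
      ultimately show "rs (\<lambda>p. g p * h p) \<in> fs.span (R (Suc k))" by simp
    qed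
  next
    case (polyd_add k h h')
    have "rs (\<lambda>p. h p + h' p) = (\<lambda>p. rs h p + rs h' p)" by (auto simp: rs_def)
    then show ?case using polyd_add.IH fs_span_addI[of "rs h" "R k" "rs h'"] by simp
  next
    case (polyd_Suc k h)
    then show ?case using fs.span_mono[OF Rmono[of k "Suc k"]] by auto
  qed
  have all: "\<forall>h. polyd k h \<longrightarrow> rs h \<in> fs.span (R k)" for k
  proof (induction k rule: less_induct)
    case (less k) then show ?case using step[of k] by blast
  qed
  define RR where "RR = rs ` pmon ` (MI m :: ('a \<Rightarrow> nat) set)"
  have finRR: "finite RR" by (simp add: RR_def)
  have "card Z \<le> card RR"
  proof (rule card_le_of_polyd_span[OF Z finRR, of "\<lambda>v. v"])
    fix k and h :: "'a \<Rightarrow> real" assume "polyd k h"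
    then have "rs h \<in> fs.span (R k)" using all by blast
    moreover have "R k \<subseteq> RR" by (auto simp: R_def RR_def)
    ultimately have "rs h \<in> fs.span RR" using fs.span_mono by blast
    then obtain u where "\<And>p. rs h p = (\<Sum>v\<in>RR. u v * v p)" using fs_span_explicit[OF finRR] by blast
    then show "\<exists>u. \<forall>p\<in>Z. h p = (\<Sum>v\<in>RR. u v * v p)" unfolding rs_def by metis
  qed
  also have "card RR \<le> card (MI m :: ('a \<Rightarrow> nat) set)"
    unfolding RR_def by (meson card_image_le finite_MI finite_imageI order_trans)
  finally show ?thesis by (simp add: card_MI)
qed

section \<open>Iterated partial derivatives\<close>

fun ders :: "nat \<Rightarrow> ('a::euclidean_space \<Rightarrow> real) \<Rightarrow> ('a \<Rightarrow> real) set" where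
  "ders 0 h = {h}"
| "ders (Suc n) h = insert h (\<Union>b\<in>Basis. ders n (pd b h))"

lemma finite_ders: "finite (ders n h)"
  by (induction n arbitrary: h) auto

lemma card_ders: "card (ders n (h::'a::euclidean_space \<Rightarrow> real)) \<le> (DIM('a) + 1) ^ n"
proof (induction n arbitrary: h)
  case (Suc n)
  have "card (ders (Suc n) h) \<le> 1 + card (\<Union>b\<in>Basis. ders n (pd b h))"
    by (simp add: card_insert_if finite_ders)
  also have "card (\<Union>b\<in>Basis. ders n (pd b h)) \<le> (\<Sum>b\<in>(Basis::'a set). card (ders n (pd b h)))"
    by (rule card_UN_le) auto
  also have "\<dots> \<le> (\<Sum>b\<in>(Basis::'a set). (DIM('a) + 1) ^ n)" by (intro sum_mono Suc)
  finally have "card (ders (Suc n) h) \<le> 1 + DIM('a) * (DIM('a) + 1) ^ n" by simp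
  also have "\<dots> \<le> (DIM('a) + 1) ^ n + DIM('a) * (DIM('a) + 1) ^ n" by simp
  finally show ?case by simp
qed simp

lemma polyd_ders: "polyd n h \<Longrightarrow> g \<in> ders n h \<Longrightarrow> polyd n g"
proof (induction n arbitrary: h)
  case (Suc n)
  show ?case
  proof (cases "g = h")
    case False
    then obtain b where "g \<in> ders n (pd b h)" using Suc.prems by auto
    then show ?thesis using Suc.IH[of "pd b h"] polyd_pd[OF Suc.prems(1), of b] by (auto intro: polyd_Suc)
  qed (use Suc in auto)
qed auto

lemma polyd_gradient_zero_const:
  fixes h :: "'a::euclidean_space \<Rightarrow> real"
  assumes h: "polyd n h" and z: "\<And>b x. b \<in> Basis \<Longrightarrow> pd b h x = 0"
  shows "h x = h y"
proof -
  have "pd v h x = 0" for v x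
    using linear_expand[OF pd_bounded_linear[OF h, of x], of v] z by simp
  then have "(h has_derivative (\<lambda>v. 0)) (at x)" for x
    using pd_has_derivative[OF h, of x] by simp
  then have "\<exists>c. \<forall>x\<in>UNIV. h x = c"
    by (intro has_derivative_zero_constant) auto
  then show ?thesis by auto
qed

text \<open>If the gradient vanishes at p, some partial derivative vanishes at p without vanishing
  identically, and its degree is smaller. The descent ends at a zero with nonzero gradient, since a
  polynomial of degree 0 that vanishes at p vanishes everywhere. Singular points of a wall thus
  become regular points of another wall.\<close>

lemma exists_regular_derivative:
  fixes h :: "'a::euclidean_space \<Rightarrow> real"
  assumes "polyd n h" "h p = 0" "h x \<noteq> 0"
  shows "\<exists>g\<in>ders n h. g p = 0 \<and> (\<exists>b\<in>Basis. pd b g p \<noteq> 0)"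
  using assms
proof (induction n arbitrary: h x)
  case 0
  then have "h x = h p" using polyd_gradient_zero_const[OF 0(1)] pd_0[OF 0(1)] by blast
  then show ?case using 0 by simp
next
  case (Suc n)
  show ?case
  proof (cases "\<exists>b\<in>Basis. pd b h p \<noteq> 0")
    case True then show ?thesis using Suc.prems by auto
  next
    case False
    obtain b y where b: "b \<in> Basis" "pd b h y \<noteq> 0"
      using polyd_gradient_zero_const[OF Suc.prems(1), of x p] Suc.prems by metis
    have "\<exists>g\<in>ders n (pd b h). g p = 0 \<and> (\<exists>b\<in>Basis. pd b g p \<noteq> 0)"
      using Suc.IH[of "pd b h" y] polyd_pd[OF Suc.prems(1), of b] False b by auto
    then show ?thesis using b by auto
  qed
qed

section \<open>Counting zeros and components\<close>

lemma polyd_inner_power: "polyd n (\<lambda>p. (p \<bullet> b) ^ n :: real)"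
  using polyd_power[OF polyd_linear[OF bounded_linear_inner_left[of b]], of n] by simp

lemma polyd_sum_powers: "polyd n (\<lambda>p. \<Sum>b\<in>Basis. (p \<bullet> b) ^ n :: real)"
  by (intro polyd_sum polyd_inner_power)

lemma has_derivative_inner_power:
  "((\<lambda>p. (p \<bullet> b) ^ Suc n) has_derivative (\<lambda>v. real (Suc n) * (q \<bullet> b) ^ n * (v \<bullet> b))) (at q)"
  using has_derivative_power[OF bounded_linear_imp_has_derivative[OF bounded_linear_inner_left[of b]], where n = "Suc n" and x = q and S = UNIV]
  by (simp add: mult_ac del: of_nat_Suc power_Suc)

lemma pd_eqI: "(h has_derivative D) (at q) \<Longrightarrow> pd v h q = D v"
  using frechet_derivative_at[of h D q] unfolding pd_def by simp

lemma pd_sum_powers: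
  assumes "b \<in> Basis"
  shows "pd b (\<lambda>p. \<Sum>b\<in>Basis. (p \<bullet> b) ^ Suc n) q = real (Suc n) * (q \<bullet> b) ^ n"
proof -
  have "((\<lambda>p. \<Sum>b\<in>Basis. (p \<bullet> b) ^ Suc n) has_derivative (\<lambda>v. \<Sum>b\<in>Basis. real (Suc n) * (q \<bullet> b) ^ n * (v \<bullet> b))) (at q)"
    by (intro has_derivative_sum has_derivative_inner_power)
  then have "pd b (\<lambda>p. \<Sum>b\<in>Basis. (p \<bullet> b) ^ Suc n) q = (\<Sum>i\<in>Basis. real (Suc n) * (q \<bullet> i) ^ n * (b \<bullet> i))"
    by (rule pd_eqI)
  also have "\<dots> = real (Suc n) * (q \<bullet> b) ^ n"
    using assms by (simp add: inner_Basis if_distrib[of "\<lambda>y. _ * y"] cong: if_cong)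
  finally show ?thesis .
qed

lemma pd_add: "polyd k f \<Longrightarrow> polyd l g \<Longrightarrow> pd v (\<lambda>p. f p + g p) q = pd v f q + pd v g q"
  by (rule pd_eqI) (intro has_derivative_add pd_has_derivative)

lemma pd_cmult: "polyd k f \<Longrightarrow> pd v (\<lambda>p. c * f p) q = c * pd v f q"
  by (rule pd_eqI) (intro has_derivative_mult_right pd_has_derivative)

text \<open>Every component, cut off by a ball, contains a local extremum of \<open>H\<close> times the cut-off, and still does after a small
  perturbation by a sum of pure powers of higher degree; the critical points of the latter are counted by dominant powers.\<close>

lemma polyd_components_card_aux:
  fixes H :: "'b::euclidean_space \<Rightarrow> real"
  assumes H: "polyd D H" and K: "finite K" "K \<subseteq> components {x. H x \<noteq> 0}" and ne: "K \<noteq> {}"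
  shows "card K \<le> (D + 2) ^ DIM('b)"
proof -
  define S where "S = {x. H x \<noteq> 0}"
  have "closed {x. H x = 0}"
    using polyd_continuous[OF H, of UNIV] by (auto intro!: closed_Collect_eq)
  then have openS: "open S" unfolding S_def by (simp add: closed_def Collect_neg_eq[symmetric])
  note K' = K(2)[folded S_def]
  have Cne: "\<exists>x. x \<in> C" if "C \<in> K" for C using in_components_nonempty[of C S] K' that by auto
  define pc where "pc = (\<lambda>C::'b set. SOME x. x \<in> C)"
  have pc: "pc C \<in> C" if "C \<in> K" for C unfolding pc_def using Cne[OF that] by (rule someI_ex)
  have CS: "C \<subseteq> S" if "C \<in> K" for C using in_components_subset[of C S] K' that by auto
  obtain \<rho> where \<rho>: "\<And>C. C \<in> K \<Longrightarrow> norm (pc C) < \<rho>" "\<rho> > 0"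
  proof -
    have "bounded (pc ` K)" using K by (auto intro: finite_imp_bounded)
    then obtain r where "r > 0" "\<forall>x\<in>pc ` K. norm x < r" by (auto simp: bounded_pos_less)
    then show ?thesis using that[of r] by auto
  qed
  define m where "m = D + 2"
  \<comment> \<open>The second factor vanishes on the sphere of radius \<rho>, and H vanishes on the
    frontier of its components, so \<open>Hd\<close> vanishes on the frontier of each
    \<open>U C\<close>. Its degree is at most m = D + 2.\<close>
  define Hd where "Hd = (\<lambda>p. H p * (\<rho>\<^sup>2 - (\<Sum>b\<in>Basis. (p \<bullet> b) ^ 2)))"
  \<comment> \<open>The gradient of \<open>W\<close> consists of multiples of pure powers of degree
    m, while that of \<open>Hd\<close> has degree at most m - 1: the shape that
    \<open>dominant_powers_card\<close> requires.\<close>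
  define W where "W = (\<lambda>p::'b. \<Sum>b\<in>Basis. (p \<bullet> b) ^ Suc m)"
  have nrm: "(\<Sum>b\<in>Basis. (p \<bullet> b) ^ 2) = (norm p)\<^sup>2" for p :: 'b
    unfolding power2_norm_eq_inner euclidean_inner[of p p] by (simp add: power2_eq_square)
  have pHd: "polyd m Hd" unfolding Hd_def m_def
    by (intro polyd_mult H polyd_diff polyd_const' polyd_sum_powers)
  have pW: "polyd (Suc m) W" unfolding W_def by (rule polyd_sum_powers)
  have contHd: "continuous_on X Hd" and contW: "continuous_on X W" for X
    using polyd_continuous[OF pHd] polyd_continuous[OF pW] by auto
  define U where "U = (\<lambda>C::'b set. C \<inter> ball 0 \<rho>)"
  have openU: "open (U C)" if "C \<in> K" for C
    using open_components[OF openS] K' that by (auto simp: U_def)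
  have pcU: "pc C \<in> U C" if "C \<in> K" for C using pc[OF that] \<rho>(1)[OF that] by (auto simp: U_def)
  have clU: "closure (U C) \<subseteq> cball 0 \<rho>" for C
    unfolding U_def by (metis ball_subset_cball closed_cball closure_minimal inf.coboundedI2)
  have compU: "compact (closure (U C))" for C
    using clU[of C] by (meson bounded_cball bounded_subset closed_closure compact_eq_bounded_closed)
  have fr: "Hd x = 0" if C: "C \<in> K" and x: "x \<in> closure (U C)" "x \<notin> U C" for C x
  proof (cases "norm x = \<rho>")
    case True then show ?thesis by (simp add: Hd_def nrm)
  next
    case False
    then have "norm x < \<rho>" using clU[of C] x by (auto simp: dist_norm)
    then have xC: "x \<notin> C" using x(2) by (auto simp: U_def)
    have "x \<in> closure C" using x(1) closure_mono[of "U C" C] by (auto simp: U_def)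
    moreover have "closedin (top_of_set S) C" using closedin_component K' C by blast
    then obtain T where "closed T" "C = S \<inter> T" by (auto simp: closedin_closed)
    ultimately have "x \<in> T" by (metis closure_minimal inf_le2 subset_iff)
    then have "x \<notin> S" using xC \<open>C = S \<inter> T\<close> by auto
    then show ?thesis by (simp add: S_def Hd_def)
  qed
  have Hdpc: "Hd (pc C) \<noteq> 0" if C: "C \<in> K" for C
  proof -
    have "H (pc C) \<noteq> 0" using CS[OF C] pc[OF C] by (auto simp: S_def)
    moreover have "(norm (pc C))\<^sup>2 < \<rho>\<^sup>2" using \<rho>(1)[OF C] by (intro power_strict_mono) auto
    ultimately show ?thesis by (simp add: Hd_def nrm)
  qed
  define \<delta> where "\<delta> = Min ((\<lambda>C. \<bar>Hd (pc C)\<bar>) ` K)"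
  have \<delta>: "\<delta> > 0" "\<And>C. C \<in> K \<Longrightarrow> \<delta> \<le> \<bar>Hd (pc C)\<bar>"
    using K ne Hdpc by (auto simp: \<delta>_def)
  obtain B where B: "\<And>x. x \<in> cball 0 \<rho> \<Longrightarrow> \<bar>W x\<bar> \<le> B" "B > 0"
  proof -
    have "bounded (W ` cball 0 \<rho>)"
      by (intro compact_imp_bounded compact_continuous_image contW) auto
    then obtain B where "B > 0" "\<forall>x\<in>W ` cball 0 \<rho>. norm x \<le> B" by (auto simp: bounded_pos)
    then show ?thesis using that[of B] by auto
  qed
  \<comment> \<open>On the ball the perturbation is at most t * B < \<delta> / 2. Up to the sign s,
    the values of F on the frontier therefore stay below its value at \<open>pc C\<close>, and the
    maximum lies inside.\<close>
  define t where "t = \<delta> / (4 * B)"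
  have t: "t > 0" "2 * t * B < \<delta>" using \<delta> B by (auto simp: t_def field_simps)
  define F where "F = (\<lambda>p. Hd p + t * W p)"
  have pF: "polyd (Suc m) F" unfolding F_def using pHd pW by (intro polyd_add polyd_cmult) (auto intro: polyd_Suc)
  have tW: "\<bar>t * W x\<bar> \<le> t * B" if "x \<in> cball 0 \<rho>" for x
    using B(1)[OF that] t by (simp add: abs_mult)
  have "\<exists>q\<in>U C. \<forall>b\<in>Basis. pd b F q = 0" if C: "C \<in> K" for C
  proof -
    define s where "s = sgn (Hd (pc C))"
    have s: "s * Hd (pc C) = \<bar>Hd (pc C)\<bar>" "\<bar>s\<bar> = 1" using Hdpc[OF C] by (auto simp: s_def sgn_if)
    have "closure (U C) \<noteq> {}" using pcU[OF C] closure_subset by blast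
    moreover have "continuous_on (closure (U C)) (\<lambda>p. s * F p)"
      using polyd_continuous[OF pF] by (intro continuous_intros) auto
    ultimately obtain q where q: "q \<in> closure (U C)" "\<And>y. y \<in> closure (U C) \<Longrightarrow> s * F y \<le> s * F q"
      using continuous_attains_sup[OF compU] by metis
    have qU: "q \<in> U C"
    proof (rule ccontr)
      assume "q \<notin> U C"
      then have "Hd q = 0" using fr[OF C q(1)] by simp
      moreover have "\<bar>s * (t * W q)\<bar> \<le> t * B" using tW[of q] clU[of C] q(1) s(2) by (auto simp: abs_mult)
      ultimately have 1: "s * F q \<le> t * B" by (simp add: F_def abs_le_iff)
      have "pc C \<in> closure (U C)" using pcU[OF C] closure_subset by blast
      then have "s * F (pc C) \<le> t * B" using q(2) 1 by force
      moreover have "\<bar>s * (t * W (pc C))\<bar> \<le> t * B"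
        using tW[of "pc C"] \<rho>(1)[OF C] s(2) by (auto simp: abs_mult)
      moreover have "s * F (pc C) = \<bar>Hd (pc C)\<bar> + s * (t * W (pc C))"
        using s(1) by (simp add: F_def distrib_left)
      ultimately have "\<bar>Hd (pc C)\<bar> \<le> 2 * t * B" by linarith
      then show False using \<delta>(2)[OF C] t by linarith
    qed
    have "((\<lambda>p. s * F p) has_derivative (\<lambda>v. s * pd v F q)) (at q)"
      by (intro has_derivative_mult_right pd_has_derivative[OF pF])
    then have "(\<lambda>v. s * pd v F q) = (\<lambda>v. 0)"
      using differential_zero_maxmin[of q "U C" "\<lambda>p. s * F p"] qU openU[OF C] q(2) closure_subset[of "U C"] by blast
    then have "s * pd v F q = 0" for v by (rule fun_cong)
    moreover have "s \<noteq> 0" using s(2) by auto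
    ultimately have "pd v F q = 0" for v by simp
    then show ?thesis using qU by blast
  qed
  then have "\<forall>C\<in>K. \<exists>q. q \<in> U C \<and> (\<forall>b\<in>Basis. pd b F q = 0)" by blast
  from bchoice[OF this] obtain q where q: "\<And>C. C \<in> K \<Longrightarrow> q C \<in> U C" "\<And>C b. C \<in> K \<Longrightarrow> b \<in> Basis \<Longrightarrow> pd b F (q C) = 0"
    by auto
  have inj: "inj_on q K"
  proof (rule inj_onI)
    fix C C' assume C: "C \<in> K" "C' \<in> K" "q C = q C'"
    then have "q C \<in> C \<inter> C'" using q(1)[OF C(1)] q(1)[OF C(2)] by (auto simp: U_def)
    then show "C = C'" using components_eq[of C S C'] K' C by auto
  qed
  have "card (q ` K) \<le> m ^ DIM('b)"
  proof (rule dominant_powers_card)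
    show "finite (q ` K)" using K by simp
    show "1 \<le> m" by (simp add: m_def)
    fix b :: 'b
    show "polyd (m - 1) (\<lambda>p. (1 / (t * real (Suc m))) * pd b Hd p)"
      by (intro polyd_cmult polyd_pd pHd)
    fix p assume "p \<in> q ` K" and b: "b \<in> Basis"
    then have "pd b F p = 0" using q(2) by auto
    moreover have "pd b F p = pd b Hd p + t * (real (Suc m) * (p \<bullet> b) ^ m)"
      unfolding F_def using pd_add[OF pHd polyd_cmult[OF pW]] pd_cmult[OF pW] pd_sum_powers[OF b, of m p]
      by (simp add: W_def)
    moreover define c where "c = t * real (Suc m)"
    ultimately have "pd b Hd p + c * (p \<bullet> b) ^ m = 0" by simp
    moreover have "c > 0" using t by (simp add: c_def)
    ultimately have "(p \<bullet> b) ^ m + (1 / c) * pd b Hd p = 0" by (simp add: field_simps)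
    then show "(p \<bullet> b) ^ m + (1 / (t * real (Suc m))) * pd b Hd p = 0" by (simp only: c_def)
  qed
  then show ?thesis using card_image[OF inj] by (simp add: m_def)
qed

theorem polyd_components_card:
  fixes H :: "'b::euclidean_space \<Rightarrow> real"
  assumes H: "polyd D H"
  shows "finite (components {x. H x \<noteq> 0})" "card (components {x. H x \<noteq> 0}) \<le> (D + 2) ^ DIM('b)"
proof -
  have "finite (components {x. H x \<noteq> 0}) \<and> card (components {x. H x \<noteq> 0}) \<le> (D + 2) ^ DIM('b)"
    by (rule finite_if_finite_subsets_card_bdd) (use polyd_components_card_aux[OF H] in \<open>metis card.empty le0\<close>)
  then show "finite (components {x. H x \<noteq> 0})" "card (components {x. H x \<noteq> 0}) \<le> (D + 2) ^ DIM('b)" by auto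
qed

text \<open>A crude Bezout bound by deformation. Adding t times the vector W of pure powers of
  degree D + 1 moves each nondegenerate zero only slightly, so for small t there are at least as
  many zeros as before, and they satisfy equations with dominant powers.\<close>

theorem nondegenerate_zeros_card:
  fixes F :: "'a::euclidean_space \<Rightarrow> 'a"
  assumes F: "\<And>b. b \<in> Basis \<Longrightarrow> polyd D (\<lambda>p. F p \<bullet> b)"
    and S: "finite S" "\<And>p. p \<in> S \<Longrightarrow> F p = 0"
    and nd: "\<And>p. p \<in> S \<Longrightarrow> \<exists>F'. (F has_derivative F') (at p) \<and> inj F'"
  shows "card S \<le> (D + 1) ^ DIM('a)"
proof (cases "S = {}")
  case False
  define W where "W = (\<lambda>p::'a. \<Sum>b\<in>Basis. (p \<bullet> b) ^ Suc D *\<^sub>R b)"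
  have Wb: "W p \<bullet> b = (p \<bullet> b) ^ Suc D" if "b \<in> Basis" for p b
    using that by (simp add: W_def inner_sum_left inner_Basis if_distrib[of "\<lambda>y. _ * y"] cong: if_cong)
  have contF: "continuous_on UNIV F"
  proof -
    have "continuous_on UNIV (\<lambda>p. \<Sum>b\<in>Basis. (F p \<bullet> b) *\<^sub>R b)"
      by (intro continuous_intros polyd_continuous[OF F]) auto
    then show ?thesis by (simp add: euclidean_representation)
  qed
  have contW: "continuous_on UNIV W" unfolding W_def by (intro continuous_intros)
  \<comment> \<open>The parameter t is carried along as a coordinate; openness of
    \<open>\<Phi>\<close> at (p, 0) then yields zeros near p for all small t at once.\<close>
  define \<Phi> where "\<Phi> = (\<lambda>(p::'a, t::real). (F p + t *\<^sub>R W p, t))"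
  have cont\<Phi>: "continuous_on UNIV \<Phi>"
    unfolding \<Phi>_def case_prod_beta
    by (intro continuous_intros continuous_on_compose2[OF contF] continuous_on_compose2[OF contW]) auto
  have persist: "\<exists>d>0. \<forall>t. \<bar>t\<bar> < d \<longrightarrow> (\<exists>q\<in>ball p e. F q + t *\<^sub>R W q = 0)" if p: "p \<in> S" and e: "e > 0" for p e
  proof -
    obtain F' where F': "(F has_derivative F') (at p)" "inj F'" using nd[OF p] by blast
    have linF: "linear F'" using F'(1) has_derivative_linear by blast
    obtain g where g: "linear g" "\<And>x. F' (g x) = x"
      using linear_injective_isomorphism[OF linF F'(2)] by blast
    have "(W has_derivative (\<lambda>v. \<Sum>b\<in>Basis. (real (Suc D) * (p \<bullet> b) ^ D * (v \<bullet> b)) *\<^sub>R b)) (at p)"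
      unfolding W_def by (intro has_derivative_sum has_derivative_scaleR_left has_derivative_inner_power)
    then obtain W' where W': "(W has_derivative W') (at p)" by blast
    have der: "(\<Phi> has_derivative (\<lambda>(v, s). (F' v + s *\<^sub>R W p, s))) (at (p, 0))"
    proof -
      have 1: "((\<lambda>x. F (fst x)) has_derivative (\<lambda>x. F' (fst x))) (at (p, 0::real))"
        by (rule has_derivative_compose[of fst fst "(p, 0)" UNIV F F', simplified]) (auto intro!: derivative_intros F')
      have 2: "((\<lambda>x. W (fst x)) has_derivative (\<lambda>x. W' (fst x))) (at (p, 0::real))"
        by (rule has_derivative_compose[of fst fst "(p, 0)" UNIV W W', simplified]) (auto intro!: derivative_intros W')
      show ?thesis
        unfolding \<Phi>_def case_prod_beta
        by (rule derivative_eq_intros 1 2 refl)+ auto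
    qed
    define g' where "g' = (\<lambda>(u, s::real). (g (u - s *\<^sub>R W p), s))"
    have bg: "bounded_linear g" using g(1) by (simp add: linear_conv_bounded_linear)
    have "bounded_linear g'"
    proof -
      have "bounded_linear (\<lambda>x::'a \<times> real. (g (fst x - snd x *\<^sub>R W p), snd x))"
        by (intro bounded_linear_Pair bounded_linear_compose[OF bg] bounded_linear_sub bounded_linear_fst
            bounded_linear_snd bounded_linear_compose[OF bounded_linear_scaleR_left])
      moreover have "g' = (\<lambda>x. (g (fst x - snd x *\<^sub>R W p), snd x))" by (auto simp: g'_def)
      ultimately show ?thesis by simp
    qed
    moreover have "(\<lambda>(v, s). (F' v + s *\<^sub>R W p, s)) \<circ> g' = id"
      by (auto simp: g'_def g(2))
    moreover have "(p, 0) \<in> interior (ball p e \<times> (UNIV::real set))"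
      using e by (simp add: interior_Times)
    ultimately have "\<Phi> (p, 0) \<in> interior (\<Phi> ` (ball p e \<times> UNIV))"
      using sussmann_open_mapping[OF open_UNIV cont\<Phi> UNIV_I der] by blast
    then have "(0, 0) \<in> interior (\<Phi> ` (ball p e \<times> UNIV))" using S(2)[OF p] by (simp add: \<Phi>_def)
    then obtain d where d: "d > 0" "ball (0, 0) d \<subseteq> \<Phi> ` (ball p e \<times> UNIV)"
      by (auto simp: mem_interior)
    have "\<exists>q\<in>ball p e. F q + t *\<^sub>R W q = 0" if "\<bar>t\<bar> < d" for t
    proof -
      have "(0, t) \<in> ball (0::'a, 0::real) d" using that by (simp add: dist_Pair_Pair)
      then have "(0, t) \<in> \<Phi> ` (ball p e \<times> UNIV)" using d by blast
      then show ?thesis by (auto simp: \<Phi>_def)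
    qed
    then show ?thesis using d by blast
  qed
  \<comment> \<open>At most half the minimal distance, so that zeros starting from different points
    cannot coincide.\<close>
  obtain e where e: "e > 0" "\<And>p q. p \<in> S \<Longrightarrow> q \<in> S \<Longrightarrow> p \<noteq> q \<Longrightarrow> 2 * e \<le> dist p q"
  proof -
    have "\<forall>p\<in>S. \<exists>d>0. \<forall>q\<in>S. q \<noteq> p \<longrightarrow> d \<le> dist p q" using finite_set_avoid[OF S(1)] by blast
    from bchoice[OF this] obtain d where d: "\<And>p. p \<in> S \<Longrightarrow> d p > 0" "\<And>p q. p \<in> S \<Longrightarrow> q \<in> S \<Longrightarrow> q \<noteq> p \<Longrightarrow> d p \<le> dist p q"
      by blast
    have 1: "Min (d ` S) > 0" using S(1) False d by simp
    have 2: "Min (d ` S) \<le> dist p q" if "p \<in> S" "q \<in> S" "p \<noteq> q" for p q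
    proof -
      have "Min (d ` S) \<le> d p" using S(1) that by (intro Min_le) auto
      also have "d p \<le> dist p q" using d(2)[of p q] that by auto
      finally show ?thesis .
    qed
    show ?thesis using that[of "Min (d ` S) / 2"] 1 2 by auto
  qed
  have "\<forall>p\<in>S. \<exists>d>0. \<forall>t. \<bar>t\<bar> < d \<longrightarrow> (\<exists>q\<in>ball p e. F q + t *\<^sub>R W q = 0)"
    using persist e(1) by blast
  from bchoice[OF this] obtain d where d: "\<And>p. p \<in> S \<Longrightarrow> d p > 0"
    "\<And>p t. p \<in> S \<Longrightarrow> \<bar>t\<bar> < d p \<Longrightarrow> \<exists>q\<in>ball p e. F q + t *\<^sub>R W q = 0"
    by blast
  define t where "t = Min (d ` S) / 2"
  have mpos: "Min (d ` S) > 0" using S(1) False d by simp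
  then have t: "t > 0" by (simp add: t_def)
  have td: "\<bar>t\<bar> < d p" if "p \<in> S" for p
  proof -
    have "Min (d ` S) \<le> d p" using S(1) that by (intro Min_le) auto
    then show ?thesis using mpos by (simp add: t_def)
  qed
  have "\<forall>p\<in>S. \<exists>q. q \<in> ball p e \<and> F q + t *\<^sub>R W q = 0" using d(2) td by blast
  from bchoice[OF this] obtain q where q: "\<And>p. p \<in> S \<Longrightarrow> q p \<in> ball p e" "\<And>p. p \<in> S \<Longrightarrow> F (q p) + t *\<^sub>R W (q p) = 0"
    by blast
  have inj: "inj_on q S"
  proof (rule inj_onI)
    fix p p' assume p: "p \<in> S" "p' \<in> S" "q p = q p'"
    have "dist p p' < 2 * e"
      using dist_triangle2[of p p' "q p"] q(1)[OF p(1)] q(1)[OF p(2)] p(3) by auto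
    then show "p = p'" using e(2)[OF p(1,2)] by auto
  qed
  have "card (q ` S) \<le> (D + 1) ^ DIM('a)"
  proof (rule dominant_powers_card)
    show "finite (q ` S)" using S by simp
    fix b :: 'a assume b: "b \<in> Basis"
    show "polyd (D + 1 - 1) (\<lambda>p. (1 / t) * (F p \<bullet> b))" using polyd_cmult[OF F[OF b], of "1 / t"] by simp
  next
    fix p b assume p: "p \<in> q ` S" and b: "b \<in> (Basis :: 'a set)"
    then have "F p + t *\<^sub>R W p = 0" using q(2) by auto
    then have "(F p + t *\<^sub>R W p) \<bullet> b = 0" by simp
    then have "F p \<bullet> b + t * (p \<bullet> b) ^ Suc D = 0" by (simp add: inner_add_left Wb[OF b] del: power_Suc)
    then show "(p \<bullet> b) ^ (D + 1) + (1 / t) * (F p \<bullet> b) = 0" using t by (simp add: field_simps del: power_Suc)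
  qed auto
  then show ?thesis using card_image[OF inj] by simp
qed simp

section \<open>Polynomial partitioning\<close>

text \<open>Signs are replaced by the clipped functions \<open>cl \<delta>\<close>, which are odd
  and Lipschitz, so that Borsuk-Ulam on the sphere of coefficient vectors balances all n sets at
  once. Compactness gives a limit vector for \<delta> tending to 0. Where the limit form is nonzero
  the clipped value is eventually its sign, and where it is zero the value is at most 1 in modulus,
  so each such point can offset only one other.\<close>

theorem discrete_ham_sandwich:
  fixes \<phi> :: "'p \<Rightarrow> nat \<Rightarrow> real" and S :: "'i \<Rightarrow> 'p set"
  assumes I: "finite I" "card I = n" and S: "\<And>i. i \<in> I \<Longrightarrow> finite (S i)"
  obtains w where "\<exists>j\<le>n. w j \<noteq> 0"
    "\<And>i. i \<in> I \<Longrightarrow> 2 * card {p \<in> S i. (\<Sum>j\<le>n. w j * \<phi> p j) > 0} \<le> card (S i)"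
    "\<And>i. i \<in> I \<Longrightarrow> 2 * card {p \<in> S i. (\<Sum>j\<le>n. w j * \<phi> p j) < 0} \<le> card (S i)"
proof -
  obtain e where e: "bij_betw e {..<n} I"
    using ex_bij_betw_nat_finite[OF I(1)] I(2) by (auto simp: lessThan_atLeast0)
  define L where "L = (\<lambda>(w::nat\<Rightarrow>real) p. \<Sum>j\<le>n. w j * \<phi> p j)"
  define cl where "cl = (\<lambda>\<delta> t::real. max (-1) (min 1 (t / \<delta>)))"
  have cl_odd: "cl \<delta> (- t) = - cl \<delta> t" for \<delta> t by (auto simp: cl_def max_def min_def)
  have cl_lip: "\<bar>cl \<delta> s - cl \<delta> t\<bar> \<le> (1 / \<delta>) * \<bar>s - t\<bar>" if "\<delta> > 0" for \<delta> s t
  proof -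
    have "\<bar>cl \<delta> s - cl \<delta> t\<bar> \<le> \<bar>s / \<delta> - t / \<delta>\<bar>" unfolding cl_def by (auto simp: max_def min_def)
    also have "\<dots> = (1 / \<delta>) * \<bar>s - t\<bar>"
      using that by (simp add: diff_divide_distrib[symmetric])
    finally show ?thesis .
  qed
  define \<delta> where "\<delta> = (\<lambda>k::nat. 1 / real (Suc k))"
  have \<delta>: "\<delta> k > 0" for k by (simp add: \<delta>_def)
  have "\<exists>w. w \<in> usph n \<and> (\<forall>i<n. (\<Sum>p\<in>S (e i). cl (\<delta> k) (L w p)) = 0)" for k
  proof -
    have fin: "finite (S (e i))" if "i < n" for i
      using S bij_betwE[OF e] that by auto
    have lL: "lip_on n (\<lambda>w. L w p)" for p
    proof -
      have "lip_on n (\<lambda>w. \<Sum>j\<le>n. \<phi> p j * w j)"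
        by (intro lip_on_sum lip_on_cmult lip_on_coord) auto
      then show ?thesis by (simp add: L_def mult.commute)
    qed
    have lipf: "lip_on n (\<lambda>w. \<Sum>p\<in>S (e i). cl (\<delta> k) (L w p))" if "i < n" for i
      by (intro lip_on_sum fin that lip_on_compose[OF lL cl_lip[OF \<delta>]])
    have oddf: "(\<Sum>p\<in>S (e i). cl (\<delta> k) (L (\<lambda>j. - w j) p)) = - (\<Sum>p\<in>S (e i). cl (\<delta> k) (L w p))" for w i
    proof -
      have "L (\<lambda>j. - w j) p = - L w p" for p by (simp add: L_def sum_negf)
      then show ?thesis by (simp add: cl_odd sum_negf)
    qed
    obtain w where "w \<in> usph n" "\<And>i. i < n \<Longrightarrow> (\<Sum>p\<in>S (e i). cl (\<delta> k) (L w p)) = 0"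
      using Borsuk_Ulam_lipschitz[of n "\<lambda>w i. \<Sum>p\<in>S (e i). cl (\<delta> k) (L w p)", OF lipf oddf] by blast
    then show ?thesis by blast
  qed
  then obtain W where W: "\<And>k. W k \<in> usph n" "\<And>k i. i < n \<Longrightarrow> (\<Sum>p\<in>S (e i). cl (\<delta> k) (L (W k) p)) = 0"
    by metis
  have "seq_compact (usph n)" using compact_usph by (rule compact_imp_seq_compact)
  then obtain w r where wr: "w \<in> usph n" "strict_mono r" "(W \<circ> r) \<longlonglongrightarrow> w"
    using W(1) unfolding seq_compact_def by blast
  have coord: "(\<lambda>k. W (r k) j) \<longlonglongrightarrow> w j" for j
    using isCont_tendsto_compose[OF isCont_coord[where x=w and i=j] wr(3)] by (simp add: o_def)
  have limL: "(\<lambda>k. L (W (r k)) p) \<longlonglongrightarrow> L w p" for p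
    unfolding L_def by (intro tendsto_intros coord)
  have lim\<delta>: "(\<lambda>k. \<delta> (r k)) \<longlonglongrightarrow> 0"
  proof -
    have "\<delta> \<longlonglongrightarrow> 0" unfolding \<delta>_def using LIMSEQ_inverse_real_of_nat by (simp add: inverse_eq_divide)
    then show ?thesis using LIMSEQ_subseq_LIMSEQ[OF _ wr(2)] by (force simp: o_def)
  qed
  have ev: "eventually (\<lambda>k. L w p \<noteq> 0 \<longrightarrow> cl (\<delta> (r k)) (L (W (r k)) p) = sgn (L w p)) sequentially" for p
  proof (cases "L w p" "0::real" rule: linorder_cases)
    case less
    have "(\<lambda>k. L (W (r k)) p + \<delta> (r k)) \<longlonglongrightarrow> L w p + 0" by (intro tendsto_intros limL lim\<delta>)
    then have "eventually (\<lambda>k. L (W (r k)) p + \<delta> (r k) < 0) sequentially"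
      using less order_tendstoD(2) by force
    then show ?thesis
    proof eventually_elim
      case (elim k)
      then have "L (W (r k)) p / \<delta> (r k) \<le> -1" using \<delta>[of "r k"] by (simp add: field_simps)
      then show ?case using less by (simp add: cl_def)
    qed
  next
    case greater
    have "(\<lambda>k. L (W (r k)) p - \<delta> (r k)) \<longlonglongrightarrow> L w p - 0" by (intro tendsto_intros limL lim\<delta>)
    then have "eventually (\<lambda>k. 0 < L (W (r k)) p - \<delta> (r k)) sequentially"
      using greater order_tendstoD(1) by force
    then show ?thesis
    proof eventually_elim
      case (elim k)
      then have "L (W (r k)) p / \<delta> (r k) \<ge> 1" using \<delta>[of "r k"] by (simp add: field_simps)
      then show ?case using greater by (simp add: cl_def)
    qed
  qed simp
  have main: "2 * card {p \<in> S i. L w p > 0} \<le> card (S i) \<and> 2 * card {p \<in> S i. L w p < 0} \<le> card (S i)" if i: "i \<in> I" for i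
  proof -
    obtain i' where i': "i' < n" "i = e i'" using i e by (auto simp: bij_betw_def)
    have fin: "finite (S i)" using S i by simp
    have "eventually (\<lambda>k. \<forall>p\<in>S i. L w p \<noteq> 0 \<longrightarrow> cl (\<delta> (r k)) (L (W (r k)) p) = sgn (L w p)) sequentially"
      using fin ev by (simp add: eventually_ball_finite)
    then obtain k where k: "\<forall>p\<in>S i. L w p \<noteq> 0 \<longrightarrow> cl (\<delta> (r k)) (L (W (r k)) p) = sgn (L w p)"
      by (auto simp: eventually_sequentially)
    define f where "f = (\<lambda>p. cl (\<delta> (r k)) (L (W (r k)) p))"
    define A where "A = {p \<in> S i. L w p > 0}"
    define B where "B = {p \<in> S i. L w p < 0}"
    define C where "C = {p \<in> S i. L w p = 0}"
    have fin': "finite A" "finite B" "finite C" using fin by (auto simp: A_def B_def C_def)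
    have SABC: "S i = (A \<union> B) \<union> C" by (auto simp: A_def B_def C_def)
    have disj: "(A \<union> B) \<inter> C = {}" "A \<inter> B = {}" by (auto simp: A_def B_def C_def)
    have cards: "card (S i) = card A + card B + card C"
      unfolding SABC using fin' disj by (simp add: card_Un_disjoint)
    have "0 = sum f (S i)" using W(2)[OF i'(1), of "r k"] by (simp add: f_def i')
    also have "\<dots> = sum f A + sum f B + sum f C"
      unfolding SABC using fin' disj by (simp add: sum.union_disjoint)
    also have "sum f A = real (card A)" using k by (simp add: f_def A_def)
    also have "sum f B = - real (card B)" using k by (simp add: f_def B_def)
    finally have eq: "0 = real (card A) - real (card B) + sum f C" by simp
    have "\<bar>sum f C\<bar> \<le> (\<Sum>p\<in>C. \<bar>f p\<bar>)" by (rule sum_abs)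
    also have "\<dots> \<le> (\<Sum>p\<in>C. 1)" by (intro sum_mono) (auto simp: f_def cl_def)
    finally have "\<bar>sum f C\<bar> \<le> real (card C)" by simp
    then have "real (card A) \<le> real (card B) + real (card C)" "real (card B) \<le> real (card A) + real (card C)"
      using eq by linarith+
    then show ?thesis using cards unfolding A_def[symmetric] B_def[symmetric] by linarith
  qed
  have "\<exists>j\<le>n. w j \<noteq> 0"
  proof (rule ccontr)
    assume "\<not> ?thesis"
    then have "(\<Sum>i\<le>n. (w i)\<^sup>2) = 0" by (intro sum.neutral) auto
    then show False using wr(1) by (simp add: usph_def)
  qed
  then show ?thesis using that[of w] main by (simp add: L_def)
qed

definition sign_class :: "(nat \<Rightarrow> 'a \<Rightarrow> real) \<Rightarrow> nat \<Rightarrow> nat set \<Rightarrow> 'a set" where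
  "sign_class Q J \<sigma> = {x. \<forall>j<J. Q j x \<noteq> 0 \<and> (Q j x > 0 \<longleftrightarrow> j \<in> \<sigma>)}"

text \<open>The monomials in \<open>MI N\<close> number \<open>N ^ DIM('a) > card I\<close>, enough
  coefficients for the ham sandwich theorem to apply to the images of the sets. Independence of the
  monomials makes the result nonzero as a function.\<close>

lemma exists_bisecting_polynomial:
  fixes \<psi> :: "'p \<Rightarrow> 'a::euclidean_space" and S :: "'i \<Rightarrow> 'p set"
  assumes I: "finite I" "card I < N ^ DIM('a)" and S: "\<And>i. i \<in> I \<Longrightarrow> finite (S i)"
  obtains h :: "'a \<Rightarrow> real" where "polyd (DIM('a) * N) h" "\<exists>x. h x \<noteq> 0"
    "\<And>i. i \<in> I \<Longrightarrow> 2 * card {p \<in> S i. h (\<psi> p) > 0} \<le> card (S i)"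
    "\<And>i. i \<in> I \<Longrightarrow> 2 * card {p \<in> S i. h (\<psi> p) < 0} \<le> card (S i)"
proof -
  define n where "n = card I"
  define M where "M = N ^ DIM('a)"
  have nM: "n < M" using I by (simp add: n_def M_def)
  obtain e where e: "bij_betw e {..<M} (MI N :: ('a \<Rightarrow> nat) set)"
    using ex_bij_betw_nat_finite[OF finite_MI[of N]] by (auto simp: lessThan_atLeast0 card_MI M_def)
  obtain w :: "nat \<Rightarrow> real" where w: "\<exists>j\<le>n. w j \<noteq> 0"
    "\<And>i. i \<in> I \<Longrightarrow> 2 * card {p \<in> S i. (\<Sum>j\<le>n. w j * pmon (e j) (\<psi> p)) > 0} \<le> card (S i)"
    "\<And>i. i \<in> I \<Longrightarrow> 2 * card {p \<in> S i. (\<Sum>j\<le>n. w j * pmon (e j) (\<psi> p)) < 0} \<le> card (S i)"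
  proof (rule discrete_ham_sandwich[where S = S and \<phi> = "\<lambda>p j. pmon (e j) (\<psi> p)", OF I(1) n_def[symmetric] S], goal_cases)
    case (1 i) then show ?case by blast
  next
    case (2 w) show ?case by (rule 2(1)) (fact 2(2), fact 2(3), fact 2(4))
  qed
  define h where "h = (\<lambda>x. \<Sum>j\<le>n. w j * pmon (e j) x)"
  show ?thesis
  proof (rule that[of h])
    have "polyd (DIM('a) * N) (pmon (e j) :: 'a \<Rightarrow> real)" if "j \<le> n" for j
    proof (rule polyd_mono[OF polyd_pmon])
      have "e j \<in> MI N" using bij_betwE[OF e] that nM by auto
      then have "(\<Sum>b\<in>Basis. e j b) \<le> (\<Sum>b\<in>(Basis::'a set). N)"
        by (intro sum_mono) (auto simp: MI_def PiE_iff less_imp_le)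
      then show "(\<Sum>b\<in>Basis. e j b) \<le> DIM('a) * N" by simp
    qed
    then show "polyd (DIM('a) * N) h" unfolding h_def by (intro polyd_sum polyd_cmult) auto
    show "\<exists>x. h x \<noteq> 0"
    proof (rule ccontr)
      assume "\<not> ?thesis"
      then have h0: "h x = 0" for x by auto
      \<comment> \<open>Only n + 1 monomials are used; the others get coefficient 0, so that
        independence over all of \<open>MI N\<close> applies.\<close>
      define c where "c = (\<lambda>\<alpha>. let j = inv_into {..<M} e \<alpha> in if j \<le> n then w j else 0)"
      have ce: "c (e j) = (if j \<le> n then w j else 0)" if "j < M" for j
        using e that by (simp add: c_def bij_betw_def inv_into_f_f)
      have "(\<Sum>\<alpha>\<in>MI N. c \<alpha> * pmon \<alpha> x) = 0" for x
      proof -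
        have "(\<Sum>\<alpha>\<in>MI N. c \<alpha> * pmon \<alpha> x) = (\<Sum>j<M. c (e j) * pmon (e j) x)"
          using sum.reindex_bij_betw[OF e, of "\<lambda>\<alpha>. c \<alpha> * pmon \<alpha> x"] by simp
        also have "\<dots> = (\<Sum>j\<le>n. c (e j) * pmon (e j) x)"
          using nM ce by (intro sum.mono_neutral_right) auto
        also have "\<dots> = h x" unfolding h_def using nM ce by (intro sum.cong) auto
        finally show ?thesis using h0 by simp
      qed
      then have "c \<alpha> = 0" if "\<alpha> \<in> MI N" for \<alpha> using pmon_independent[where N=N and c=c and \<alpha>=\<alpha>] that by blast
      then have "w j = 0" if "j \<le> n" for j
        using ce[of j] that nM bij_betwE[OF e] by auto
      then show False using w(1) by auto
    qed
  qed (use w in \<open>auto simp: h_def\<close>)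
qed

text \<open>The polynomial with index j has to halve 2 ^ j classes and needs more than 2 ^ j
  monomials. A box of exponents of side N = 2 ^ (j div q + 1) suffices, as N ^ q = 2 ^ (q * (j div q
  + 1)) > 2 ^ j, and the degree is at most q * N.\<close>

lemma polynomial_partition_aux:
  fixes \<psi> :: "'p \<Rightarrow> 'a::euclidean_space"
  assumes P: "finite P"
  defines "q \<equiv> DIM('a)"
  shows "\<exists>Q :: nat \<Rightarrow> 'a \<Rightarrow> real. (\<forall>j<J. polyd (q * 2 ^ (j div q + 1)) (Q j) \<and> (\<exists>x. Q j x \<noteq> 0)) \<and>
    (\<forall>\<sigma>. card {p \<in> P. \<psi> p \<in> sign_class Q J \<sigma>} * 2 ^ J \<le> card P)"
proof (induction J)
  case 0 then show ?case by (auto simp: sign_class_def)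
next
  case (Suc J)
  then obtain Q :: "nat \<Rightarrow> 'a \<Rightarrow> real" where Q: "\<And>j. j < J \<Longrightarrow> polyd (q * 2 ^ (j div q + 1)) (Q j)" "\<And>j. j < J \<Longrightarrow> \<exists>x. Q j x \<noteq> 0"
    "\<And>\<sigma>. card {p \<in> P. \<psi> p \<in> sign_class Q J \<sigma>} * 2 ^ J \<le> card P" by blast
  define N where "N = (2::nat) ^ (J div q + 1)"
  have q0: "q > 0" by (simp add: q_def)
  have "J < q * (J div q + 1)"
  proof -
    have "q * (J div q) + J mod q = J" by simp
    with mod_less_divisor[OF q0, of J] have "J < q * (J div q) + q" by linarith
    then show ?thesis by simp
  qed
  then have "(2::nat) ^ J < 2 ^ (q * (J div q + 1))" by simp
  also have "\<dots> = N ^ q" by (simp add: N_def power_mult[symmetric] mult.commute power_add)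
  finally have NJ: "card (Pow {..<J}) < N ^ DIM('a)" by (simp add: card_Pow q_def)
  define S where "S = (\<lambda>\<sigma>. {p \<in> P. \<psi> p \<in> sign_class Q J \<sigma>})"
  have finS: "finite (S \<sigma>)" for \<sigma> using P by (simp add: S_def)
  obtain h :: "'a \<Rightarrow> real" where h: "polyd (DIM('a) * N) h" "\<exists>x. h x \<noteq> 0"
    "\<And>\<sigma>. \<sigma> \<in> Pow {..<J} \<Longrightarrow> 2 * card {p \<in> S \<sigma>. h (\<psi> p) > 0} \<le> card (S \<sigma>)"
    "\<And>\<sigma>. \<sigma> \<in> Pow {..<J} \<Longrightarrow> 2 * card {p \<in> S \<sigma>. h (\<psi> p) < 0} \<le> card (S \<sigma>)"
    using exists_bisecting_polynomial[of "Pow {..<J}" N S \<psi>, OF _ NJ finS] by auto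
  define Q' where "Q' = Q(J := h)"
  have "card {p \<in> P. \<psi> p \<in> sign_class Q' (Suc J) \<sigma>} * 2 ^ Suc J \<le> card P" for \<sigma>
  proof -
    define \<tau> where "\<tau> = \<sigma> \<inter> {..<J}"
    have cls: "sign_class Q' (Suc J) \<sigma> \<subseteq> {x \<in> sign_class Q J \<tau>. if J \<in> \<sigma> then h x > 0 else h x < 0}"
      unfolding sign_class_def Q'_def \<tau>_def by (auto simp: less_Suc_eq split: if_splits)
    have "2 * card {p \<in> P. \<psi> p \<in> sign_class Q' (Suc J) \<sigma>} \<le> card (S \<tau>)"
    proof (cases "J \<in> \<sigma>")
      case True
      have "card {p \<in> P. \<psi> p \<in> sign_class Q' (Suc J) \<sigma>} \<le> card {p \<in> S \<tau>. h (\<psi> p) > 0}"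
        by (rule card_mono) (use P cls True in \<open>auto simp: S_def\<close>)
      then show ?thesis using h(3)[of \<tau>] by (auto simp: \<tau>_def)
    next
      case False
      have "card {p \<in> P. \<psi> p \<in> sign_class Q' (Suc J) \<sigma>} \<le> card {p \<in> S \<tau>. h (\<psi> p) < 0}"
        by (rule card_mono) (use P cls False in \<open>auto simp: S_def\<close>)
      then show ?thesis using h(4)[of \<tau>] by (auto simp: \<tau>_def)
    qed
    then have "2 * card {p \<in> P. \<psi> p \<in> sign_class Q' (Suc J) \<sigma>} * 2 ^ J \<le> card (S \<tau>) * 2 ^ J"
      by (rule mult_right_mono) simp
    also have "\<dots> \<le> card P" using Q(3)[of \<tau>] by (simp add: S_def)
    finally show ?thesis by (simp add: mult_ac)
  qed
  moreover have "polyd (q * 2 ^ (j div q + 1)) (Q' j) \<and> (\<exists>x. Q' j x \<noteq> 0)" if "j < Suc J" for j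
  proof (cases "j = J")
    case True
    then show ?thesis using h(1,2) by (simp add: Q'_def q_def N_def)
  next
    case False
    then show ?thesis using Q(1,2)[of j] that by (simp add: Q'_def)
  qed
  ultimately show ?case by blast
qed

text \<open>Blocks of q consecutive polynomials share a degree that doubles from block to block, so
  the sum is geometric. The summand \<open>2 * q\<^sup>2\<close> on the left avoids a subtraction of
  natural numbers.\<close>

lemma partition_degree_sum: "q > 0 \<Longrightarrow> (\<Sum>j<q * T. q * 2 ^ (j div q + 1)) + 2 * q\<^sup>2 = 2 * q\<^sup>2 * (2::nat) ^ T"
proof (induction T)
  case (Suc T)
  have "(\<Sum>j<q * Suc T. q * 2 ^ (j div q + 1)) = (\<Sum>j<q * T. q * 2 ^ (j div q + 1)) + (\<Sum>j=q*T..<q * T + q. q * 2 ^ (j div q + 1))"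
    by (simp add: lessThan_atLeast0 sum.atLeastLessThan_concat add.commute)
  also have "(\<Sum>j=q*T..<q * T + q. q * 2 ^ (j div q + 1)) = (\<Sum>j=q*T..<q * T + q. q * (2::nat) ^ (T + 1))"
  proof (intro sum.cong refl)
    fix j assume j: "j \<in> {q * T..<q * T + q}"
    have "j div q = T"
      by (rule div_nat_eqI) (use j in \<open>auto simp: mult.commute\<close>)
    then show "q * 2 ^ (j div q + 1) = q * (2::nat) ^ (T + 1)" by simp
  qed
  finally show ?case using Suc by (simp add: power2_eq_square algebra_simps)
qed simp

text \<open>Taking a multiple of the dimension q as the number of polynomials gives 2 ^ (q * T)
  cells at total degree O(2 ^ T), the q-th root of the number of cells.\<close>

theorem polynomial_partition:
  fixes \<psi> :: "'p \<Rightarrow> 'a::euclidean_space"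
  assumes P: "finite P"
  obtains Q :: "nat \<Rightarrow> 'a \<Rightarrow> real" and D :: "nat \<Rightarrow> nat" where
    "\<And>j. j < DIM('a) * T \<Longrightarrow> polyd (D j) (Q j)"
    "\<And>j. j < DIM('a) * T \<Longrightarrow> \<exists>x. Q j x \<noteq> 0"
    "(\<Sum>j<DIM('a) * T. D j) \<le> 2 * DIM('a)\<^sup>2 * 2 ^ T"
    "\<And>\<sigma>. card {p \<in> P. \<psi> p \<in> sign_class Q (DIM('a) * T) \<sigma>} * 2 ^ (DIM('a) * T) \<le> card P"
proof -
  obtain Q :: "nat \<Rightarrow> 'a \<Rightarrow> real" where
    Q: "\<And>j. j < DIM('a) * T \<Longrightarrow> polyd (DIM('a) * 2 ^ (j div DIM('a) + 1)) (Q j)"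
      "\<And>j. j < DIM('a) * T \<Longrightarrow> \<exists>x. Q j x \<noteq> 0"
      "\<And>\<sigma>. card {p \<in> P. \<psi> p \<in> sign_class Q (DIM('a) * T) \<sigma>} * 2 ^ (DIM('a) * T) \<le> card P"
    using polynomial_partition_aux[OF P, of "DIM('a) * T" \<psi>] by blast
  show ?thesis
    by (rule that[of "\<lambda>j. DIM('a) * 2 ^ (j div DIM('a) + 1)" Q])
      (use Q partition_degree_sum[of "DIM('a)" T] in auto)
qed

section \<open>Sign vectors on finite coverings\<close>

text \<open>The polynomial functions on \<open>W\<close> form a module, generated by the \<open>v j\<close>, over the polynomials in the projection \<open>\<tau>\<close>;
  degrees grow by a factor of at most \<open>\<kappa>\<close>.\<close>

definition fin_mod :: "'a::euclidean_space set \<Rightarrow> ('a \<Rightarrow> 'b::euclidean_space) \<Rightarrow> 'j set \<Rightarrow> ('j \<Rightarrow> 'a \<Rightarrow> complex) \<Rightarrow> nat \<Rightarrow> bool" where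
  "fin_mod W \<tau> J v \<kappa> \<longleftrightarrow> finite J \<and> (\<forall>k (h :: 'a \<Rightarrow> complex). polyd k h \<longrightarrow>
     (\<exists>u. (\<forall>j\<in>J. polyd (\<kappa> * k) (u j)) \<and> (\<forall>p\<in>W. h p = (\<Sum>j\<in>J. u j (\<tau> p) * v j p))))"

lemma pmon_MI_degree:
  assumes "\<alpha> \<in> MI (Suc n)"
  shows "polyd (DIM('b) * n) (pmon \<alpha> :: 'b::euclidean_space \<Rightarrow> 'k::real_normed_field)"
proof (rule polyd_mono[OF polyd_pmon])
  have "(\<Sum>b\<in>Basis. \<alpha> b) \<le> (\<Sum>b\<in>(Basis::'b set). n)"
    using assms by (intro sum_mono) (auto simp: MI_def PiE_iff less_Suc_eq_le)
  then show "(\<Sum>b\<in>Basis. \<alpha> b) \<le> DIM('b) * n" by simp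
qed

text \<open>With m the dimension of the base, there are (K + 1) * N ^ m products of a base monomial
  with a power of G, all in a space spanned by at most K * N ^ m functions. Taking K as the number
  of generators times (\<kappa> * (m + 1)) ^ m makes this work for N = K * D + 1, and K does not
  depend on D.\<close>

lemma algebraic_relation:
  fixes \<tau> :: "'a::euclidean_space \<Rightarrow> 'b::euclidean_space" and G :: "'a \<Rightarrow> complex"
  assumes mod: "fin_mod W \<tau> J v \<kappa>" and \<kappa>: "\<kappa> \<ge> 1" and \<tau>: "bounded_linear \<tau>" and G: "polyd D G"
    and K: "K = card J * (\<kappa> * (DIM('b) + 1)) ^ DIM('b)"
  obtains e where "\<And>k. k \<le> K \<Longrightarrow> polyd (DIM('b) * (K * D)) (e k :: 'b \<Rightarrow> complex)"
    "\<exists>k\<le>K. \<exists>y. e k y \<noteq> 0" "\<And>p. p \<in> W \<Longrightarrow> (\<Sum>k\<le>K. e k (\<tau> p) * G p ^ k) = 0"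
proof -
  define m where "m = DIM('b)"
  define N where "N = Suc (K * D)"
  define \<kappa>' where "\<kappa>' = \<kappa> * ((m + 1) * (K * D))"
  define I where "I = {..K} \<times> (MI N :: ('b \<Rightarrow> nat) set)"
  define g where "g = (\<lambda>(k, \<alpha>) p. if p \<in> W then pmon \<alpha> (\<tau> p) * G p ^ k else 0 :: complex)"
  define Mo where "Mo = (pmon ` MI (Suc \<kappa>') :: ('b \<Rightarrow> complex) set)"
  define w where "w = (\<lambda>(j, \<mu>::'b \<Rightarrow> complex) p. if p \<in> W then \<mu> (\<tau> p) * v j p else 0)"
  define H where "H = w ` (J \<times> Mo)"
  have finJ: "finite J" using mod by (simp add: fin_mod_def)
  have finMo: "finite Mo" by (simp add: Mo_def)
  have finH: "finite H" using finJ finMo by (simp add: H_def)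
  have finI: "finite I" by (simp add: I_def)
  have "\<kappa>' + 1 \<le> \<kappa> * (m + 1) * N"
    using \<kappa> by (simp add: \<kappa>'_def N_def algebra_simps)
  have "card H \<le> card (J \<times> Mo)" unfolding H_def using finJ finMo by (intro card_image_le) auto
  also have "\<dots> \<le> card J * (Suc \<kappa>') ^ m"
    using card_image_le[OF finite_MI, of "pmon :: _ \<Rightarrow> 'b \<Rightarrow> complex" "Suc \<kappa>'"]
    by (simp add: card_cartesian_product card_MI Mo_def m_def)
  also have "\<dots> \<le> card J * (\<kappa> * (m + 1) * N) ^ m"
    using \<open>\<kappa>' + 1 \<le> _\<close> by (intro mult_left_mono power_mono) auto
  also have "\<dots> = K * N ^ m" by (simp add: K m_def power_mult_distrib mult.assoc)
  also have "\<dots> < Suc K * N ^ m" by (simp add: N_def)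
  also have "\<dots> = card I" by (simp add: I_def card_cartesian_product card_MI m_def)
  finally have card: "card H < card I" .
  have span: "g i \<in> fs.span H" if i: "i \<in> I" for i
  proof -
    obtain k \<alpha> where ka: "i = (k, \<alpha>)" "k \<le> K" "\<alpha> \<in> MI N" using i by (auto simp: I_def)
    have "polyd (m * (K * D) + K * D) (\<lambda>p. pmon \<alpha> (\<tau> p) * G p ^ k)"
    proof (rule polyd_mult)
      show "polyd (m * (K * D)) (\<lambda>p. pmon \<alpha> (\<tau> p) :: complex)"
        using polyd_compose_linear[OF pmon_MI_degree \<tau>] ka(3) by (simp add: N_def m_def)
      show "polyd (K * D) (\<lambda>p. G p ^ k)"
        by (rule polyd_mono[OF polyd_power[OF G]]) (use ka(2) in auto)
    qed
    then have "polyd ((m + 1) * (K * D)) (\<lambda>p. pmon \<alpha> (\<tau> p) * G p ^ k)" by (simp add: algebra_simps)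
    then obtain u where u: "\<And>j. j \<in> J \<Longrightarrow> polyd \<kappa>' (u j)"
      "\<And>p. p \<in> W \<Longrightarrow> pmon \<alpha> (\<tau> p) * G p ^ k = (\<Sum>j\<in>J. u j (\<tau> p) * v j p)"
      using mod unfolding fin_mod_def \<kappa>'_def by blast
    have "\<forall>j\<in>J. \<exists>a. \<forall>y. u j y = (\<Sum>\<mu>\<in>Mo. a \<mu> * \<mu> y)"
    proof
      fix j assume "j \<in> J"
      then have "u j \<in> fs.span Mo" unfolding Mo_def using polyd_in_span_pmon[OF u(1)] by blast
      then obtain a where "\<And>y. u j y = (\<Sum>\<mu>\<in>Mo. a \<mu> * \<mu> y)" using fs_span_explicit[OF finMo] by blast
      then show "\<exists>a. \<forall>y. u j y = (\<Sum>\<mu>\<in>Mo. a \<mu> * \<mu> y)" by blast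
    qed
    from bchoice[OF this] obtain a where a: "\<And>j y. j \<in> J \<Longrightarrow> u j y = (\<Sum>\<mu>\<in>Mo. a j \<mu> * \<mu> y)" by blast
    have b: "w (j, \<mu>) \<in> fs.span H" if "j \<in> J" "\<mu> \<in> Mo" for j \<mu>
      using that by (intro fs.span_base) (auto simp: H_def)
    have "(\<lambda>p. \<Sum>j\<in>J. \<Sum>\<mu>\<in>Mo. a j \<mu> * w (j, \<mu>) p) \<in> fs.span H"
      by (intro fs_span_sumI) (rule fs.span_scale[OF b])
    moreover have "g i = (\<lambda>p. \<Sum>j\<in>J. \<Sum>\<mu>\<in>Mo. a j \<mu> * w (j, \<mu>) p)"
    proof
      fix p
      show "g i p = (\<Sum>j\<in>J. \<Sum>\<mu>\<in>Mo. a j \<mu> * w (j, \<mu>) p)"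
      proof (cases "p \<in> W")
        case True
        have "g i p = (\<Sum>j\<in>J. u j (\<tau> p) * v j p)" using u(2)[OF True] True by (simp add: g_def ka)
        also have "\<dots> = (\<Sum>j\<in>J. \<Sum>\<mu>\<in>Mo. a j \<mu> * w (j, \<mu>) p)"
          using True a by (intro sum.cong) (auto simp: w_def sum_distrib_right mult.assoc)
        finally show ?thesis .
      qed (simp add: g_def w_def ka)
    qed
    ultimately show ?thesis by simp
  qed
  obtain c where c: "\<exists>i\<in>I. c i \<noteq> 0" "\<And>p. (\<Sum>i\<in>I. c i * g i p) = 0"
    using linear_relation_in_span[of I H g, OF finI finH card span] by blast
  define e where "e = (\<lambda>k y. \<Sum>\<alpha>\<in>MI N. c (k, \<alpha>) * pmon \<alpha> y :: complex)"
  show ?thesis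
  proof (rule that[of e])
    fix k assume "k \<le> K"
    have "polyd (DIM('b) * (K * D)) (pmon \<alpha> :: 'b \<Rightarrow> complex)" if "\<alpha> \<in> MI N" for \<alpha>
      using that unfolding N_def by (rule pmon_MI_degree)
    then show "polyd (DIM('b) * (K * D)) (e k)" unfolding e_def by (intro polyd_sum polyd_cmult)
  next
    show "\<exists>k\<le>K. \<exists>y. e k y \<noteq> 0"
    proof (rule ccontr)
      assume "\<not> ?thesis"
      then have z: "\<And>k y. k \<le> K \<Longrightarrow> e k y = 0" by blast
      have "c (k, \<alpha>) = 0" if "k \<le> K" "\<alpha> \<in> MI N" for k \<alpha>
        using pmon_independent[where N=N and c="\<lambda>\<alpha>. c (k, \<alpha>)" and \<alpha>=\<alpha>] z[OF that(1)] that(2) by (auto simp: e_def)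
      then show False using c(1) by (auto simp: I_def)
    qed
  next
    fix p assume p: "p \<in> W"
    have "0 = (\<Sum>i\<in>I. c i * g i p)" using c(2) by simp
    also have "\<dots> = (\<Sum>k\<le>K. \<Sum>\<alpha>\<in>MI N. c (k, \<alpha>) * g (k, \<alpha>) p)"
      unfolding I_def by (simp add: sum.cartesian_product case_prod_beta)
    also have "\<dots> = (\<Sum>k\<le>K. e k (\<tau> p) * G p ^ k)"
      using p by (intro sum.cong) (auto simp: e_def g_def sum_distrib_right mult.assoc)
    finally show "(\<Sum>k\<le>K. e k (\<tau> p) * G p ^ k) = 0" by simp
  qed
qed

text \<open>Multiplication by \<open>R\<close> satisfies an algebraic equation over the base. As \<open>R\<close> does not vanish on \<open>W\<close>, powers of \<open>R\<close> can be
  cancelled until the constant coefficient is nonzero; this coefficient is the polynomial sought.\<close>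

lemma vanishing_locus_polynomial:
  fixes \<tau> :: "'a::euclidean_space \<Rightarrow> 'b::euclidean_space" and R :: "'a \<Rightarrow> real"
  assumes mod: "fin_mod W \<tau> J v \<kappa>" and \<kappa>: "\<kappa> \<ge> 1" and \<tau>: "bounded_linear \<tau>" and R: "polyd D R"
    and nz: "\<And>p. p \<in> W \<Longrightarrow> R p \<noteq> 0"
    and K: "K = card J * (\<kappa> * (DIM('b) + 1)) ^ DIM('b)"
  shows "\<exists>N :: 'b \<Rightarrow> complex. polyd (DIM('b) * (K * D)) N \<and> (\<exists>y. N y \<noteq> 0) \<and>
    (\<forall>p\<in>closure W. R p = 0 \<longrightarrow> N (\<tau> p) = 0)"
proof -
  define G where "G = (\<lambda>p. complex_of_real (R p))"
  have pG: "polyd D G" unfolding G_def by (rule polyd_of_real[OF R])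
  obtain e where e: "\<And>k. k \<le> K \<Longrightarrow> polyd (DIM('b) * (K * D)) (e k :: 'b \<Rightarrow> complex)"
    "\<exists>k\<le>K. \<exists>y. e k y \<noteq> 0" "\<And>p. p \<in> W \<Longrightarrow> (\<Sum>k\<le>K. e k (\<tau> p) * G p ^ k) = 0"
    using algebraic_relation[OF mod \<kappa> \<tau> pG K] by blast
  define r where "r = (LEAST k. k \<le> K \<and> (\<exists>y. e k y \<noteq> 0))"
  have r: "r \<le> K" "\<exists>y. e r y \<noteq> 0"
    using LeastI_ex[OF e(2)] unfolding r_def by auto
  have small: "e k y = 0" if "k < r" for k y
    using not_less_Least[of k "\<lambda>k. k \<le> K \<and> (\<exists>y. e k y \<noteq> 0)"] that r(1) unfolding r_def[symmetric] by auto
  define f where "f = (\<lambda>p. \<Sum>k\<in>{r..K}. e k (\<tau> p) * G p ^ (k - r))"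
  have f0: "f p = 0" if p: "p \<in> W" for p
  proof -
    have "0 = (\<Sum>k\<le>K. e k (\<tau> p) * G p ^ k)" using e(3)[OF p] by simp
    also have "\<dots> = (\<Sum>k\<in>{r..K}. e k (\<tau> p) * G p ^ k)"
      by (intro sum.mono_neutral_right) (auto simp: small)
    also have "\<dots> = (\<Sum>k\<in>{r..K}. (e k (\<tau> p) * G p ^ (k - r)) * G p ^ r)"
      by (intro sum.cong) (auto simp: mult.assoc power_add[symmetric])
    also have "\<dots> = f p * G p ^ r" by (simp add: f_def sum_distrib_right)
    finally show ?thesis using nz[OF p] by (simp add: G_def)
  qed
  \<comment> \<open>By continuity the relation extends to the closure, where R may vanish; there
    only the term with k = r survives.\<close>
  have "continuous_on UNIV f"
    unfolding f_def
    by (intro continuous_intros polyd_continuous[OF pG] continuous_on_compose2[OF polyd_continuous[OF e(1)] linear_continuous_on[OF \<tau>]]) auto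
  then have "closed {p. f p = 0}" by (intro closed_Collect_eq continuous_on_const)
  then have f0': "f p = 0" if "p \<in> closure W" for p
    using closure_minimal[of W "{p. f p = 0}"] f0 that by auto
  show ?thesis
  proof (intro exI[of _ "e r"] conjI ballI impI)
    show "polyd (DIM('b) * (K * D)) (e r)" by (rule e(1)[OF r(1)])
    show "\<exists>y. e r y \<noteq> 0" by (rule r(2))
    fix p assume p: "p \<in> closure W" "R p = 0"
    have "0 = f p" using f0'[OF p(1)] by simp
    also have "f p = (\<Sum>k\<in>{r}. e k (\<tau> p) * G p ^ (k - r))"
      unfolding f_def using p(2) r(1) by (intro sum.mono_neutral_right) (auto simp: G_def)
    finally show "e r (\<tau> p) = 0" by simp
  qed
qed

text \<open>On the line from y to y0 the function is a nonzero polynomial in one variable, so it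
  cannot vanish on an interval.\<close>

lemma polyd_nonzero_dense:
  fixes N :: "'b::euclidean_space \<Rightarrow> 'k::real_normed_field"
  assumes N: "polyd k N" "N y0 \<noteq> 0" and e: "e > 0"
  shows "\<exists>y'\<in>ball y e. N y' \<noteq> 0"
proof (rule ccontr)
  assume "\<not> ?thesis"
  then have z: "\<And>y'. y' \<in> ball y e \<Longrightarrow> N y' = 0" by blast
  obtain q where q: "\<And>t. N (y + t *\<^sub>R (y0 - y)) = poly q (of_real t)"
    using polyd_line[OF N(1), of y "y0 - y"] by blast
  define d where "d = e / (norm (y0 - y) + 1)"
  have d: "d > 0" using e by (simp add: d_def add_nonneg_pos)
  have "poly q (of_real t) = 0" if t: "t \<in> {0<..<d}" for t
  proof -
    have "norm (t *\<^sub>R (y0 - y)) < e"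
    proof -
      have "t * norm (y0 - y) \<le> t * (norm (y0 - y) + 1)" using t by (intro mult_left_mono) auto
      also have "\<dots> < d * (norm (y0 - y) + 1)" using t by (intro mult_strict_right_mono) (auto simp: add_nonneg_pos)
      also have "\<dots> = e" by (simp add: d_def) (metis add_nonneg_eq_0_iff norm_ge_zero zero_le_one zero_neq_one)
      finally show ?thesis using t by simp
    qed
    then have "y + t *\<^sub>R (y0 - y) \<in> ball y e" by (simp add: dist_norm)
    then show ?thesis using z q by metis
  qed
  then have "(of_real ` {0<..<d} :: 'k set) \<subseteq> {x. poly q x = 0}" by auto
  moreover have "infinite (of_real ` {0<..<d} :: 'k set)"
  proof -
    have inj: "inj_on (of_real :: real \<Rightarrow> 'k) {0<..<d}" by (simp add: inj_on_def)
    show ?thesis using finite_image_iff[OF inj] infinite_Ioo[OF d] by simp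
  qed
  ultimately have "q = 0" using poly_roots_finite[of q] finite_subset by blast
  then show False using q[of 1] N(2) by simp
qed

text \<open>The nonzero sets are open and dense, so finitely many of them have a common
  point.\<close>

lemma polyd_common_nonzero:
  fixes N :: "'i \<Rightarrow> 'b::euclidean_space \<Rightarrow> 'k::real_normed_field"
  assumes "finite I" "\<And>i. i \<in> I \<Longrightarrow> polyd (k i) (N i)" "\<And>i. i \<in> I \<Longrightarrow> \<exists>y. N i y \<noteq> 0"
  shows "\<exists>y. \<forall>i\<in>I. N i y \<noteq> 0"
  using assms
proof (induction I rule: finite_induct)
  case (insert i I)
  then obtain y where y: "\<forall>j\<in>I. N j y \<noteq> 0" by auto
  have "polyd (\<Sum>j\<in>I. k j) (\<lambda>y. \<Prod>j\<in>I. N j y)" using insert.prems by (intro polyd_prod) auto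
  then have "continuous_on UNIV (\<lambda>y. \<Prod>j\<in>I. N j y)" by (rule polyd_continuous)
  then have "open {y. (\<Prod>j\<in>I. N j y) \<noteq> 0}" by (intro open_Collect_neq continuous_on_const)
  moreover have "y \<in> {y. (\<Prod>j\<in>I. N j y) \<noteq> 0}" using y insert.hyps by simp
  ultimately obtain e where e: "e > 0" "ball y e \<subseteq> {y. (\<Prod>j\<in>I. N j y) \<noteq> 0}"
    using open_contains_ball by blast
  obtain y0 where "N i y0 \<noteq> 0" using insert.prems by auto
  then obtain y' where "y' \<in> ball y e" "N i y' \<noteq> 0"
    using polyd_nonzero_dense[of "k i" "N i" y0 e y] insert.prems e by auto
  then show ?case using e insert.hyps by (intro exI[of _ y']) auto
qed simp

text \<open>The positive indices determine all signs wherever none of the functions vanishes, which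
  is where sign vectors are counted.\<close>

definition sign_vector :: "(nat \<Rightarrow> 'a \<Rightarrow> real) \<Rightarrow> nat \<Rightarrow> 'a \<Rightarrow> nat set" where
  "sign_vector R n p = {j. j < n \<and> R j p > 0}"

text \<open>On a fibre the coefficients \<open>u j (\<tau> p)\<close> are constants, so all
  polynomials are combinations of the generators, and \<open>card_le_of_polyd_span\<close> bounds
  the number of points.\<close>

lemma fin_mod_fibre:
  assumes "fin_mod W \<tau> J v \<kappa>"
  shows "finite {p\<in>W. \<tau> p = y}" "card {p\<in>W. \<tau> p = y} \<le> card J"
proof -
  have "finite {p\<in>W. \<tau> p = y} \<and> card {p\<in>W. \<tau> p = y} \<le> card J"
  proof (rule finite_if_finite_subsets_card_bdd)
    fix F assume F: "F \<subseteq> {p\<in>W. \<tau> p = y}" "finite F"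
    show "card F \<le> card J"
    proof (rule card_le_of_polyd_span[OF F(2)])
      show "finite J" using assms by (simp add: fin_mod_def)
      fix k and h :: "'a \<Rightarrow> complex" assume "polyd k h"
      then obtain u where "\<forall>p\<in>W. h p = (\<Sum>j\<in>J. u j (\<tau> p) * v j p)"
        using assms unfolding fin_mod_def by blast
      then show "\<exists>u. \<forall>p\<in>F. h p = (\<Sum>j\<in>J. u j * v j p)"
        using F(1) by (intro exI[of _ "\<lambda>j. u j y"]) auto
    qed
  qed
  then show "finite {p\<in>W. \<tau> p = y}" "card {p\<in>W. \<tau> p = y} \<le> card J" by auto
qed

text \<open>Off the zero set of one polynomial on the base, \<open>W\<close> is a covering with at most \<open>card J\<close> sheets on which no sign changes.
  Hence the sign vectors are bounded by the number of components below times the number of sheets.\<close>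

theorem sign_vectors_card:
  fixes \<tau> :: "'a::euclidean_space \<Rightarrow> 'b::euclidean_space" and R :: "nat \<Rightarrow> 'a \<Rightarrow> real"
  assumes mod: "fin_mod W \<tau> J v \<kappa>" and \<kappa>: "\<kappa> \<ge> 1" and \<tau>: "bounded_linear \<tau>"
    and R: "\<And>j. j < n \<Longrightarrow> polyd (D j) (R j)"
    and nz: "\<And>p j. p \<in> W \<Longrightarrow> j < n \<Longrightarrow> R j p \<noteq> 0"
    and proper: "\<And>B. bounded B \<Longrightarrow> bounded {p\<in>W. \<tau> p \<in> B}"
    and lift: "\<And>p e. p \<in> W \<Longrightarrow> e > 0 \<Longrightarrow> \<exists>d>0. \<forall>y\<in>ball (\<tau> p) d. \<exists>p'\<in>W. dist p' p < e \<and> \<tau> p' = y"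
    and clos: "\<And>p. p \<in> closure W \<Longrightarrow> (\<forall>j<n. R j p \<noteq> 0) \<Longrightarrow> p \<in> W"
    and K: "K = card J * (\<kappa> * (DIM('b) + 1)) ^ DIM('b)"
  shows "finite (sign_vector R n ` W)"
    "card (sign_vector R n ` W) \<le> card J * (2 * (DIM('b) * K) * (\<Sum>j<n. D j) + 2) ^ DIM('b)"
proof -
  define sv where "sv = sign_vector R n"
  have "\<exists>N :: 'b \<Rightarrow> complex. polyd (DIM('b) * (K * D j)) N \<and> (\<exists>y. N y \<noteq> 0) \<and> (\<forall>p\<in>closure W. R j p = 0 \<longrightarrow> N (\<tau> p) = 0)"
    if "j < n" for j
    by (rule vanishing_locus_polynomial[OF mod \<kappa> \<tau> R[OF that] _ K]) (use nz that in auto)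
  then have "\<forall>j\<in>{..<n}. \<exists>N :: 'b \<Rightarrow> complex. polyd (DIM('b) * (K * D j)) N \<and> (\<exists>y. N y \<noteq> 0) \<and> (\<forall>p\<in>closure W. R j p = 0 \<longrightarrow> N (\<tau> p) = 0)"
    by blast
  from bchoice[OF this] obtain N :: "nat \<Rightarrow> 'b \<Rightarrow> complex" where
    N: "\<And>j. j < n \<Longrightarrow> polyd (DIM('b) * (K * D j)) (N j)" "\<And>j. j < n \<Longrightarrow> \<exists>y. N j y \<noteq> 0"
      "\<And>j p. j < n \<Longrightarrow> p \<in> closure W \<Longrightarrow> R j p = 0 \<Longrightarrow> N j (\<tau> p) = 0"
    by blast
  \<comment> \<open>The product of the squared moduli turns the complex polynomials
    \<open>N j\<close> into one real polynomial that vanishes where one of them does.\<close>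
  define H where "H = (\<lambda>y. \<Prod>j<n. Re (N j y) ^ 2 + Im (N j y) ^ 2)"
  have H_nz: "H y \<noteq> 0 \<longleftrightarrow> (\<forall>j<n. N j y \<noteq> 0)" for y
    unfolding H_def by (auto simp: complex_eq_iff sum_power2_eq_zero_iff)
  define E where "E = 2 * (DIM('b) * K) * (\<Sum>j<n. D j)"
  have "polyd (\<Sum>j<n. 2 * (DIM('b) * (K * D j))) H"
    unfolding H_def by (intro polyd_prod polyd_add polyd_power polyd_Re polyd_Im N) auto
  then have pH: "polyd E H" by (simp add: E_def sum_distrib_left mult.assoc)
  have "\<exists>y. \<forall>j\<in>{..<n}. N j y \<noteq> 0"
    by (rule polyd_common_nonzero[of _ "\<lambda>j. DIM('b) * (K * D j)"]) (use N(1,2) in auto)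
  then obtain y0 where "\<forall>j\<in>{..<n}. N j y0 \<noteq> 0" by blast
  then have y0: "H y0 \<noteq> 0" using H_nz by simp
  define U where "U = {y. H y \<noteq> 0}"
  have "open U" unfolding U_def by (intro open_Collect_neq continuous_on_const polyd_continuous[OF pH])
  define S where "S = (\<lambda>y. sv ` {p\<in>W. \<tau> p = y})"
  have finS: "finite (S y)" and cardS: "card (S y) \<le> card J" for y
    unfolding S_def using fin_mod_fibre[OF mod, of y] card_image_le[of "{p\<in>W. \<tau> p = y}" sv] by auto
  have contR: "isCont (R j) p" if "j < n" for j p using polyd_isCont[OF R[OF that]] .
  have sv_near: "eventually (\<lambda>p'. sv p' = sv p) (nhds p)" if nzp: "\<And>j. j < n \<Longrightarrow> R j p \<noteq> 0" for p
  proof -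
    have "eventually (\<lambda>p'. \<forall>j\<in>{..<n}. (R j p' > 0) = (R j p > 0)) (nhds p)"
    proof (rule eventually_ball_finite)
      show "\<forall>j\<in>{..<n}. eventually (\<lambda>p'. (R j p' > 0) = (R j p > 0)) (nhds p)"
      proof
        fix j assume j: "j \<in> {..<n}"
        then have lim: "(R j \<longlongrightarrow> R j p) (nhds p)" using contR[of j p] by (simp add: continuous_within tendsto_at_iff_tendsto_nhds)
        show "eventually (\<lambda>p'. (R j p' > 0) = (R j p > 0)) (nhds p)"
        proof (cases "R j p > 0")
          case True
          from order_tendstoD(1)[OF lim True] show ?thesis by eventually_elim (use True in auto)
        next
          case False
          then have "R j p < 0" using nzp[of j] j by auto
          from order_tendstoD(2)[OF lim this] show ?thesis by eventually_elim (use False in auto)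
        qed
      qed
    qed simp
    then show ?thesis by eventually_elim (auto simp: sv_def sign_vector_def)
  qed
  \<comment> \<open>Sign vectors over a point persist over nearby points, because points of W lift
    and signs are locally constant.\<close>
  have lower: "eventually (\<lambda>y'. sv p \<in> S y') (nhds (\<tau> p))" if p: "p \<in> W" for p
  proof -
    obtain e where e: "e > 0" "\<And>p'. dist p' p < e \<Longrightarrow> sv p' = sv p"
      using sv_near[of p] nz[OF p] by (auto simp: eventually_nhds_metric)
    obtain d where d: "d > 0" "\<forall>y\<in>ball (\<tau> p) d. \<exists>p'\<in>W. dist p' p < e \<and> \<tau> p' = y"
      using lift[OF p e(1)] by blast
    have "sv p \<in> S y" if "dist y (\<tau> p) < d" for y
    proof -
      have "y \<in> ball (\<tau> p) d" using that by (simp add: dist_commute)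
      then obtain p' where p': "p' \<in> W" "dist p' p < e" "\<tau> p' = y" using d by blast
      then show ?thesis using e(2)[OF p'(2)] unfolding S_def by (intro image_eqI[of _ _ p']) auto
    qed
    then show ?thesis using d(1) by (auto simp: eventually_nhds_metric)
  qed
  \<comment> \<open>No new sign vector appears near a point of U: a sequence of counterexamples is
    bounded by \<open>proper\<close>, and a subsequence tends to a point of the closure of W. Over U
    no \<open>R j\<close> vanishes at the limit, so it lies in W and has the same sign vector as
    late members of the subsequence.\<close>
  have upper: "eventually (\<lambda>y'. S y' \<subseteq> S y) (nhds y)" if y: "y \<in> U" for y
  proof (rule ccontr)
    assume "\<not> ?thesis"
    then have "\<exists>y'. dist y' y < 1 / real (Suc k) \<and> \<not> S y' \<subseteq> S y" for k
      unfolding eventually_nhds_metric by (metis of_nat_0_less_iff zero_less_Suc zero_less_divide_1_iff)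
    then have "\<exists>p. p \<in> W \<and> dist (\<tau> p) y < 1 / real (Suc k) \<and> sv p \<notin> S y" for k
      unfolding S_def by blast
    then obtain p where p: "\<And>k. p k \<in> W" "\<And>k. dist (\<tau> (p k)) y < 1 / real (Suc k)" "\<And>k. sv (p k) \<notin> S y"
      by metis
    have "\<tau> (p k) \<in> ball y 1" for k
    proof -
      have "1 / real (Suc k) \<le> 1" by simp
      with p(2)[of k] have "dist (\<tau> (p k)) y < 1" by (rule less_le_trans)
      then show ?thesis by (simp add: dist_commute)
    qed
    then have "range p \<subseteq> {p\<in>W. \<tau> p \<in> ball y 1}" using p(1) by auto
    then have "bounded (range p)" using proper[of "ball y 1"] bounded_subset by blast
    then obtain l r where lr: "strict_mono r" "(p \<circ> r) \<longlonglongrightarrow> l"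
      using bounded_imp_convergent_subsequence[of p] by auto
    have tl: "\<tau> l = y"
    proof (rule LIMSEQ_unique)
      show "(\<lambda>k. \<tau> ((p \<circ> r) k)) \<longlonglongrightarrow> \<tau> l"
        using bounded_linear.tendsto[OF \<tau> lr(2)] .
      have "(\<lambda>k. dist (\<tau> (p k)) y) \<longlonglongrightarrow> 0"
      proof (rule real_tendsto_sandwich[where f = "\<lambda>k. 0" and h = "\<lambda>k. inverse (real (Suc k))"])
        show "eventually (\<lambda>k. dist (\<tau> (p k)) y \<le> inverse (real (Suc k))) sequentially"
          using p(2) by (intro always_eventually allI) (simp add: inverse_eq_divide less_imp_le)
        show "(\<lambda>k. inverse (real (Suc k))) \<longlonglongrightarrow> 0" by (rule LIMSEQ_inverse_real_of_nat)
      qed auto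
      then have "(\<lambda>k. \<tau> (p k)) \<longlonglongrightarrow> y" by (rule tendsto_dist_iff[THEN iffD2])
      from LIMSEQ_subseq_LIMSEQ[OF this lr(1)] show "(\<lambda>k. \<tau> ((p \<circ> r) k)) \<longlonglongrightarrow> y" unfolding comp_def .
    qed
    have lc: "l \<in> closure W" unfolding closure_sequential
      by (rule exI[of _ "p \<circ> r"]) (simp add: lr(2) p(1))
    have nzl: "R j l \<noteq> 0" if "j < n" for j
    proof
      assume "R j l = 0"
      then have "N j y = 0" using N(3)[OF that lc] tl by simp
      moreover have "H y \<noteq> 0" using y unfolding U_def by blast
      ultimately show False using H_nz[of y] that by blast
    qed
    then have lW: "l \<in> W" using clos lc by blast
    have "eventually (\<lambda>k. sv ((p \<circ> r) k) = sv l) sequentially"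
      by (rule eventually_compose_filterlim[OF sv_near[OF nzl] lr(2)])
    then obtain k where "sv ((p \<circ> r) k) = sv l" by (auto simp: eventually_sequentially)
    moreover have "sv l \<in> S y" unfolding S_def using lW tl by auto
    ultimately show False using p(3)[of "r k"] by simp
  qed
  have loc: "eventually (\<lambda>y'. S y = S y') (nhds y)" if y: "y \<in> U" for y
  proof -
    have "eventually (\<lambda>y'. \<forall>s\<in>S y. s \<in> S y') (nhds y)"
      by (rule eventually_ball_finite[OF finS]) (use lower in \<open>auto simp: S_def\<close>)
    with upper[OF y] show ?thesis by eventually_elim blast
  qed
  have const: "S a = S b" if "C \<in> components U" "a \<in> C" "b \<in> C" for C a b
  proof (rule connected_local_const[of C a b S])
    show "connected C" using in_components_connected that by blast
    show "\<forall>a\<in>C. eventually (\<lambda>b. S a = S b) (at a within C)"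
    proof
      fix a assume "a \<in> C"
      then have "a \<in> U" using in_components_subset[OF that(1)] by blast
      from loc[OF this] show "eventually (\<lambda>b. S a = S b) (at a within C)"
        unfolding eventually_at_filter by (rule eventually_mono) auto
    qed
  qed (use that in auto)
  have compU: "finite (components U)" "card (components U) \<le> (E + 2) ^ DIM('b)"
    unfolding U_def by (rule polyd_components_card[OF pH])+
  define pk where "pk = (\<lambda>C::'b set. SOME y. y \<in> C)"
  have pk: "pk C \<in> C" if "C \<in> components U" for C
  proof -
    have "\<exists>y. y \<in> C" using in_components_nonempty[OF that] by blast
    then show ?thesis unfolding pk_def by (rule someI_ex)
  qed
  \<comment> \<open>A point of W may lie over the zero set of H, but its sign vector also occurs
    over nearby points of U, which is dense.\<close>
  have cover: "sv ` W \<subseteq> (\<Union>C\<in>components U. S (pk C))"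
  proof
    fix s assume "s \<in> sv ` W"
    then obtain p where p: "p \<in> W" "s = sv p" by auto
    obtain d where d: "d > 0" "\<And>y'. dist y' (\<tau> p) < d \<Longrightarrow> sv p \<in> S y'"
      using lower[OF p(1)] by (auto simp: eventually_nhds_metric)
    obtain y' where y': "y' \<in> ball (\<tau> p) d" "H y' \<noteq> 0"
      using polyd_nonzero_dense[OF pH y0 d(1)] by blast
    then have "y' \<in> U" by (simp add: U_def)
    then have "y' \<in> \<Union>(components U)" using Union_components[of U] by metis
    then obtain C where C: "C \<in> components U" "y' \<in> C" by blast
    have "s \<in> S y'" using d(2) y'(1) p by (simp add: dist_commute)
    then have "s \<in> S (pk C)" using const[OF C(1) C(2) pk[OF C(1)]] by simp
    then show "s \<in> (\<Union>C\<in>components U. S (pk C))" using C(1) by blast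
  qed
  have fin: "finite (\<Union>C\<in>components U. S (pk C))" by (rule finite_UN_I[OF compU(1) finS])
  then show "finite (sign_vector R n ` W)" using cover finite_subset unfolding sv_def by blast
  have "card (sv ` W) \<le> card (\<Union>C\<in>components U. S (pk C))" by (rule card_mono[OF fin cover])
  also have "\<dots> \<le> (\<Sum>C\<in>components U. card (S (pk C)))" by (rule card_UN_le[OF compU(1)])
  also have "\<dots> \<le> card (components U) * card J" using sum_bounded_above[of "components U" "\<lambda>C. card (S (pk C))" "card J"] cardS by simp
  also have "\<dots> \<le> (E + 2) ^ DIM('b) * card J" using compU(2) by simp
  finally show "card (sign_vector R n ` W) \<le> card J * (2 * (DIM('b) * K) * (\<Sum>j<n. D j) + 2) ^ DIM('b)"
    by (simp add: sv_def E_def mult.commute)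
qed

section \<open>Sign vectors on complex curves\<close>

text \<open>The degree filtration of the module in \<open>fin_mod\<close>: coefficients of degree at
  most k. Tracking k through sums and products is what produces the growth factor \<kappa>.\<close>

definition md :: "'a::euclidean_space set \<Rightarrow> ('a \<Rightarrow> 'b::euclidean_space) \<Rightarrow> 'j set \<Rightarrow> ('j \<Rightarrow> 'a \<Rightarrow> complex) \<Rightarrow> nat \<Rightarrow> ('a \<Rightarrow> complex) \<Rightarrow> bool" where
  "md W \<tau> J v k h \<longleftrightarrow> (\<exists>u. (\<forall>j\<in>J. polyd k (u j)) \<and> (\<forall>p\<in>W. h p = (\<Sum>j\<in>J. u j (\<tau> p) * v j p)))"

lemma md_add: "md W \<tau> J v k f \<Longrightarrow> md W \<tau> J v k g \<Longrightarrow> md W \<tau> J v k (\<lambda>p. f p + g p)"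
proof -
  assume "md W \<tau> J v k f" "md W \<tau> J v k g"
  then obtain u u' where "\<forall>j\<in>J. polyd k (u j)" "\<forall>p\<in>W. f p = (\<Sum>j\<in>J. u j (\<tau> p) * v j p)"
    "\<forall>j\<in>J. polyd k (u' j)" "\<forall>p\<in>W. g p = (\<Sum>j\<in>J. u' j (\<tau> p) * v j p)"
    unfolding md_def by blast
  then show ?thesis unfolding md_def
    by (intro exI[of _ "\<lambda>j y. u j y + u' j y"]) (auto intro: polyd_add simp: distrib_right sum.distrib)
qed

lemma md_mono: "md W \<tau> J v k f \<Longrightarrow> k \<le> l \<Longrightarrow> md W \<tau> J v l f"
proof -
  assume "md W \<tau> J v k f" "k \<le> l"
  then obtain u where "\<forall>j\<in>J. polyd k (u j)" "\<forall>p\<in>W. f p = (\<Sum>j\<in>J. u j (\<tau> p) * v j p)"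
    unfolding md_def by blast
  then show ?thesis unfolding md_def using polyd_mono[OF _ \<open>k \<le> l\<close>] by (intro exI[of _ u]) auto
qed

lemma md_zero: "md W \<tau> J v k (\<lambda>p. 0)"
  unfolding md_def by (rule exI[of _ "\<lambda>j y. 0"]) (auto intro: polyd_const')

lemma md_sum: "(\<And>i. i \<in> I \<Longrightarrow> md W \<tau> J v k (f i)) \<Longrightarrow> md W \<tau> J v k (\<lambda>p. \<Sum>i\<in>I. f i p)"
  by (induction I rule: infinite_finite_induct) (auto intro: md_zero md_add)

lemma md_base_mult:
  assumes \<beta>: "polyd e \<beta>" and h: "md W \<tau> J v k h"
  shows "md W \<tau> J v (e + k) (\<lambda>p. \<beta> (\<tau> p) * h p)"
proof -
  obtain u where "\<forall>j\<in>J. polyd k (u j)" "\<forall>p\<in>W. h p = (\<Sum>j\<in>J. u j (\<tau> p) * v j p)"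
    using h unfolding md_def by blast
  then show ?thesis unfolding md_def
    by (intro exI[of _ "\<lambda>j y. \<beta> y * u j y"]) (auto intro: polyd_mult \<beta> simp: sum_distrib_left mult.assoc)
qed

lemma md_cmult: "md W \<tau> J v k h \<Longrightarrow> md W \<tau> J v k (\<lambda>p. c * h p)"
  using md_base_mult[OF polyd_const[of c], of W \<tau> J v k h] by simp

lemma md_cong: "md W \<tau> J v k f \<Longrightarrow> (\<And>p. p \<in> W \<Longrightarrow> f p = g p) \<Longrightarrow> md W \<tau> J v k g"
  unfolding md_def by auto

lemma md_generator: "finite J \<Longrightarrow> j \<in> J \<Longrightarrow> md W \<tau> J v 0 (v j)"
  unfolding md_def
  by (rule exI[of _ "\<lambda>i y. if i = j then 1 else 0"])
    (auto intro: polyd_const' simp: if_distrib[of "\<lambda>x. x * _"] cong: if_cong)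

lemma md_lin_mult:
  assumes X: "\<And>j. j \<in> J \<Longrightarrow> md W \<tau> J v e (\<lambda>p. X p * v j p)" and h: "md W \<tau> J v k h"
  shows "md W \<tau> J v (k + e) (\<lambda>p. X p * h p)"
proof -
  obtain u where u: "\<forall>j\<in>J. polyd k (u j)" "\<forall>p\<in>W. h p = (\<Sum>j\<in>J. u j (\<tau> p) * v j p)"
    using h unfolding md_def by blast
  have "md W \<tau> J v (k + e) (\<lambda>p. \<Sum>j\<in>J. u j (\<tau> p) * (X p * v j p))"
    using u(1) by (intro md_sum md_base_mult X) auto
  then show ?thesis
    by (rule md_cong) (use u(2) in \<open>auto simp: sum_distrib_left mult_ac\<close>)
qed

text \<open>Polynomials arise from constants by addition and multiplication with linear forms, so it
  suffices that a linear form times a generator costs \<kappa> degrees in the base. The generator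
  that is 1 on W represents the constants.\<close>

lemma fin_modI:
  assumes J: "finite J" and one: "j0 \<in> J" "\<And>p. p \<in> W \<Longrightarrow> v j0 p = 1"
    and lin: "\<And>g j. bounded_linear g \<Longrightarrow> j \<in> J \<Longrightarrow> md W \<tau> J v \<kappa> (\<lambda>p. g p * v j p)"
  shows "fin_mod W \<tau> J v \<kappa>"
proof -
  have "md W \<tau> J v (\<kappa> * k) h" if "polyd k h" for k h
    using that
  proof (induction rule: polyd.induct)
    case (polyd_const c)
    have "md W \<tau> J v 0 (\<lambda>p. c * v j0 p)" by (intro md_cmult md_generator J one)
    then show ?case by (rule md_cong[THEN md_mono]) (use one in auto)
  next
    case (polyd_lin k h g)
    have "md W \<tau> J v (\<kappa> * k + \<kappa>) (\<lambda>p. g p * h p)"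
      by (rule md_lin_mult[OF lin[OF polyd_lin.hyps(2)] polyd_lin.IH])
    then show ?case by (simp add: add.commute)
  next
    case (polyd_add k h h') then show ?case by (intro md_add)
  next
    case (polyd_Suc k h) show ?case by (rule md_mono[OF polyd_Suc.IH]) simp
  qed
  then show ?thesis using J unfolding fin_mod_def md_def by blast
qed

text \<open>A version for an intermediate projection \<pi>: when linear forms in \<pi> cost e
  degrees, polynomials of degree k in \<pi> cost k * e. It is applied to the projection to y over
  the real line of Im y.\<close>

lemma md_poly_mult:
  assumes X: "\<And>\<gamma> j. bounded_linear \<gamma> \<Longrightarrow> j \<in> J \<Longrightarrow> md W \<tau> J v e (\<lambda>p. \<gamma> (\<pi> p) * v j p)"
    and \<beta>: "polyd k \<beta>" and h: "md W \<tau> J v l h"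
  shows "md W \<tau> J v (l + k * e) (\<lambda>p. \<beta> (\<pi> p) * h p)"
  using \<beta>
proof (induction rule: polyd.induct)
  case (polyd_const c) then show ?case using md_cmult[OF h, of c] by simp
next
  case (polyd_lin k f g)
  have "md W \<tau> J v (l + k * e + e) (\<lambda>p. g (\<pi> p) * (f (\<pi> p) * h p))"
    by (rule md_lin_mult[OF X[OF polyd_lin.hyps(2)] polyd_lin.IH])
  then show ?case by (simp add: mult.assoc add.commute add.left_commute)
next
  case (polyd_add k f f')
  from md_add[OF polyd_add.IH] show ?case by (simp add: distrib_right)
next
  case (polyd_Suc k f) show ?case by (rule md_mono[OF polyd_Suc.IH]) simp
qed

section \<open>Monic equations with a parameter\<close>

definition mfun :: "nat \<Rightarrow> (nat \<Rightarrow> 't \<Rightarrow> complex) \<Rightarrow> complex \<Rightarrow> 't \<Rightarrow> complex" where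
  "mfun n b z t = z ^ n + (\<Sum>i<n. b i t * z ^ i)"

lemma monic_root_bound:
  fixes z :: complex
  assumes "z ^ n + (\<Sum>i<n. c i * z ^ i) = 0" "\<And>i. i < n \<Longrightarrow> norm (c i) \<le> B" "B \<ge> 0"
  shows "norm z \<le> 1 + real n * B"
proof (rule ccontr)
  assume "\<not> ?thesis"
  then have z: "norm z > 1 + real n * B" by simp
  then have z1: "norm z \<ge> 1" using assms(3) by (smt (verit) mult_nonneg_nonneg of_nat_0_le_iff)
  show False
  proof (cases n)
    case 0 then show False using assms(1) by simp
  next
    case (Suc m)
    have "norm z ^ n = norm (\<Sum>i<n. c i * z ^ i)"
      using assms(1) by (metis add_eq_0_iff2 norm_minus_cancel norm_power)
    also have "\<dots> \<le> (\<Sum>i<n. B * norm z ^ m)"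
    proof (rule sum_norm_le)
      fix i assume i: "i \<in> {..<n}"
      have "norm z ^ i \<le> norm z ^ m" using z1 i Suc by (intro power_increasing) auto
      then show "norm (c i * z ^ i) \<le> B * norm z ^ m"
        using assms(2)[of i] assms(3) i by (auto simp: norm_mult norm_power intro!: mult_mono)
    qed
    also have "\<dots> = real n * B * norm z ^ m" by simp
    finally have "norm z * norm z ^ m \<le> real n * B * norm z ^ m" by (simp add: Suc)
    moreover have "norm z ^ m > 0" using z1 by (intro zero_less_power) linarith
    ultimately have "norm z \<le> real n * B" by simp
    then show False using z by simp
  qed
qed

text \<open>The modulus of a monic polynomial at x is the product of the distances from x to its
  roots, each at least the distance to the nearest one. This gives continuity of roots, at multiple
  roots as well.\<close>

lemma monic_root_near:
  fixes q :: "complex poly"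
  assumes "lead_coeff q = 1" "degree q > 0"
  shows "\<exists>z. poly q z = 0 \<and> norm (x - z) ^ degree q \<le> norm (poly q x)"
proof -
  have q0: "q \<noteq> 0" using assms by auto
  obtain A where A: "size A = degree q" "q = (\<Prod>x\<in>#A. [:-x, 1:])"
    using alg_closed_imp_factorization[OF q0] assms(1) by auto
  have Ane: "set_mset A \<noteq> {}" using A(1) assms(2) by (metis gr_implies_not0 set_mset_eq_empty_iff size_empty)
  define z where "z = arg_min_on (\<lambda>z. norm (x - z)) (set_mset A)"
  have z: "z \<in> set_mset A" "\<And>y. y \<in> set_mset A \<Longrightarrow> norm (x - z) \<le> norm (x - y)"
    unfolding z_def using arg_min_if_finite[of "set_mset A" "\<lambda>z. norm (x - z)"] Ane by (auto simp: not_less)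
  have root: "poly (\<Prod>x\<in>#A. [:-x, 1:]) z = 0"
    using z(1) by (auto simp: poly_prod_mset prod_mset_zero_iff intro!: image_eqI)
  have bound: "(\<forall>y\<in>#B. norm (x - z) \<le> norm (x - y)) \<Longrightarrow> norm (x - z) ^ size B \<le> norm (poly (\<Prod>x\<in>#B. [:-x, 1:]) x)" for B
  proof (induction B)
    case (add y B)
    then have "norm (x - z) * norm (x - z) ^ size B \<le> norm (x - y) * norm (poly (\<Prod>x\<in>#B. [:-x, 1:]) x)"
      by (intro mult_mono) auto
    then show ?case by (simp add: norm_mult[symmetric] left_diff_distrib)
  qed simp
  show ?thesis
    using root bound[of A] A z(2) by (intro exI[of _ z]) auto
qed

text \<open>For t near t0 the value at x0 is below e ^ n, so the root nearest to x0 is closer than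
  e.\<close>

lemma mfun_root_lift:
  fixes b :: "nat \<Rightarrow> 't::euclidean_space \<Rightarrow> complex"
  assumes b: "\<And>i. i < n \<Longrightarrow> polyd k (b i)" and z: "mfun n b x0 t0 = 0" and e: "e > 0"
  shows "\<exists>d>0. \<forall>t\<in>ball t0 d. \<exists>x. norm (x - x0) < e \<and> mfun n b x t = 0"
proof -
  have n: "n > 0" using z by (cases n) (auto simp: mfun_def)
  have "continuous_on UNIV (\<lambda>t. mfun n b x0 t)"
    unfolding mfun_def by (intro continuous_intros polyd_continuous[OF b]) auto
  then have "isCont (\<lambda>t. mfun n b x0 t) t0" by (simp add: continuous_on_eq_continuous_at)
  then have "\<exists>d>0. \<forall>t. dist t t0 < d \<longrightarrow> dist (mfun n b x0 t) (mfun n b x0 t0) < e ^ n"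
    using e unfolding continuous_at_eps_delta by simp
  then obtain d where d: "d > 0" "\<And>t. dist t t0 < d \<Longrightarrow> norm (mfun n b x0 t) < e ^ n"
    using z by auto
  have "\<exists>x. norm (x - x0) < e \<and> mfun n b x t = 0" if t: "t \<in> ball t0 d" for t
  proof -
    define q where "q = Polynomial.monom 1 n + (\<Sum>i<n. Polynomial.monom (b i t) i)"
    have pq: "poly q x = mfun n b x t" for x by (simp add: q_def mfun_def poly_sum poly_monom)
    have deg: "degree (\<Sum>i<n. Polynomial.monom (b i t) i) < n"
      using n by (intro degree_sum_less) (auto intro: le_less_trans[OF degree_monom_le])
    have dq: "degree q = n" unfolding q_def using deg by (subst degree_add_eq_left) (auto simp: degree_monom_eq)
    have "lead_coeff q = 1" unfolding dq using coeff_eq_0[OF deg] by (simp add: q_def)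
    then obtain x where x: "poly q x = 0" "norm (x0 - x) ^ n \<le> norm (poly q x0)"
      using monic_root_near[of q x0] n dq by auto
    have "norm (x0 - x) ^ n < e ^ n" using x(2) d(2)[of t] t by (simp add: pq dist_commute)
    then have "norm (x0 - x) < e" using e by (meson less_imp_le power_less_imp_less_base)
    then show ?thesis using x(1) by (auto simp: pq norm_minus_commute)
  qed
  then show ?thesis using d(1) by blast
qed

section \<open>Monic form of bivariate polynomials\<close>

text \<open>It serves two purposes: complex curves, with u and w the coordinates of a point, and
  complex-valued polynomials on the plane, with u and w the real and imaginary parts of the
  variable.\<close>

definition bsum :: "nat \<Rightarrow> (nat \<Rightarrow> nat \<Rightarrow> complex) \<Rightarrow> complex \<Rightarrow> complex \<Rightarrow> complex" where
  "bsum d a u w = (\<Sum>i\<le>d. \<Sum>j\<le>d - i. a i j * u ^ i * w ^ j)"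

lemma bsum_add: "bsum d a u w + bsum d a' u w = bsum d (\<lambda>i j. a i j + a' i j) u w"
  by (simp add: bsum_def sum.distrib[symmetric] distrib_right)

lemma bsum_cmult: "c * bsum d a u w = bsum d (\<lambda>i j. c * a i j) u w"
  by (simp add: bsum_def sum_distrib_left mult.assoc)

lemma bsum_mult_fst: "u * bsum d a u w = bsum (Suc d) (\<lambda>i j. case i of 0 \<Rightarrow> 0 | Suc k \<Rightarrow> a k j) u w"
  unfolding bsum_def by (subst sum.atMost_Suc_shift) (simp add: sum_distrib_left mult_ac)

lemma bsum_mult_snd: "w * bsum d a u w = bsum (Suc d) (\<lambda>i j. case j of 0 \<Rightarrow> 0 | Suc k \<Rightarrow> a i k) u w"
proof -
  have "(\<Sum>j\<le>Suc d - i. (case j of 0 \<Rightarrow> 0 | Suc k \<Rightarrow> a i k) * u ^ i * w ^ j) = (\<Sum>j\<le>d - i. w * (a i j * u ^ i * w ^ j))"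
    if "i \<le> d" for i
    using that by (simp add: Suc_diff_le sum.atMost_Suc_shift mult_ac del: sum.atMost_Suc)
  then show ?thesis unfolding bsum_def by (simp add: sum_distrib_left)
qed

lemma bsum_Suc: "bsum d a u w = bsum (Suc d) (\<lambda>i j. if i + j \<le> d then a i j else 0) u w"
proof -
  have "(\<Sum>j\<le>Suc d - i. (if i + j \<le> d then a i j else 0) * u ^ i * w ^ j) = (\<Sum>j\<le>d - i. a i j * u ^ i * w ^ j)"
    if "i \<le> d" for i
    by (rule sum.mono_neutral_cong_right) (use that in auto)
  then show ?thesis unfolding bsum_def by simp
qed

lemma polyd_complex_bsum:
  fixes N :: "complex \<Rightarrow> complex"
  assumes "polyd k N" shows "\<exists>a. \<forall>y. N y = bsum k a (of_real (Re y)) (of_real (Im y))"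
  using assms
proof (induction rule: polyd.induct)
  case (polyd_const c)
  show ?case by (rule exI[of _ "\<lambda>i j. c"]) (simp add: bsum_def)
next
  case (polyd_lin k h g)
  then obtain a where a: "\<And>y. h y = bsum k a (of_real (Re y)) (of_real (Im y))" by blast
  have g: "g y = g 1 * of_real (Re y) + g \<i> * of_real (Im y)" for y
    using linear_expand[OF polyd_lin.hyps(2), of y] by (simp add: Basis_complex_def)
  have "g y * h y = g 1 * (of_real (Re y) * h y) + g \<i> * (of_real (Im y) * h y)" for y
    by (subst g) (simp add: distrib_right)
  then show ?case unfolding a bsum_mult_fst bsum_mult_snd bsum_cmult bsum_add by blast
next
  case (polyd_add k h h')
  then obtain a a' where "\<And>y. h y = bsum k a (of_real (Re y)) (of_real (Im y))" "\<And>y. h' y = bsum k a' (of_real (Re y)) (of_real (Im y))"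
    by blast
  then show ?case by (intro exI[of _ "\<lambda>i j. a i j + a' i j"]) (simp add: bsum_add)
next
  case (polyd_Suc k h)
  then obtain a where "\<And>y. h y = bsum k a (of_real (Re y)) (of_real (Im y))" by blast
  then show ?case
    by (intro exI[of _ "\<lambda>i j. if i + j \<le> k then a i j else 0"]) (simp only: bsum_Suc[symmetric] simp_thms)
qed

lemma polyd_coeff_linear_mult:
  fixes r :: "'t::euclidean_space \<Rightarrow> complex poly"
  assumes r: "\<And>k. polyd m (\<lambda>t. poly.coeff (r t) k)" and l: "bounded_linear l"
  shows "polyd (Suc m) (\<lambda>t. poly.coeff ([:l t, c:] * r t) k)"
proof -
  have eq: "poly.coeff ([:l t, c:] * r t) k = l t * poly.coeff (r t) k + c * (case k of 0 \<Rightarrow> 0 | Suc i \<Rightarrow> poly.coeff (r t) i)" for t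
    by (cases k) (auto simp: coeff_pCons)
  have "polyd m (\<lambda>t. c * (case k of 0 \<Rightarrow> 0 | Suc i \<Rightarrow> poly.coeff (r t) i))"
    by (cases k) (auto intro: polyd_const' polyd_cmult r)
  then show ?thesis unfolding eq by (intro polyd_add polyd_lin r l polyd_Suc)
qed

lemma coeff_mult_degree_le:
  fixes p q :: "complex poly"
  assumes "degree p \<le> m" "degree q \<le> n"
  shows "poly.coeff (p * q) (m + n) = poly.coeff p m * poly.coeff q n"
proof -
  have "poly.coeff (p * q) (m + n) = (\<Sum>i\<le>m + n. poly.coeff p i * poly.coeff q (m + n - i))" by (simp add: coeff_mult)
  also have "\<dots> = (\<Sum>i\<in>{m}. poly.coeff p i * poly.coeff q (m + n - i))"
  proof (rule sum.mono_neutral_right)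
    show "\<forall>i\<in>{..m + n} - {m}. poly.coeff p i * poly.coeff q (m + n - i) = 0"
    proof
      fix i assume i: "i \<in> {..m + n} - {m}"
      show "poly.coeff p i * poly.coeff q (m + n - i) = 0"
      proof (cases "i > m")
        case True then show ?thesis using assms(1) coeff_eq_0[of p i] by simp
      next
        case False then have "m + n - i > n" using i by auto
        then show ?thesis using assms(2) coeff_eq_0[of q "m + n - i"] by simp
      qed
    qed
  qed auto
  finally show ?thesis by simp
qed

text \<open>Noether normalisation. With n the exact degree, the coefficient of z ^ n after the
  substitution is the leading form at (1, s); it is independent of t and nonzero for all but
  finitely many s. The excluded set B depends on a alone, so s can be chosen to meet further
  conditions, and \<alpha> and \<beta> may depend on s.\<close>

lemma monic_after_substitution:
  assumes ne: "\<exists>i j. i + j \<le> d \<and> a i j \<noteq> 0"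
  obtains n B where "n \<le> d" "finite B"
    "\<And>s \<alpha> \<beta> (l :: 't::euclidean_space \<Rightarrow> complex). s \<notin> B \<Longrightarrow> bounded_linear l \<Longrightarrow>
      \<exists>c b. c \<noteq> 0 \<and> (\<forall>i. polyd d (b i)) \<and> (\<forall>z t. bsum d a (z + \<alpha> * l t) (s * z + \<beta> * l t) = c * mfun n b z t)"
proof -
  define n where "n = Max {m. \<exists>i j. i + j = m \<and> m \<le> d \<and> a i j \<noteq> 0}"
  have fin: "finite {m. \<exists>i j. i + j = m \<and> m \<le> d \<and> a i j \<noteq> 0}" by (rule finite_subset[of _ "{..d}"]) auto
  have n: "n \<le> d" "\<exists>i j. i + j = n \<and> a i j \<noteq> 0"
    using Max_in[OF fin] ne unfolding n_def[symmetric] by auto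
  have big: "a i j = 0" if "i + j > n" "i + j \<le> d" for i j
    using Max_ge[OF fin, of "i + j"] that unfolding n_def[symmetric] by force
  \<comment> \<open>The leading form at (1, s), as a polynomial in s.\<close>
  define top where "top = (\<Sum>i\<le>n. Polynomial.monom (a i (n - i)) (n - i))"
  obtain i0 j0 where ij: "i0 + j0 = n" "a i0 j0 \<noteq> 0" using n(2) by blast
  have "poly.coeff top j0 = (\<Sum>i\<le>n. poly.coeff (Polynomial.monom (a i (n - i)) (n - i)) j0)" by (simp add: top_def coeff_sum)
  also have "\<dots> = (\<Sum>i\<in>{i0}. poly.coeff (Polynomial.monom (a i (n - i)) (n - i)) j0)"
    by (rule sum.mono_neutral_right) (use ij in auto)
  also have "\<dots> = a i0 j0" using ij by auto
  finally have "poly.coeff top j0 = a i0 j0" .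
  then have top: "top \<noteq> 0" using ij by auto
  show ?thesis
  proof (rule that[of n "{s. poly top s = 0}"])
    show "finite {s. poly top s = 0}" using top by (rule poly_roots_finite)
    fix s \<alpha> \<beta> and l :: "'t \<Rightarrow> complex" assume s: "s \<notin> {s. poly top s = 0}" and l: "bounded_linear l"
    define c where "c = poly top s"
    have c: "c \<noteq> 0" using s by (simp add: c_def)
    \<comment> \<open>The monomial u ^ i * w ^ j as a polynomial in z. Its coefficients have degree
      at most i + j in t, and the one at z ^ (i + j) is s ^ j.\<close>
    define r where "r = (\<lambda>i j t. [:\<alpha> * l t, 1:] ^ i * [:\<beta> * l t, s:] ^ j)"
    have bl: "bounded_linear (\<lambda>t. \<gamma> * l t)" for \<gamma> using bounded_linear_const_mult[OF l] .
    have rd2: "polyd j (\<lambda>t. poly.coeff ([:\<beta> * l t, s:] ^ j) k)" for j k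
    proof (induction j arbitrary: k)
      case 0 show ?case by (simp add: polyd_const')
    next
      case (Suc j) show ?case unfolding power_Suc by (rule polyd_coeff_linear_mult[OF Suc bl])
    qed
    have rd: "polyd (i + j) (\<lambda>t. poly.coeff (r i j t) k)" for i j k
    proof (induction i arbitrary: k)
      case 0 show ?case using rd2 by (simp add: r_def)
    next
      case (Suc i)
      have eq: "r (Suc i) j t = [:\<alpha> * l t, 1:] * r i j t" for t by (simp only: r_def power_Suc mult.assoc)
      show ?case
        unfolding eq add_Suc by (rule polyd_coeff_linear_mult[OF Suc bl])
    qed
    have deg: "degree (r i j t) \<le> i + j" for i j t
    proof -
      have 1: "degree ([:x, y:] ^ k :: complex poly) \<le> k" for x y k
        using degree_power_le[of "[:x, y:]" k] by (auto intro: order_trans split: if_splits)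
      show ?thesis unfolding r_def using degree_mult_le 1 by (meson add_mono order_trans)
    qed
    have lead: "poly.coeff (r i j t) (i + j) = s ^ j" for i j t
    proof -
      have 1: "degree ([:x, y:] ^ k :: complex poly) \<le> k" for x y k
        using degree_power_le[of "[:x, y:]" k] by (auto intro: order_trans split: if_splits)
      have 2: "poly.coeff ([:x, y:] ^ k :: complex poly) k = y ^ k" for x y k
      proof (induction k)
        case (Suc k)
        then show ?case using coeff_eq_0[of "[:x, y:] ^ k" "Suc k"] 1[of x y k] by (simp add: coeff_pCons)
      qed simp
      show ?thesis
        unfolding r_def using coeff_mult_degree_le[OF 1 1] by (simp add: 2)
    qed
    define q where "q = (\<lambda>t. \<Sum>i\<le>d. \<Sum>j\<le>d - i. Polynomial.smult (a i j) (r i j t))"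
    have pq: "poly (q t) z = bsum d a (z + \<alpha> * l t) (s * z + \<beta> * l t)" for t z
      by (simp add: q_def bsum_def r_def poly_sum mult.assoc algebra_simps)
    show "\<exists>c b. c \<noteq> 0 \<and> (\<forall>i. polyd d (b i)) \<and> (\<forall>z t. bsum d a (z + \<alpha> * l t) (s * z + \<beta> * l t) = c * mfun n b z t)"
    proof (intro exI conjI allI)
      show "c \<noteq> 0" by (rule c)
      show "polyd d (\<lambda>t. (1 / c) * poly.coeff (q t) k)" for k
        unfolding q_def coeff_sum coeff_smult
        by (intro polyd_cmult polyd_sum polyd_mono[OF rd]) auto
      fix z t
      have dq: "degree (q t) \<le> n"
        unfolding q_def
      proof (intro degree_sum_le)
        fix i j assume ij: "i \<in> {..d}" "j \<in> {..d - i}"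
        show "degree (Polynomial.smult (a i j) (r i j t)) \<le> n"
          using ij big[of i j] deg[of i j t] by (cases "i + j > n") auto
      qed auto
      have "poly.coeff (q t) n = (\<Sum>i\<le>d. \<Sum>j\<le>d - i. a i j * poly.coeff (r i j t) n)"
        by (simp add: q_def coeff_sum)
      also have "\<dots> = (\<Sum>i\<le>d. if i \<le> n then a i (n - i) * s ^ (n - i) else 0)"
      proof (intro sum.cong refl)
        fix i assume i: "i \<in> {..d}"
        have z: "a i j * poly.coeff (r i j t) n = 0" if "j \<le> d - i" "i + j \<noteq> n" for j
        proof (cases "i + j > n")
          case True then show ?thesis using big[of i j] that i by auto
        next
          case False
          then have "degree (r i j t) < n" using deg[of i j t] that by linarith
          then show ?thesis by (simp add: coeff_eq_0)
        qed
        show "(\<Sum>j\<le>d - i. a i j * poly.coeff (r i j t) n) = (if i \<le> n then a i (n - i) * s ^ (n - i) else 0)"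
        proof (cases "i \<le> n")
          case True
          have "(\<Sum>j\<le>d - i. a i j * poly.coeff (r i j t) n) = (\<Sum>j\<in>{n - i}. a i j * poly.coeff (r i j t) n)"
          proof (rule sum.mono_neutral_right)
            show "\<forall>j\<in>{..d - i} - {n - i}. a i j * poly.coeff (r i j t) n = 0"
            proof
              fix j assume "j \<in> {..d - i} - {n - i}"
              then show "a i j * poly.coeff (r i j t) n = 0" using z[of j] True by auto
            qed
          qed (use True n(1) in auto)
          then show ?thesis using lead[of i "n - i" t] True by simp
        next
          case False
          then show ?thesis using z by (auto intro!: sum.neutral)
        qed
      qed
      also have "\<dots> = (\<Sum>i\<le>n. a i (n - i) * s ^ (n - i))"
        by (rule sum.mono_neutral_cong_right) (use n(1) in auto)
      also have "\<dots> = c" by (simp add: c_def top_def poly_sum poly_monom)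
      finally have cn: "poly.coeff (q t) n = c" .
      have "poly (q t) z = (\<Sum>k\<le>degree (q t). poly.coeff (q t) k * z ^ k)" by (rule poly_altdef)
      also have "\<dots> = (\<Sum>k\<le>n. poly.coeff (q t) k * z ^ k)"
        by (rule sum.mono_neutral_left) (use dq coeff_eq_0[of "q t"] in auto)
      also have "\<dots> = c * z ^ n + (\<Sum>k<n. poly.coeff (q t) k * z ^ k)"
        by (simp add: lessThan_Suc_atMost[symmetric] cn)
      also have "\<dots> = c * mfun n (\<lambda>k t. (1 / c) * poly.coeff (q t) k) z t"
        using c by (simp add: mfun_def distrib_left sum_distrib_left mult.assoc[symmetric])
      finally show "bsum d a (z + \<alpha> * l t) (s * z + \<beta> * l t) = c * mfun n (\<lambda>k t. (1 / c) * poly.coeff (q t) k) z t"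
        unfolding pq .
    qed
  qed (use n in auto)
qed

section \<open>Finite generation of the polynomials on a curve\<close>

text \<open>A real-linear function of a complex number is a combination of it and its conjugate,
  which is why conjugates occur among the generators below.\<close>

lemma complex_pair_linear:
  fixes g :: "complex \<times> complex \<Rightarrow> complex"
  assumes g: "bounded_linear g"
  shows "\<exists>\<alpha> \<beta> \<gamma>. bounded_linear \<gamma> \<and> (\<forall>p. g p = \<alpha> * fst p + \<beta> * cnj (fst p) + \<gamma> (snd p))"
proof (rule exI[of _ "(g (1, 0) - \<i> * g (\<i>, 0)) / 2"], rule exI[of _ "(g (1, 0) + \<i> * g (\<i>, 0)) / 2"],
    rule exI[of _ "\<lambda>y. g (0, y)"], intro conjI allI)
  show "bounded_linear (\<lambda>y. g (0, y))"
    by (rule bounded_linear_compose[OF g bounded_linear_Pair[OF bounded_linear_zero bounded_linear_ident]])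
  fix p :: "complex \<times> complex"
  interpret bounded_linear g by (rule g)
  have "g p = g (fst p, 0) + g (0, snd p)" by (simp add: add[symmetric])
  also have "g (fst p, 0) = g (Re (fst p) *\<^sub>R (1, 0) + Im (fst p) *\<^sub>R (\<i>, 0))"
    by (rule arg_cong[of _ _ g]) (simp add: complex_eq_iff)
  also have "\<dots> = of_real (Re (fst p)) * g (1, 0) + of_real (Im (fst p)) * g (\<i>, 0)"
    unfolding add scaleR by (simp only: scaleR_conv_of_real)
  also have "\<dots> = (g (1, 0) - \<i> * g (\<i>, 0)) / 2 * fst p + (g (1, 0) + \<i> * g (\<i>, 0)) / 2 * cnj (fst p)"
    by (simp add: complex_eq_iff field_simps)
  finally show "g p = (g (1, 0) - \<i> * g (\<i>, 0)) / 2 * fst p + (g (1, 0) + \<i> * g (\<i>, 0)) / 2 * cnj (fst p) + g (0, snd p)" .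
qed

lemma mfun_top_power: "mfun n b z t = 0 \<Longrightarrow> z ^ n = (\<Sum>i<n. - b i t * z ^ i)"
  by (simp add: mfun_def sum_negf eq_neg_iff_add_eq_0)

text \<open>The monic equation reduces the n-th power of the first coordinate and its conjugate
  reduces that of the conjugate, so the n * n products of lower powers generate. A reduction costs
  at most d degrees in the base, a linear form in the base costs 1.\<close>

lemma fin_mod_monic_curve:
  fixes b :: "nat \<Rightarrow> complex \<Rightarrow> complex"
  assumes n: "n > 0" and b: "\<And>i. i < n \<Longrightarrow> polyd d (b i)"
    and W: "\<And>p. p \<in> W \<Longrightarrow> mfun n b (fst p) (snd p) = 0"
  shows "fin_mod W snd ({..<n} \<times> {..<n}) (\<lambda>(i, k) p. fst p ^ i * cnj (fst p) ^ k) (d + 1)"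
proof (rule fin_modI[where ?j0.0 = "(0, 0)"])
  let ?J = "{..<n} \<times> {..<n}" and ?v = "\<lambda>(i, k) p. fst p ^ i * cnj (fst p) ^ k :: complex"
  have gen: "md W snd ?J ?v 0 (\<lambda>p. fst p ^ i * cnj (fst p) ^ k)" if "i < n" "k < n" for i k
    using md_generator[of ?J "(i, k)" W snd ?v] that by simp
  have base: "md W snd ?J ?v a (\<lambda>p. \<beta> (snd p) * (fst p ^ i * cnj (fst p) ^ k))"
    if "polyd a \<beta>" "i < n" "k < n" for a \<beta> i k
    using md_base_mult[OF that(1) gen[OF that(2,3)]] by simp
  fix g :: "complex \<times> complex \<Rightarrow> complex" and j assume g: "bounded_linear g" and j: "j \<in> ?J"
  obtain i k where ik: "j = (i, k)" "i < n" "k < n" using j by auto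
  obtain \<alpha> \<beta> \<gamma> where \<gamma>: "bounded_linear \<gamma>" "\<And>p. g p = \<alpha> * fst p + \<beta> * cnj (fst p) + \<gamma> (snd p)"
    using complex_pair_linear[OF g] by blast
  have 1: "md W snd ?J ?v (d + 1) (\<lambda>p. fst p * (fst p ^ i * cnj (fst p) ^ k))"
  proof (cases "Suc i < n")
    case True
    show ?thesis by (rule md_mono[OF md_cong[OF gen[OF True ik(3)]]]) auto
  next
    case False
    then have i: "Suc i = n" using ik by simp
    have "md W snd ?J ?v d (\<lambda>p. \<Sum>l<n. - b l (snd p) * (fst p ^ l * cnj (fst p) ^ k))"
      by (intro md_sum base polyd_uminus b ik(3)) auto
    then show ?thesis
    proof (rule md_mono[OF md_cong])
      fix p assume "p \<in> W"
      then have "fst p * fst p ^ i = (\<Sum>l<n. - b l (snd p) * fst p ^ l)"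
        using mfun_top_power[OF W, of p] i by (simp only: power_Suc[symmetric])
      then show "(\<Sum>l<n. - b l (snd p) * (fst p ^ l * cnj (fst p) ^ k)) = fst p * (fst p ^ i * cnj (fst p) ^ k)"
        by (simp only: mult.assoc[symmetric] sum_distrib_right)
    qed simp
  qed
  have 2: "md W snd ?J ?v (d + 1) (\<lambda>p. cnj (fst p) * (fst p ^ i * cnj (fst p) ^ k))"
  proof (cases "Suc k < n")
    case True
    show ?thesis by (rule md_mono[OF md_cong[OF gen[OF ik(2) True]]]) auto
  next
    case False
    then have k: "Suc k = n" using ik by simp
    have "md W snd ?J ?v d (\<lambda>p. \<Sum>l<n. - cnj (b l (snd p)) * (fst p ^ i * cnj (fst p) ^ l))"
      by (intro md_sum base polyd_uminus polyd_cnj b ik(2)) auto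
    then show ?thesis
    proof (rule md_mono[OF md_cong])
      fix p assume "p \<in> W"
      then have "cnj (fst p * fst p ^ k) = cnj (\<Sum>l<n. - b l (snd p) * fst p ^ l)"
        using mfun_top_power[OF W, of p] k by (simp only: power_Suc[symmetric])
      then have eq: "cnj (fst p) * cnj (fst p) ^ k = (\<Sum>l<n. - cnj (b l (snd p)) * cnj (fst p) ^ l)" by simp
      have "(\<Sum>l<n. - cnj (b l (snd p)) * (fst p ^ i * cnj (fst p) ^ l)) = fst p ^ i * (\<Sum>l<n. - cnj (b l (snd p)) * cnj (fst p) ^ l)"
        unfolding sum_distrib_left by (intro sum.cong) auto
      then show "(\<Sum>l<n. - cnj (b l (snd p)) * (fst p ^ i * cnj (fst p) ^ l)) = cnj (fst p) * (fst p ^ i * cnj (fst p) ^ k)"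
        unfolding eq[symmetric] by simp
    qed simp
  qed
  have 3: "md W snd ?J ?v (d + 1) (\<lambda>p. \<gamma> (snd p) * (fst p ^ i * cnj (fst p) ^ k))"
    by (rule md_mono[OF base[OF polyd_linear[OF \<gamma>(1)] ik(2,3)]]) simp
  have "md W snd ?J ?v (d + 1) (\<lambda>p. (\<alpha> * (fst p * (fst p ^ i * cnj (fst p) ^ k)) + \<beta> * (cnj (fst p) * (fst p ^ i * cnj (fst p) ^ k)))
      + \<gamma> (snd p) * (fst p ^ i * cnj (fst p) ^ k))"
    by (intro md_add md_cmult 1 2 3)
  then show "md W snd ?J ?v (d + 1) (\<lambda>p. g p * ?v j p)"
    by (rule md_cong) (simp add: \<gamma>(2) ik distrib_right mult.assoc)
qed (use n in auto)

text \<open>Now Re y satisfies a monic equation of degree e over Im y, so powers of Re y below e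
  join the generators and the base becomes a real line. Reducing the n-th power of the first
  coordinate brings in a polynomial of degree d in y, and each linear form in y costs d2 +
  1.\<close>

lemma fin_mod_curve_over_line:
  fixes b :: "nat \<Rightarrow> complex \<Rightarrow> complex" and c :: "nat \<Rightarrow> real \<Rightarrow> complex"
  assumes n: "n > 0" and b: "\<And>i. i < n \<Longrightarrow> polyd d (b i)"
    and e: "e > 0" and c: "\<And>i. i < e \<Longrightarrow> polyd d2 (c i)"
    and W: "\<And>p. p \<in> W \<Longrightarrow> mfun n b (fst p) (snd p) = 0"
      "\<And>p. p \<in> W \<Longrightarrow> mfun e c (of_real (Re (snd p))) (Im (snd p)) = 0"
  shows "fin_mod W (\<lambda>p. Im (snd p)) ({..<n} \<times> {..<n} \<times> {..<e})
    (\<lambda>(i, k, l) p. fst p ^ i * cnj (fst p) ^ k * of_real (Re (snd p)) ^ l) ((d + 1) * (d2 + 1))"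
proof (rule fin_modI[where ?j0.0 = "(0, 0, 0)"])
  let ?J = "{..<n} \<times> {..<n} \<times> {..<e}" and ?t = "\<lambda>p :: complex \<times> complex. Im (snd p)"
  let ?v = "\<lambda>(i, k, l) p. fst p ^ i * cnj (fst p) ^ k * of_real (Re (snd p)) ^ l :: complex"
  have gen: "md W ?t ?J ?v 0 (\<lambda>p. fst p ^ i * cnj (fst p) ^ k * of_real (Re (snd p)) ^ l)"
    if "i < n" "k < n" "l < e" for i k l
    using md_generator[of ?J "(i, k, l)" W ?t ?v] that by simp
  have base: "md W ?t ?J ?v a (\<lambda>p. \<beta> (Im (snd p)) * (fst p ^ i * cnj (fst p) ^ k * of_real (Re (snd p)) ^ l))"
    if "polyd a \<beta>" "i < n" "k < n" "l < e" for a \<beta> i k l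
    using md_base_mult[OF that(1) gen[OF that(2,3,4)]] by simp
  have R: "md W ?t ?J ?v (d2 + 1) (\<lambda>p. of_real (Re (snd p)) * (fst p ^ i * cnj (fst p) ^ k * of_real (Re (snd p)) ^ l))"
    if "i < n" "k < n" "l < e" for i k l
  proof (cases "Suc l < e")
    case True
    show ?thesis by (rule md_mono[OF md_cong[OF gen[OF that(1,2) True]]]) auto
  next
    case False
    then have l: "Suc l = e" using that by simp
    have "md W ?t ?J ?v d2 (\<lambda>p. \<Sum>m<e. - c m (Im (snd p)) * (fst p ^ i * cnj (fst p) ^ k * of_real (Re (snd p)) ^ m))"
    proof (rule md_sum)
      fix m assume "m \<in> {..<e}"
      then show "md W ?t ?J ?v d2 (\<lambda>p. - c m (Im (snd p)) * (fst p ^ i * cnj (fst p) ^ k * of_real (Re (snd p)) ^ m))"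
        using base[OF polyd_uminus[OF c], of m i k m] that by simp
    qed
    then show ?thesis
    proof (rule md_mono[OF md_cong])
      fix p assume "p \<in> W"
      then have eq: "of_real (Re (snd p)) * of_real (Re (snd p)) ^ l = (\<Sum>m<e. - c m (Im (snd p)) * of_real (Re (snd p)) ^ m)"
        using mfun_top_power[OF W(2), of p] l by (simp only: power_Suc[symmetric])
      have "(\<Sum>m<e. - c m (Im (snd p)) * (fst p ^ i * cnj (fst p) ^ k * of_real (Re (snd p)) ^ m))
        = fst p ^ i * cnj (fst p) ^ k * (\<Sum>m<e. - c m (Im (snd p)) * of_real (Re (snd p)) ^ m)"
        unfolding sum_distrib_left by (intro sum.cong) auto
      then show "(\<Sum>m<e. - c m (Im (snd p)) * (fst p ^ i * cnj (fst p) ^ k * of_real (Re (snd p)) ^ m))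
        = of_real (Re (snd p)) * (fst p ^ i * cnj (fst p) ^ k * of_real (Re (snd p)) ^ l)"
        unfolding eq[symmetric] by simp
    qed simp
  qed
  have Y: "md W ?t ?J ?v (d2 + 1) (\<lambda>p. \<gamma> (snd p) * ?v j p)" if \<gamma>: "bounded_linear \<gamma>" and j: "j \<in> ?J" for \<gamma> :: "complex \<Rightarrow> complex" and j
  proof -
    obtain i k l where ikl: "j = (i, k, l)" "i < n" "k < n" "l < e" using j by auto
    have I: "md W ?t ?J ?v (d2 + 1) (\<lambda>p. of_real (Im (snd p)) * (fst p ^ i * cnj (fst p) ^ k * of_real (Re (snd p)) ^ l))"
      by (rule md_mono[OF base[OF polyd_linear[OF bounded_linear_of_real] ikl(2-)]]) simp
    have g: "\<gamma> y = \<gamma> 1 * of_real (Re y) + \<gamma> \<i> * of_real (Im y)" for y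
      using linear_expand[OF \<gamma>, of y] by (simp add: Basis_complex_def)
    have "md W ?t ?J ?v (d2 + 1) (\<lambda>p. \<gamma> 1 * (of_real (Re (snd p)) * (fst p ^ i * cnj (fst p) ^ k * of_real (Re (snd p)) ^ l))
      + \<gamma> \<i> * (of_real (Im (snd p)) * (fst p ^ i * cnj (fst p) ^ k * of_real (Re (snd p)) ^ l)))"
      by (intro md_add md_cmult R I ikl)
    then show ?thesis
    proof (rule md_cong)
      fix p :: "complex \<times> complex"
      show "\<gamma> 1 * (of_real (Re (snd p)) * (fst p ^ i * cnj (fst p) ^ k * of_real (Re (snd p)) ^ l))
      + \<gamma> \<i> * (of_real (Im (snd p)) * (fst p ^ i * cnj (fst p) ^ k * of_real (Re (snd p)) ^ l)) = \<gamma> (snd p) * ?v j p"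
        by (subst g[of "snd p"]) (simp add: ikl distrib_right mult.assoc)
    qed
  qed
  have By: "md W ?t ?J ?v (d * (d2 + 1)) (\<lambda>p. \<beta> (snd p) * (fst p ^ i * cnj (fst p) ^ k * of_real (Re (snd p)) ^ l))"
    if "polyd d \<beta>" "i < n" "k < n" "l < e" for \<beta> i k l
    using md_poly_mult[where \<pi> = snd, OF Y that(1) gen[OF that(2-)]] by simp
  fix g :: "complex \<times> complex \<Rightarrow> complex" and j assume g: "bounded_linear g" and j: "j \<in> ?J"
  obtain i k l where ikl: "j = (i, k, l)" "i < n" "k < n" "l < e" using j by auto
  obtain \<alpha> \<beta> \<gamma> where \<gamma>: "bounded_linear \<gamma>" "\<And>p. g p = \<alpha> * fst p + \<beta> * cnj (fst p) + \<gamma> (snd p)"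
    using complex_pair_linear[OF g] by blast
  define \<kappa> where "\<kappa> = (d + 1) * (d2 + 1)"
  have \<kappa>: "d * (d2 + 1) \<le> \<kappa>" "d2 + 1 \<le> \<kappa>" by (auto simp: \<kappa>_def)
  have 1: "md W ?t ?J ?v \<kappa> (\<lambda>p. fst p * (fst p ^ i * cnj (fst p) ^ k * of_real (Re (snd p)) ^ l))"
  proof (cases "Suc i < n")
    case True
    show ?thesis by (rule md_mono[OF md_cong[OF gen[OF True ikl(3,4)]]]) auto
  next
    case False
    then have i: "Suc i = n" using ikl by simp
    have "md W ?t ?J ?v (d * (d2 + 1)) (\<lambda>p. \<Sum>m<n. - b m (snd p) * (fst p ^ m * cnj (fst p) ^ k * of_real (Re (snd p)) ^ l))"
    proof (rule md_sum)
      fix m assume "m \<in> {..<n}"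
      then show "md W ?t ?J ?v (d * (d2 + 1)) (\<lambda>p. - b m (snd p) * (fst p ^ m * cnj (fst p) ^ k * of_real (Re (snd p)) ^ l))"
        using By[OF polyd_uminus[OF b], of m m k l] ikl by simp
    qed
    then show ?thesis
    proof (rule md_mono[OF md_cong])
      fix p assume "p \<in> W"
      then have eq: "fst p * fst p ^ i = (\<Sum>m<n. - b m (snd p) * fst p ^ m)"
        using mfun_top_power[OF W(1), of p] i by (simp only: power_Suc[symmetric])
      have "(\<Sum>m<n. - b m (snd p) * (fst p ^ m * cnj (fst p) ^ k * of_real (Re (snd p)) ^ l))
        = (cnj (fst p) ^ k * of_real (Re (snd p)) ^ l) * (\<Sum>m<n. - b m (snd p) * fst p ^ m)"
        unfolding sum_distrib_left by (intro sum.cong) auto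
      then show "(\<Sum>m<n. - b m (snd p) * (fst p ^ m * cnj (fst p) ^ k * of_real (Re (snd p)) ^ l))
        = fst p * (fst p ^ i * cnj (fst p) ^ k * of_real (Re (snd p)) ^ l)"
        unfolding eq[symmetric] by simp
    qed (rule \<kappa>)
  qed
  have 2: "md W ?t ?J ?v \<kappa> (\<lambda>p. cnj (fst p) * (fst p ^ i * cnj (fst p) ^ k * of_real (Re (snd p)) ^ l))"
  proof (cases "Suc k < n")
    case True
    show ?thesis by (rule md_mono[OF md_cong[OF gen[OF ikl(2) True ikl(4)]]]) auto
  next
    case False
    then have k: "Suc k = n" using ikl by simp
    have "md W ?t ?J ?v (d * (d2 + 1)) (\<lambda>p. \<Sum>m<n. - cnj (b m (snd p)) * (fst p ^ i * cnj (fst p) ^ m * of_real (Re (snd p)) ^ l))"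
    proof (rule md_sum)
      fix m assume "m \<in> {..<n}"
      then show "md W ?t ?J ?v (d * (d2 + 1)) (\<lambda>p. - cnj (b m (snd p)) * (fst p ^ i * cnj (fst p) ^ m * of_real (Re (snd p)) ^ l))"
        using By[OF polyd_uminus[OF polyd_cnj[OF b]], of m i m l] ikl by simp
    qed
    then show ?thesis
    proof (rule md_mono[OF md_cong])
      fix p assume "p \<in> W"
      then have "cnj (fst p * fst p ^ k) = cnj (\<Sum>m<n. - b m (snd p) * fst p ^ m)"
        using mfun_top_power[OF W(1), of p] k by (simp only: power_Suc[symmetric])
      then have eq: "cnj (fst p) * cnj (fst p) ^ k = (\<Sum>m<n. - cnj (b m (snd p)) * cnj (fst p) ^ m)" by simp
      have "(\<Sum>m<n. - cnj (b m (snd p)) * (fst p ^ i * cnj (fst p) ^ m * of_real (Re (snd p)) ^ l))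
        = (fst p ^ i * of_real (Re (snd p)) ^ l) * (\<Sum>m<n. - cnj (b m (snd p)) * cnj (fst p) ^ m)"
        unfolding sum_distrib_left by (intro sum.cong) auto
      then show "(\<Sum>m<n. - cnj (b m (snd p)) * (fst p ^ i * cnj (fst p) ^ m * of_real (Re (snd p)) ^ l))
        = cnj (fst p) * (fst p ^ i * cnj (fst p) ^ k * of_real (Re (snd p)) ^ l)"
        unfolding eq[symmetric] by simp
    qed (rule \<kappa>)
  qed
  have 3: "md W ?t ?J ?v \<kappa> (\<lambda>p. \<gamma> (snd p) * (fst p ^ i * cnj (fst p) ^ k * of_real (Re (snd p)) ^ l))"
    using md_mono[OF Y[OF \<gamma>(1) j] \<kappa>(2)] by (simp add: ikl)
  have "md W ?t ?J ?v \<kappa> (\<lambda>p. (\<alpha> * (fst p * (fst p ^ i * cnj (fst p) ^ k * of_real (Re (snd p)) ^ l))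
      + \<beta> * (cnj (fst p) * (fst p ^ i * cnj (fst p) ^ k * of_real (Re (snd p)) ^ l)))
      + \<gamma> (snd p) * (fst p ^ i * cnj (fst p) ^ k * of_real (Re (snd p)) ^ l))"
    by (intro md_add md_cmult 1 2 3)
  then have "md W ?t ?J ?v \<kappa> (\<lambda>p. g p * ?v j p)"
    by (rule md_cong) (simp add: \<gamma>(2) ikl distrib_right mult.assoc)
  then show "md W ?t ?J ?v ((d + 1) * (d2 + 1)) (\<lambda>p. g p * ?v j p)" by (simp add: \<kappa>_def)
qed (use n e in auto)

lemma mfun_bounded_roots:
  fixes b :: "nat \<Rightarrow> 't::euclidean_space \<Rightarrow> complex"
  assumes b: "\<And>i. i < n \<Longrightarrow> polyd k (b i)" and B: "bounded B"
  shows "\<exists>M. \<forall>t\<in>B. \<forall>z. mfun n b z t = 0 \<longrightarrow> norm z \<le> M"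
proof -
  have "\<exists>C. \<forall>t\<in>B. norm (b i t) \<le> C" if "i < n" for i
  proof -
    have "compact (b i ` closure B)"
      using B by (intro compact_continuous_image polyd_continuous[OF b[OF that]]) (simp add: compact_closure)
    then have "bounded (b i ` closure B)" by (rule compact_imp_bounded)
    then obtain C where "\<forall>x\<in>b i ` closure B. norm x \<le> C" by (auto simp: bounded_iff)
    then show ?thesis using closure_subset[of B] by (intro exI[of _ C]) auto
  qed
  then have "\<forall>i\<in>{..<n}. \<exists>C. \<forall>t\<in>B. norm (b i t) \<le> C" by blast
  from bchoice[OF this] obtain C where C: "\<And>i t. i < n \<Longrightarrow> t \<in> B \<Longrightarrow> norm (b i t) \<le> C i" by blast
  define M where "M = (\<Sum>i<n. \<bar>C i\<bar>)"
  have "norm (b i t) \<le> M" if "i < n" "t \<in> B" for i t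
  proof -
    have "norm (b i t) \<le> \<bar>C i\<bar>" using C[OF that] by linarith
    also have "\<dots> \<le> M" unfolding M_def using that(1) by (intro member_le_sum) auto
    finally show ?thesis .
  qed
  moreover have "M \<ge> 0" by (simp add: M_def sum_nonneg)
  ultimately show ?thesis
    unfolding mfun_def
    by (intro exI[of _ "1 + real n * M"] ballI allI impI) (rule monic_root_bound, auto)
qed

lemma nonvanishing_near:
  fixes R :: "nat \<Rightarrow> 'a::euclidean_space \<Rightarrow> real"
  assumes R: "\<And>j. j < N \<Longrightarrow> polyd (D j) (R j)" and nz: "\<And>j. j < N \<Longrightarrow> R j p \<noteq> 0"
  shows "\<exists>e>0. \<forall>p'. dist p' p < e \<longrightarrow> (\<forall>j<N. R j p' \<noteq> 0)"
proof -
  have "polyd (\<Sum>j<N. D j) (\<lambda>p. \<Prod>j<N. R j p)" using R by (intro polyd_prod) auto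
  then have "open {p. (\<Prod>j<N. R j p) \<noteq> 0}"
    by (intro open_Collect_neq continuous_on_const polyd_continuous)
  moreover have "p \<in> {p. (\<Prod>j<N. R j p) \<noteq> 0}" using nz by simp
  ultimately obtain e where "e > 0" "ball p e \<subseteq> {p. (\<Prod>j<N. R j p) \<noteq> 0}"
    using open_contains_ball by blast
  then show ?thesis by (intro exI[of _ e]) (auto simp: subset_iff dist_commute)
qed

text \<open>The curve covers the plane of the second coordinate as \<open>sign_vectors_card\<close>
  requires: roots of a monic equation stay bounded over bounded sets and move continuously with the
  coefficients. The 3 in K is the dimension of the base plus one.\<close>

lemma sign_vectors_monic_curve:
  fixes b :: "nat \<Rightarrow> complex \<Rightarrow> complex" and R :: "nat \<Rightarrow> complex \<times> complex \<Rightarrow> real"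
  assumes n: "n > 0" and b: "\<And>i. polyd d (b i)" and R: "\<And>j. j < N \<Longrightarrow> polyd (D j) (R j)"
    and W: "W = {p. mfun n b (fst p) (snd p) = 0 \<and> (\<forall>j<N. R j p \<noteq> 0)}"
    and K: "K = n * n * ((d + 1) * 3)\<^sup>2"
  shows "finite (sign_vector R N ` W) \<and> card (sign_vector R N ` W) \<le> n * n * (4 * K * (\<Sum>j<N. D j) + 2)\<^sup>2"
proof -
  let ?J = "{..<n} \<times> {..<n}"
  have fm: "fin_mod W snd ?J (\<lambda>(i, k) p. fst p ^ i * cnj (fst p) ^ k) (d + 1)"
    by (rule fin_mod_monic_curve[OF n]) (auto simp: W intro: b)
  have cJ: "card ?J = n * n" by (simp add: card_cartesian_product)
  have proper: "bounded {p \<in> W. snd p \<in> B}" if B: "bounded B" for B :: "complex set"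
  proof -
    obtain M where "\<forall>t\<in>B. \<forall>z. mfun n b z t = 0 \<longrightarrow> norm z \<le> M"
      using mfun_bounded_roots[of n d b, OF _ B] b by blast
    then have "{p \<in> W. snd p \<in> B} \<subseteq> cball 0 M \<times> B" by (auto simp: W)
    then show ?thesis using bounded_subset[OF bounded_Times[OF bounded_cball B]] by blast
  qed
  have lift: "\<exists>\<delta>>0. \<forall>y\<in>ball (snd p) \<delta>. \<exists>p'\<in>W. dist p' p < e \<and> snd p' = y" if p: "p \<in> W" and e: "e > 0" for p e
  proof -
    obtain e1 where e1: "e1 > 0" "\<forall>p'. dist p' p < e1 \<longrightarrow> (\<forall>j<N. R j p' \<noteq> 0)"
      using nonvanishing_near[of N D R p] R p unfolding W by blast
    define e2 where "e2 = min e e1 / 2"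
    have e2: "e2 > 0" using e e1 by (simp add: e2_def)
    obtain \<delta> where \<delta>: "\<delta> > 0" "\<forall>t\<in>ball (snd p) \<delta>. \<exists>x. norm (x - fst p) < e2 \<and> mfun n b x t = 0"
      using mfun_root_lift[of n d b "fst p" "snd p" e2] b p e2 unfolding W by blast
    have "\<exists>p'\<in>W. dist p' p < e \<and> snd p' = y" if y: "y \<in> ball (snd p) (min \<delta> e2)" for y
    proof -
      have "y \<in> ball (snd p) \<delta>" using y by simp
      then obtain x where x: "norm (x - fst p) < e2" "mfun n b x y = 0" using \<delta>(2) by blast
      have "dist (x, y) p \<le> dist x (fst p) + dist y (snd p)"
        unfolding dist_prod_def fst_conv snd_conv by (rule sqrt_sum_squares_le_sum) auto
      also have "\<dots> < e2 + e2" using x y by (intro add_strict_mono) (auto simp: dist_norm norm_minus_commute)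
      finally have "dist (x, y) p < min e e1" by (simp add: e2_def)
      then show ?thesis using e1(2) x(2) by (intro bexI[of _ "(x, y)"]) (auto simp: W)
    qed
    then show ?thesis using \<delta> e2 by (intro exI[of _ "min \<delta> e2"]) auto
  qed
  have clos: "p \<in> W" if p: "p \<in> closure W" "\<forall>j<N. R j p \<noteq> 0" for p
  proof -
    have "continuous_on UNIV (\<lambda>p. mfun n b (fst p) (snd p))"
      unfolding mfun_def
      by (intro continuous_intros continuous_on_compose2[OF polyd_continuous[OF b]]) auto
    then have "closed {p. mfun n b (fst p) (snd p) = 0}" by (intro closed_Collect_eq continuous_on_const)
    then have "closure W \<subseteq> {p. mfun n b (fst p) (snd p) = 0}" by (rule closure_minimal[rotated]) (auto simp: W)
    then show ?thesis using p by (auto simp: W)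
  qed
  have K': "K = card ?J * ((d + 1) * (DIM(complex) + 1)) ^ DIM(complex)" by (simp add: K cJ)
  have "finite (sign_vector R N ` W)"
    by (rule sign_vectors_card(1)[where R = R and D = D, OF fm _ bounded_linear_snd _ _ _ _ _ K'];
        (erule R | erule proper | (erule (1) lift) | (erule (1) clos) | simp add: W))
  moreover have "card (sign_vector R N ` W) \<le> card ?J * (2 * (DIM(complex) * K) * (\<Sum>j<N. D j) + 2) ^ DIM(complex)"
    by (rule sign_vectors_card(2)[where R = R and D = D, OF fm _ bounded_linear_snd _ _ _ _ _ K'];
        (erule R | erule proper | (erule (1) lift) | (erule (1) clos) | simp add: W))
  ultimately show ?thesis by (simp add: cJ mult.assoc)
qed

text \<open>A generic shear makes the equation monic in the first coordinate; as a linear bijection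
  it preserves the degree bounds and the set of sign vectors. The bound is quadratic in the degree
  sum because the base is a real plane.\<close>

theorem sign_vectors_on_curve:
  "\<exists>C. \<forall>a N (Q :: nat \<Rightarrow> complex \<times> complex \<Rightarrow> real) D. (\<exists>i j. i + j \<le> d \<and> a i j \<noteq> 0) \<and> (\<forall>j<N. polyd (D j) (Q j)) \<longrightarrow>
     finite (sign_vector Q N ` {p. bsum d a (fst p) (snd p) = 0 \<and> (\<forall>j<N. Q j p \<noteq> 0)}) \<and>
     card (sign_vector Q N ` {p. bsum d a (fst p) (snd p) = 0 \<and> (\<forall>j<N. Q j p \<noteq> 0)}) \<le> C * ((\<Sum>j<N. D j) + 1)\<^sup>2"
proof -
  define K where "K = (\<lambda>n. n * n * ((d + 1) * 3)\<^sup>2)"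
  define C where "C = d * d * (4 * K d + 2)\<^sup>2"
  have "finite (sign_vector Q N ` {p. bsum d a (fst p) (snd p) = 0 \<and> (\<forall>j<N. Q j p \<noteq> 0)}) \<and>
     card (sign_vector Q N ` {p. bsum d a (fst p) (snd p) = 0 \<and> (\<forall>j<N. Q j p \<noteq> 0)}) \<le> C * ((\<Sum>j<N. D j) + 1)\<^sup>2"
    if ne: "\<exists>i j. i + j \<le> d \<and> a i j \<noteq> 0" and Q: "\<And>j. j < N \<Longrightarrow> polyd (D j) (Q j)"
    for a N and Q :: "nat \<Rightarrow> complex \<times> complex \<Rightarrow> real" and D
  proof -
    obtain n B where nB: "n \<le> d" "finite B" "\<And>s \<alpha> \<beta> (l :: complex \<Rightarrow> complex). s \<notin> B \<Longrightarrow> bounded_linear l \<Longrightarrow>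
      \<exists>c b. c \<noteq> 0 \<and> (\<forall>i. polyd d (b i)) \<and> (\<forall>z t. bsum d a (z + \<alpha> * l t) (s * z + \<beta> * l t) = c * mfun n b z t)"
      by (rule monic_after_substitution[OF ne, where 't = complex]) blast
    obtain s where s: "s \<notin> B" using nB(2) ex_new_if_finite infinite_UNIV_char_0 by blast
    obtain c b where cb: "c \<noteq> 0" "\<And>i. polyd d (b i)"
      "\<And>z t. bsum d a z (s * z + t) = c * mfun n b z t"
      using nB(3)[OF s bounded_linear_ident, of 0 1] by auto
    define \<Phi> where "\<Phi> = (\<lambda>p::complex \<times> complex. (fst p, s * fst p + snd p))"
    have bl: "bounded_linear \<Phi>" unfolding \<Phi>_def
      by (intro bounded_linear_Pair bounded_linear_add bounded_linear_fst bounded_linear_snd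
          bounded_linear_compose[OF bounded_linear_mult_right])
    define W where "W = {p. bsum d a (fst p) (snd p) = 0 \<and> (\<forall>j<N. Q j p \<noteq> 0)}"
    define W' where "W' = {p. mfun n b (fst p) (snd p) = 0 \<and> (\<forall>j<N. Q j (\<Phi> p) \<noteq> 0)}"
    have "W = \<Phi> ` W'"
    proof (intro equalityI subsetI)
      fix p assume p: "p \<in> W"
      define p' where "p' = (fst p, snd p - s * fst p)"
      have "\<Phi> p' = p" by (simp add: \<Phi>_def p'_def)
      moreover have "p' \<in> W'" using p cb(1) cb(3)[of "fst p" "snd p - s * fst p"] \<open>\<Phi> p' = p\<close> by (simp add: W_def W'_def p'_def)
      ultimately show "p \<in> \<Phi> ` W'" by force
    next
      fix p assume "p \<in> \<Phi> ` W'"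
      then obtain p' where p': "p' \<in> W'" "p = \<Phi> p'" by blast
      then show "p \<in> W" using cb(3)[of "fst p'" "snd p'"] by (simp add: W_def W'_def \<Phi>_def)
    qed
    then have img: "sign_vector Q N ` W = sign_vector (\<lambda>j p. Q j (\<Phi> p)) N ` W'"
      by (simp add: image_image sign_vector_def)
    show ?thesis
    proof (cases "n = 0")
      \<comment> \<open>For n = 0 the polynomial is a nonzero constant and the curve is
        empty.\<close>
      case True
      then have "W' = {}" by (simp add: W'_def mfun_def)
      then show ?thesis unfolding W_def[symmetric] img by simp
    next
      case False
      have "finite (sign_vector (\<lambda>j p. Q j (\<Phi> p)) N ` W') \<and> card (sign_vector (\<lambda>j p. Q j (\<Phi> p)) N ` W') \<le> n * n * (4 * K n * (\<Sum>j<N. D j) + 2)\<^sup>2"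
        by (rule sign_vectors_monic_curve[where R = "\<lambda>j p. Q j (\<Phi> p)" and D = D, OF _ cb(2)])
          (use False in \<open>auto simp: W'_def K_def intro: polyd_compose_linear[OF Q bl]\<close>)
      moreover have "n * n * (4 * K n * (\<Sum>j<N. D j) + 2)\<^sup>2 \<le> C * ((\<Sum>j<N. D j) + 1)\<^sup>2"
      proof -
        have "n * n \<le> d * d" using nB(1) by (rule mult_le_mono[OF _ nB(1)])
        moreover have "K n \<le> K d" unfolding K_def using \<open>n * n \<le> d * d\<close> by (rule mult_le_mono1)
        then have "4 * K n * (\<Sum>j<N. D j) + 2 \<le> 4 * K d * (\<Sum>j<N. D j) + 2"
          by (intro add_right_mono mult_right_mono) auto
        then have "4 * K n * (\<Sum>j<N. D j) + 2 \<le> (4 * K d + 2) * ((\<Sum>j<N. D j) + 1)"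
          by (rule order_trans) (simp add: algebra_simps)
        then have "(4 * K n * (\<Sum>j<N. D j) + 2)\<^sup>2 \<le> ((4 * K d + 2) * ((\<Sum>j<N. D j) + 1))\<^sup>2"
          by (rule power_mono) simp
        ultimately have "n * n * (4 * K n * (\<Sum>j<N. D j) + 2)\<^sup>2 \<le> d * d * ((4 * K d + 2) * ((\<Sum>j<N. D j) + 1))\<^sup>2"
          by (rule mult_le_mono)
        then show ?thesis by (simp only: C_def power_mult_distrib mult.assoc)
      qed
      ultimately show ?thesis unfolding W_def[symmetric] img by linarith
    qed
  qed
  then show ?thesis by blast
qed

section \<open>Sign vectors on curves in a real hypersurface\<close>

text \<open>Injectivity, at p, of the derivative of (f, Q, S) as a real-linear map from \<real>^4 to
  \<real>^4.\<close>

definition nondeg :: "(complex \<times> complex \<Rightarrow> complex) \<Rightarrow> (complex \<times> complex \<Rightarrow> real) \<Rightarrow> (complex \<times> complex \<Rightarrow> real) \<Rightarrow> complex \<times> complex \<Rightarrow> bool" where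
  "nondeg f Q S p \<longleftrightarrow> (\<forall>w. pd w f p = 0 \<longrightarrow> pd w Q p = 0 \<longrightarrow> pd w S p = 0 \<longrightarrow> w = 0)"

text \<open>The two real values are packed into one complex number, so that source and target are
  the same Euclidean space, as \<open>nondegenerate_zeros_card\<close> demands.\<close>

definition triple :: "(complex \<times> complex \<Rightarrow> complex) \<Rightarrow> (complex \<times> complex \<Rightarrow> real) \<Rightarrow> (complex \<times> complex \<Rightarrow> real) \<Rightarrow> complex \<times> complex \<Rightarrow> complex \<times> complex" where
  "triple f Q S p = (f p, of_real (Q p) + \<i> * of_real (S p))"

lemma triple_eq_iff: "triple f Q S p = (z, of_real a + \<i> * of_real b) \<longleftrightarrow> f p = z \<and> Q p = a \<and> S p = b"
  by (auto simp: triple_def complex_eq_iff)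

lemma triple_has_derivative:
  assumes "polyd d f" "polyd q Q" "polyd r S"
  shows "(triple f Q S has_derivative (\<lambda>w. (pd w f p, of_real (pd w Q p) + \<i> * of_real (pd w S p)))) (at p)"
  unfolding triple_def[abs_def]
  by (intro has_derivative_Pair has_derivative_add has_derivative_mult_right has_derivative_of_real
      pd_has_derivative[OF assms(1)] pd_has_derivative[OF assms(2)] pd_has_derivative[OF assms(3)])

lemma nondeg_inj:
  assumes "polyd d f" "polyd q Q" "polyd r S" "nondeg f Q S p"
  shows "inj (\<lambda>w. (pd w f p, of_real (pd w Q p) + \<i> * of_real (pd w S p)))"
proof -
  have lin: "linear (\<lambda>w. (pd w f p, of_real (pd w Q p) + \<i> * of_real (pd w S p)))"
    using triple_has_derivative[OF assms(1-3), of p] by (rule has_derivative_linear)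
  show ?thesis
    unfolding linear_injective_0[OF lin]
  proof (intro allI impI)
    fix w assume 0: "(pd w f p, of_real (pd w Q p) + \<i> * of_real (pd w S p)) = 0"
    have f0: "pd w f p = 0" using arg_cong[OF 0, of fst] by simp
    have c0: "complex_of_real (pd w Q p) + \<i> * of_real (pd w S p) = 0" using arg_cong[OF 0, of snd] by simp
    have "pd w Q p = 0" "pd w S p = 0" using arg_cong[OF c0, of Re] arg_cong[OF c0, of Im] by simp_all
    with f0 show "w = 0" using assms(4) unfolding nondeg_def by blast
  qed
qed

lemma nondeg_zeros_card:
  assumes "polyd D f" "polyd D Q" "polyd D S" "finite X"
    and X: "\<And>p. p \<in> X \<Longrightarrow> f p = 0 \<and> Q p = 0 \<and> S p = 0 \<and> nondeg f Q S p"
  shows "card X \<le> (D + 1) ^ 4"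
proof -
  have "card X \<le> (D + 1) ^ DIM(complex \<times> complex)"
  proof (rule nondegenerate_zeros_card[where F = "triple f Q S"])
    fix b :: "complex \<times> complex" assume "b \<in> Basis"
    then have b: "b = (1, 0) \<or> b = (\<i>, 0) \<or> b = (0, 1) \<or> b = (0, \<i>)"
      by (auto simp: Basis_prod_def Basis_complex_def)
    have "(\<lambda>p. triple f Q S p \<bullet> b) = (\<lambda>p. Re (f p)) \<or> (\<lambda>p. triple f Q S p \<bullet> b) = (\<lambda>p. Im (f p))
      \<or> (\<lambda>p. triple f Q S p \<bullet> b) = Q \<or> (\<lambda>p. triple f Q S p \<bullet> b) = S"
      using b by (auto simp: triple_def inner_complex_def)
    then show "polyd D (\<lambda>p. triple f Q S p \<bullet> b)"
      using polyd_Re[OF assms(1)] polyd_Im[OF assms(1)] assms(2,3) by metis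
  next
    fix p assume p: "p \<in> X"
    show "triple f Q S p = 0" using X[OF p] by (simp add: triple_def zero_prod_def)
    show "\<exists>F'. (triple f Q S has_derivative F') (at p) \<and> inj F'"
      using triple_has_derivative[OF assms(1-3), of p] nondeg_inj[OF assms(1-3), of p] X[OF p] by blast
  qed (rule assms(4))
  then show ?thesis by simp
qed

text \<open>An open mapping argument. Prescribing Q and S serves both to move along the real curve
  {f = 0, Q = 0} and to leave {Q = 0} without leaving f = 0.\<close>

lemma nondeg_lift:
  assumes "polyd d f" "polyd q Q" "polyd r S" "nondeg f Q S p" "e > 0"
  shows "\<exists>\<delta>>0. \<forall>a b. \<bar>a - Q p\<bar> < \<delta> \<longrightarrow> \<bar>b - S p\<bar> < \<delta> \<longrightarrow> (\<exists>p'. dist p' p < e \<and> f p' = f p \<and> Q p' = a \<and> S p' = b)"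
proof -
  define F' where "F' = (\<lambda>w. (pd w f p, of_real (pd w Q p) + \<i> * of_real (pd w S p)))"
  have der: "(triple f Q S has_derivative F') (at p)"
    unfolding F'_def by (rule triple_has_derivative[OF assms(1-3)])
  have lin: "linear F'" using der by (rule has_derivative_linear)
  have inj: "inj F'" unfolding F'_def by (rule nondeg_inj[OF assms(1-4)])
  obtain g where g: "linear g" "\<And>x. F' (g x) = x"
    using linear_injective_isomorphism[OF lin inj] by blast
  have cont: "continuous_on UNIV (triple f Q S)"
    unfolding triple_def[abs_def]
    by (intro continuous_intros polyd_continuous[OF assms(1)] polyd_continuous[OF assms(2)] polyd_continuous[OF assms(3)])
  have "triple f Q S p \<in> interior (triple f Q S ` ball p e)"
    by (rule sussmann_open_mapping[OF open_UNIV cont UNIV_I der, of g])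
      (use g assms(5) in \<open>auto simp: linear_conv_bounded_linear fun_eq_iff\<close>)
  then obtain \<delta> where \<delta>: "\<delta> > 0" "ball (triple f Q S p) \<delta> \<subseteq> triple f Q S ` ball p e"
    by (auto simp: mem_interior)
  have "\<exists>p'. dist p' p < e \<and> f p' = f p \<and> Q p' = a \<and> S p' = b" if ab: "\<bar>a - Q p\<bar> < \<delta> / 2" "\<bar>b - S p\<bar> < \<delta> / 2" for a b
  proof -
    have "dist (triple f Q S p) (f p, of_real a + \<i> * of_real b) = cmod (of_real (Q p - a) + \<i> * of_real (S p - b))"
      by (simp add: triple_def dist_Pair_Pair dist_norm algebra_simps)
    also have "\<dots> \<le> \<bar>Q p - a\<bar> + \<bar>S p - b\<bar>"
      using norm_triangle_ineq[of "of_real (Q p - a) :: complex" "\<i> * of_real (S p - b)"]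
      by (simp only: norm_mult norm_of_real norm_ii mult_1)
    also have "\<dots> < \<delta>" using ab by linarith
    finally have "(f p, of_real a + \<i> * of_real b) \<in> triple f Q S ` ball p e" using \<delta>(2) by auto
    then obtain p' where p': "p' \<in> ball p e" "triple f Q S p' = (f p, of_real a + \<i> * of_real b)" by force
    then show ?thesis by (intro exI[of _ p']) (auto simp: triple_eq_iff dist_commute)
  qed
  then show ?thesis using \<delta>(1) by (intro exI[of _ "\<delta> / 2"]) auto
qed

text \<open>The base is the real line of Im y. Where J \<noteq> 0, nondegeneracy lets a point of the
  real curve move to any nearby value of Im y. Adjoining J to the functions \<open>R j\<close> keeps
  the covering away from degenerate points, at the cost of r in the degree sum.\<close>

lemma sign_vectors_transversal_core:
  fixes b :: "nat \<Rightarrow> complex \<Rightarrow> complex" and c :: "nat \<Rightarrow> real \<Rightarrow> complex" and R :: "nat \<Rightarrow> complex \<times> complex \<Rightarrow> real"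
    and Q J :: "complex \<times> complex \<Rightarrow> real"
  assumes n: "n > 0" and b: "\<And>i. polyd d (b i)" and e: "e > 0" and c: "\<And>i. polyd d2 (c i)"
    and f: "polyd d f" "\<And>p. f p = 0 \<longleftrightarrow> mfun n b (fst p) (snd p) = 0"
    and Q: "polyd q Q" and J: "polyd r J"
    and nd: "\<And>p. f p = 0 \<Longrightarrow> Q p = 0 \<Longrightarrow> J p \<noteq> 0 \<Longrightarrow> nondeg f Q (\<lambda>p. Im (snd p)) p"
    and cz: "\<And>p. f p = 0 \<Longrightarrow> Q p = 0 \<Longrightarrow> J p \<noteq> 0 \<Longrightarrow> mfun e c (of_real (Re (snd p))) (Im (snd p)) = 0"
    and R: "\<And>j. j < N \<Longrightarrow> polyd (D j) (R j)"
    and X: "\<And>p. p \<in> X \<Longrightarrow> f p = 0 \<and> Q p = 0 \<and> J p \<noteq> 0 \<and> (\<forall>j<N. R j p \<noteq> 0)"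
    and s: "s = n * (n * e)" and K: "K = s * ((d + 1) * (d2 + 1) * 2)"
  shows "finite (sign_vector R N ` X) \<and> card (sign_vector R N ` X) \<le> s * (2 * K * ((\<Sum>j<N. D j) + r) + 2)"
proof -
  let ?J = "{..<n} \<times> {..<n} \<times> {..<e}" and ?t = "\<lambda>p :: complex \<times> complex. Im (snd p)"
  define R' where "R' = (\<lambda>j. if j < N then R j else J)"
  define D' where "D' = (\<lambda>j. if j < N then D j else r)"
  define W where "W = {p. f p = 0 \<and> Q p = 0 \<and> (\<forall>j<Suc N. R' j p \<noteq> 0)}"
  have W: "p \<in> W \<longleftrightarrow> f p = 0 \<and> Q p = 0 \<and> J p \<noteq> 0 \<and> (\<forall>j<N. R j p \<noteq> 0)" for p
    by (auto simp: W_def R'_def less_Suc_eq)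
  have pR': "polyd (D' j) (R' j)" if "j < Suc N" for j using R J by (simp add: R'_def D'_def)
  have fm: "fin_mod W ?t ?J (\<lambda>(i, k, l) p. fst p ^ i * cnj (fst p) ^ k * of_real (Re (snd p)) ^ l) ((d + 1) * (d2 + 1))"
    by (rule fin_mod_curve_over_line[OF n _ e]) (use b c f(2) cz W in auto)
  have cJ: "card ?J = s" by (simp add: card_cartesian_product s)
  have bl: "bounded_linear ?t" by (intro bounded_linear_compose[OF bounded_linear_Im] bounded_linear_snd)
  have proper: "bounded {p \<in> W. ?t p \<in> B}" if B: "bounded B" for B :: "real set"
  proof -
    obtain M1 where M1: "\<And>t z. t \<in> B \<Longrightarrow> mfun e c z t = 0 \<Longrightarrow> norm z \<le> M1"
      using mfun_bounded_roots[of e d2 c, OF _ B] c by blast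
    obtain M2 where M2: "\<And>t. t \<in> B \<Longrightarrow> norm t \<le> M2" using B by (auto simp: bounded_iff)
    have y: "snd p \<in> cball 0 (M1 + M2)" if p: "p \<in> W" "?t p \<in> B" for p
    proof -
      have "norm (complex_of_real (Re (snd p))) \<le> M1" using M1[OF p(2)] cz[of p] p(1) W by blast
      moreover have "\<bar>Im (snd p)\<bar> \<le> M2" using M2[OF p(2)] by simp
      ultimately show ?thesis using cmod_le[of "snd p"] by simp
    qed
    obtain M3 where M3: "\<And>t z. t \<in> cball 0 (M1 + M2) \<Longrightarrow> mfun n b z t = 0 \<Longrightarrow> norm z \<le> M3"
      using mfun_bounded_roots[of n d b, OF _ bounded_cball] b by blast
    have "{p \<in> W. ?t p \<in> B} \<subseteq> cball 0 M3 \<times> cball 0 (M1 + M2)"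
    proof
      fix p assume p: "p \<in> {p \<in> W. ?t p \<in> B}"
      then have "snd p \<in> cball 0 (M1 + M2)" using y by blast
      moreover from this have "fst p \<in> cball 0 M3" using M3[of "snd p" "fst p"] p f(2) W by auto
      ultimately show "p \<in> cball 0 M3 \<times> cball 0 (M1 + M2)" by (simp add: mem_Times_iff)
    qed
    then show ?thesis using bounded_subset[OF bounded_Times[OF bounded_cball bounded_cball]] by blast
  qed
  have pt: "polyd 1 ?t" by (rule polyd_linear[OF bl])
  have lift: "\<exists>\<delta>>0. \<forall>y\<in>ball (?t p) \<delta>. \<exists>p'\<in>W. dist p' p < \<epsilon> \<and> ?t p' = y" if p: "p \<in> W" and \<epsilon>: "\<epsilon> > 0" for p \<epsilon>
  proof -
    obtain e1 where e1: "e1 > 0" "\<And>p'. dist p' p < e1 \<Longrightarrow> (\<forall>j<Suc N. R' j p' \<noteq> 0)"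
      using nonvanishing_near[of "Suc N" D' R' p] pR' p unfolding W_def by blast
    have nd': "nondeg f Q ?t p" using nd[of p] p W by blast
    obtain \<delta> where \<delta>: "\<delta> > 0" "\<And>a b. \<bar>a - Q p\<bar> < \<delta> \<Longrightarrow> \<bar>b - ?t p\<bar> < \<delta> \<Longrightarrow> \<exists>p'. dist p' p < min \<epsilon> e1 \<and> f p' = f p \<and> Q p' = a \<and> ?t p' = b"
      using nondeg_lift[OF f(1) Q pt nd', of "min \<epsilon> e1"] \<epsilon> e1(1) by auto
    have "\<exists>p'\<in>W. dist p' p < \<epsilon> \<and> ?t p' = y" if y: "y \<in> ball (?t p) \<delta>" for y
    proof -
      have "\<bar>y - ?t p\<bar> < \<delta>" using y by (simp add: dist_real_def)
      then obtain p' where p': "dist p' p < min \<epsilon> e1" "f p' = f p" "Q p' = Q p" "?t p' = y"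
        using \<delta>(2)[of "Q p" y] \<delta>(1) by auto
      then have "p' \<in> W" using e1(2)[of p'] p unfolding W_def by auto
      then show ?thesis using p' by auto
    qed
    then show ?thesis using \<delta>(1) by blast
  qed
  have clos: "p \<in> W" if p: "p \<in> closure W" "\<forall>j<Suc N. R' j p \<noteq> 0" for p
  proof -
    have "closed {p. f p = 0}" "closed {p. Q p = 0}"
      by (intro closed_Collect_eq continuous_on_const polyd_continuous[OF f(1)] polyd_continuous[OF Q])+
    then have "closed ({p. f p = 0} \<inter> {p. Q p = 0})" by (rule closed_Int)
    then have "closure W \<subseteq> {p. f p = 0} \<inter> {p. Q p = 0}" by (rule closure_minimal[rotated]) (auto simp: W_def)
    then show ?thesis using p by (auto simp: W_def)
  qed
  have K': "K = card ?J * ((d + 1) * (d2 + 1) * (DIM(real) + 1)) ^ DIM(real)" by (simp add: K cJ)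
  have fin: "finite (sign_vector R' (Suc N) ` W)"
    by (rule sign_vectors_card(1)[where R = R' and D = D', OF fm _ bl _ _ _ _ _ K'];
        (erule pR' | erule proper | (erule (1) lift) | (erule (1) clos) | simp add: W_def))
  have "card (sign_vector R' (Suc N) ` W) \<le> card ?J * (2 * (DIM(real) * K) * (\<Sum>j<Suc N. D' j) + 2) ^ DIM(real)"
    by (rule sign_vectors_card(2)[where R = R' and D = D', OF fm _ bl _ _ _ _ _ K'];
        (erule pR' | erule proper | (erule (1) lift) | (erule (1) clos) | simp add: W_def))
  also have "\<dots> = s * (2 * K * ((\<Sum>j<N. D j) + r) + 2)" by (simp add: cJ D'_def)
  finally have card: "card (sign_vector R' (Suc N) ` W) \<le> s * (2 * K * ((\<Sum>j<N. D j) + r) + 2)" .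
  \<comment> \<open>Dropping the index N, which belongs to J, recovers the sign vectors of
    R.\<close>
  have sub: "sign_vector R N ` X \<subseteq> (\<lambda>\<sigma>. \<sigma> \<inter> {..<N}) ` (sign_vector R' (Suc N) ` W)"
  proof
    fix \<sigma> assume "\<sigma> \<in> sign_vector R N ` X"
    then obtain p where p: "p \<in> X" "\<sigma> = sign_vector R N p" by blast
    have "p \<in> W" using X[OF p(1)] W by blast
    moreover have "\<sigma> = sign_vector R' (Suc N) p \<inter> {..<N}" by (auto simp: p(2) sign_vector_def R'_def)
    ultimately show "\<sigma> \<in> (\<lambda>\<sigma>. \<sigma> \<inter> {..<N}) ` (sign_vector R' (Suc N) ` W)" by blast
  qed
  then have "finite (sign_vector R N ` X)" using fin finite_subset by blast
  moreover have "card (sign_vector R N ` X) \<le> card (sign_vector R' (Suc N) ` W)"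
    using card_mono[OF finite_imageI[OF fin] sub] card_image_le[OF fin, of "\<lambda>\<sigma>. \<sigma> \<inter> {..<N}"] by linarith
  ultimately show ?thesis using card by linarith
qed

section \<open>Tangent directions of complex curves\<close>

text \<open>Complex differentiability, expressed as complex linearity of the real derivative; the
  derivative is then determined by the two complex partial derivatives, as in
  \<open>holp_pd\<close>.\<close>

definition holp :: "(complex \<times> complex \<Rightarrow> complex) \<Rightarrow> bool" where
  "holp f \<longleftrightarrow> (\<exists>D. \<forall>p. (f has_derivative D p) (at p) \<and> (\<forall>\<zeta> u v. D p (\<zeta> * u, \<zeta> * v) = \<zeta> * D p (u, v)))"

lemma holpI: "(\<And>p. (f has_derivative D p) (at p)) \<Longrightarrow> (\<And>p \<zeta> u v. D p (\<zeta> * u, \<zeta> * v) = \<zeta> * D p (u, v)) \<Longrightarrow> holp f"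
  unfolding holp_def by blast

lemma
  assumes "holp f"
  shows holp_has_derivative: "(f has_derivative (\<lambda>w. pd w f p)) (at p)"
    and holp_complex_linear: "pd (\<zeta> * u, \<zeta> * v) f p = \<zeta> * pd (u, v) f p"
proof -
  obtain D where D: "\<forall>p. (f has_derivative D p) (at p) \<and> (\<forall>\<zeta> u v. D p (\<zeta> * u, \<zeta> * v) = \<zeta> * D p (u, v))"
    using assms unfolding holp_def by (rule exE)
  have D1: "(f has_derivative D p) (at p)" for p by (rule D[THEN spec, THEN conjunct1])
  have D2: "D p (\<zeta> * u, \<zeta> * v) = \<zeta> * D p (u, v)" for p \<zeta> u v by (rule D[THEN spec, THEN conjunct2, THEN spec, THEN spec, THEN spec])
  have pd: "pd w f p = D p w" for w by (rule pd_eqI[OF D1])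
  show "(f has_derivative (\<lambda>w. pd w f p)) (at p)" by (simp add: pd D1)
  show "pd (\<zeta> * u, \<zeta> * v) f p = \<zeta> * pd (u, v) f p" unfolding pd by (rule D2)
qed

lemma holp_const: "holp (\<lambda>p. c)"
  by (rule holpI[of _ "\<lambda>p w. 0"]) auto

lemma holp_fst: "holp fst"
  by (rule holpI[of _ "\<lambda>p w. fst w"]) (auto intro: derivative_intros)

lemma holp_snd: "holp snd"
  by (rule holpI[of _ "\<lambda>p w. snd w"]) (auto intro: derivative_intros)

lemma holp_add:
  assumes "holp f" "holp g"
  shows "holp (\<lambda>p. f p + g p)"
proof (rule holpI[where D = "\<lambda>p w. pd w f p + pd w g p"])
  show "((\<lambda>p. f p + g p) has_derivative (\<lambda>w. pd w f p + pd w g p)) (at p)" for p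
    by (rule has_derivative_add[OF assms[THEN holp_has_derivative]])
  show "pd (\<zeta> * u, \<zeta> * v) f p + pd (\<zeta> * u, \<zeta> * v) g p = \<zeta> * (pd (u, v) f p + pd (u, v) g p)" for p \<zeta> u v
    unfolding assms[THEN holp_complex_linear] by (rule distrib_left[symmetric])
qed

lemma holp_mult:
  assumes "holp f" "holp g"
  shows "holp (\<lambda>p. f p * g p)"
proof (rule holpI[where D = "\<lambda>p w. f p * pd w g p + pd w f p * g p"])
  show "((\<lambda>p. f p * g p) has_derivative (\<lambda>w. f p * pd w g p + pd w f p * g p)) (at p)" for p
    by (rule has_derivative_mult[OF assms[THEN holp_has_derivative]])
  show "f p * pd (\<zeta> * u, \<zeta> * v) g p + pd (\<zeta> * u, \<zeta> * v) f p * g p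
      = \<zeta> * (f p * pd (u, v) g p + pd (u, v) f p * g p)" for p \<zeta> u v
    unfolding assms[THEN holp_complex_linear] by (simp only: distrib_left mult_ac)
qed

lemma holp_power: "holp f \<Longrightarrow> holp (\<lambda>p. f p ^ n)"
  by (induction n) (auto intro: holp_const holp_mult)

lemma holp_sum: "(\<And>i. i \<in> I \<Longrightarrow> holp (f i)) \<Longrightarrow> holp (\<lambda>p. \<Sum>i\<in>I. f i p)"
  by (induction I rule: infinite_finite_induct) (auto intro: holp_const holp_add)

lemma holp_pd:
  assumes "holp f"
  shows "pd (u, v) f p = u * pd (1, 0) f p + v * pd (0, 1) f p"
proof -
  have "pd (u, v) f p = pd ((u, 0) + (0, v)) f p" by simp
  also have "\<dots> = pd (u, 0) f p + pd (0, v) f p"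
    by (rule linear_add[OF has_derivative_linear[OF holp_has_derivative[OF assms]]])
  also have "pd (u, 0) f p = u * pd (1, 0) f p" using holp_complex_linear[OF assms, of u 1 0] by simp
  also have "pd (0, v) f p = v * pd (0, 1) f p" using holp_complex_linear[OF assms, of v 0 1] by simp
  finally show ?thesis .
qed

definition cf :: "nat \<Rightarrow> (nat \<Rightarrow> nat \<Rightarrow> complex) \<Rightarrow> complex \<times> complex \<Rightarrow> complex" where
  "cf d a p = bsum d a (fst p) (snd p)"

lemma polyd_cf: "polyd d (cf d a)"
proof -
  have "polyd d (\<lambda>p. \<Sum>i\<le>d. \<Sum>j\<le>d - i. a i j * (fst p ^ i * snd p ^ j))"
  proof (intro polyd_sum polyd_cmult)
    fix i j assume ij: "i \<in> {..d}" "j \<in> {..d - i}"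
    have "polyd (i * 1 + j * 1) (\<lambda>p :: complex \<times> complex. fst p ^ i * snd p ^ j)"
      by (intro polyd_mult polyd_power polyd_linear bounded_linear_fst bounded_linear_snd)
    then show "polyd d (\<lambda>p :: complex \<times> complex. fst p ^ i * snd p ^ j)"
      by (rule polyd_mono) (use ij in auto)
  qed
  then show ?thesis by (simp add: cf_def[abs_def] bsum_def mult.assoc)
qed

lemma holp_cf: "holp (cf d a)"
proof -
  have "holp (\<lambda>p. \<Sum>i\<le>d. \<Sum>j\<le>d - i. a i j * (fst p ^ i * snd p ^ j))"
    by (intro holp_sum holp_mult holp_const holp_power holp_fst holp_snd)
  then show ?thesis by (simp add: cf_def[abs_def] bsum_def mult.assoc)
qed

lemma pd_compose_linear:
  assumes "polyd k h" "bounded_linear T"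
  shows "pd w (\<lambda>p. h (T p)) p = pd (T w) h (T p)"
  by (rule pd_eqI[OF has_derivative_compose[OF bounded_linear_imp_has_derivative[OF assms(2)] pd_has_derivative[OF assms(1)]]])

lemma pd_real_expand:
  fixes Q :: "complex \<times> complex \<Rightarrow> real"
  assumes "polyd q Q"
  shows "pd (u, v) Q p = Re u * pd (1, 0) Q p + Im u * pd (\<i>, 0) Q p + Re v * pd (0, 1) Q p + Im v * pd (0, \<i>) Q p"
proof -
  have lin: "linear (\<lambda>w. pd w Q p)" using pd_bounded_linear[OF assms] bounded_linear.linear by blast
  have "(u, v) = Re u *\<^sub>R (1, 0) + Im u *\<^sub>R (\<i>, 0) + Re v *\<^sub>R (0, 1) + Im v *\<^sub>R (0, \<i>)"
    by (simp add: complex_eq_iff)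
  then have "pd (u, v) Q p = pd (Re u *\<^sub>R (1, 0) + Im u *\<^sub>R (\<i>, 0) + Re v *\<^sub>R (0, 1) + Im v *\<^sub>R (0, \<i>)) Q p"
    by (rule arg_cong)
  also have "\<dots> = Re u * pd (1, 0) Q p + Im u * pd (\<i>, 0) Q p + Re v * pd (0, 1) Q p + Im v * pd (0, \<i>) Q p"
    by (simp only: linear_add[OF lin] linear_scale[OF lin] real_scaleR_def)
  finally show ?thesis .
qed

text \<open>The restriction of the differential of \<open>Q\<close> to the complex tangent line of \<open>f = 0\<close>, parametrised by
  \<open>\<zeta> \<mapsto> (- \<zeta> f\<^sub>y, \<zeta> f\<^sub>x)\<close>, is the real-linear form \<open>\<zeta> \<mapsto> Re (\<zeta> * slope f Q p)\<close>.\<close>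

definition slope :: "(complex \<times> complex \<Rightarrow> complex) \<Rightarrow> (complex \<times> complex \<Rightarrow> real) \<Rightarrow> complex \<times> complex \<Rightarrow> complex" where
  "slope f Q p = of_real (pd (- pd (0, 1) f p, pd (1, 0) f p) Q p)
     - \<i> * of_real (pd (\<i> * - pd (0, 1) f p, \<i> * pd (1, 0) f p) Q p)"

lemma pd_tangent:
  assumes "polyd q Q"
  shows "pd (\<zeta> * - pd (0, 1) f p, \<zeta> * pd (1, 0) f p) Q p = Re (\<zeta> * slope f Q p)"
proof -
  define g h where "g = pd (1, 0) f p" and "h = pd (0, 1) f p"
  show ?thesis
    unfolding slope_def g_def[symmetric] h_def[symmetric]
      pd_real_expand[OF assms, of "\<zeta> * - h" "\<zeta> * g"] pd_real_expand[OF assms, of "- h" g]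
      pd_real_expand[OF assms, of "\<i> * - h" "\<i> * g"]
    by (simp add: algebra_simps)
qed

text \<open>The derivative of Im y along the real tangent line of {f = 0, Q = 0}: that line is given
  by the parameter \<zeta> = \<i> * cnj (slope f Q p), and the imaginary part of the y-component
  \<zeta> * f_x equals the real part of slope times cnj f_x.\<close>

definition jac :: "(complex \<times> complex \<Rightarrow> complex) \<Rightarrow> (complex \<times> complex \<Rightarrow> real) \<Rightarrow> complex \<times> complex \<Rightarrow> real" where
  "jac f Q p = Re (slope f Q p * cnj (pd (1, 0) f p))"

lemma polyd_jac:
  assumes f: "polyd d f" and Q: "polyd q Q"
  shows "polyd (d + q + d) (jac f Q)"
proof -
  have pf: "polyd d (pd w f)" for w using polyd_mono[OF polyd_pd[OF f]] by simp
  have pQ: "polyd q (pd w Q)" for w using polyd_mono[OF polyd_pd[OF Q]] by simp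
  have expand: "polyd (d + q) (\<lambda>p. pd (g p, h p) Q p)" if "polyd d g" "polyd d h" for g h
  proof -
    have eq: "(\<lambda>p. pd (g p, h p) Q p) = (\<lambda>p. Re (g p) * pd (1, 0) Q p + Im (g p) * pd (\<i>, 0) Q p
        + Re (h p) * pd (0, 1) Q p + Im (h p) * pd (0, \<i>) Q p)"
      by (rule ext) (rule pd_real_expand[OF Q])
    show ?thesis unfolding eq by (intro polyd_add polyd_mult polyd_Re polyd_Im that pQ)
  qed
  have "polyd (d + q + d) (\<lambda>p. pd (- pd (0, 1) f p, pd (1, 0) f p) Q p * Re (pd (1, 0) f p)
      - pd (\<i> * - pd (0, 1) f p, \<i> * pd (1, 0) f p) Q p * Im (pd (1, 0) f p))"
    by (intro polyd_diff polyd_mult expand polyd_uminus polyd_cmult polyd_Re polyd_Im pf)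
  moreover have "jac f Q p = pd (- pd (0, 1) f p, pd (1, 0) f p) Q p * Re (pd (1, 0) f p)
      - pd (\<i> * - pd (0, 1) f p, \<i> * pd (1, 0) f p) Q p * Im (pd (1, 0) f p)" for p
    by (simp add: jac_def slope_def)
  ultimately show ?thesis by (simp add: jac_def[abs_def])
qed

text \<open>As f_x \<noteq> 0, a kernel vector of f has the form (- \<zeta> f_y, \<zeta> f_x). If Q
  kills it and v = \<zeta> f_x is real, then v * jac = |f_x| ^ 2 * Re (\<zeta> * slope) = 0, so v
  and with it \<zeta> vanish.\<close>

lemma jac_nondeg:
  assumes f: "holp f" and Q: "polyd q Q" and J: "jac f Q p \<noteq> 0"
  shows "nondeg f Q (\<lambda>p. Im (snd p)) p"
  unfolding nondeg_def
proof (intro allI impI)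
  fix w :: "complex \<times> complex" assume w: "pd w f p = 0" "pd w Q p = 0" "pd w (\<lambda>p. Im (snd p)) p = 0"
  obtain u v where uv: "w = (u, v)" by (cases w)
  define g where "g = pd (1, 0) f p"
  define h where "h = pd (0, 1) f p"
  have g0: "g \<noteq> 0" using J by (auto simp: jac_def g_def)
  define \<zeta> where "\<zeta> = v / g"
  have v: "v = \<zeta> * g" using g0 by (simp add: \<zeta>_def)
  have "u * g + v * h = 0" using w(1) holp_pd[OF f, of u v p] by (simp add: uv g_def h_def)
  then have "g * (u + \<zeta> * h) = 0" by (simp add: v algebra_simps)
  then have u: "u = \<zeta> * - h" using g0 by (simp add: eq_neg_iff_add_eq_0)
  have "Re (\<zeta> * slope f Q p) = 0"
    using w(2) pd_tangent[OF Q, of \<zeta> f p] by (simp add: uv u v g_def h_def)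
  moreover have "((\<lambda>p :: complex \<times> complex. Im (snd p)) has_derivative (\<lambda>w. Im (snd w))) (at p)"
    by (intro bounded_linear_imp_has_derivative bounded_linear_compose[OF bounded_linear_Im] bounded_linear_snd)
  then have "Im (snd w) = 0" using w(3) pd_eqI by metis
  then have imv: "Im v = 0" by (simp add: uv)
  have "slope f Q p * cnj g * of_real (Re v) = of_real ((norm g)\<^sup>2) * (\<zeta> * slope f Q p)"
  proof -
    have "of_real (Re v) = \<zeta> * g" using imv v by (simp add: complex_eq_iff)
    then show ?thesis using complex_norm_square[of g] by (simp add: mult_ac)
  qed
  then have "Re (of_real (Re v) * (slope f Q p * cnj g)) = Re (of_real ((norm g)\<^sup>2) * (\<zeta> * slope f Q p))"
    by (metis mult.commute)
  then have "Re v * Re (slope f Q p * cnj g) = (norm g)\<^sup>2 * Re (\<zeta> * slope f Q p)"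
    by (simp only: times_complex.sel Re_complex_of_real Im_complex_of_real mult_zero_left diff_zero)
  ultimately have "Re v = 0" using J by (simp add: jac_def g_def)
  then have "v = 0" using imv by (simp add: complex_eq_iff)
  then have "\<zeta> = 0" using v g0 by simp
  then show "w = 0" using u v by (simp add: uv zero_prod_def)
qed

text \<open>The curve is smooth at p and the differential of Q does not vanish on its complex
  tangent line. If p lies on both zero sets, {f = 0, Q = 0} is a smooth real curve near p.\<close>

definition good :: "(complex \<times> complex \<Rightarrow> complex) \<Rightarrow> (complex \<times> complex \<Rightarrow> real) \<Rightarrow> complex \<times> complex \<Rightarrow> bool" where
  "good f Q p \<longleftrightarrow> (pd (1, 0) f p \<noteq> 0 \<or> pd (0, 1) f p \<noteq> 0) \<and> slope f Q p \<noteq> 0"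

text \<open>The substitution multiplies the slope by \<omega> and replaces f_x by f_x + \<mu> f_y. A
  generic \<mu> makes the latter nonzero at finitely many good points, and a generic \<omega> then
  makes the real part nonzero there.\<close>

lemma jac_substitution:
  fixes \<mu> \<omega> :: complex
  assumes f: "polyd d f" "holp f" and Q: "polyd q Q"
  defines "\<Phi> \<equiv> \<lambda>p::complex \<times> complex. (fst p, \<mu> * fst p + \<omega> * snd p)"
  shows "jac (\<lambda>p. f (\<Phi> p)) (\<lambda>p. Q (\<Phi> p)) p =
    Re (\<omega> * (slope f Q (\<Phi> p) * cnj (pd (1, 0) f (\<Phi> p) + \<mu> * pd (0, 1) f (\<Phi> p))))"
proof -
  have bl: "bounded_linear \<Phi>" unfolding \<Phi>_def
    by (intro bounded_linear_Pair bounded_linear_add bounded_linear_fst bounded_linear_snd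
          bounded_linear_compose[OF bounded_linear_mult_right])
  define g where "g = pd (1, 0) f (\<Phi> p)"
  define h where "h = pd (0, 1) f (\<Phi> p)"
  have 1: "pd (1, 0) (\<lambda>p. f (\<Phi> p)) p = g + \<mu> * h"
    unfolding pd_compose_linear[OF f(1) bl] using holp_pd[OF f(2), of 1 \<mu> "\<Phi> p"] by (simp add: \<Phi>_def g_def h_def)
  have 2: "pd (0, 1) (\<lambda>p. f (\<Phi> p)) p = \<omega> * h"
    unfolding pd_compose_linear[OF f(1) bl] using holp_pd[OF f(2), of 0 \<omega> "\<Phi> p"] by (simp add: \<Phi>_def g_def h_def)
  have 3: "pd (\<zeta> * - (\<omega> * h), \<zeta> * (g + \<mu> * h)) (\<lambda>p. Q (\<Phi> p)) p = Re (\<zeta> * \<omega> * slope f Q (\<Phi> p))" for \<zeta>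
  proof -
    have "\<Phi> (\<zeta> * - (\<omega> * h), \<zeta> * (g + \<mu> * h)) = ((\<zeta> * \<omega>) * - h, (\<zeta> * \<omega>) * g)"
      by (simp add: \<Phi>_def algebra_simps)
    then show ?thesis
      unfolding pd_compose_linear[OF Q bl] using pd_tangent[OF Q, of "\<zeta> * \<omega>" f "\<Phi> p"] by (simp add: g_def h_def)
  qed
  have "slope (\<lambda>p. f (\<Phi> p)) (\<lambda>p. Q (\<Phi> p)) p = \<omega> * slope f Q (\<Phi> p)"
    unfolding slope_def[of "\<lambda>p. f (\<Phi> p)"] 1 2 using 3[of 1] 3[of \<i>] by (simp add: complex_eq_iff)
  then show ?thesis unfolding jac_def 1 by (simp add: g_def h_def mult.assoc)
qed

text \<open>Coordinates are chosen generically for the finite set X, while the constant depends on d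
  and q only. In them f is monic in x over y, Re y satisfies a monic equation over Im y on the
  nondegenerate part of {f = 0, Q = 0}, and \<open>jac\<close> is nonzero on X. The bound is linear
  in the degree sum because the base is a line.\<close>

theorem sign_vectors_transversal:
  "\<exists>C. \<forall>a (Q :: complex \<times> complex \<Rightarrow> real) N (R :: nat \<Rightarrow> complex \<times> complex \<Rightarrow> real) D X.
     (\<exists>i j. i + j \<le> d \<and> a i j \<noteq> 0) \<and> polyd q Q \<and> finite X \<and> (\<forall>j<N. polyd (D j) (R j)) \<and>
     (\<forall>p\<in>X. cf d a p = 0 \<and> Q p = 0 \<and> good (cf d a) Q p \<and> (\<forall>j<N. R j p \<noteq> 0)) \<longrightarrow>
     finite (sign_vector R N ` X) \<and> card (sign_vector R N ` X) \<le> C * ((\<Sum>j<N. D j) + 1)"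
proof -
  \<comment> \<open>k1 bounds the degree of the polynomial M below and r that of \<open>jac\<close>;
    sd and Kd are s and K of the core lemma with n and n2 replaced by their bounds d and k1.\<close>
  define k1 where "k1 = 2 * (d * d * ((d + 1) * 3)\<^sup>2 * q)"
  define r where "r = d + q + d"
  define sd where "sd = d * (d * k1)"
  define Kd where "Kd = sd * ((d + 1) * (k1 + 1) * 2)"
  define C where "C = sd * (2 * Kd * (r + 1) + 2)"
  have "finite (sign_vector R N ` X) \<and> card (sign_vector R N ` X) \<le> C * ((\<Sum>j<N. D j) + 1)"
    if ne: "\<exists>i j. i + j \<le> d \<and> a i j \<noteq> 0" and Q: "polyd q Q" and X: "finite X"
      and R: "\<And>j. j < N \<Longrightarrow> polyd (D j) (R j)"
      and XX: "\<And>p. p \<in> X \<Longrightarrow> cf d a p = 0 \<and> Q p = 0 \<and> good (cf d a) Q p \<and> (\<forall>j<N. R j p \<noteq> 0)"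
    for a N D X and Q :: "complex \<times> complex \<Rightarrow> real" and R :: "nat \<Rightarrow> complex \<times> complex \<Rightarrow> real"
  proof (cases "X = {}")
    case False
    define f where "f = cf d a"
    have f: "polyd d f" "holp f" by (simp_all add: f_def polyd_cf holp_cf)
    define g where "g = (\<lambda>\<mu> p. pd (1, 0) f p + \<mu> * pd (0, 1) f p)"
    obtain n B where nB: "n \<le> d" "finite B" "\<And>s \<alpha> \<beta> (l :: complex \<Rightarrow> complex). s \<notin> B \<Longrightarrow> bounded_linear l \<Longrightarrow>
      \<exists>c b. c \<noteq> 0 \<and> (\<forall>i. polyd d (b i)) \<and> (\<forall>z t. bsum d a (z + \<alpha> * l t) (s * z + \<beta> * l t) = c * mfun n b z t)"
      by (rule monic_after_substitution[OF ne, where 't = complex]) blast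
    \<comment> \<open>The values of \<mu> to avoid: those that may spoil monicity, and those for
      which f_x + \<mu> f_y vanishes at a point of X.\<close>
    have finB: "finite (B \<union> (\<lambda>p. - pd (1, 0) f p / pd (0, 1) f p) ` X)"
      by (intro finite_UnI finite_imageI nB(2) X)
    obtain \<mu> where "\<mu> \<notin> B \<union> (\<lambda>p. - pd (1, 0) f p / pd (0, 1) f p) ` X"
      using ex_new_if_finite[OF infinite_UNIV_char_0 finB] by (rule exE)
    then have \<mu>: "\<mu> \<notin> B" "\<mu> \<notin> (\<lambda>p. - pd (1, 0) f p / pd (0, 1) f p) ` X" by simp_all
    have g0: "g \<mu> p \<noteq> 0" if p: "p \<in> X" for p
    proof
      assume 0: "g \<mu> p = 0"
      show False
      proof (cases "pd (0, 1) f p = 0")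
        case True then show False using 0 XX[OF p] by (simp add: g_def good_def f_def)
      next
        case False
        then have "\<mu> = - pd (1, 0) f p / pd (0, 1) f p" using 0 by (simp add: g_def field_simps eq_neg_iff_add_eq_0)
        then show False using \<mu>(2) p by blast
      qed
    qed
    obtain c1 b where cb: "c1 \<noteq> 0" "\<And>i. polyd d (b i)"
      "\<And>z t. bsum d a z (\<mu> * z + t) = c1 * mfun n b z t"
      using nB(3)[OF \<mu>(1) bounded_linear_ident, of 0 1] by auto
    have n: "n > 0"
    proof (rule ccontr)
      assume "\<not> n > 0"
      then have m1: "mfun n b z t = 1" for z t by (simp add: mfun_def)
      obtain p where p: "p \<in> X" using False by blast
      have "cf d a p = c1" using cb(3)[of "fst p" "snd p - \<mu> * fst p"] m1 by (simp add: cf_def)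
      then show False using XX[OF p] cb(1) by simp
    qed
    define \<Phi>1 where "\<Phi>1 = (\<lambda>p::complex \<times> complex. (fst p, \<mu> * fst p + snd p))"
    have bl1: "bounded_linear \<Phi>1" unfolding \<Phi>1_def
      by (intro bounded_linear_Pair bounded_linear_add bounded_linear_fst bounded_linear_snd
          bounded_linear_compose[OF bounded_linear_mult_right])
    \<comment> \<open>A function without zeros is needed on W1, so the zeros of Q are removed; those
      that are limits of the remaining points return in the closure.\<close>
    define W1 where "W1 = {p. f (\<Phi>1 p) = 0 \<and> Q (\<Phi>1 p) \<noteq> 0}"
    have fm: "fin_mod W1 snd ({..<n} \<times> {..<n}) (\<lambda>(i, k) p. fst p ^ i * cnj (fst p) ^ k) (d + 1)"
      by (rule fin_mod_monic_curve[OF n]) (use cb in \<open>auto simp: W1_def f_def cf_def \<Phi>1_def\<close>)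
    have "\<exists>M :: complex \<Rightarrow> complex. polyd (DIM(complex) * (n * n * ((d + 1) * 3)\<^sup>2 * q)) M \<and> (\<exists>y. M y \<noteq> 0) \<and>
      (\<forall>p\<in>closure W1. Q (\<Phi>1 p) = 0 \<longrightarrow> M (snd p) = 0)"
      by (rule vanishing_locus_polynomial[OF fm _ bounded_linear_snd polyd_compose_linear[OF Q bl1]])
        (auto simp: W1_def card_cartesian_product)
    then obtain M :: "complex \<Rightarrow> complex" where M0: "polyd (DIM(complex) * (n * n * ((d + 1) * 3)\<^sup>2 * q)) M"
      and M: "\<exists>y. M y \<noteq> 0" "\<And>p. p \<in> closure W1 \<Longrightarrow> Q (\<Phi>1 p) = 0 \<Longrightarrow> M (snd p) = 0" by blast
    have nd2: "n * n \<le> d * d" by (rule mult_le_mono[OF nB(1) nB(1)])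
    have pM: "polyd k1 M"
      by (rule polyd_mono[OF M0]) (auto simp: k1_def nd2 intro!: mult_le_mono)
    obtain a2 where a2: "\<And>y. M y = bsum k1 a2 (of_real (Re y)) (of_real (Im y))"
      using polyd_complex_bsum[OF pM] by blast
    have ne2: "\<exists>i j. i + j \<le> k1 \<and> a2 i j \<noteq> 0"
    proof (rule ccontr)
      assume "\<not> ?thesis"
      then have "M y = 0" for y unfolding a2 bsum_def by (intro sum.neutral ballI) auto
      then show False using M(1) by blast
    qed
    obtain n2 B2 where nB2: "n2 \<le> k1" "finite B2" "\<And>s \<alpha> \<beta> (l :: real \<Rightarrow> complex). s \<notin> B2 \<Longrightarrow> bounded_linear l \<Longrightarrow>
      \<exists>c b. c \<noteq> 0 \<and> (\<forall>i. polyd k1 (b i)) \<and> (\<forall>z t. bsum k1 a2 (z + \<alpha> * l t) (s * z + \<beta> * l t) = c * mfun n2 b z t)"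
      by (rule monic_after_substitution[OF ne2, where 't = real]) blast
    define \<kappa> where "\<kappa> = (\<lambda>p. slope f Q p * cnj (g \<mu> p))"
    have \<kappa>0: "\<kappa> p \<noteq> 0" if "p \<in> X" for p using g0[OF that] XX[OF that] by (simp add: \<kappa>_def good_def f_def)
    \<comment> \<open>The values of s to avoid: those for which M may fail to be monic in Re y after
      the rotation, and those for which the real part of \<omega> * \<kappa> p vanishes at a point
      of X.\<close>
    have finB2: "finite (Re ` B2 \<union> (\<lambda>p. Re (\<kappa> p) / Im (\<kappa> p)) ` X)"
      by (intro finite_UnI finite_imageI nB2(2) X)
    obtain s :: real where "s \<notin> Re ` B2 \<union> (\<lambda>p. Re (\<kappa> p) / Im (\<kappa> p)) ` X"
      using ex_new_if_finite[OF infinite_UNIV_char_0 finB2] by (rule exE)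
    then have s: "s \<notin> Re ` B2" "s \<notin> (\<lambda>p. Re (\<kappa> p) / Im (\<kappa> p)) ` X" by simp_all
    have sB2: "complex_of_real s \<notin> B2" using s(1) by force
    \<comment> \<open>Multiplication by \<omega> sends Re y + \<i> Im y to (Re y - s Im y) + \<i> (s
      Re y + Im y), the substitution with parameters \<alpha> = - s and \<beta> = 1.\<close>
    define \<omega> where "\<omega> = 1 + \<i> * of_real s"
    have \<omega>0: "\<omega> \<noteq> 0" by (simp add: \<omega>_def complex_eq_iff)
    have Re\<omega>: "Re (\<omega> * \<kappa> p) \<noteq> 0" if p: "p \<in> X" for p
    proof
      assume "Re (\<omega> * \<kappa> p) = 0"
      then have eq: "Re (\<kappa> p) = s * Im (\<kappa> p)" by (simp add: \<omega>_def)
      then have "Im (\<kappa> p) \<noteq> 0" using \<kappa>0[OF p] by (auto simp: complex_eq_iff)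
      then have "s = Re (\<kappa> p) / Im (\<kappa> p)" using eq by simp
      then show False using s(2) p by blast
    qed
    obtain c2 c where c2: "c2 \<noteq> 0" "\<And>i. polyd k1 (c i)"
      "\<And>z t. bsum k1 a2 (z + - of_real s * of_real t) (of_real s * z + 1 * of_real t) = c2 * mfun n2 c z t"
      using nB2(3)[OF sB2 bounded_linear_of_real, of "- of_real s" 1] by blast
    have M\<omega>: "M (\<omega> * y) = c2 * mfun n2 c (of_real (Re y)) (Im y)" for y
      using c2(3)[of "of_real (Re y)" "Im y"] unfolding a2 by (simp add: \<omega>_def algebra_simps)
    define \<Phi> where "\<Phi> = (\<lambda>p::complex \<times> complex. (fst p, \<mu> * fst p + \<omega> * snd p))"
    define \<Phi>0 where "\<Phi>0 = (\<lambda>p::complex \<times> complex. (fst p, \<omega> * snd p))"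
    have comp: "\<Phi>1 (\<Phi>0 p) = \<Phi> p" for p by (simp add: \<Phi>1_def \<Phi>0_def \<Phi>_def)
    have bl: "bounded_linear \<Phi>" unfolding \<Phi>_def
      by (intro bounded_linear_Pair bounded_linear_add bounded_linear_fst bounded_linear_snd
          bounded_linear_compose[OF bounded_linear_mult_right])
    define \<Psi> where "\<Psi> = (\<lambda>p::complex \<times> complex. (fst p, (snd p - \<mu> * fst p) / \<omega>))"
    have \<Phi>\<Psi>: "\<Phi> (\<Psi> p) = p" for p using \<omega>0 by (simp add: \<Phi>_def \<Psi>_def)
    define f2 where "f2 = (\<lambda>p. f (\<Phi> p))"
    define Q2 where "Q2 = (\<lambda>p. Q (\<Phi> p))"
    define J where "J = jac f2 Q2"
    have f2: "polyd d f2" "holp f2"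
    proof -
      show "polyd d f2" unfolding f2_def by (rule polyd_compose_linear[OF f(1) bl])
      have clin: "\<Phi> (\<zeta> * u, \<zeta> * v) = (\<zeta> * fst (\<Phi> (u, v)), \<zeta> * snd (\<Phi> (u, v)))" for \<zeta> u v
        by (simp add: \<Phi>_def algebra_simps)
      show "holp f2"
      proof (rule holpI[of _ "\<lambda>p w. pd w f2 p"])
        show "(f2 has_derivative (\<lambda>w. pd w f2 p)) (at p)" for p
          by (rule pd_has_derivative) (use \<open>polyd d f2\<close> in auto)
        fix p \<zeta> u v
        show "pd (\<zeta> * u, \<zeta> * v) f2 p = \<zeta> * pd (u, v) f2 p"
          unfolding f2_def pd_compose_linear[OF f(1) bl] clin
          using holp_pd[OF f(2), of "\<zeta> * fst (\<Phi> (u, v))" "\<zeta> * snd (\<Phi> (u, v))" "\<Phi> p"]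
            holp_pd[OF f(2), of "fst (\<Phi> (u, v))" "snd (\<Phi> (u, v))" "\<Phi> p"]
          by (simp add: distrib_left mult.assoc)
      qed
    qed
    have Q2: "polyd q Q2" unfolding Q2_def by (rule polyd_compose_linear[OF Q bl])
    have pJ: "polyd r J" unfolding J_def r_def by (rule polyd_jac[OF f2(1) Q2])
    have f2z: "f2 p = 0 \<longleftrightarrow> mfun n (\<lambda>i z. b i (\<omega> * z)) (fst p) (snd p) = 0" for p
      using cb(1) cb(3)[of "fst p" "\<omega> * snd p"] by (simp add: f2_def f_def cf_def \<Phi>_def mfun_def)
    have nd: "nondeg f2 Q2 (\<lambda>p. Im (snd p)) p" if "J p \<noteq> 0" for p
      by (rule jac_nondeg[OF f2(2) Q2]) (use that in \<open>simp add: J_def\<close>)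
    have cz: "mfun n2 c (of_real (Re (snd p))) (Im (snd p)) = 0" if p: "f2 p = 0" "Q2 p = 0" "J p \<noteq> 0" for p
    proof -
      have pI: "polyd 1 (\<lambda>p::complex \<times> complex. Im (snd p))"
        by (intro polyd_linear bounded_linear_compose[OF bounded_linear_Im] bounded_linear_snd)
      \<comment> \<open>By nondegeneracy Q takes small nonzero values on f = 0 arbitrarily near p,
        so p is a limit of points of the curve off {Q = 0}, and M vanishes at the corresponding
        y-coordinate.\<close>
      have "p \<in> closure {p. f2 p = 0 \<and> Q2 p \<noteq> 0}"
        unfolding closure_approachable
      proof (intro allI impI)
        fix e :: real assume "e > 0"
        then obtain \<delta> where \<delta>: "\<delta> > 0" "\<And>a b. \<bar>a - Q2 p\<bar> < \<delta> \<Longrightarrow> \<bar>b - Im (snd p)\<bar> < \<delta> \<Longrightarrow> \<exists>p'. dist p' p < e \<and> f2 p' = f2 p \<and> Q2 p' = a \<and> Im (snd p') = b"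
          using nondeg_lift[OF f2(1) Q2 pI nd[OF p(3)]] by blast
        obtain p' where "dist p' p < e" "f2 p' = f2 p" "Q2 p' = \<delta> / 2"
          using \<delta>(2)[of "\<delta> / 2" "Im (snd p)"] \<delta>(1) p(2) by auto
        then show "\<exists>y\<in>{p. f2 p = 0 \<and> Q2 p \<noteq> 0}. dist y p < e"
          using p(1) \<delta>(1) by (intro bexI[of _ p']) auto
      qed
      then have "\<Phi>0 p \<in> \<Phi>0 ` closure {p. f2 p = 0 \<and> Q2 p \<noteq> 0}" by blast
      also have "\<dots> \<subseteq> closure W1"
      proof (rule image_closure_subset)
        show "continuous_on (closure {p. f2 p = 0 \<and> Q2 p \<noteq> 0}) \<Phi>0" unfolding \<Phi>0_def by (intro continuous_intros)
        show "\<Phi>0 ` {p. f2 p = 0 \<and> Q2 p \<noteq> 0} \<subseteq> closure W1"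
          using closure_subset[of W1] by (auto simp: W1_def comp f2_def Q2_def)
      qed auto
      finally have "M (snd (\<Phi>0 p)) = 0" by (rule M(2)) (use p(2) in \<open>simp add: comp Q2_def\<close>)
      then show ?thesis using c2(1) M\<omega>[of "snd p"] by (simp add: \<Phi>0_def)
    qed
    define X2 where "X2 = \<Psi> ` X"
    have X2: "f2 p = 0 \<and> Q2 p = 0 \<and> J p \<noteq> 0 \<and> (\<forall>j<N. R j (\<Phi> p) \<noteq> 0)" if pX: "p \<in> X2" for p
    proof -
      obtain p0 where p0: "p0 \<in> X" "p = \<Psi> p0" using pX unfolding X2_def by blast
      have p: "\<Phi> p = p0" by (simp add: p0 \<Phi>\<Psi>)
      have "J p = Re (\<omega> * \<kappa> p0)"
        unfolding J_def f2_def Q2_def \<Phi>_def jac_substitution[OF f Q]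
        by (simp only: p[unfolded \<Phi>_def] \<kappa>_def g_def)
      then show ?thesis using XX[OF p0(1)] Re\<omega>[OF p0(1)] by (simp add: f2_def Q2_def p f_def)
    qed
    have n2: "n2 > 0"
    proof (rule ccontr)
      assume "\<not> n2 > 0"
      then have m1: "mfun n2 c z t = 1" for z t by (simp add: mfun_def)
      obtain p where "p \<in> X2" using False unfolding X2_def by blast
      then show False using cz[of p] X2[of p] m1 by simp
    qed
    define sn where "sn = n * (n * n2)"
    define Kn where "Kn = sn * ((d + 1) * (k1 + 1) * 2)"
    have main: "finite (sign_vector (\<lambda>j p. R j (\<Phi> p)) N ` X2) \<and>
      card (sign_vector (\<lambda>j p. R j (\<Phi> p)) N ` X2) \<le> sn * (2 * Kn * ((\<Sum>j<N. D j) + r) + 2)"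
    proof (rule sign_vectors_transversal_core[where R = "\<lambda>j p. R j (\<Phi> p)" and D = D and b = "\<lambda>i z. b i (\<omega> * z)" and c = c
          and f = f2 and Q = Q2 and J = J and e = n2 and ?d2.0 = k1, OF n _ n2 c2(2) f2(1) f2z Q2 pJ])
      show "polyd d (\<lambda>z. b i (\<omega> * z))" for i by (rule polyd_compose_linear[OF cb(2) bounded_linear_mult_right])
      show "polyd (D j) (\<lambda>p. R j (\<Phi> p))" if "j < N" for j by (rule polyd_compose_linear[OF R[OF that] bl])
    qed (use nd cz X2 in \<open>auto simp: sn_def Kn_def\<close>)
    have img: "sign_vector R N ` X = sign_vector (\<lambda>j p. R j (\<Phi> p)) N ` X2"
      by (simp add: X2_def image_image sign_vector_def \<Phi>\<Psi>)
    have "sn \<le> sd" unfolding sn_def sd_def by (intro mult_le_mono nB(1) nB2(1))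
    moreover have "Kn \<le> Kd" unfolding Kn_def Kd_def by (intro mult_le_mono \<open>sn \<le> sd\<close> le_refl)
    ultimately have "sn * (2 * Kn * ((\<Sum>j<N. D j) + r) + 2) \<le> sd * (2 * Kd * ((\<Sum>j<N. D j) + r) + 2)"
      by (intro mult_le_mono add_le_mono le_refl)
    also have "\<dots> \<le> sd * ((2 * Kd * (r + 1) + 2) * ((\<Sum>j<N. D j) + 1))"
      by (intro mult_le_mono le_refl) (simp add: algebra_simps)
    also have "\<dots> = C * ((\<Sum>j<N. D j) + 1)" by (simp only: C_def mult.assoc)
    finally show ?thesis using main unfolding img by linarith
  qed simp
  note main = this
  show ?thesis
  proof (rule exI[of _ C], intro allI impI, elim conjE, goal_cases)
    case (1 a Q N R D X)
    show ?case by (rule main[OF 1(1,2,3)]) (use 1(4,5) in simp_all)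
  qed
qed

section \<open>Induction on incidences\<close>

text \<open>An arbitrary relation is allowed, so that incidences can be split into kinds and the
  roles of the two sides exchanged.\<close>

definition icount :: "('p \<Rightarrow> 'l \<Rightarrow> bool) \<Rightarrow> 'p set \<Rightarrow> 'l set \<Rightarrow> nat" where
  "icount inc P L = (\<Sum>l\<in>L. card {p \<in> P. inc p l})"

lemma icount_swap:
  assumes "finite P" "finite L"
  shows "icount inc P L = (\<Sum>p\<in>P. card {l \<in> L. inc p l})"
proof -
  have "icount inc P L = (\<Sum>l\<in>L. \<Sum>p\<in>P. if inc p l then 1 else 0)"
    using assms(1) by (simp add: icount_def sum.If_cases Int_def)
  also have "\<dots> = (\<Sum>p\<in>P. \<Sum>l\<in>L. if inc p l then 1 else 0)" by (rule sum.swap)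
  also have "\<dots> = (\<Sum>p\<in>P. card {l \<in> L. inc p l})"
    using assms(2) by (simp add: sum.If_cases Int_def)
  finally show ?thesis .
qed

lemma icount_eq_card:
  assumes "finite P" "finite L"
  shows "icount inc P L = card {x \<in> P \<times> L. inc (fst x) (snd x)}"
proof -
  have "{x \<in> P \<times> L. inc (fst x) (snd x)} = Sigma P (\<lambda>p. {l \<in> L. inc p l})" by auto
  then show ?thesis using icount_swap[OF assms] assms by (simp add: card_SigmaI)
qed

lemma icount_mono:
  assumes "finite P" "finite L" "\<And>p l. p \<in> P \<Longrightarrow> l \<in> L \<Longrightarrow> inc p l \<Longrightarrow> inc' p l"
  shows "icount inc P L \<le> icount inc' P L"
  unfolding icount_def by (intro sum_mono card_mono) (use assms in auto)

lemma icount_disj: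
  assumes "finite P" "finite L"
  shows "icount (\<lambda>p l. inc p l \<or> inc' p l) P L \<le> icount inc P L + icount inc' P L"
proof -
  have "card {p \<in> P. inc p l \<or> inc' p l} \<le> card {p \<in> P. inc p l} + card {p \<in> P. inc' p l}" for l
    by (rule order_trans[OF card_mono card_Un_le]) (use assms in auto)
  then show ?thesis unfolding icount_def sum.distrib[symmetric] by (rule sum_mono)
qed

text \<open>The power function is concave, so it lies below its tangent at Y / n, and this
  inequality is summed. The constant term of the tangent is nonnegative, hence an upper bound n for
  the number of summands is enough.\<close>

lemma sum_powr_le:
  fixes x :: "'s \<Rightarrow> real"
  assumes "finite S" "real (card S) \<le> n" "n > 0" "\<And>s. s \<in> S \<Longrightarrow> x s \<ge> 0" "sum x S \<le> Y" "Y > 0" "0 \<le> \<beta>" "\<beta> \<le> 1"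
  shows "(\<Sum>s\<in>S. x s powr \<beta>) \<le> n * (Y / n) powr \<beta>"
proof -
  define t where "t = Y / n"
  have t: "t > 0" using assms by (simp add: t_def)
  have pt: "x s powr \<beta> \<le> t powr \<beta> * (1 - \<beta>) + \<beta> * t powr \<beta> / t * x s" if s: "s \<in> S" for s
  proof (cases "x s = 0")
    case True
    then show ?thesis using assms by simp
  next
    case False
    then have xs: "x s > 0" using assms(4)[OF s] by simp
    have "(x s / t) powr \<beta> * 1 powr (1 - \<beta>) \<le> \<beta> * (x s / t) + (1 - \<beta>) * 1"
      by (rule Youngs_inequality_0) (use assms t xs in auto)
    then have "t powr \<beta> * (x s / t) powr \<beta> \<le> t powr \<beta> * (\<beta> * (x s / t) + (1 - \<beta>))"
      by (intro mult_left_mono) auto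
    moreover have "t powr \<beta> * (x s / t) powr \<beta> = x s powr \<beta>"
      using t xs by (simp flip: powr_mult)
    ultimately show ?thesis by (simp add: algebra_simps)
  qed
  have "(\<Sum>s\<in>S. x s powr \<beta>) \<le> real (card S) * (t powr \<beta> * (1 - \<beta>)) + \<beta> * t powr \<beta> / t * sum x S"
    using sum_mono[OF pt] by (simp add: sum.distrib sum_distrib_left)
  also have "\<dots> \<le> n * (t powr \<beta> * (1 - \<beta>)) + \<beta> * t powr \<beta> / t * Y"
    by (intro add_mono mult_right_mono mult_left_mono) (use assms t in auto)
  also have "\<dots> = n * t powr \<beta>" using assms(3,6) by (simp add: t_def field_simps)
  finally show ?thesis by (simp add: t_def)
qed

text \<open>\<open>H\<close> bounds the number of cells met by one curve. With \<open>M\<close> cells and \<open>H\<close> of order \<open>sqrt M\<close>, the main terms of the cells add up to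
  \<open>M powr (1 - \<alpha> - \<epsilon> - \<beta>) * H powr \<beta>\<close> times the original one, so that a large constant \<open>M\<close> leaves a factor \<open>1 / 2\<close>.\<close>

theorem incidence_induction:
  fixes inc :: "'p \<Rightarrow> 'l \<Rightarrow> bool" and M H B \<alpha> \<beta> \<epsilon> :: real
  assumes fin: "finite P0" "finite L0"
    and pos: "M > 1" "H \<ge> 0" "B \<ge> 0" "0 \<le> \<alpha>" "0 < \<beta>" "\<beta> \<le> 1" "\<epsilon> > 0"
    and gain: "M powr (1 - \<alpha> - \<epsilon> - \<beta>) * H powr \<beta> \<le> 1 / 2"
    and rich: "\<And>P L. P \<subseteq> P0 \<Longrightarrow> L \<subseteq> L0 \<Longrightarrow> (\<forall>l\<in>L. card {p \<in> P. inc p l} > m) \<Longrightarrow>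
        real (card L) \<le> real (card P) powr \<alpha> * real (card L) powr \<beta>"
    and part: "\<And>P. P \<subseteq> P0 \<Longrightarrow> \<exists>Z (c :: 'p \<Rightarrow> 'i). Z \<subseteq> P \<and> real (card (c ` (P - Z))) \<le> M \<and>
        (\<forall>\<sigma>. real (card {p \<in> P - Z. c p = \<sigma>}) * M \<le> real (card P)) \<and>
        (\<forall>l\<in>L0. real (card (c ` {p \<in> P - Z. inc p l})) \<le> H) \<and>
        (\<forall>L\<subseteq>L0. real (icount inc Z L) \<le> B * (real (card P) powr (\<alpha> + \<epsilon>) * real (card L) powr \<beta> + real (card Z) + real (card L)))"
  shows "P \<subseteq> P0 \<Longrightarrow> L \<subseteq> L0 \<Longrightarrow> real (icount inc P L) \<le>
      2 * (real m * H + 2 * B) * (real (card P) powr (\<alpha> + \<epsilon>) * real (card L) powr \<beta>) + B * real (card P) + real m * real (card L)"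
proof (induction "card P" arbitrary: P L rule: less_induct)
  case less
  \<comment> \<open>By \<open>gain\<close> the cells return half of C1; the other half, m * H + 2 *
    B, pays for the wall and for the linear terms in the number of rich curves.\<close>
  define C1 where "C1 = 2 * (real m * H + 2 * B)"
  have C1: "C1 \<ge> 0" using pos by (simp add: C1_def)
  have fP: "finite P" and fL: "finite L" using less.prems fin finite_subset by blast+
  show ?case
  proof (cases "P = {}")
    case True
    then show ?thesis using pos by (simp add: icount_def)
  next
    case ne: False
    define n where "n = real (card P)"
    have n1: "n \<ge> 1" using ne fP by (simp add: n_def Suc_le_eq card_gt_0_iff)
    \<comment> \<open>Poor curves cost at most m incidences each and are set aside at every level.
      Otherwise the term m * |L| would be multiplied by H again and again; for rich curves it is
      dominated by the main term.\<close>
    define Lr where "Lr = {l \<in> L. card {p \<in> P. inc p l} > m}"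
    define Lp where "Lp = L - Lr"
    have fLr: "finite Lr" and LrL: "Lr \<subseteq> L" using fL by (auto simp: Lr_def)
    have split: "icount inc P L = icount inc P Lr + icount inc P Lp"
      unfolding icount_def Lp_def using sum.subset_diff[OF LrL fL] by (simp add: add.commute)
    have "icount inc P Lp \<le> of_nat (card Lp) * m"
      unfolding icount_def by (rule sum_bounded_above) (auto simp: Lp_def Lr_def)
    then have poor: "real (icount inc P Lp) \<le> real m * real (card Lp)"
      by (simp add: mult.commute flip: of_nat_mult)
    have cLp: "real (card Lp) = real (card L) - real (card Lr)"
      using card_mono[OF fL LrL] by (simp add: Lp_def card_Diff_subset[OF fLr LrL] of_nat_diff)
    have richLr: "real (card Lr) \<le> n powr \<alpha> * real (card Lr) powr \<beta>"
      unfolding n_def by (rule rich) (use less.prems LrL in \<open>auto simp: Lr_def\<close>)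
    also have "\<dots> \<le> n powr (\<alpha> + \<epsilon>) * real (card Lr) powr \<beta>"
      by (intro mult_right_mono powr_mono) (use n1 pos in auto)
    finally have rich': "real (card Lr) \<le> n powr (\<alpha> + \<epsilon>) * real (card Lr) powr \<beta>" .
    have LrL0: "Lr \<subseteq> L0" using LrL less.prems by auto
    have main: "real (icount inc P Lr) \<le> C1 * (n powr (\<alpha> + \<epsilon>) * real (card Lr) powr \<beta>) + B * n + real m * real (card Lr)"
    proof (cases "Lr = {}")
      case True
      then show ?thesis using pos n1 by (simp add: icount_def)
    next
      case Lrne: False
      have \<open>\<exists>Z (c :: 'p \<Rightarrow> 'i). Z \<subseteq> P \<and> real (card (c ` (P - Z))) \<le> M \<and>
        (\<forall>\<sigma>. real (card {p \<in> P - Z. c p = \<sigma>}) * M \<le> real (card P)) \<and>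
        (\<forall>l\<in>L0. real (card (c ` {p \<in> P - Z. inc p l})) \<le> H) \<and>
        (\<forall>L\<subseteq>L0. real (icount inc Z L) \<le> B * (real (card P) powr (\<alpha> + \<epsilon>) * real (card L) powr \<beta> + real (card Z) + real (card L)))\<close>
        by (rule part[OF less.prems(1)])
      then obtain Z and c :: "'p \<Rightarrow> 'i" where Z: "Z \<subseteq> P" and S: "real (card (c ` (P - Z))) \<le> M"
        and cell: "\<And>\<sigma>. real (card {p \<in> P - Z. c p = \<sigma>}) * M \<le> real (card P)"
        and hit: "\<And>l. l \<in> L0 \<Longrightarrow> real (card (c ` {p \<in> P - Z. inc p l})) \<le> H"
        and bd: "\<And>L. L \<subseteq> L0 \<Longrightarrow> real (icount inc Z L) \<le> B * (real (card P) powr (\<alpha> + \<epsilon>) * real (card L) powr \<beta> + real (card Z) + real (card L))"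
        by (elim exE conjE) (rule that, auto)
      define S where "S = c ` (P - Z)"
      define Pc where "Pc = (\<lambda>\<sigma>. {p \<in> P - Z. c p = \<sigma>})"
      define Lc where "Lc = (\<lambda>\<sigma>. {l \<in> Lr. \<exists>p\<in>Pc \<sigma>. inc p l})"
      have fS: "finite S" using fP by (simp add: S_def)
      have fPc: "finite (Pc \<sigma>)" for \<sigma> using fP by (simp add: Pc_def)
      have cellP: "real (card (Pc \<sigma>)) \<le> n / M" for \<sigma>
        using cell[of \<sigma>] pos(1) by (simp add: Pc_def n_def field_simps)
      have smaller: "card (Pc \<sigma>) < card P" for \<sigma>
      proof -
        have "n / M < n" using pos(1) n1 by (simp add: field_simps)
        then show ?thesis using cellP[of \<sigma>] by (simp add: n_def)
      qed
      have IH: "real (icount inc (Pc \<sigma>) (Lc \<sigma>)) \<le> C1 * ((n / M) powr (\<alpha> + \<epsilon>) * real (card (Lc \<sigma>)) powr \<beta>)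
          + B * real (card (Pc \<sigma>)) + real m * real (card (Lc \<sigma>))" for \<sigma>
      proof -
        have "real (icount inc (Pc \<sigma>) (Lc \<sigma>)) \<le> C1 * (real (card (Pc \<sigma>)) powr (\<alpha> + \<epsilon>) * real (card (Lc \<sigma>)) powr \<beta>)
          + B * real (card (Pc \<sigma>)) + real m * real (card (Lc \<sigma>))"
          unfolding C1_def by (rule less.hyps[OF smaller]) (use less.prems LrL0 in \<open>auto simp: Pc_def Lc_def\<close>)
        also have "\<dots> \<le> C1 * ((n / M) powr (\<alpha> + \<epsilon>) * real (card (Lc \<sigma>)) powr \<beta>)
          + B * real (card (Pc \<sigma>)) + real m * real (card (Lc \<sigma>))"
          by (intro add_mono mult_left_mono mult_right_mono powr_mono2 cellP C1 order_refl) (use pos in auto)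
        finally show ?thesis .
      qed
      \<comment> \<open>Double counting of the pairs of a curve and a cell that it meets.\<close>
      have hits: "(\<Sum>\<sigma>\<in>S. real (card (Lc \<sigma>))) \<le> H * real (card Lr)"
      proof -
        have "(\<Sum>\<sigma>\<in>S. card (Lc \<sigma>)) = (\<Sum>l\<in>Lr. card {\<sigma> \<in> S. \<exists>p\<in>Pc \<sigma>. inc p l})"
          using icount_swap[OF fLr fS, of "\<lambda>l \<sigma>. \<exists>p\<in>Pc \<sigma>. inc p l"] by (simp add: icount_def Lc_def)
        moreover have "{\<sigma> \<in> S. \<exists>p\<in>Pc \<sigma>. inc p l} = c ` {p \<in> P - Z. inc p l}" for l
          unfolding S_def Pc_def by (auto simp: image_iff) metis+
        ultimately have "(\<Sum>\<sigma>\<in>S. real (card (Lc \<sigma>))) = (\<Sum>l\<in>Lr. real (card (c ` {p \<in> P - Z. inc p l})))"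
          by (simp flip: of_nat_sum)
        also have "\<dots> \<le> of_nat (card Lr) * H"
          by (rule sum_bounded_above) (use hit LrL0 in auto)
        finally show ?thesis by (simp add: mult.commute)
      qed
      have fZ: "finite Z" using Z fP by (rule finite_subset)
      have "card {p \<in> P. inc p l} \<le> card {p \<in> Z. inc p l} + (\<Sum>\<sigma>\<in>S. card {p \<in> Pc \<sigma>. inc p l})" for l
      proof -
        have "card {p \<in> P. inc p l} \<le> card ({p \<in> Z. inc p l} \<union> (\<Union>\<sigma>\<in>S. {p \<in> Pc \<sigma>. inc p l}))"
          by (rule card_mono) (use fP fZ in \<open>auto simp: S_def Pc_def\<close>)
        also have "\<dots> \<le> card {p \<in> Z. inc p l} + (\<Sum>\<sigma>\<in>S. card {p \<in> Pc \<sigma>. inc p l})"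
          by (rule order_trans[OF card_Un_le add_left_mono[OF card_UN_le[OF fS]]])
        finally show ?thesis .
      qed
      then have "icount inc P Lr \<le> icount inc Z Lr + (\<Sum>l\<in>Lr. \<Sum>\<sigma>\<in>S. card {p \<in> Pc \<sigma>. inc p l})"
        unfolding icount_def sum.distrib[symmetric] by (intro sum_mono)
      also have "(\<Sum>l\<in>Lr. \<Sum>\<sigma>\<in>S. card {p \<in> Pc \<sigma>. inc p l}) = (\<Sum>\<sigma>\<in>S. \<Sum>l\<in>Lr. card {p \<in> Pc \<sigma>. inc p l})"
        by (rule sum.swap)
      also have "\<dots> = (\<Sum>\<sigma>\<in>S. icount inc (Pc \<sigma>) (Lc \<sigma>))"
        unfolding icount_def
      proof (rule sum.cong[OF refl])
        fix \<sigma>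
        show "(\<Sum>l\<in>Lr. card {p \<in> Pc \<sigma>. inc p l}) = (\<Sum>l\<in>Lc \<sigma>. card {p \<in> Pc \<sigma>. inc p l})"
          by (rule sum.mono_neutral_right[OF fLr]) (auto simp: Lc_def fPc)
      qed
      finally have "real (icount inc P Lr) \<le> real (icount inc Z Lr) + (\<Sum>\<sigma>\<in>S. real (icount inc (Pc \<sigma>) (Lc \<sigma>)))"
        by (simp flip: of_nat_sum of_nat_add)
      also have "(\<Sum>\<sigma>\<in>S. real (icount inc (Pc \<sigma>) (Lc \<sigma>))) \<le> (\<Sum>\<sigma>\<in>S. C1 * ((n / M) powr (\<alpha> + \<epsilon>) * real (card (Lc \<sigma>)) powr \<beta>)
          + B * real (card (Pc \<sigma>)) + real m * real (card (Lc \<sigma>)))"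
        by (rule sum_mono) (rule IH)
      also have "\<dots> = C1 * ((n / M) powr (\<alpha> + \<epsilon>) * (\<Sum>\<sigma>\<in>S. real (card (Lc \<sigma>)) powr \<beta>))
          + B * (\<Sum>\<sigma>\<in>S. real (card (Pc \<sigma>))) + real m * (\<Sum>\<sigma>\<in>S. real (card (Lc \<sigma>)))"
        by (simp only: sum.distrib sum_distrib_left)
      also have "\<dots> \<le> C1 * (1 / 2 * (n powr (\<alpha> + \<epsilon>) * real (card Lr) powr \<beta>)) + B * real (card (P - Z)) + real m * (H * real (card Lr))"
      proof (intro add_mono mult_left_mono hits C1)
        have "(\<Sum>\<sigma>\<in>S. card (Pc \<sigma>)) = card (\<Union>\<sigma>\<in>S. Pc \<sigma>)"
          by (rule card_UN_disjoint[symmetric]) (use fS fPc in \<open>auto simp: Pc_def\<close>)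
        also have "\<dots> \<le> card (P - Z)" by (rule card_mono) (use fP in \<open>auto simp: Pc_def\<close>)
        finally show "(\<Sum>\<sigma>\<in>S. real (card (Pc \<sigma>))) \<le> real (card (P - Z))" by (simp flip: of_nat_sum)
        have cLr: "real (card Lr) > 0" using Lrne fLr by (simp add: card_gt_0_iff)
        show "(n / M) powr (\<alpha> + \<epsilon>) * (\<Sum>\<sigma>\<in>S. real (card (Lc \<sigma>)) powr \<beta>) \<le> 1 / 2 * (n powr (\<alpha> + \<epsilon>) * real (card Lr) powr \<beta>)"
        proof (cases "H = 0")
          case True
          have "(\<Sum>\<sigma>\<in>S. real (card (Lc \<sigma>))) \<ge> 0" by (rule sum_nonneg) simp
          then have "(\<Sum>\<sigma>\<in>S. real (card (Lc \<sigma>))) = 0" using hits True by simp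
          then have "\<forall>\<sigma>\<in>S. real (card (Lc \<sigma>)) = 0"
            by (subst (asm) sum_nonneg_eq_0_iff[OF fS]) simp_all
          then have "(\<Sum>\<sigma>\<in>S. real (card (Lc \<sigma>)) powr \<beta>) = 0" by (intro sum.neutral) auto
          then show ?thesis by simp
        next
          case False
          have "(\<Sum>\<sigma>\<in>S. real (card (Lc \<sigma>)) powr \<beta>) \<le> M * (H * real (card Lr) / M) powr \<beta>"
            by (rule sum_powr_le[OF fS]) (use S hits pos False cLr in \<open>auto simp: S_def\<close>)
          then have "(n / M) powr (\<alpha> + \<epsilon>) * (\<Sum>\<sigma>\<in>S. real (card (Lc \<sigma>)) powr \<beta>)
              \<le> (n / M) powr (\<alpha> + \<epsilon>) * (M * (H * real (card Lr) / M) powr \<beta>)"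
            by (rule mult_left_mono) auto
          also have "\<dots> = (M powr (1 - \<alpha> - \<epsilon> - \<beta>) * H powr \<beta>) * (n powr (\<alpha> + \<epsilon>) * real (card Lr) powr \<beta>)"
          proof -
            have 1: "(n / M) powr (\<alpha> + \<epsilon>) = n powr (\<alpha> + \<epsilon>) * M powr - (\<alpha> + \<epsilon>)"
              unfolding powr_minus[of M "\<alpha> + \<epsilon>"] divide_inverse[symmetric]
              by (rule powr_divide)
            have 2: "(H * real (card Lr) / M) powr \<beta> = H powr \<beta> * real (card Lr) powr \<beta> * M powr - \<beta>"
              unfolding powr_minus[of M \<beta>] divide_inverse[symmetric] powr_mult[symmetric]
              by (rule powr_divide)
            have 3: "M powr (1 - \<alpha> - \<epsilon> - \<beta>) = M * M powr - (\<alpha> + \<epsilon>) * M powr - \<beta>"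
            proof -
              have "1 - \<alpha> - \<epsilon> - \<beta> = 1 + - (\<alpha> + \<epsilon>) + - \<beta>" by simp
              then have "M powr (1 - \<alpha> - \<epsilon> - \<beta>) = M powr 1 * M powr - (\<alpha> + \<epsilon>) * M powr - \<beta>"
                by (simp only: powr_add)
              then show ?thesis using pos by simp
            qed
            show ?thesis unfolding 1 2 3 by (simp only: mult_ac)
          qed
          also have "\<dots> \<le> 1 / 2 * (n powr (\<alpha> + \<epsilon>) * real (card Lr) powr \<beta>)"
            by (rule mult_right_mono[OF gain]) auto
          finally show ?thesis .
        qed
      qed (use pos in auto)
      finally have fin1: "real (icount inc P Lr) \<le> real (icount inc Z Lr) + (C1 * (1 / 2 * (n powr (\<alpha> + \<epsilon>) * real (card Lr) powr \<beta>))
          + B * real (card (P - Z)) + real m * (H * real (card Lr)))" by simp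
      have bd': "real (icount inc Z Lr) \<le> B * (n powr (\<alpha> + \<epsilon>) * real (card Lr) powr \<beta>) + B * real (card Z) + B * real (card Lr)"
        using bd[OF LrL0] by (simp add: n_def distrib_left)
      have cPZ: "real (card Z) + real (card (P - Z)) = n"
        using card_mono[OF fP Z] finite_subset[OF Z fP] Z by (simp add: n_def card_Diff_subset of_nat_diff)
      have r1: "(B + real m * H) * real (card Lr) \<le> (B + real m * H) * (n powr (\<alpha> + \<epsilon>) * real (card Lr) powr \<beta>)"
        by (rule mult_left_mono[OF rich']) (use pos in auto)
      define X where "X = n powr (\<alpha> + \<epsilon>) * real (card Lr) powr \<beta>"
      have "real (icount inc P Lr) \<le> B * X + B * real (card Z) + B * real (card Lr) + (C1 * (1 / 2 * X)
          + B * real (card (P - Z)) + real m * (H * real (card Lr)))"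
        using fin1 bd' unfolding X_def by linarith
      also have "\<dots> = B * X + C1 * (1 / 2 * X) + B * (real (card Z) + real (card (P - Z))) + (B + real m * H) * real (card Lr)"
        by (simp add: algebra_simps)
      also have "\<dots> \<le> B * X + C1 * (1 / 2 * X) + B * n + (B + real m * H) * X"
        unfolding cPZ using r1 by (simp add: X_def)
      also have "\<dots> = C1 * X + B * n" by (simp add: C1_def algebra_simps)
      finally show ?thesis unfolding X_def by (simp add: add_increasing2)
    qed
    have "real (icount inc P L) \<le> C1 * (n powr (\<alpha> + \<epsilon>) * real (card Lr) powr \<beta>) + B * n + real m * real (card L)"
      using main poor unfolding split of_nat_add cLp by (simp add: algebra_simps)
    also have "\<dots> \<le> C1 * (n powr (\<alpha> + \<epsilon>) * real (card L) powr \<beta>) + B * n + real m * real (card L)"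
      by (intro add_mono mult_left_mono powr_mono2 C1 order_refl) (use pos card_mono[OF fL LrL] in auto)
    finally show ?thesis by (simp add: C1_def n_def)
  qed
qed

section \<open>Curves through many points\<close>

lemma card_monomial_index: "card (SIGMA i:{..d}. {..d - i}) = (d + 2) choose 2"
proof -
  have "(\<Sum>i\<le>d. Suc (d - i)) = (d + 2) choose 2"
  proof (induction d)
    case (Suc d)
    then show ?case unfolding sum.atMost_Suc_shift by (simp add: numeral_2_eq_2)
  qed (simp add: numeral_2_eq_2)
  then show ?thesis by simp
qed

text \<open>Evaluation of curves of degree \<open>d\<close> at \<open>p\<close>, as a vector indexed by the monomials.\<close>

definition veronese :: "nat \<Rightarrow> complex \<times> complex \<Rightarrow> nat \<times> nat \<Rightarrow> complex" where
  "veronese d p x = (if x \<in> (SIGMA i:{..d}. {..d - i}) then fst p ^ fst x * snd p ^ snd x else 0)"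

lemma cf_veronese: "cf d a p = (\<Sum>x\<in>(SIGMA i:{..d}. {..d - i}). a (fst x) (snd x) * veronese d p x)"
proof -
  have "(\<Sum>x\<in>(SIGMA i:{..d}. {..d - i}). a (fst x) (snd x) * veronese d p x)
      = (\<Sum>(i, j)\<in>(SIGMA i:{..d}. {..d - i}). a i j * fst p ^ i * snd p ^ j)"
    by (rule sum.cong) (auto simp: veronese_def mult.assoc)
  also have "\<dots> = cf d a p" unfolding cf_def bsum_def by (rule sum.Sigma[symmetric]) auto
  finally show ?thesis by simp
qed

text \<open>The equation of the curve is a nonzero linear form that annihilates the Veronese vectors
  of Y, so these span a proper subspace. A basis of it chosen among them decides which curves of
  degree d contain Y.\<close>

lemma determining_subset:
  assumes ne: "\<exists>i j. i + j \<le> d \<and> a i j \<noteq> 0" and Y: "finite Y" "Y \<noteq> {}" and 0: "\<And>p. p \<in> Y \<Longrightarrow> cf d a p = 0"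
  shows "\<exists>T\<subseteq>Y. T \<noteq> {} \<and> card T \<le> ((d + 2) choose 2) - 1 \<and>
    (\<forall>c. (\<forall>p\<in>T. cf d c p = 0) \<longrightarrow> (\<forall>p\<in>Y. cf d c p = 0))"
proof -
  define J :: "(nat \<times> nat) set" where "J = (SIGMA i:{..d}. {..d - i})"
  define \<phi> where "\<phi> = (\<lambda>c (v :: nat \<times> nat \<Rightarrow> complex). \<Sum>x\<in>J. c (fst x) (snd x) * v x :: complex)"
  have fJ: "finite J" by (simp add: J_def)
  have cf: "cf d c p = \<phi> c (veronese d p)" for c p by (simp add: cf_veronese \<phi>_def J_def)
  obtain B where B: "B \<subseteq> veronese d ` Y" "fs.independent B" "veronese d ` Y \<subseteq> fs.span B"
    using fs.maximal_independent_subset[of "veronese d ` Y"] by blast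
  have fB: "finite B" using B(1) Y(1) by (blast intro: finite_subset)
  have \<phi>B: "\<phi> c v = 0" if v: "v \<in> fs.span B" and c: "\<forall>b\<in>B. \<phi> c b = 0" for c v
  proof -
    obtain u where u: "\<And>p. v p = (\<Sum>b\<in>B. u b * b p)" using fs_span_explicit[OF fB v] by blast
    have "\<phi> c v = (\<Sum>x\<in>J. \<Sum>b\<in>B. u b * (c (fst x) (snd x) * b x))"
      by (simp add: \<phi>_def u sum_distrib_left mult_ac)
    also have "\<dots> = (\<Sum>b\<in>B. \<Sum>x\<in>J. u b * (c (fst x) (snd x) * b x))" by (rule sum.swap)
    also have "\<dots> = (\<Sum>b\<in>B. u b * \<phi> c b)" by (simp add: \<phi>_def sum_distrib_left)
    finally show ?thesis using c by simp
  qed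
  define e where "e = (\<lambda>y x :: nat \<times> nat. if x = y then 1 else (0::complex))"
  have \<phi>e: "\<phi> c (e y) = (if y \<in> J then c (fst y) (snd y) else 0)" for c y
    using fJ by (simp add: \<phi>_def e_def if_distrib sum.delta cong: if_cong)
  obtain i j where ij: "i + j \<le> d" "a i j \<noteq> 0" using ne by blast
  have ijJ: "(i, j) \<in> J" using ij by (auto simp: J_def)
  have Ba: "\<forall>b\<in>B. \<phi> a b = 0" using B(1) 0 by (auto simp: cf[symmetric])
  \<comment> \<open>A unit vector on which the form of a does not vanish lies outside the span of B;
    adjoining it accounts for the - 1 in the bound.\<close>
  have notin: "e (i, j) \<notin> fs.span B" using \<phi>B[OF _ Ba, of "e (i, j)"] ij ijJ by (auto simp: \<phi>e)
  have ind: "fs.independent (insert (e (i, j)) B)" by (rule fs.independent_insertI[OF notin B(2)])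
  have span: "veronese d p \<in> fs.span (e ` J)" for p
  proof -
    have "(\<lambda>x. \<Sum>y\<in>J. veronese d p y * e y x) \<in> fs.span (e ` J)"
      by (intro fs_span_sumI fs.span_scale fs.span_base) auto
    moreover have "(\<lambda>x. \<Sum>y\<in>J. veronese d p y * e y x) = veronese d p"
      using fJ by (auto simp: fun_eq_iff e_def veronese_def J_def[symmetric] if_distrib sum.delta cong: if_cong)
    ultimately show ?thesis by simp
  qed
  have "insert (e (i, j)) B \<subseteq> fs.span (e ` J)"
    using span B(1) ijJ by (auto intro: fs.span_base)
  then have "card (insert (e (i, j)) B) \<le> card (e ` J)"
    using fs.independent_span_bound[of "e ` J" "insert (e (i, j)) B"] ind fJ by simp
  also have "\<dots> \<le> card J" by (rule card_image_le[OF fJ])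
  also have "\<dots> = (d + 2) choose 2" unfolding J_def by (rule card_monomial_index)
  finally have cB: "card B \<le> ((d + 2) choose 2) - 1"
    using notin fB fs.span_base[of "e (i, j)" B] by (auto simp: card_insert_if split: if_splits)
  define T where "T = inv_into Y (veronese d) ` B"
  have vT: "veronese d ` T = B"
    using B(1) by (force simp: T_def image_image f_inv_into_f subset_iff)
  have TY: "T \<subseteq> Y" unfolding T_def using B(1) inv_into_into[of _ "veronese d" Y] by blast
  have "card T \<le> card B" unfolding T_def by (rule card_image_le[OF fB])
  \<comment> \<open>The entry of a Veronese vector at the monomial 1 is 1, so none of them is
    zero.\<close>
  moreover have "T \<noteq> {}"
  proof
    assume "T = {}"
    then have B0: "B = {}" using vT by simp
    obtain p where p: "p \<in> Y" using Y(2) by blast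
    then have "veronese d p = 0" using B(3) unfolding B0 fs.span_empty by blast
    then have "veronese d p (0, 0) = 0" by (simp add: zero_fun_def)
    then show False by (simp add: veronese_def)
  qed
  moreover have "cf d c p = 0" if c: "\<forall>p\<in>T. cf d c p = 0" and p: "p \<in> Y" for c p
  proof -
    have "\<forall>b\<in>B. \<phi> c b = 0" using c unfolding vT[symmetric] by (simp add: cf)
    then show ?thesis unfolding cf using B(3) p by (intro \<phi>B) auto
  qed
  ultimately show ?thesis using TY cB by (intro exI[of _ T]) auto
qed

section \<open>Families of transversal curves\<close>

definition tjac :: "(complex \<times> complex \<Rightarrow> complex) \<Rightarrow> (complex \<times> complex \<Rightarrow> complex) \<Rightarrow> complex \<times> complex \<Rightarrow> complex" where
  "tjac f g p = pd (1, 0) f p * pd (0, 1) g p - pd (0, 1) f p * pd (1, 0) g p"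

text \<open>Curves are coefficient arrays over an arbitrary index type, which keeps the incidence
  arguments apart from the representation of polynomials. At a common zero,
  \<open>tjac \<noteq> 0\<close> says that both curves are smooth and that their tangents
  differ.\<close>

definition admissible :: "nat \<Rightarrow> ('l \<Rightarrow> nat \<Rightarrow> nat \<Rightarrow> complex) \<Rightarrow> 'l set \<Rightarrow> bool" where
  "admissible d a L \<longleftrightarrow> (\<forall>l\<in>L. \<exists>i j. i + j \<le> d \<and> a l i j \<noteq> 0) \<and>
     (\<forall>l\<in>L. \<forall>l'\<in>L. l \<noteq> l' \<longrightarrow> (\<forall>p. cf d (a l) p = 0 \<longrightarrow> cf d (a l') p = 0 \<longrightarrow> tjac (cf d (a l)) (cf d (a l')) p \<noteq> 0))"

lemma admissible_subset: "admissible d a L \<Longrightarrow> L' \<subseteq> L \<Longrightarrow> admissible d a L'"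
  by (simp add: admissible_def subset_iff)

lemma admissible_nonzero: "admissible d a L \<Longrightarrow> l \<in> L \<Longrightarrow> \<exists>i j. i + j \<le> d \<and> a l i j \<noteq> 0"
  by (simp add: admissible_def)

lemma admissible_transversal:
  assumes "admissible d a L" "l \<in> L" "l' \<in> L" "l \<noteq> l'" "cf d (a l) p = 0" "cf d (a l') p = 0"
  shows "tjac (cf d (a l)) (cf d (a l')) p \<noteq> 0"
  using assms by (cases p) (simp add: admissible_def)

lemma tjac_kernel:
  assumes "holp f" "holp g" "tjac f g p \<noteq> 0" "pd (u, v) f p = 0" "pd (u, v) g p = 0"
  shows "u = 0 \<and> v = 0"
proof -
  define f1 f2 g1 g2 where "f1 = pd (1, 0) f p" and "f2 = pd (0, 1) f p" and "g1 = pd (1, 0) g p" and "g2 = pd (0, 1) g p"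
  have 1: "u * f1 + v * f2 = 0" "u * g1 + v * g2 = 0"
    using assms(4,5) holp_pd[OF assms(1), of u v p] holp_pd[OF assms(2), of u v p] by (simp_all add: f1_def f2_def g1_def g2_def)
  have J: "f1 * g2 - f2 * g1 \<noteq> 0" using assms(3) by (simp add: tjac_def f1_def f2_def g1_def g2_def)
  have "u * (f1 * g2 - f2 * g1) = (u * f1 + v * f2) * g2 - (u * g1 + v * g2) * f2" by (simp add: algebra_simps)
  moreover have "v * (f1 * g2 - f2 * g1) = (u * g1 + v * g2) * f1 - (u * f1 + v * f2) * g1" by (simp add: algebra_simps)
  ultimately show ?thesis using 1 J by simp
qed

text \<open>By transversality the system (f, Re g, Im g) is nondegenerate at common zeros, so its
  four real equations can be counted by \<open>nondeg_zeros_card\<close>. The exponent 4 instead of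
  Bezout's 2 is harmless.\<close>

lemma common_points_card:
  assumes adm: "admissible d a L" and l: "l \<in> L" "l' \<in> L" "l \<noteq> l'" and X: "finite X"
    and XX: "\<And>p. p \<in> X \<Longrightarrow> cf d (a l) p = 0 \<and> cf d (a l') p = 0"
  shows "card X \<le> (d + 1) ^ 4"
proof (rule nondeg_zeros_card)
  show "polyd d (\<lambda>p. Re (cf d (a l') p))" "polyd d (\<lambda>p. Im (cf d (a l') p))" "polyd d (cf d (a l))"
    by (intro polyd_Re polyd_Im polyd_cf)+
  fix p assume p: "p \<in> X"
  have "nondeg (cf d (a l)) (\<lambda>p. Re (cf d (a l') p)) (\<lambda>p. Im (cf d (a l') p)) p"
    unfolding nondeg_def
  proof (intro allI impI)
    fix w assume w: "pd w (cf d (a l)) p = 0" "pd w (\<lambda>p. Re (cf d (a l') p)) p = 0" "pd w (\<lambda>p. Im (cf d (a l') p)) p = 0"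
    have "((\<lambda>p. Re (cf d (a l') p)) has_derivative (\<lambda>w. Re (pd w (cf d (a l')) p))) (at p)"
      "((\<lambda>p. Im (cf d (a l') p)) has_derivative (\<lambda>w. Im (pd w (cf d (a l')) p))) (at p)"
      by (intro has_derivative_Re has_derivative_Im holp_has_derivative holp_cf)+
    then have "Re (pd w (cf d (a l')) p) = 0" "Im (pd w (cf d (a l')) p) = 0"
      using w(2,3) pd_eqI by metis+
    then have w': "pd w (cf d (a l')) p = 0" by (simp add: complex_eq_iff)
    obtain u v where uv: "w = (u, v)" by (cases w)
    have "tjac (cf d (a l)) (cf d (a l')) p \<noteq> 0" using admissible_transversal[OF adm l] XX[OF p] by simp
    then have "u = 0 \<and> v = 0" by (rule tjac_kernel[OF holp_cf holp_cf]) (use w w' uv in auto)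
    then show "w = 0" by (simp add: uv zero_prod_def)
  qed
  then show "cf d (a l) p = 0 \<and> Re (cf d (a l') p) = 0 \<and> Im (cf d (a l') p) = 0 \<and>
      nondeg (cf d (a l)) (\<lambda>p. Re (cf d (a l') p)) (\<lambda>p. Im (cf d (a l') p)) p"
    using XX[OF p] by simp
qed (rule X)

text \<open>Each rich curve is sent to an A-tuple of its points in P such that every curve of degree
  d through the tuple contains all of them. Two curves with the same tuple would share more than (d
  + 1) ^ 4 points, so the map is injective.\<close>

lemma rich_curves_card:
  assumes adm: "admissible d a L" and P: "finite P"
    and rich: "\<And>l. l \<in> L \<Longrightarrow> card {p \<in> P. cf d (a l) p = 0} > (d + 1) ^ 4"
  shows "card L \<le> card P ^ (((d + 2) choose 2) - 1)"
proof -
  define A where "A = ((d + 2) choose 2) - 1"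
  have "\<forall>l\<in>L. \<exists>t. (t \<in> {..<A} \<rightarrow>\<^sub>E P \<and> (\<forall>i<A. cf d (a l) (t i) = 0) \<and>
      (\<forall>c. (\<forall>i<A. cf d c (t i) = 0) \<longrightarrow> (\<forall>p\<in>P. cf d (a l) p = 0 \<longrightarrow> cf d c p = 0)))"
  proof
    fix l assume l: "l \<in> L"
    define Y where "Y = {p \<in> P. cf d (a l) p = 0}"
    have fY: "finite Y" using P by (simp add: Y_def)
    have "card Y > 0" using rich[OF l] by (simp add: Y_def)
    then have Yne: "Y \<noteq> {}" by auto
    have ne: "\<exists>i j. i + j \<le> d \<and> a l i j \<noteq> 0" by (rule admissible_nonzero[OF adm l])
    have "\<exists>T\<subseteq>Y. T \<noteq> {} \<and> card T \<le> ((d + 2) choose 2) - 1 \<and>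
        (\<forall>c. (\<forall>p\<in>T. cf d c p = 0) \<longrightarrow> (\<forall>p\<in>Y. cf d c p = 0))"
      by (rule determining_subset[OF ne fY Yne]) (simp add: Y_def)
    then obtain T where T: "T \<subseteq> Y" "T \<noteq> {}" "card T \<le> A" "\<And>c. (\<forall>p\<in>T. cf d c p = 0) \<Longrightarrow> (\<forall>p\<in>Y. cf d c p = 0)"
      unfolding A_def by blast
    have fT: "finite T" using T(1) fY by (rule finite_subset)
    obtain h where h: "bij_betw h {..<card T} T" using ex_bij_betw_nat_finite[OF fT] by (auto simp: atLeast0LessThan)
    obtain y where y: "y \<in> T" using T(2) by blast
    \<comment> \<open>A determining set with fewer than A points is padded by repeating y; beyond A
      the value is \<open>undefined\<close>, as \<open>\<rightarrow>\<^sub>E\<close>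
      requires.\<close>
    define t where "t = (\<lambda>i. if i < A then (if i < card T then h i else y) else undefined)"
    have tT: "t i \<in> T" if "i < A" for i using that y h by (auto simp: t_def bij_betw_def)
    have Tt: "\<exists>i<A. t i = p" if p: "p \<in> T" for p
    proof -
      obtain i where i: "i < card T" "h i = p" using p h unfolding bij_betw_def by (metis imageE lessThan_iff)
      then show ?thesis using T(3) by (intro exI[of _ i]) (auto simp: t_def)
    qed
    have tP: "t \<in> {..<A} \<rightarrow>\<^sub>E P" using tT T(1) by (force simp: PiE_iff extensional_def t_def Y_def)
    moreover have "\<forall>i<A. cf d (a l) (t i) = 0" using tT T(1) by (auto simp: Y_def)
    moreover have "\<forall>p\<in>P. cf d (a l) p = 0 \<longrightarrow> cf d c p = 0" if "\<forall>i<A. cf d c (t i) = 0" for c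
    proof -
      have "\<forall>p\<in>T. cf d c p = 0" using that Tt by blast
      then show ?thesis using T(4)[of c] unfolding Y_def by blast
    qed
    ultimately show "\<exists>t. (t \<in> {..<A} \<rightarrow>\<^sub>E P \<and> (\<forall>i<A. cf d (a l) (t i) = 0) \<and>
      (\<forall>c. (\<forall>i<A. cf d c (t i) = 0) \<longrightarrow> (\<forall>p\<in>P. cf d (a l) p = 0 \<longrightarrow> cf d c p = 0)))"
      by (intro exI[of _ t]) blast
  qed
  from bchoice[OF this] obtain t where "\<forall>l\<in>L. (t l \<in> {..<A} \<rightarrow>\<^sub>E P \<and> (\<forall>i<A. cf d (a l) (t l i) = 0) \<and>
      (\<forall>c. (\<forall>i<A. cf d c (t l i) = 0) \<longrightarrow> (\<forall>p\<in>P. cf d (a l) p = 0 \<longrightarrow> cf d c p = 0)))"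
    by (rule exE)
  then have t: "\<And>l. l \<in> L \<Longrightarrow> t l \<in> {..<A} \<rightarrow>\<^sub>E P" "\<And>l. l \<in> L \<Longrightarrow> \<forall>i<A. cf d (a l) (t l i) = 0"
      "\<And>l c. l \<in> L \<Longrightarrow> \<forall>i<A. cf d c (t l i) = 0 \<Longrightarrow> \<forall>p\<in>P. cf d (a l) p = 0 \<longrightarrow> cf d c p = 0"
    by blast+
  have "inj_on t L"
  proof (rule inj_onI, rule ccontr)
    fix l l' assume l: "l \<in> L" "l' \<in> L" "t l = t l'" "l \<noteq> l'"
    have "\<forall>p\<in>P. cf d (a l) p = 0 \<longrightarrow> cf d (a l') p = 0"
      by (rule t(3)[OF l(1)]) (use t(2)[OF l(2)] l(3) in simp)
    then have "card {p \<in> P. cf d (a l) p = 0} \<le> (d + 1) ^ 4"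
      by (intro common_points_card[OF adm l(1,2,4)]) (use P in auto)
    then show False using rich[OF l(1)] by simp
  qed
  then have "card L \<le> card ({..<A} \<rightarrow>\<^sub>E P)"
    by (rule card_inj_on_le) (use t(1) P in \<open>auto intro!: finite_PiE\<close>)
  also have "\<dots> = card P ^ A" using P by (simp add: card_PiE)
  finally show ?thesis by (simp add: A_def)
qed

section \<open>Incidence bounds by partitioning\<close>

lemma exists_partition:
  fixes \<psi> :: "'p \<Rightarrow> 'a::euclidean_space"
  assumes P: "finite P" and N: "N = DIM('a) * T"
  shows "\<exists>(Q :: nat \<Rightarrow> 'a \<Rightarrow> real) D. (\<forall>j<N. polyd (D j) (Q j)) \<and> (\<forall>j<N. \<exists>x. Q j x \<noteq> 0) \<and>
    (\<Sum>j<N. D j) \<le> 2 * DIM('a)\<^sup>2 * 2 ^ T \<and>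
    card (sign_vector (\<lambda>j p. Q j (\<psi> p)) N ` (P - {p \<in> P. \<exists>j<N. Q j (\<psi> p) = 0})) \<le> 2 ^ N \<and>
    (\<forall>\<sigma>. card {p \<in> P - {p \<in> P. \<exists>j<N. Q j (\<psi> p) = 0}. sign_vector (\<lambda>j p. Q j (\<psi> p)) N p = \<sigma>} * 2 ^ N \<le> card P)"
proof -
  obtain Q :: "nat \<Rightarrow> 'a \<Rightarrow> real" and D :: "nat \<Rightarrow> nat" where
    Q: "\<And>j. j < DIM('a) * T \<Longrightarrow> polyd (D j) (Q j)" "\<And>j. j < DIM('a) * T \<Longrightarrow> \<exists>x. Q j x \<noteq> 0"
      "(\<Sum>j<DIM('a) * T. D j) \<le> 2 * DIM('a)\<^sup>2 * 2 ^ T"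
      "\<And>\<sigma>. card {p \<in> P. \<psi> p \<in> sign_class Q (DIM('a) * T) \<sigma>} * 2 ^ (DIM('a) * T) \<le> card P"
    by (rule polynomial_partition[OF P, of T \<psi>]) (rule that)
  have "card (sign_vector (\<lambda>j p. Q j (\<psi> p)) N ` (P - {p \<in> P. \<exists>j<N. Q j (\<psi> p) = 0})) \<le> card (Pow {..<N})"
    by (rule card_mono) (auto simp: sign_vector_def)
  moreover have "card {p \<in> P - {p \<in> P. \<exists>j<N. Q j (\<psi> p) = 0}. sign_vector (\<lambda>j p. Q j (\<psi> p)) N p = \<sigma>} * 2 ^ N \<le> card P" for \<sigma>
  proof -
    have "{p \<in> P - {p \<in> P. \<exists>j<N. Q j (\<psi> p) = 0}. sign_vector (\<lambda>j p. Q j (\<psi> p)) N p = \<sigma>} \<subseteq> {p \<in> P. \<psi> p \<in> sign_class Q N \<sigma>}"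
      by (auto simp: sign_vector_def sign_class_def)
    then have "card {p \<in> P - {p \<in> P. \<exists>j<N. Q j (\<psi> p) = 0}. sign_vector (\<lambda>j p. Q j (\<psi> p)) N p = \<sigma>} \<le> card {p \<in> P. \<psi> p \<in> sign_class Q N \<sigma>}"
      by (rule card_mono[rotated]) (use P in auto)
    then show ?thesis using Q(4)[of \<sigma>] unfolding N by (meson le_trans mult_le_mono1)
  qed
  ultimately show ?thesis using Q(1-3) by (intro exI[of _ Q] exI[of _ D]) (simp add: N card_Pow)
qed

lemma icount_UN_le:
  assumes "finite G" "finite L" "\<And>g. g \<in> G \<Longrightarrow> finite (Z g)" "P \<subseteq> (\<Union>g\<in>G. Z g)"
  shows "icount inc P L \<le> (\<Sum>g\<in>G. icount inc (Z g) L)"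
proof -
  have "card {p \<in> P. inc p l} \<le> (\<Sum>g\<in>G. card {p \<in> Z g. inc p l})" for l
  proof -
    have "card {p \<in> P. inc p l} \<le> card (\<Union>g\<in>G. {p \<in> Z g. inc p l})"
      by (rule card_mono) (use assms in auto)
    also have "\<dots> \<le> (\<Sum>g\<in>G. card {p \<in> Z g. inc p l})" by (rule card_UN_le[OF assms(1)])
    finally show ?thesis .
  qed
  then have "icount inc P L \<le> (\<Sum>l\<in>L. \<Sum>g\<in>G. card {p \<in> Z g. inc p l})" unfolding icount_def by (rule sum_mono)
  also have "\<dots> = (\<Sum>g\<in>G. icount inc (Z g) L)" unfolding icount_def by (rule sum.swap)
  finally show ?thesis .
qed

text \<open>The common frame of both partitions: \<psi> is the identity of \<complex>^2 for complex
  curves and a generic projection to \<complex> for real curves in a wall. Each wall point is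
  regular on one of at most \<open>N * (DIM('a) + 1) ^ q\<close> iterated derivatives; summing
  \<open>bd\<close> over these turns B into B'.\<close>

theorem incidence_bound_by_partition:
  fixes \<psi> :: "'p \<Rightarrow> 'a::euclidean_space" and inc :: "'p \<Rightarrow> 'l \<Rightarrow> bool" and H B \<alpha> \<beta> \<epsilon> :: real
  assumes fin: "finite P0" "finite L0"
    and pos: "T > 0" "H \<ge> 0" "B \<ge> 0" "0 \<le> \<alpha>" "0 < \<beta>" "\<beta> \<le> 1" "\<epsilon> > 0"
    and N: "N = DIM('a) * T" and q: "q = 2 * DIM('a)\<^sup>2 * 2 ^ T"
    and gain: "(2 ^ N) powr (1 - \<alpha> - \<epsilon> - \<beta>) * H powr \<beta> \<le> 1 / 2"
    and rich: "\<And>P L. P \<subseteq> P0 \<Longrightarrow> L \<subseteq> L0 \<Longrightarrow> (\<forall>l\<in>L. card {p \<in> P. inc p l} > m) \<Longrightarrow>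
        real (card L) \<le> real (card P) powr \<alpha> * real (card L) powr \<beta>"
    and hit: "\<And>(Q :: nat \<Rightarrow> 'a \<Rightarrow> real) D X l. l \<in> L0 \<Longrightarrow> X \<subseteq> P0 \<Longrightarrow> (\<forall>j<N. polyd (D j) (Q j)) \<Longrightarrow> (\<Sum>j<N. D j) \<le> q \<Longrightarrow>
        (\<forall>p\<in>X. inc p l \<and> (\<forall>j<N. Q j (\<psi> p) \<noteq> 0)) \<Longrightarrow> real (card (sign_vector (\<lambda>j p. Q j (\<psi> p)) N ` X)) \<le> H"
    and bd: "\<And>(g :: 'a \<Rightarrow> real) Z L. Z \<subseteq> P0 \<Longrightarrow> L \<subseteq> L0 \<Longrightarrow> polyd q g \<Longrightarrow>
        (\<forall>p\<in>Z. g (\<psi> p) = 0 \<and> (\<exists>b\<in>Basis. pd b g (\<psi> p) \<noteq> 0)) \<Longrightarrow>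
        real (icount inc Z L) \<le> B * (real (card Z) powr (\<alpha> + \<epsilon>) * real (card L) powr \<beta> + real (card Z) + real (card L))"
    and B': "B' = real (N * (DIM('a) + 1) ^ q) * B"
  shows "real (icount inc P0 L0) \<le> (2 * (real m * H + 2 * B') + B' + real m) *
      (real (card P0) powr (\<alpha> + \<epsilon>) * real (card L0) powr \<beta> + real (card P0) + real (card L0))"
proof -
  have B'0: "B' \<ge> 0" using pos by (simp add: B')
  have part: "\<exists>Z (c :: 'p \<Rightarrow> nat set). Z \<subseteq> P \<and> real (card (c ` (P - Z))) \<le> 2 ^ N \<and>
        (\<forall>\<sigma>. real (card {p \<in> P - Z. c p = \<sigma>}) * 2 ^ N \<le> real (card P)) \<and>
        (\<forall>l\<in>L0. real (card (c ` {p \<in> P - Z. inc p l})) \<le> H) \<and>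
        (\<forall>L\<subseteq>L0. real (icount inc Z L) \<le> B' * (real (card P) powr (\<alpha> + \<epsilon>) * real (card L) powr \<beta> + real (card Z) + real (card L)))"
    if P: "P \<subseteq> P0" for P
  proof -
    have fP: "finite P" using P fin(1) by (rule finite_subset)
    obtain Q :: "nat \<Rightarrow> 'a \<Rightarrow> real" and D where Q: "\<forall>j<N. polyd (D j) (Q j)" "\<forall>j<N. \<exists>x. Q j x \<noteq> 0"
      and D: "(\<Sum>j<N. D j) \<le> q"
      and cells: "card (sign_vector (\<lambda>j p. Q j (\<psi> p)) N ` (P - {p \<in> P. \<exists>j<N. Q j (\<psi> p) = 0})) \<le> 2 ^ N"
        "\<forall>\<sigma>. card {p \<in> P - {p \<in> P. \<exists>j<N. Q j (\<psi> p) = 0}. sign_vector (\<lambda>j p. Q j (\<psi> p)) N p = \<sigma>} * 2 ^ N \<le> card P"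
      using exists_partition[OF fP N, of \<psi>, folded q] by (elim exE conjE) (rule that)
    define Z where "Z = {p \<in> P. \<exists>j<N. Q j (\<psi> p) = 0}"
    define c where "c = sign_vector (\<lambda>j p. Q j (\<psi> p)) N"
    define G where "G = (\<Union>j<N. ders (D j) (Q j))"
    define Zg where "Zg = (\<lambda>g :: 'a \<Rightarrow> real. {p \<in> Z. g (\<psi> p) = 0 \<and> (\<exists>b\<in>Basis. pd b g (\<psi> p) \<noteq> 0)})"
    have Dq: "D j \<le> q" if "j < N" for j
      using member_le_sum[of j "{..<N}" D] that D by simp
    have fG: "finite G" by (simp add: G_def finite_ders)
    have cG: "card G \<le> N * (DIM('a) + 1) ^ q"
    proof -
      have "card G \<le> (\<Sum>j<N. card (ders (D j) (Q j)))" unfolding G_def by (rule card_UN_le) simp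
      also have "\<dots> \<le> of_nat (card {..<N}) * (DIM('a) + 1) ^ q"
      proof (rule sum_bounded_above)
        fix j assume "j \<in> {..<N}"
        then have "(DIM('a) + 1) ^ D j \<le> (DIM('a) + 1) ^ q" using Dq by (intro power_increasing) auto
        then show "card (ders (D j) (Q j)) \<le> (DIM('a) + 1) ^ q" using card_ders[of "D j" "Q j"] by linarith
      qed
      finally show ?thesis by simp
    qed
    have pG: "polyd q g" if gG: "g \<in> G" for g
    proof -
      obtain j where j: "j < N" "g \<in> ders (D j) (Q j)" using gG unfolding G_def by blast
      have "polyd (D j) g" by (rule polyd_ders[OF _ j(2)]) (use Q(1) j(1) in simp)
      then show ?thesis by (rule polyd_mono) (rule Dq[OF j(1)])
    qed
    have ZP: "Z \<subseteq> P" and fZ: "finite Z" using fP by (auto simp: Z_def)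
    have cover: "Z \<subseteq> (\<Union>g\<in>G. Zg g)"
    proof
      fix p assume p: "p \<in> Z"
      then obtain j where j: "j < N" "Q j (\<psi> p) = 0" by (auto simp: Z_def)
      have pj: "polyd (D j) (Q j)" using Q(1) j(1) by simp
      obtain x where x: "Q j x \<noteq> 0" using Q(2) j(1) by auto
      have "\<exists>g\<in>ders (D j) (Q j). g (\<psi> p) = 0 \<and> (\<exists>b\<in>Basis. pd b g (\<psi> p) \<noteq> 0)"
        by (rule exists_regular_derivative[OF pj j(2) x])
      then obtain g where g: "g \<in> ders (D j) (Q j)" "g (\<psi> p) = 0 \<and> (\<exists>b\<in>Basis. pd b g (\<psi> p) \<noteq> 0)"
        by (rule bexE)
      have "g \<in> G" using g(1) j(1) by (auto simp: G_def)
      moreover have "p \<in> Zg g" using g(2) p by (simp add: Zg_def)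
      ultimately show "p \<in> (\<Union>g\<in>G. Zg g)" by blast
    qed
    have boundary: "real (icount inc Z L) \<le> B' * (real (card P) powr (\<alpha> + \<epsilon>) * real (card L) powr \<beta> + real (card Z) + real (card L))"
      if L: "L \<subseteq> L0" for L
    proof -
      define X where "X = real (card P) powr (\<alpha> + \<epsilon>) * real (card L) powr \<beta> + real (card Z) + real (card L)"
      have "icount inc Z L \<le> (\<Sum>g\<in>G. icount inc (Zg g) L)"
        by (rule icount_UN_le[OF fG finite_subset[OF L fin(2)] _ cover]) (simp add: Zg_def fZ)
      then have "real (icount inc Z L) \<le> (\<Sum>g\<in>G. real (icount inc (Zg g) L))" by (simp flip: of_nat_sum)
      also have "\<dots> \<le> of_nat (card G) * (B * X)"
      proof (rule sum_bounded_above)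
        fix g assume g: "g \<in> G"
        have le: "card (Zg g) \<le> card Z" by (rule card_mono[OF fZ]) (auto simp: Zg_def)
        have le': "card (Zg g) \<le> card P" using le card_mono[OF fP ZP] by linarith
        have "real (icount inc (Zg g) L) \<le> B * (real (card (Zg g)) powr (\<alpha> + \<epsilon>) * real (card L) powr \<beta> + real (card (Zg g)) + real (card L))"
          by (rule bd[OF _ L pG[OF g]]) (use ZP P in \<open>auto simp: Zg_def\<close>)
        also have "\<dots> \<le> B * X" unfolding X_def
          by (intro mult_left_mono add_mono mult_right_mono powr_mono2 order_refl) (use pos le le' in auto)
        finally show "real (icount inc (Zg g) L) \<le> B * X" .
      qed
      also have "\<dots> \<le> real (N * (DIM('a) + 1) ^ q) * (B * X)"
        by (rule mult_right_mono) (use cG pos in \<open>auto simp: X_def simp flip: of_nat_power of_nat_mult intro!: mult_nonneg_nonneg\<close>)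
      finally show ?thesis by (simp add: B' X_def mult.assoc)
    qed
    have hits: "real (card (c ` {p \<in> P - Z. inc p l})) \<le> H" if "l \<in> L0" for l
      unfolding c_def by (rule hit[OF that _ Q(1) D]) (use P in \<open>auto simp: Z_def\<close>)
    have c1: "real (card (c ` (P - Z))) \<le> 2 ^ N" using cells(1) by (simp add: c_def Z_def flip: of_nat_power)
    have c2: "real (card {p \<in> P - Z. c p = \<sigma>}) * 2 ^ N \<le> real (card P)" for \<sigma>
    proof -
      have "card {p \<in> P - Z. c p = \<sigma>} * 2 ^ N \<le> card P" unfolding c_def Z_def using cells(2) by (rule spec)
      then have "real (card {p \<in> P - Z. c p = \<sigma>} * 2 ^ N) \<le> real (card P)" by (rule of_nat_mono)
      then show ?thesis by simp
    qed
    show ?thesis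
      by (rule exI[of _ Z], rule exI[of _ c]) (intro conjI allI ballI impI ZP c1 c2 hits boundary; assumption)
  qed
  have N0: "N > 0" using pos(1) by (simp add: N)
  have "real (icount inc P0 L0) \<le> 2 * (real m * H + 2 * B') * (real (card P0) powr (\<alpha> + \<epsilon>) * real (card L0) powr \<beta>) + B' * real (card P0) + real m * real (card L0)"
  proof (rule incidence_induction[OF fin _ pos(2) B'0 pos(4-7) gain rich part order_refl order_refl])
    show "(2::real) ^ N > 1" using N0 by (rule one_less_power[rotated]) simp
  qed
  also have "\<dots> \<le> (2 * (real m * H + 2 * B') + B' + real m) * (real (card P0) powr (\<alpha> + \<epsilon>) * real (card L0) powr \<beta>)
     + (2 * (real m * H + 2 * B') + B' + real m) * real (card P0) + (2 * (real m * H + 2 * B') + B' + real m) * real (card L0)"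
    by (intro add_mono mult_right_mono) (use pos B'0 in auto)
  finally show ?thesis by (simp only: distrib_left)
qed

text \<open>For M = x ^ 2 and H \<le> K * x the relation \<alpha> + \<beta> / 2 = 1 leaves K powr
  \<beta> * x powr (- 2 * \<epsilon>), which is at most 1 / 2 for large x. The case \<delta> = 2
  belongs to four real dimensions, \<delta> = 1 to the plane.\<close>

lemma exists_gain:
  fixes K \<alpha> \<beta> \<epsilon> :: real
  assumes "K \<ge> 0" "\<epsilon> > 0" "\<alpha> + \<beta> / 2 = 1" "0 < \<beta>" and \<delta>: "\<delta> > 0"
  shows "\<exists>T>0. \<forall>H. 0 \<le> H \<longrightarrow> H \<le> K * 2 ^ (\<delta> * T) \<longrightarrow> (2 ^ (2 * \<delta> * T)) powr (1 - \<alpha> - \<epsilon> - \<beta>) * H powr \<beta> \<le> 1 / 2"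
proof -
  define y where "y = (2 * K powr \<beta> + 1) powr (1 / (2 * \<epsilon>))"
  obtain T0 where T0: "y < 2 ^ T0" using real_arch_pow[of 2 y] by auto
  define T where "T = Suc T0"
  have gain: "(2 ^ (2 * \<delta> * T)) powr (1 - \<alpha> - \<epsilon> - \<beta>) * H powr \<beta> \<le> 1 / 2" if H: "0 \<le> H" "H \<le> K * 2 ^ (\<delta> * T)" for H
  proof -
    define x :: real where "x = 2 ^ (\<delta> * T)"
    have "T0 \<le> \<delta> * T" using \<delta> by (cases \<delta>) (auto simp: T_def)
    then have "(2::real) ^ T0 \<le> x" unfolding x_def by (rule power_increasing) simp
    then have yx: "y < x" using T0 by simp
    have x0: "x > 0" by (simp add: x_def)
    have kp: "2 * K powr \<beta> + 1 > 0" by (simp add: add_nonneg_pos)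
    have "y powr (2 * \<epsilon>) < x powr (2 * \<epsilon>)"
      by (rule powr_less_mono2) (use yx assms in \<open>auto simp: y_def\<close>)
    moreover have "y powr (2 * \<epsilon>) = 2 * K powr \<beta> + 1" using assms kp by (simp add: y_def powr_powr)
    ultimately have big: "2 * K powr \<beta> + 1 < x powr (2 * \<epsilon>)" by simp
    have M: "(2 ^ (2 * \<delta> * T)) powr (1 - \<alpha> - \<epsilon> - \<beta>) = x powr (2 * (1 - \<alpha> - \<epsilon> - \<beta>))"
    proof -
      have "(2::real) ^ (2 * \<delta> * T) = x ^ 2" by (simp add: x_def mult.assoc mult.commute flip: power_mult)
      also have "\<dots> = x powr 2" using x0 by simp
      finally show ?thesis by (simp only: powr_powr)
    qed
    have "H powr \<beta> \<le> (K * x) powr \<beta>" by (rule powr_mono2) (use H assms in \<open>auto simp: x_def\<close>)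
    also have "\<dots> = K powr \<beta> * x powr \<beta>" using assms x0 by (simp add: powr_mult)
    finally have "x powr (2 * (1 - \<alpha> - \<epsilon> - \<beta>)) * H powr \<beta> \<le> x powr (2 * (1 - \<alpha> - \<epsilon> - \<beta>)) * (K powr \<beta> * x powr \<beta>)"
      by (rule mult_left_mono) simp
    also have "\<dots> = K powr \<beta> * x powr (2 * (1 - \<alpha> - \<epsilon> - \<beta>) + \<beta>)"
      unfolding powr_add[of x "2 * (1 - \<alpha> - \<epsilon> - \<beta>)" \<beta>] by (simp only: mult_ac)
    also have "2 * (1 - \<alpha> - \<epsilon> - \<beta>) + \<beta> = - (2 * \<epsilon>)"
    proof -
      have a: "\<alpha> = 1 - \<beta> / 2" using assms(3) by simp
      show ?thesis unfolding a by (simp add: field_simps)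
    qed
    also have "K powr \<beta> * x powr - (2 * \<epsilon>) = K powr \<beta> / x powr (2 * \<epsilon>)" by (simp only: powr_minus divide_inverse)
    also have "\<dots> \<le> 1 / 2"
    proof -
      have "x powr (2 * \<epsilon>) > 0" using x0 by simp
      then show ?thesis using big by (simp add: divide_le_eq)
    qed
    finally show ?thesis unfolding M .
  qed
  show ?thesis by (rule exI[of _ T]) (use gain in \<open>auto simp: T_def\<close>)
qed

text \<open>From l \<le> n ^ A follows l powr (1 - \<beta>) \<le> n powr (A * (1 - \<beta>)) = n
  powr \<alpha>; the other factor is l powr \<beta>.\<close>

lemma rich_exponents:
  fixes \<alpha> \<beta> :: real
  assumes "real A * (1 - \<beta>) = \<alpha>" "\<alpha> + \<beta> / 2 = 1" "0 < \<beta>" "\<beta> \<le> 1" "l \<le> n ^ A"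
  shows "real l \<le> real n powr \<alpha> * real l powr \<beta>"
proof (cases "l = 0")
  case False
  have "A > 0" using assms(1-4) by (cases A) auto
  then have n: "n > 0" using False assms(5) by (cases n) (auto simp: zero_power)
  have "real l = real l powr (1 - \<beta>) * real l powr \<beta>" using False by (simp flip: powr_add)
  also have "\<dots> \<le> (real n powr real A) powr (1 - \<beta>) * real l powr \<beta>"
    by (intro mult_right_mono powr_mono2) (use assms n in \<open>auto simp: powr_realpow simp flip: of_nat_power\<close>)
  also have "(real n powr real A) powr (1 - \<beta>) = real n powr \<alpha>" by (simp add: powr_powr assms(1))
  finally show ?thesis .
qed simp

text \<open>On the real curve \<open>s = t + \<i> t\<^sup>2\<close> of projections, failure of independence is a polynomial equation in \<open>t\<close>.\<close>

lemma generic_projection: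
  fixes U :: "((complex \<times> complex) \<times> (complex \<times> complex)) set"
  assumes "finite U" "\<And>u v u' v'. ((u, v), (u', v')) \<in> U \<Longrightarrow> u * v' - v * u' \<noteq> 0"
  shows "\<exists>s. \<forall>((u, v), (u', v'))\<in>U. Im (cnj (u + s * v) * (u' + s * v')) \<noteq> 0"
proof -
  define pol where "pol = (\<lambda>((u, v), (u', v')). [:Im (cnj u * u'), Im (cnj u * v') + Im (cnj v * u'),
      Re (cnj u * v') - Re (cnj v * u') + Im (cnj v * v'), 0, Im (cnj v * v'):])"
  \<comment> \<open>If all coefficients vanish, then cnj u * u' and cnj v * v' are real and cnj u *
    v' = v * cnj u'. Hence cnj u times the determinant is 0, so u = 0, and then v * cnj u' = 0 makes
    the determinant vanish.\<close>
  have nz: "pol x \<noteq> 0" if x: "x \<in> U" for x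
  proof
    obtain u v u' v' where e: "x = ((u, v), (u', v'))" by (metis surj_pair)
    have det: "u * v' - v * u' \<noteq> 0" using assms(2) x e by blast
    assume "pol x = 0"
    then have z: "Im (cnj u * u') = 0" "Im (cnj v * v') = 0" "Re (cnj u * v') = Re (cnj v * u')" "Im (cnj u * v') = - Im (cnj v * u')"
      by (simp_all add: pol_def e)
    have 1: "cnj u * u' = u * cnj u'" using z(1) by (simp add: complex_eq_iff)
    have 2: "cnj v * v' = v * cnj v'" using z(2) by (simp add: complex_eq_iff)
    have 3: "cnj u * v' = v * cnj u'" using z(3,4) by (simp add: complex_eq_iff)
    have "cnj u * (u * v' - v * u') = u * (cnj u * v') - v * (cnj u * u')" by (simp add: algebra_simps)
    also have "\<dots> = 0" unfolding 1 3 by (simp add: algebra_simps)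
    finally have u0: "u = 0" using det by simp
    then have "v * cnj u' = 0" using 3 by simp
    then show False using det u0 by auto
  qed
  have fin: "finite (\<Union>x\<in>U. {t. poly (pol x) t = 0})" using assms(1) nz by (auto intro: poly_roots_finite)
  obtain t where t: "t \<notin> (\<Union>x\<in>U. {t. poly (pol x) t = 0})"
    using ex_new_if_finite[OF infinite_UNIV_char_0 fin] by (rule exE)
  define s where "s = Complex t (t\<^sup>2)"
  have "Im (cnj (u + s * v) * (u' + s * v')) = poly (pol ((u, v), (u', v'))) t" for u v u' v'
    by (simp add: pol_def s_def algebra_simps power2_eq_square)
  then show ?thesis using t by (intro exI[of _ s]) auto
qed

text \<open>The vector spanning the real tangent line of the real curve \<open>{f = 0, Q = 0}\<close>.\<close>

definition tangent :: "(complex \<times> complex \<Rightarrow> complex) \<Rightarrow> (complex \<times> complex \<Rightarrow> real) \<Rightarrow> complex \<times> complex \<Rightarrow> complex \<times> complex" where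
  "tangent f Q p = (\<i> * cnj (slope f Q p) * - pd (0, 1) f p, \<i> * cnj (slope f Q p) * pd (1, 0) f p)"

section \<open>Real curves in a wall and their projections\<close>

lemma kernel_of_gradient:
  assumes f: "holp f" "pd (1, 0) f p \<noteq> 0 \<or> pd (0, 1) f p \<noteq> 0" and w: "pd (u, v) f p = 0"
  shows "\<exists>\<zeta>. u = \<zeta> * - pd (0, 1) f p \<and> v = \<zeta> * pd (1, 0) f p"
proof -
  define g h where "g = pd (1, 0) f p" and "h = pd (0, 1) f p"
  have eq: "u * g + v * h = 0" using w holp_pd[OF f(1), of u v p] by (simp add: g_def h_def)
  have "\<exists>\<zeta>. u = \<zeta> * - h \<and> v = \<zeta> * g"
  proof (cases "g = 0")
    case False
    have "u * g = v / g * - h * g" using eq False by (simp add: eq_neg_iff_add_eq_0)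
    then have "u = v / g * - h" using False by (metis mult_right_cancel)
    then show ?thesis using False by (intro exI[of _ "v / g"]) simp
  next
    case True
    then have "h \<noteq> 0" using f(2) by (simp add: g_def h_def)
    then show ?thesis using eq True by (intro exI[of _ "- u / h"]) simp
  qed
  then show ?thesis by (simp add: g_def h_def)
qed

lemma real_multiple_of_tangent:
  assumes s: "s \<noteq> 0" and "Re (\<zeta> * s) = 0"
  shows "\<exists>t::real. \<zeta> = of_real t * (\<i> * cnj s)"
proof -
  have "\<zeta> * s = \<i> * of_real (Im (\<zeta> * s))" using assms(2) by (simp add: complex_eq_iff)
  then have "\<zeta> * (s * cnj s) = \<i> * of_real (Im (\<zeta> * s)) * cnj s" by (metis mult.assoc)
  then have "\<zeta> * of_real ((norm s)\<^sup>2) = \<i> * of_real (Im (\<zeta> * s)) * cnj s" by (simp only: complex_norm_square)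
  then have "\<zeta> = of_real (Im (\<zeta> * s) / (norm s)\<^sup>2) * (\<i> * cnj s)" using s by (simp add: field_simps)
  then show ?thesis by blast
qed

text \<open>The kernel of the derivative of f is the complex tangent line. Inside it Q cuts out the
  real line spanned by \<open>tangent f Q p\<close>, and the derivative of S along that vector is
  nonzero.\<close>

lemma tangent_nondeg:
  assumes f: "holp f" and Q: "polyd q Q" and S: "polyd r S" and g: "good f Q p" and t: "pd (tangent f Q p) S p \<noteq> 0"
  shows "nondeg f Q S p"
  unfolding nondeg_def
proof (intro allI impI)
  fix w assume w: "pd w f p = 0" "pd w Q p = 0" "pd w S p = 0"
  obtain u v where uv: "w = (u, v)" by (cases w)
  have g': "pd (1, 0) f p \<noteq> 0 \<or> pd (0, 1) f p \<noteq> 0" "slope f Q p \<noteq> 0" using g by (simp_all add: good_def)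
  have "\<exists>\<zeta>. u = \<zeta> * - pd (0, 1) f p \<and> v = \<zeta> * pd (1, 0) f p"
    by (rule kernel_of_gradient[OF f g'(1)]) (use w(1) uv in simp)
  then obtain \<zeta> where \<zeta>: "u = \<zeta> * - pd (0, 1) f p" "v = \<zeta> * pd (1, 0) f p" by (elim exE conjE)
  have "Re (\<zeta> * slope f Q p) = 0" using w(2) pd_tangent[OF Q, of \<zeta> f p] unfolding uv \<zeta> by simp
  then obtain x :: real where x: "\<zeta> = of_real x * (\<i> * cnj (slope f Q p))"
    using real_multiple_of_tangent[OF g'(2)] by blast
  have w': "w = x *\<^sub>R tangent f Q p" by (simp add: uv \<zeta> x tangent_def scaleR_conv_of_real mult.assoc)
  have "x * pd (tangent f Q p) S p = 0"
    using w(3) linear_scale[OF bounded_linear.linear[OF pd_bounded_linear[OF S]], of x "tangent f Q p" p] unfolding w' by simp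
  then have "x = 0" using t by simp
  then show "w = 0" by (simp add: w')
qed

text \<open>x and y are independent over the reals, so two vanishing directional derivatives kill
  the gradient.\<close>

lemma real_derivatives_vanish:
  fixes g :: "complex \<Rightarrow> real"
  assumes g: "polyd k g" and x: "pd x g z = 0" and y: "pd y g z = 0" and i: "Im (cnj x * y) \<noteq> 0"
  shows "pd b g z = 0"
proof -
  have lin: "linear (\<lambda>w. pd w g z)" by (rule bounded_linear.linear[OF pd_bounded_linear[OF g]])
  have ex: "pd w g z = Re w * pd 1 g z + Im w * pd \<i> g z" for w
  proof -
    have "w = Re w *\<^sub>R 1 + Im w *\<^sub>R \<i>" by (simp add: complex_eq_iff)
    then have "pd w g z = pd (Re w *\<^sub>R 1 + Im w *\<^sub>R \<i>) g z" by (rule arg_cong)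
    also have "\<dots> = Re w * pd 1 g z + Im w * pd \<i> g z"
      by (simp only: linear_add[OF lin] linear_scale[OF lin] real_scaleR_def)
    finally show ?thesis .
  qed
  define D1 Di where "D1 = pd 1 g z" and "Di = pd \<i> g z"
  have 1: "Re x * D1 + Im x * Di = 0" "Re y * D1 + Im y * Di = 0"
    using x y ex[of x] ex[of y] by (simp_all add: D1_def Di_def)
  have J: "Re x * Im y - Im x * Re y \<noteq> 0" using i by simp
  have a: "D1 * (Re x * Im y - Im x * Re y) = (Re x * D1 + Im x * Di) * Im y - (Re y * D1 + Im y * Di) * Im x"
    by (simp add: algebra_simps)
  have b: "Di * (Re x * Im y - Im x * Re y) = (Re y * D1 + Im y * Di) * Re x - (Re x * D1 + Im x * Di) * Re y"
    by (simp add: algebra_simps)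
  have "D1 * (Re x * Im y - Im x * Re y) = 0" "Di * (Re x * Im y - Im x * Re y) = 0" unfolding a b 1 by simp_all
  then have "D1 = 0" "Di = 0" using J by simp_all
  then show ?thesis using ex[of b] by (simp add: D1_def Di_def)
qed

lemma icount_le_points:
  assumes "finite P" "finite L" and one: "\<And>p l l'. p \<in> P \<Longrightarrow> l \<in> L \<Longrightarrow> l' \<in> L \<Longrightarrow> inc p l \<Longrightarrow> inc p l' \<Longrightarrow> l = l'"
  shows "icount inc P L \<le> card P"
proof -
  have "(\<Sum>p\<in>P. card {l \<in> L. inc p l}) \<le> of_nat (card P) * 1"
  proof (rule sum_bounded_above)
    fix p assume p: "p \<in> P"
    show "card {l \<in> L. inc p l} \<le> 1"
    proof (cases "{l \<in> L. inc p l} = {}")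
      case False
      then obtain x where "x \<in> L" "inc p x" by blast
      then have "{l \<in> L. inc p l} \<subseteq> {x}" using one[OF p] by blast
      then show ?thesis using card_mono[of "{x}" "{l \<in> L. inc p l}"] by simp
    qed (simp only: card.empty)
  qed
  then show ?thesis using icount_swap[OF assms(1,2), of inc] by simp
qed

text \<open>The projection to \<complex> is chosen so that the tangents of two real curves at a
  common point of P stay independent. At regular points of a wall {g = 0} of the plane partition,
  crossings with nonzero derivative of g along the tangent are nondegenerate zeros and hence bounded
  in number on each curve; two curves tangent to the wall at one point would force the gradient of g
  to vanish.\<close>

theorem good_incidences_bound:
  fixes \<alpha> \<beta> \<epsilon> :: real
  assumes ab: "0 \<le> \<alpha>" "0 < \<beta>" "\<beta> \<le> 1" "\<alpha> + \<beta> / 2 = 1" "real (((d + 2) choose 2) - 1) * (1 - \<beta>) = \<alpha>" and eps: "\<epsilon> > 0"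
  shows "\<exists>B\<ge>0. \<forall>(a :: 'l \<Rightarrow> nat \<Rightarrow> nat \<Rightarrow> complex) P L Q. finite P \<and> finite L \<and> admissible d a L \<and> polyd q Q \<longrightarrow>
    real (icount (\<lambda>p l. cf d (a l) p = 0 \<and> Q p = 0 \<and> good (cf d (a l)) Q p) P L) \<le>
      B * (real (card P) powr (\<alpha> + \<epsilon>) * real (card L) powr \<beta> + real (card P) + real (card L))"
proof -
  obtain C where C: "\<forall>a (Q :: complex \<times> complex \<Rightarrow> real) N (R :: nat \<Rightarrow> complex \<times> complex \<Rightarrow> real) D X.
     (\<exists>i j. i + j \<le> d \<and> a i j \<noteq> 0) \<and> polyd q Q \<and> finite X \<and> (\<forall>j<N. polyd (D j) (R j)) \<and>
     (\<forall>p\<in>X. cf d a p = 0 \<and> Q p = 0 \<and> good (cf d a) Q p \<and> (\<forall>j<N. R j p \<noteq> 0)) \<longrightarrow>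
     finite (sign_vector R N ` X) \<and> card (sign_vector R N ` X) \<le> C * ((\<Sum>j<N. D j) + 1)"
    using sign_vectors_transversal[of d q] by (rule exE)
  \<comment> \<open>q' is 8 * 2 ^ T, so q' + 1 \<le> 9 * 2 ^ T.\<close>
  define K :: real where "K = real (9 * C)"
  have "\<exists>T>0. \<forall>H. 0 \<le> H \<longrightarrow> H \<le> K * 2 ^ (1 * T) \<longrightarrow> (2 ^ (2 * 1 * T)) powr (1 - \<alpha> - \<epsilon> - \<beta>) * H powr \<beta> \<le> 1 / 2"
    by (rule exists_gain) (use ab eps in \<open>auto simp: K_def\<close>)
  then obtain T where T: "T > 0" and gain: "\<And>H. 0 \<le> H \<Longrightarrow> H \<le> K * 2 ^ T \<Longrightarrow> (2 ^ (2 * T)) powr (1 - \<alpha> - \<epsilon> - \<beta>) * H powr \<beta> \<le> 1 / 2"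
    by auto
  define q' :: nat where "q' = 2 * DIM(complex)\<^sup>2 * 2 ^ T"
  define H where "H = real (C * (q' + 1))"
  define m where "m = (d + 1) ^ 4"
  define B0 where "B0 = real ((d + q + q' + 1) ^ 4 + 1)"
  define N where "N = DIM(complex) * T"
  define B' where "B' = real (N * (DIM(complex) + 1) ^ q') * B0"
  define B where "B = 2 * (real m * H + 2 * B') + B' + real m"
  have HK: "H \<le> K * 2 ^ T"
  proof -
    have "q' + 1 \<le> 9 * 2 ^ T" by (simp add: q'_def)
    then have "C * (q' + 1) \<le> C * (9 * 2 ^ T)" by (rule mult_le_mono2)
    then have "real (C * (q' + 1)) \<le> real (C * (9 * 2 ^ T))" by (rule of_nat_mono)
    then show ?thesis by (simp add: H_def K_def)
  qed
  have B0: "B \<ge> 0" by (simp add: B_def H_def B'_def B0_def)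
  have main: "real (icount (\<lambda>p l. cf d (a l) p = 0 \<and> Q p = 0 \<and> good (cf d (a l)) Q p) P L) \<le>
      B * (real (card P) powr (\<alpha> + \<epsilon>) * real (card L) powr \<beta> + real (card P) + real (card L))"
    if P: "finite P" and L: "finite L" and adm: "admissible d a L" and Q: "polyd q Q"
    for a :: "'l \<Rightarrow> nat \<Rightarrow> nat \<Rightarrow> complex" and P L Q
  proof -
    define inc where "inc = (\<lambda>p l. cf d (a l) p = 0 \<and> Q p = 0 \<and> good (cf d (a l)) Q p)"
    define tg where "tg = (\<lambda>p l. tangent (cf d (a l)) Q p)"
    define U where "U = (\<lambda>(p, l, l'). (tg p l, tg p l')) ` {x \<in> P \<times> L \<times> L. case x of (p, l, l') \<Rightarrow> inc p l \<and> inc p l' \<and> l \<noteq> l'}"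
    have "\<exists>s. \<forall>((u, v), (u', v'))\<in>U. Im (cnj (u + s * v) * (u' + s * v')) \<noteq> 0"
    proof (rule generic_projection)
      show "finite U" using P L by (simp add: U_def)
      fix u v u' v' assume "((u, v), (u', v')) \<in> U"
      then obtain p l l' where pl: "l \<in> L" "l' \<in> L" "inc p l" "inc p l'" "l \<noteq> l'" "(u, v) = tg p l" "(u', v') = tg p l'"
        unfolding U_def by auto
      define s s' where "s = \<i> * cnj (slope (cf d (a l)) Q p)" and "s' = \<i> * cnj (slope (cf d (a l')) Q p)"
      have s0: "s \<noteq> 0" "s' \<noteq> 0" using pl(3,4) by (simp_all add: s_def s'_def inc_def good_def)
      have J: "tjac (cf d (a l)) (cf d (a l')) p \<noteq> 0"
        by (rule admissible_transversal[OF adm pl(1,2,5)]) (use pl(3,4) in \<open>simp_all add: inc_def\<close>)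
      \<comment> \<open>Tangents are complex multiples of (- f_y, f_x), so their determinant is that
        of the gradients times s * s'.\<close>
      have "u * v' - v * u' = s * s' * tjac (cf d (a l)) (cf d (a l')) p"
        using pl(6,7) by (simp add: tg_def tangent_def s_def s'_def tjac_def algebra_simps)
      then show "u * v' - v * u' \<noteq> 0" using s0 J by simp
    qed
    then obtain s where s0: "\<forall>((u, v), (u', v'))\<in>U. Im (cnj (u + s * v) * (u' + s * v')) \<noteq> 0" by (rule exE)
    have s: "Im (cnj (u + s * v) * (u' + s * v')) \<noteq> 0" if "((u, v), (u', v')) \<in> U" for u v u' v'
      using bspec[OF s0 that] by simp
    define \<pi> where "\<pi> = (\<lambda>p :: complex \<times> complex. fst p + s * snd p)"
    have bl: "bounded_linear \<pi>" unfolding \<pi>_def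
      by (intro bounded_linear_add bounded_linear_fst bounded_linear_snd bounded_linear_compose[OF bounded_linear_mult_right])
    have indep: "Im (cnj (\<pi> (tg p l)) * \<pi> (tg p l')) \<noteq> 0"
      if "p \<in> P" "l \<in> L" "l' \<in> L" "inc p l" "inc p l'" "l \<noteq> l'" for p l l'
    proof -
      have "(tg p l, tg p l') \<in> U" unfolding U_def by (rule image_eqI[of _ _ "(p, l, l')"]) (use that in auto)
      then show ?thesis using s[of "fst (tg p l)" "snd (tg p l)" "fst (tg p l')" "snd (tg p l')"] by (simp add: \<pi>_def)
    qed
    have "real (icount inc P L) \<le> (2 * (real m * H + 2 * B') + B' + real m) *
      (real (card P) powr (\<alpha> + \<epsilon>) * real (card L) powr \<beta> + real (card P) + real (card L))"
    proof (rule incidence_bound_by_partition[where \<psi> = \<pi>, OF P L T _ _ ab(1-3) eps N_def q'_def _ _ _ _ B'_def])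
      show "(2 ^ N) powr (1 - \<alpha> - \<epsilon> - \<beta>) * H powr \<beta> \<le> 1 / 2"
        using gain[OF _ HK] by (simp add: N_def H_def)
      show "H \<ge> 0" "B0 \<ge> 0" by (simp_all add: H_def B0_def)
      show "real (card L') \<le> real (card P') powr \<alpha> * real (card L') powr \<beta>"
        if "P' \<subseteq> P" "L' \<subseteq> L" and r: "\<forall>l\<in>L'. card {p \<in> P'. inc p l} > m" for P' L'
      proof (rule rich_exponents[OF ab(5) ab(4) ab(2,3)], rule rich_curves_card)
        show fP': "finite P'" using that(1) P by (rule finite_subset)
        show "admissible d a L'" by (rule admissible_subset[OF adm that(2)])
        fix l assume l: "l \<in> L'"
        have "card {p \<in> P'. inc p l} \<le> card {p \<in> P'. cf d (a l) p = 0}"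
          by (rule card_mono) (use fP' in \<open>auto simp: inc_def\<close>)
        then show "(d + 1) ^ 4 < card {p \<in> P'. cf d (a l) p = 0}" using r l by (auto simp: m_def)
      qed
      show "real (card (sign_vector (\<lambda>j p. R j (\<pi> p)) N ` X)) \<le> H"
        if l: "l \<in> L" and X: "X \<subseteq> P" and R: "\<forall>j<N. polyd (D j) (R j)" and D: "(\<Sum>j<N. D j) \<le> q'"
          and XX: "\<forall>p\<in>X. inc p l \<and> (\<forall>j<N. R j (\<pi> p) \<noteq> 0)" for R :: "nat \<Rightarrow> complex \<Rightarrow> real" and D X l
      proof -
        have R': "\<forall>j<N. polyd (D j) (\<lambda>p. R j (\<pi> p))" using R by (auto intro: polyd_compose_linear[OF _ bl])
        have fX: "finite X" using X P by (rule finite_subset)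
        have "card (sign_vector (\<lambda>j p. R j (\<pi> p)) N ` X) \<le> C * ((\<Sum>j<N. D j) + 1)"
          using C[rule_format, of "a l" Q X N D "\<lambda>j p. R j (\<pi> p)"] admissible_nonzero[OF adm l] Q fX R' XX
          by (simp add: inc_def)
        also have "\<dots> \<le> C * (q' + 1)" using D by (intro mult_le_mono2) simp
        finally show ?thesis unfolding H_def by (rule of_nat_mono)
      qed
      show "real (icount inc Z L') \<le> B0 * (real (card Z) powr (\<alpha> + \<epsilon>) * real (card L') powr \<beta> + real (card Z) + real (card L'))"
        if Z: "Z \<subseteq> P" and L': "L' \<subseteq> L" and g: "polyd q' g"
          and reg: "\<forall>p\<in>Z. g (\<pi> p) = 0 \<and> (\<exists>b\<in>Basis. pd b g (\<pi> p) \<noteq> 0)" for g :: "complex \<Rightarrow> real" and Z L'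
      proof -
        have fZ: "finite Z" and fL': "finite L'" using Z L' P L finite_subset by blast+
        define S where "S = (\<lambda>p. g (\<pi> p))"
        have pS: "polyd q' S" unfolding S_def by (rule polyd_compose_linear[OF g bl])
        \<comment> \<open>Incidences are split by whether the real curve crosses the wall g = 0 or
          is tangent to it at p.\<close>
        define i1 where "i1 = (\<lambda>p l. inc p l \<and> pd (tg p l) S p \<noteq> 0)"
        define i2 where "i2 = (\<lambda>p l. inc p l \<and> pd (tg p l) S p = 0)"
        have "icount inc Z L' \<le> icount (\<lambda>p l. i1 p l \<or> i2 p l) Z L'"
          by (rule icount_mono[OF fZ fL']) (auto simp: i1_def i2_def)
        also have "\<dots> \<le> icount i1 Z L' + icount i2 Z L'" by (rule icount_disj[OF fZ fL'])
        also have "icount i1 Z L' \<le> of_nat (card L') * (d + q + q' + 1) ^ 4"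
          unfolding icount_def
        proof (rule sum_bounded_above)
          fix l assume l: "l \<in> L'"
          show "card {p \<in> Z. i1 p l} \<le> (d + q + q' + 1) ^ 4"
          proof (rule nondeg_zeros_card[of "d + q + q'" "cf d (a l)" Q S])
            show "polyd (d + q + q') (cf d (a l))" by (rule polyd_mono[OF polyd_cf]) simp
            show "polyd (d + q + q') Q" by (rule polyd_mono[OF Q]) simp
            show "polyd (d + q + q') S" by (rule polyd_mono[OF pS]) simp
            show "finite {p \<in> Z. i1 p l}" using fZ by simp
            fix p assume "p \<in> {p \<in> Z. i1 p l}"
            then have p: "p \<in> Z" "inc p l" "pd (tg p l) S p \<noteq> 0" by (auto simp: i1_def)
            have "nondeg (cf d (a l)) Q S p"
              by (rule tangent_nondeg[OF holp_cf Q pS]) (use p in \<open>simp_all add: inc_def tg_def\<close>)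
            moreover have "S p = 0" using reg p(1) by (simp add: S_def)
            ultimately show "cf d (a l) p = 0 \<and> Q p = 0 \<and> S p = 0 \<and> nondeg (cf d (a l)) Q S p"
              using p(2) by (simp add: inc_def)
          qed
        qed
        also have "icount i2 Z L' \<le> card Z"
        proof (rule icount_le_points[OF fZ fL'], rule ccontr)
          fix p l l' assume p: "p \<in> Z" "l \<in> L'" "l' \<in> L'" "i2 p l" "i2 p l'" "l \<noteq> l'"
          have ind: "Im (cnj (\<pi> (tg p l)) * \<pi> (tg p l')) \<noteq> 0" by (rule indep) (use p Z L' in \<open>auto simp: i2_def\<close>)
          have z: "pd (\<pi> (tg p l)) g (\<pi> p) = 0" "pd (\<pi> (tg p l')) g (\<pi> p) = 0"
            using p(4,5) by (simp_all add: i2_def S_def pd_compose_linear[OF g bl])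
          have "pd b g (\<pi> p) = 0" for b by (rule real_derivatives_vanish[OF g z ind])
          then show False using reg p(1) by auto
        qed
        finally have "real (icount inc Z L') \<le> real (card L' * (d + q + q' + 1) ^ 4 + card Z)" by (simp flip: of_nat_add of_nat_mult of_nat_power)
        also have "\<dots> = real ((d + q + q' + 1) ^ 4) * real (card L') + real (card Z)" by simp
        also have "\<dots> \<le> B0 * real (card L') + B0 * real (card Z)"
        proof (rule add_mono)
          show "real ((d + q + q' + 1) ^ 4) * real (card L') \<le> B0 * real (card L')" by (rule mult_right_mono) (simp_all add: B0_def)
          have "1 * real (card Z) \<le> B0 * real (card Z)" by (rule mult_right_mono) (simp_all add: B0_def)
          then show "real (card Z) \<le> B0 * real (card Z)" by simp
        qed
        also have "\<dots> \<le> B0 * (real (card Z) powr (\<alpha> + \<epsilon>) * real (card L') powr \<beta>) + (B0 * real (card L') + B0 * real (card Z))"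
          by (simp add: B0_def)
        finally show ?thesis by (simp add: distrib_left)
      qed
    qed
    then show ?thesis unfolding B_def inc_def .
  qed
  show ?thesis
  proof (rule exI[of _ B], intro conjI B0 allI impI, elim conjE, goal_cases)
    case (1 a P L Q)
    then show ?case by (intro main)
  qed
qed

text \<open>By transversality the complex tangent lines of the two curves span \<complex>^2. Slope 0
  means that the differential of g vanishes on such a line, so here it vanishes altogether.\<close>

lemma tangents_span:
  assumes g: "polyd k g" and J: "tjac f f' p \<noteq> 0" and s: "slope f g p = 0" "slope f' g p = 0"
  shows "pd w g p = 0"
proof -
  define f1 f2 g1 g2 where "f1 = pd (1, 0) f p" and "f2 = pd (0, 1) f p" and "g1 = pd (1, 0) f' p" and "g2 = pd (0, 1) f' p"
  obtain u v where uv: "w = (u, v)" by (cases w)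
  define J where "J = f1 * g2 - f2 * g1"
  have J0: "J \<noteq> 0" using J by (simp add: tjac_def J_def f1_def f2_def g1_def g2_def)
  \<comment> \<open>The coefficients of w along the two tangent directions, by Cramer's
    rule.\<close>
  define \<zeta> \<xi> where "\<zeta> = (u * g1 + v * g2) / J" and "\<xi> = - (u * f1 + v * f2) / J"
  have z: "\<zeta> * J = u * g1 + v * g2" "\<xi> * J = - (u * f1 + v * f2)" using J0 by (simp_all add: \<zeta>_def \<xi>_def)
  have "(\<zeta> * - f2 + \<xi> * - g2) * J = - (\<zeta> * J) * f2 - (\<xi> * J) * g2" by (simp add: algebra_simps)
  also have "\<dots> = u * J" unfolding z by (simp add: J_def algebra_simps)
  finally have u: "u = \<zeta> * - f2 + \<xi> * - g2" using J0 by simp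
  have "(\<zeta> * f1 + \<xi> * g1) * J = (\<zeta> * J) * f1 + (\<xi> * J) * g1" by (simp add: algebra_simps)
  also have "\<dots> = v * J" unfolding z by (simp add: J_def algebra_simps)
  finally have v: "v = \<zeta> * f1 + \<xi> * g1" using J0 by simp
  have "pd w g p = pd ((\<zeta> * - f2, \<zeta> * f1) + (\<xi> * - g2, \<xi> * g1)) g p"
    by (rule arg_cong[where f = "\<lambda>w. pd w g p"]) (simp add: uv u v)
  also have "\<dots> = pd (\<zeta> * - f2, \<zeta> * f1) g p + pd (\<xi> * - g2, \<xi> * g1) g p"
    by (rule linear_add[OF bounded_linear.linear[OF pd_bounded_linear[OF g]]])
  also have "\<dots> = 0"
    using pd_tangent[OF g, of \<zeta> f p] pd_tangent[OF g, of \<xi> f' p] s by (simp add: f1_def f2_def g1_def g2_def)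
  finally show ?thesis .
qed

text \<open>With \<psi> the identity, walls are real hypersurfaces of \<complex>^2. Incidences that
  are good for the wall are left to \<open>good_incidences_bound\<close>; at a regular point of the
  wall two curves that are not good would contradict \<open>tangents_span\<close>, so the remaining
  incidences number at most |Z|.\<close>

theorem admissible_incidence_bound:
  fixes \<alpha> \<beta> \<epsilon> :: real
  assumes ab: "0 \<le> \<alpha>" "0 < \<beta>" "\<beta> \<le> 1" "\<alpha> + \<beta> / 2 = 1" "real (((d + 2) choose 2) - 1) * (1 - \<beta>) = \<alpha>" and eps: "\<epsilon> > 0"
  shows "\<exists>B\<ge>0. \<forall>(a :: 'l \<Rightarrow> nat \<Rightarrow> nat \<Rightarrow> complex) P L. finite P \<and> finite L \<and> admissible d a L \<longrightarrow>
    real (icount (\<lambda>p l. cf d (a l) p = 0) P L) \<le>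
      B * (real (card P) powr (\<alpha> + \<epsilon>) * real (card L) powr \<beta> + real (card P) + real (card L))"
proof -
  obtain C where C: "\<forall>a N (Q :: nat \<Rightarrow> complex \<times> complex \<Rightarrow> real) D. (\<exists>i j. i + j \<le> d \<and> a i j \<noteq> 0) \<and> (\<forall>j<N. polyd (D j) (Q j)) \<longrightarrow>
     finite (sign_vector Q N ` {p. bsum d a (fst p) (snd p) = 0 \<and> (\<forall>j<N. Q j p \<noteq> 0)}) \<and>
     card (sign_vector Q N ` {p. bsum d a (fst p) (snd p) = 0 \<and> (\<forall>j<N. Q j p \<noteq> 0)}) \<le> C * ((\<Sum>j<N. D j) + 1)\<^sup>2"
    using sign_vectors_on_curve[of d] by (rule exE)
  \<comment> \<open>q is 32 * 2 ^ T, so q + 1 \<le> 33 * 2 ^ T.\<close>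
  define K :: real where "K = real (C * 33\<^sup>2)"
  have "\<exists>T>0. \<forall>H. 0 \<le> H \<longrightarrow> H \<le> K * 2 ^ (2 * T) \<longrightarrow> (2 ^ (2 * 2 * T)) powr (1 - \<alpha> - \<epsilon> - \<beta>) * H powr \<beta> \<le> 1 / 2"
    by (rule exists_gain) (use ab eps in \<open>auto simp: K_def\<close>)
  then obtain T where T: "T > 0" and gain: "\<And>H. 0 \<le> H \<Longrightarrow> H \<le> K * 2 ^ (2 * T) \<Longrightarrow> (2 ^ (4 * T)) powr (1 - \<alpha> - \<epsilon> - \<beta>) * H powr \<beta> \<le> 1 / 2"
    by auto
  define q :: nat where "q = 2 * DIM(complex \<times> complex)\<^sup>2 * 2 ^ T"
  obtain B1 where B1: "B1 \<ge> 0" and good: "\<forall>(a :: 'l \<Rightarrow> nat \<Rightarrow> nat \<Rightarrow> complex) P L Q. finite P \<and> finite L \<and> admissible d a L \<and> polyd q Q \<longrightarrow>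
    real (icount (\<lambda>p l. cf d (a l) p = 0 \<and> Q p = 0 \<and> good (cf d (a l)) Q p) P L) \<le>
      B1 * (real (card P) powr (\<alpha> + \<epsilon>) * real (card L) powr \<beta> + real (card P) + real (card L))"
    using good_incidences_bound[OF ab eps, of q] by (elim exE conjE) (rule that)
  define H where "H = real (C * (q + 1)\<^sup>2)"
  define m where "m = (d + 1) ^ 4"
  define N where "N = DIM(complex \<times> complex) * T"
  define B' where "B' = real (N * (DIM(complex \<times> complex) + 1) ^ q) * (B1 + 1)"
  define B where "B = 2 * (real m * H + 2 * B') + B' + real m"
  have HK: "H \<le> K * 2 ^ (2 * T)"
  proof -
    have "q + 1 \<le> 33 * 2 ^ T" by (simp add: q_def)
    then have "(q + 1)\<^sup>2 \<le> (33 * 2 ^ T)\<^sup>2" by (rule power_mono) simp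
    then have "C * (q + 1)\<^sup>2 \<le> C * (33 * 2 ^ T)\<^sup>2" by (rule mult_le_mono2)
    also have "\<dots> = C * 33\<^sup>2 * 2 ^ (2 * T)" by (simp only: power_mult_distrib power_mult[symmetric] mult.assoc mult.commute[of T 2])
    finally have "real (C * (q + 1)\<^sup>2) \<le> real (C * 33\<^sup>2 * 2 ^ (2 * T))" by (rule of_nat_mono)
    then show ?thesis unfolding H_def K_def by simp
  qed
  have B0: "B \<ge> 0" using B1 by (simp add: B_def H_def B'_def)
  have main: "real (icount (\<lambda>p l. cf d (a l) p = 0) P L) \<le>
      B * (real (card P) powr (\<alpha> + \<epsilon>) * real (card L) powr \<beta> + real (card P) + real (card L))"
    if P: "finite P" and L: "finite L" and adm: "admissible d a L"
    for a :: "'l \<Rightarrow> nat \<Rightarrow> nat \<Rightarrow> complex" and P L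
  proof -
    define inc where "inc = (\<lambda>p l. cf d (a l) p = 0)"
    have "real (icount inc P L) \<le> (2 * (real m * H + 2 * B') + B' + real m) *
      (real (card P) powr (\<alpha> + \<epsilon>) * real (card L) powr \<beta> + real (card P) + real (card L))"
    proof (rule incidence_bound_by_partition[where \<psi> = "\<lambda>p. p", OF P L T _ _ ab(1-3) eps N_def q_def _ _ _ _ B'_def])
      show "(2 ^ N) powr (1 - \<alpha> - \<epsilon> - \<beta>) * H powr \<beta> \<le> 1 / 2"
        using gain[OF _ HK] by (simp add: N_def H_def)
      show "H \<ge> 0" "B1 + 1 \<ge> 0" using B1 by (simp_all add: H_def)
      show "real (card L') \<le> real (card P') powr \<alpha> * real (card L') powr \<beta>"
        if "P' \<subseteq> P" "L' \<subseteq> L" and r: "\<forall>l\<in>L'. card {p \<in> P'. inc p l} > m" for P' L'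
      proof (rule rich_exponents[OF ab(5) ab(4) ab(2,3)], rule rich_curves_card)
        show fP': "finite P'" using that(1) P by (rule finite_subset)
        show "admissible d a L'" by (rule admissible_subset[OF adm that(2)])
        show "(d + 1) ^ 4 < card {p \<in> P'. cf d (a l) p = 0}" if "l \<in> L'" for l using r that by (auto simp: m_def inc_def)
      qed
      show "real (card (sign_vector (\<lambda>j p. R j p) N ` X)) \<le> H"
        if l: "l \<in> L" and X: "X \<subseteq> P" and R: "\<forall>j<N. polyd (D j) (R j)" and D: "(\<Sum>j<N. D j) \<le> q"
          and XX: "\<forall>p\<in>X. inc p l \<and> (\<forall>j<N. R j p \<noteq> 0)" for R :: "nat \<Rightarrow> complex \<times> complex \<Rightarrow> real" and D X l
      proof -
        define Y where "Y = {p. bsum d (a l) (fst p) (snd p) = 0 \<and> (\<forall>j<N. R j p \<noteq> 0)}"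
        have Y: "finite (sign_vector R N ` Y) \<and> card (sign_vector R N ` Y) \<le> C * ((\<Sum>j<N. D j) + 1)\<^sup>2"
          unfolding Y_def by (rule C[rule_format]) (use admissible_nonzero[OF adm l] R in simp)
        have "X \<subseteq> Y" using XX by (auto simp: Y_def inc_def cf_def)
        then have "card (sign_vector R N ` X) \<le> card (sign_vector R N ` Y)"
          using Y by (intro card_mono image_mono) simp_all
        also have "\<dots> \<le> C * ((\<Sum>j<N. D j) + 1)\<^sup>2" using Y by simp
        also have "\<dots> \<le> C * (q + 1)\<^sup>2" using D by (intro mult_le_mono2 power_mono) simp_all
        finally show ?thesis unfolding H_def by (rule of_nat_mono)
      qed
      show "real (icount inc Z L') \<le> (B1 + 1) * (real (card Z) powr (\<alpha> + \<epsilon>) * real (card L') powr \<beta> + real (card Z) + real (card L'))"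
        if Z: "Z \<subseteq> P" and L': "L' \<subseteq> L" and g: "polyd q g"
          and reg: "\<forall>p\<in>Z. g p = 0 \<and> (\<exists>b\<in>Basis. pd b g p \<noteq> 0)" for g :: "complex \<times> complex \<Rightarrow> real" and Z L'
      proof -
        have fZ: "finite Z" and fL': "finite L'" using Z L' P L finite_subset by blast+
        define i1 where "i1 = (\<lambda>p l. cf d (a l) p = 0 \<and> g p = 0 \<and> good (cf d (a l)) g p)"
        define i2 where "i2 = (\<lambda>p l. inc p l \<and> \<not> good (cf d (a l)) g p)"
        define X where "X = real (card Z) powr (\<alpha> + \<epsilon>) * real (card L') powr \<beta> + real (card Z) + real (card L')"
        have "icount inc Z L' \<le> icount (\<lambda>p l. i1 p l \<or> i2 p l) Z L'"
          by (rule icount_mono[OF fZ fL']) (use reg in \<open>auto simp: i1_def i2_def inc_def\<close>)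
        also have "\<dots> \<le> icount i1 Z L' + icount i2 Z L'" by (rule icount_disj[OF fZ fL'])
        also have "icount i2 Z L' \<le> card Z"
        proof (rule icount_le_points[OF fZ fL'], rule ccontr)
          fix p l l' assume p: "p \<in> Z" "l \<in> L'" "l' \<in> L'" "i2 p l" "i2 p l'" "l \<noteq> l'"
          have J: "tjac (cf d (a l)) (cf d (a l')) p \<noteq> 0"
            by (rule admissible_transversal[OF adm]) (use p L' in \<open>auto simp: i2_def inc_def\<close>)
          \<comment> \<open>A nonzero Jacobian excludes zero gradients, so failing to be good means
            slope 0 for both curves.\<close>
          then have s: "slope (cf d (a l)) g p = 0" "slope (cf d (a l')) g p = 0"
            using p(4,5) by (auto simp: i2_def good_def tjac_def)
          have "pd b g p = 0" for b by (rule tangents_span[OF g J s])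
          then show False using bspec[OF reg p(1)] by blast
        qed
        finally have "real (icount inc Z L') \<le> real (icount i1 Z L') + real (card Z)" by (simp flip: of_nat_add)
        also have "real (icount i1 Z L') \<le> B1 * X"
          unfolding i1_def X_def by (rule good[rule_format]) (use fZ fL' admissible_subset[OF adm L'] g in simp)
        also have "real (card Z) \<le> X" by (simp add: X_def)
        finally show ?thesis unfolding X_def[symmetric] by (simp add: distrib_right)
      qed
    qed
    then show ?thesis unfolding B_def inc_def .
  qed
  show ?thesis
  proof (rule exI[of _ B], intro conjI B0 allI impI, elim conjE, goal_cases)
    case (1 a P L)
    then show ?case by (intro main)
  qed
qed

section \<open>Curves given by bivariate polynomials\<close>

lemma poly_eq_sum_atMost:
  fixes q :: "'a::comm_semiring_1 poly"
  assumes "degree q \<le> n"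
  shows "poly q x = (\<Sum>i\<le>n. poly.coeff q i * x ^ i)"
  unfolding poly_altdef
  by (rule sum.mono_neutral_left) (use assms in \<open>auto intro!: le_degree\<close>)

lemma eval2_eq_sum:
  assumes "degree f \<le> n"
  shows "eval2 f p = (\<Sum>i\<le>n. poly (poly.coeff f i) (snd p) * fst p ^ i)"
proof -
  have "degree (map_poly (\<lambda>c. poly c (snd p)) f) \<le> n"
    using map_poly_degree_leq[of "\<lambda>c. poly c (snd p)" f] assms by linarith
  then show ?thesis unfolding eval2_def by (simp add: poly_eq_sum_atMost coeff_map_poly)
qed

lemma tdeg_bound:
  assumes "tdeg f \<le> d"
  shows "degree f \<le> d" "i \<le> d \<Longrightarrow> degree (poly.coeff f i) \<le> d - i" "i \<le> degree f \<Longrightarrow> i + degree (poly.coeff f i) \<le> d"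
proof -
  have "finite {i + degree (poly.coeff f i) | i. i \<le> degree f}" by (rule finite_image_set) simp
  then have le: "i + degree (poly.coeff f i) \<le> d" if "i \<le> degree f" for i
    using Max_ge[of "{i + degree (poly.coeff f i) | i. i \<le> degree f}" "i + degree (poly.coeff f i)"] that assms
    unfolding tdeg_def by fastforce
  show "degree f \<le> d" using le[of "degree f"] by simp
  show "i \<le> degree f \<Longrightarrow> i + degree (poly.coeff f i) \<le> d" by (rule le)
  show "degree (poly.coeff f i) \<le> d - i" if "i \<le> d"
  proof (cases "i \<le> degree f")
    case True then show ?thesis using le[of i] by simp
  next
    case False then show ?thesis by (simp add: coeff_eq_0)
  qed
qed

definition coefs :: "bipoly \<Rightarrow> nat \<Rightarrow> nat \<Rightarrow> complex" where
  "coefs f i j = poly.coeff (poly.coeff f i) j"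

lemma eval2_eq_cf:
  assumes "tdeg f \<le> d"
  shows "eval2 f p = cf d (coefs f) p"
proof -
  have "eval2 f p = (\<Sum>i\<le>d. poly (poly.coeff f i) (snd p) * fst p ^ i)"
    by (rule eval2_eq_sum[OF tdeg_bound(1)[OF assms]])
  also have "\<dots> = (\<Sum>i\<le>d. \<Sum>j\<le>d - i. coefs f i j * fst p ^ i * snd p ^ j)"
  proof (rule sum.cong[OF refl])
    fix i assume i: "i \<in> {..d}"
    have "degree (poly.coeff f i) \<le> d - i" by (rule tdeg_bound(2)[OF assms]) (use i in simp)
    then show "poly (poly.coeff f i) (snd p) * fst p ^ i = (\<Sum>j\<le>d - i. coefs f i j * fst p ^ i * snd p ^ j)"
      by (simp add: poly_eq_sum_atMost coefs_def sum_distrib_left sum_distrib_right mult_ac)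
  qed
  finally show ?thesis by (simp add: cf_def bsum_def)
qed

text \<open>Partial derivatives are read off from one-variable polynomials on coordinate lines, by
  the chain rule and uniqueness of derivatives.\<close>

lemma pd_along_section:
  assumes h: "polyd k h" and \<gamma>: "(\<gamma> has_derivative \<gamma>') (at t)" and g: "((\<lambda>t. h (\<gamma> t)) has_field_derivative D) (at t)"
  shows "pd (\<gamma>' 1) h (\<gamma> t) = D"
proof -
  have "((\<lambda>t. h (\<gamma> t)) has_derivative (\<lambda>s. pd (\<gamma>' s) h (\<gamma> t))) (at t)"
    by (rule has_derivative_compose[OF \<gamma> pd_has_derivative[OF h]])
  moreover have "((\<lambda>t. h (\<gamma> t)) has_derivative (*) D) (at t)"
    using g by (simp add: has_field_derivative_def)
  ultimately have "(\<lambda>s. pd (\<gamma>' s) h (\<gamma> t)) = (*) D" by (rule has_derivative_unique)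
  from fun_cong[OF this, of 1] show ?thesis by simp
qed

lemma eval2_dx:
  assumes "tdeg f \<le> d"
  shows "eval2 (dx f) p = pd (1, 0) (cf d (coefs f)) p"
proof -
  define q where "q = map_poly (\<lambda>c. poly c (snd p)) f"
  have "pd (1, 0) (cf d (coefs f)) (fst p, snd p) = poly (pderiv q) (fst p)"
  proof (rule pd_along_section[where h = "cf d (coefs f)" and \<gamma> = "\<lambda>t. (t, snd p)" and \<gamma>' = "\<lambda>s. (s, 0)" and t = "fst p", OF polyd_cf])
    show "((\<lambda>t. (t, snd p)) has_derivative (\<lambda>s. (s, 0))) (at (fst p))" by (auto intro!: derivative_eq_intros)
    have "(\<lambda>t. cf d (coefs f) (t, snd p)) = poly q"
      by (rule ext) (simp add: eval2_eq_cf[OF assms, symmetric] eval2_def q_def)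
    then show "((\<lambda>t. cf d (coefs f) (t, snd p)) has_field_derivative poly (pderiv q) (fst p)) (at (fst p))"
      by (simp add: poly_DERIV)
  qed
  moreover have "pderiv q = map_poly (\<lambda>c. poly c (snd p)) (pderiv f)"
    by (rule poly_eqI) (simp add: q_def coeff_pderiv coeff_map_poly of_nat_poly algebra_simps)
  ultimately show ?thesis by (simp add: eval2_def dx_def)
qed

lemma eval2_dy:
  assumes "tdeg f \<le> d"
  shows "eval2 (dy f) p = pd (0, 1) (cf d (coefs f)) p"
proof -
  have "degree (dy f) \<le> degree f" unfolding dy_def by (rule map_poly_degree_leq)
  then have e: "eval2 (dy f) p = (\<Sum>i\<le>degree f. poly (pderiv (poly.coeff f i)) (snd p) * fst p ^ i)"
    by (simp add: eval2_eq_sum dy_def coeff_map_poly)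
  have "pd (0, 1) (cf d (coefs f)) (fst p, snd p) = eval2 (dy f) p"
  proof (rule pd_along_section[where h = "cf d (coefs f)" and \<gamma> = "\<lambda>t. (fst p, t)" and \<gamma>' = "\<lambda>s. (0, s)" and t = "snd p", OF polyd_cf])
    show "((\<lambda>t. (fst p, t)) has_derivative (\<lambda>s. (0, s))) (at (snd p))" by (auto intro!: derivative_eq_intros)
    have "(\<lambda>t. cf d (coefs f) (fst p, t)) = (\<lambda>t. \<Sum>i\<le>degree f. poly (poly.coeff f i) t * fst p ^ i)"
      by (rule ext) (simp add: eval2_eq_cf[OF assms, symmetric] eval2_eq_sum[OF order_refl])
    moreover have "((\<lambda>t. \<Sum>i\<le>degree f. poly (poly.coeff f i) t * fst p ^ i) has_field_derivative
        (\<Sum>i\<le>degree f. poly (pderiv (poly.coeff f i)) (snd p) * fst p ^ i)) (at (snd p))"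
      by (intro DERIV_sum DERIV_cmult_right poly_DERIV)
    ultimately show "((\<lambda>t. cf d (coefs f) (fst p, t)) has_field_derivative eval2 (dy f) p) (at (snd p))"
      by (simp add: e)
  qed
  then show ?thesis by simp
qed

lemma admissible_curves:
  assumes c: "\<forall>l\<in>L. is_curve d l" and t: "\<forall>l\<in>L. \<forall>l'\<in>L. l \<noteq> l' \<longrightarrow> transversal l l'"
  shows "admissible d coefs L"
proof -
  have d: "tdeg l \<le> d" if "l \<in> L" for l using c that by (simp add: is_curve_def)
  have "\<exists>i j. i + j \<le> d \<and> coefs l i j \<noteq> 0" if l: "l \<in> L" for l
  proof -
    have "tdeg l \<ge> 1" using c l by (simp add: is_curve_def)
    \<comment> \<open>The zero polynomial has \<open>tdeg\<close> 0.\<close>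
    then have "l \<noteq> 0" by (auto simp: tdeg_def)
    then have "coefs l (degree l) (degree (poly.coeff l (degree l))) \<noteq> 0"
      by (simp add: coefs_def leading_coeff_neq_0)
    then show ?thesis using tdeg_bound(3)[OF d[OF l], of "degree l"] by blast
  qed
  moreover have "tjac (cf d (coefs l)) (cf d (coefs l')) p \<noteq> 0"
    if l: "l \<in> L" "l' \<in> L" "l \<noteq> l'" and z: "cf d (coefs l) p = 0" "cf d (coefs l') p = 0" for l l' p
  proof -
    have "p \<in> zset l \<inter> zset l'" using z by (simp add: zset_def eval2_eq_cf[OF d[OF l(1)]] eval2_eq_cf[OF d[OF l(2)]])
    moreover have "transversal l l'" using t l by simp
    ultimately have "eval2 (dx l) p * eval2 (dy l') p - eval2 (dy l) p * eval2 (dx l') p \<noteq> 0"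
      unfolding transversal_def by simp
    then show ?thesis
      unfolding tjac_def eval2_dx[OF d[OF l(1)], symmetric] eval2_dx[OF d[OF l(2)], symmetric]
        eval2_dy[OF d[OF l(1)], symmetric] eval2_dy[OF d[OF l(2)], symmetric] .
  qed
  ultimately show ?thesis unfolding admissible_def by (intro conjI ballI impI allI) simp_all
qed

lemma card_incidences:
  assumes "finite P" "finite L" "\<forall>l\<in>L. is_curve d l"
  shows "card (incidences P L) = icount (\<lambda>p l. cf d (coefs l) p = 0) P L"
proof -
  have "cf d (coefs l) p = eval2 l p" if "l \<in> L" for l p
    by (rule eval2_eq_cf[symmetric]) (use assms(3) that in \<open>simp add: is_curve_def\<close>)
  then have "incidences P L = {x \<in> P \<times> L. cf d (coefs (snd x)) (fst x) = 0}"
    by (auto simp: incidences_def zset_def)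
  then show ?thesis by (simp add: icount_eq_card[OF assms(1,2)])
qed

section \<open>Moving the loss from the points to the curves\<close>

lemma multiple_points_card:
  assumes adm: "admissible d a L" and L: "finite L" and P: "finite P"
    and two: "\<And>p. p \<in> P \<Longrightarrow> \<exists>l\<in>L. \<exists>l'\<in>L. l \<noteq> l' \<and> cf d (a l) p = 0 \<and> cf d (a l') p = 0"
  shows "card P \<le> (d + 1) ^ 4 * (card L)\<^sup>2"
proof -
  define S where "S = {x \<in> L \<times> L. fst x \<noteq> snd x}"
  define X where "X = (\<lambda>x. {p \<in> P. cf d (a (fst x)) p = 0 \<and> cf d (a (snd x)) p = 0})"
  have fS: "finite S" using L by (simp add: S_def)
  have "P \<subseteq> (\<Union>x\<in>S. X x)"
  proof
    fix p assume p: "p \<in> P"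
    from two[OF p] obtain l l' where l: "l \<in> L" "l' \<in> L" "l \<noteq> l'" "cf d (a l) p = 0" "cf d (a l') p = 0" by (elim bexE conjE)
    have "(l, l') \<in> S" using l by (simp add: S_def)
    moreover have "p \<in> X (l, l')" using l p by (simp add: X_def)
    ultimately show "p \<in> (\<Union>x\<in>S. X x)" by blast
  qed
  then have "card P \<le> card (\<Union>x\<in>S. X x)" by (rule card_mono[rotated]) (use fS P in \<open>auto simp: X_def\<close>)
  also have "\<dots> \<le> (\<Sum>x\<in>S. card (X x))" by (rule card_UN_le[OF fS])
  also have "\<dots> \<le> of_nat (card S) * (d + 1) ^ 4"
  proof (rule sum_bounded_above)
    fix x assume x: "x \<in> S"
    show "card (X x) \<le> (d + 1) ^ 4"
      by (rule common_points_card[OF adm, of "fst x" "snd x"]) (use x P in \<open>auto simp: S_def X_def\<close>)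
  qed
  also have "\<dots> \<le> (card L)\<^sup>2 * (d + 1) ^ 4"
    using card_mono[of "L \<times> L" S] L by (simp add: S_def card_cartesian_product power2_eq_square)
  finally show ?thesis by (simp add: mult.commute)
qed

text \<open>Points on at most one curve are paid for by |P|. For the others, |P2| \<le> (d + 1) ^ 4
  * |L| ^ 2 makes |P2| powr (\<epsilon> / 2) at most a constant times |L| powr \<epsilon>, which is
  why \<open>bound\<close> is stated with \<epsilon> / 2.\<close>

lemma swapped_incidence_bound:
  fixes \<alpha> \<beta> \<epsilon> B :: real
  assumes adm: "admissible d a L" and fin: "finite P" "finite L" and pos: "0 \<le> \<alpha>" "\<epsilon> > 0" "B \<ge> 0"
    and bound: "\<And>P'. P' \<subseteq> P \<Longrightarrow> real (icount (\<lambda>p l. cf d (a l) p = 0) P' L) \<le>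
      B * (real (card P') powr (\<alpha> + \<epsilon> / 2) * real (card L) powr \<beta> + real (card P') + real (card L))"
  shows "real (icount (\<lambda>p l. cf d (a l) p = 0) P L) \<le> (B * real ((d + 1) ^ 4) powr (\<epsilon> / 2) + B + 1) *
      (real (card P) powr \<alpha> * real (card L) powr (\<beta> + \<epsilon>) + real (card P) + real (card L))"
proof (cases "L = {}")
  case True
  then show ?thesis using pos by (simp add: icount_def)
next
  case False
  define inc where "inc = (\<lambda>p l. cf d (a l) p = 0)"
  define n m where "n = real (card P)" and "m = real (card L)"
  define b where "b = real ((d + 1) ^ 4) powr (\<epsilon> / 2)"
  have m: "m > 0" using False fin by (simp add: m_def card_gt_0_iff)
  define P2 where "P2 = {p \<in> P. \<exists>l\<in>L. \<exists>l'\<in>L. l \<noteq> l' \<and> inc p l \<and> inc p l'}"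
  have P2P: "P2 \<subseteq> P" and fP2: "finite P2" using fin by (auto simp: P2_def)
  have "icount inc P L \<le> icount inc (P - P2) L + icount inc P2 L"
    using icount_UN_le[of "{False, True}" L "\<lambda>b. if b then P2 else P - P2" P inc] fin fP2 by (force simp: if_split)
  moreover have "icount inc (P - P2) L \<le> card (P - P2)"
    by (rule icount_le_points) (use fin in \<open>auto simp: P2_def\<close>)
  moreover have "card (P - P2) \<le> card P" by (rule card_mono) (use fin in auto)
  ultimately have 1: "real (icount inc P L) \<le> n + real (icount inc P2 L)" by (simp add: n_def flip: of_nat_add)
  have n2: "real (card P2) \<le> n" using card_mono[OF fin(1) P2P] by (simp add: n_def)
  have "card P2 \<le> (d + 1) ^ 4 * (card L)\<^sup>2"
    by (rule multiple_points_card[OF adm fin(2) fP2]) (simp add: P2_def inc_def)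
  then have "real (card P2) \<le> real ((d + 1) ^ 4 * (card L)\<^sup>2)" by (rule of_nat_mono)
  then have "real (card P2) powr (\<epsilon> / 2) \<le> (real ((d + 1) ^ 4) * m\<^sup>2) powr (\<epsilon> / 2)"
    by (intro powr_mono2) (use pos in \<open>simp_all add: m_def\<close>)
  also have "\<dots> = b * (m powr 2) powr (\<epsilon> / 2)" using m by (simp add: b_def powr_mult)
  also have "\<dots> = b * m powr \<epsilon>" by (simp add: powr_powr)
  finally have 2: "real (card P2) powr (\<epsilon> / 2) \<le> b * m powr \<epsilon>" .
  have "real (card P2) powr (\<alpha> + \<epsilon> / 2) * m powr \<beta> = real (card P2) powr \<alpha> * real (card P2) powr (\<epsilon> / 2) * m powr \<beta>"
    by (simp add: powr_add)
  also have "\<dots> \<le> n powr \<alpha> * (b * m powr \<epsilon>) * m powr \<beta>"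
    by (intro mult_right_mono mult_mono 2 powr_mono2) (use pos n2 in auto)
  also have "\<dots> = b * (n powr \<alpha> * m powr (\<beta> + \<epsilon>))" by (simp add: powr_add)
  finally have 3: "real (card P2) powr (\<alpha> + \<epsilon> / 2) * m powr \<beta> \<le> b * (n powr \<alpha> * m powr (\<beta> + \<epsilon>))" .
  define X where "X = n powr \<alpha> * m powr (\<beta> + \<epsilon>)"
  have X: "X \<ge> 0" "b \<ge> 0" "n \<ge> 0" by (simp_all add: X_def b_def n_def)
  have "real (icount inc P2 L) \<le> B * (real (card P2) powr (\<alpha> + \<epsilon> / 2) * m powr \<beta> + real (card P2) + m)"
    unfolding inc_def m_def by (rule bound[OF P2P])
  also have "\<dots> \<le> B * (b * X + n + m)" unfolding X_def by (intro mult_left_mono add_mono 3 n2 pos order_refl)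
  finally have "real (icount inc P L) \<le> n + B * (b * X + n + m)" using 1 by simp
  also have "\<dots> \<le> (B * b + B + 1) * X + (B * b + B + 1) * n + (B * b + B + 1) * m"
  proof -
    have "0 \<le> (B + 1) * X + B * b * n + B * b * m + m" using X pos m by (intro add_nonneg_nonneg mult_nonneg_nonneg) simp_all
    then show ?thesis by (simp add: algebra_simps)
  qed
  finally show ?thesis unfolding X_def inc_def b_def n_def m_def by (simp only: distrib_left)
qed

theorem theorem1p6:
  fixes d :: nat and \<epsilon> :: real
  assumes "d \<ge> 1" and "\<epsilon> > 0"
  defines "A \<equiv> real ((d + 2) choose 2) - 1"
  shows "\<exists>C::real. \<forall>(P :: (complex \<times> complex) set) (L :: bipoly set).
     finite P \<and> finite L \<and> (\<forall>l\<in>L. is_curve d l) \<and>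
     (\<forall>l\<in>L. \<forall>l'\<in>L. l \<noteq> l' \<longrightarrow> no_common_component l l' \<and> transversal l l')
     \<longrightarrow>
     real (card (incidences P L)) \<le> C * (real (card P) powr (A / (2*A - 1) + \<epsilon>) *
            real (card L) powr ((2*A - 2) / (2*A - 1)) + real (card P) + real (card L))
   \<and> real (card (incidences P L)) \<le> C * (real (card P) powr (A / (2*A - 1)) *
            real (card L) powr ((2*A - 2) / (2*A - 1) + \<epsilon>) + real (card P) + real (card L))"
proof -
  define \<alpha> \<beta> where "\<alpha> = A / (2 * A - 1)" and "\<beta> = (2 * A - 2) / (2 * A - 1)"
  obtain e where e: "d = Suc e" using assms(1) by (cases d) auto
  \<comment> \<open>The hypothesis d \<ge> 1 gives A \<ge> 2, and with it \<beta> > 0.\<close>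
  have choose: "(d + 2) choose 2 \<ge> 3" unfolding e by (simp add: numeral_2_eq_2)
  then have A: "A \<ge> 2" by (simp add: A_def)
  have A': "real (((d + 2) choose 2) - 1) = A" using choose by (simp add: A_def of_nat_diff)
  have ab: "0 \<le> \<alpha>" "0 < \<beta>" "\<beta> \<le> 1" "\<alpha> + \<beta> / 2 = 1" "real (((d + 2) choose 2) - 1) * (1 - \<beta>) = \<alpha>"
  proof -
    \<comment> \<open>With D = 2 * A - 1 the exponents are (D + 1) / (2 * D) and (D - 1) / D, from
      which both relations between them are immediate.\<close>
    define D where "D = 2 * A - 1"
    have D: "D \<ge> 3" "A = (D + 1) / 2" "\<alpha> = (D + 1) / 2 / D" "\<beta> = (D - 1) / D"
      using A by (simp_all add: D_def \<alpha>_def \<beta>_def)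
    show "0 \<le> \<alpha>" "0 < \<beta>" "\<beta> \<le> 1" "\<alpha> + \<beta> / 2 = 1" "real (((d + 2) choose 2) - 1) * (1 - \<beta>) = \<alpha>"
      unfolding A' D(2-4) using D(1) by (simp_all add: field_simps)
  qed
  obtain B1 where B1: "B1 \<ge> 0" "\<forall>(a :: bipoly \<Rightarrow> nat \<Rightarrow> nat \<Rightarrow> complex) P L. finite P \<and> finite L \<and> admissible d a L \<longrightarrow>
    real (icount (\<lambda>p l. cf d (a l) p = 0) P L) \<le>
      B1 * (real (card P) powr (\<alpha> + \<epsilon>) * real (card L) powr \<beta> + real (card P) + real (card L))"
    using admissible_incidence_bound[OF ab assms(2)] by (elim exE conjE) (rule that)
  have eps2: "\<epsilon> / 2 > 0" using assms(2) by simp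
  obtain B2 where B2: "B2 \<ge> 0" "\<forall>(a :: bipoly \<Rightarrow> nat \<Rightarrow> nat \<Rightarrow> complex) P L. finite P \<and> finite L \<and> admissible d a L \<longrightarrow>
    real (icount (\<lambda>p l. cf d (a l) p = 0) P L) \<le>
      B2 * (real (card P) powr (\<alpha> + \<epsilon> / 2) * real (card L) powr \<beta> + real (card P) + real (card L))"
    using admissible_incidence_bound[OF ab eps2] by (elim exE conjE) (rule that)
  define B3 where "B3 = B2 * real ((d + 1) ^ 4) powr (\<epsilon> / 2) + B2 + 1"
  have B3: "B3 \<ge> 0" using B2(1) by (simp add: B3_def)
  show ?thesis unfolding \<alpha>_def[symmetric] \<beta>_def[symmetric]
  \<comment> \<open>One constant serves both inequalities: B1 is the constant for \<epsilon>, and B3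
    comes from the one for \<epsilon> / 2.\<close>
  proof (rule exI[of _ "B1 + B3"], intro allI impI, elim conjE)
    fix P :: "(complex \<times> complex) set" and L :: "bipoly set"
    assume P: "finite P" and L: "finite L" and c: "\<forall>l\<in>L. is_curve d l"
      and t: "\<forall>l\<in>L. \<forall>l'\<in>L. l \<noteq> l' \<longrightarrow> no_common_component l l' \<and> transversal l l'"
    have adm: "admissible d coefs L" by (rule admissible_curves[OF c]) (use t in simp)
    have inc: "card (incidences P L) = icount (\<lambda>p l. cf d (coefs l) p = 0) P L" by (rule card_incidences[OF P L c])
    have 1: "real (card (incidences P L)) \<le> B1 * (real (card P) powr (\<alpha> + \<epsilon>) * real (card L) powr \<beta> + real (card P) + real (card L))"
      unfolding inc by (rule B1(2)[rule_format]) (simp add: P L adm)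
    have 2: "real (card (incidences P L)) \<le> B3 * (real (card P) powr \<alpha> * real (card L) powr (\<beta> + \<epsilon>) + real (card P) + real (card L))"
      unfolding inc B3_def
    proof (rule swapped_incidence_bound[OF adm P L ab(1) assms(2) B2(1)])
      fix P' assume "P' \<subseteq> P"
      then have "finite P'" using P by (rule finite_subset)
      then show "real (icount (\<lambda>p l. cf d (coefs l) p = 0) P' L) \<le>
          B2 * (real (card P') powr (\<alpha> + \<epsilon> / 2) * real (card L) powr \<beta> + real (card P') + real (card L))"
        by (intro B2(2)[rule_format]) (simp add: L adm)
    qed
    have "B1 * (real (card P) powr (\<alpha> + \<epsilon>) * real (card L) powr \<beta> + real (card P) + real (card L))
        \<le> (B1 + B3) * (real (card P) powr (\<alpha> + \<epsilon>) * real (card L) powr \<beta> + real (card P) + real (card L))"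
      by (rule mult_right_mono) (use B3 in auto)
    moreover have "B3 * (real (card P) powr \<alpha> * real (card L) powr (\<beta> + \<epsilon>) + real (card P) + real (card L))
        \<le> (B1 + B3) * (real (card P) powr \<alpha> * real (card L) powr (\<beta> + \<epsilon>) + real (card P) + real (card L))"
      by (rule mult_right_mono) (use B1 in auto)
    ultimately show "real (card (incidences P L)) \<le> (B1 + B3) * (real (card P) powr (\<alpha> + \<epsilon>) * real (card L) powr \<beta> + real (card P) + real (card L))
      \<and> real (card (incidences P L)) \<le> (B1 + B3) * (real (card P) powr \<alpha> * real (card L) powr (\<beta> + \<epsilon>) + real (card P) + real (card L))"
      using 1 2 by linarith
  qed
qed

end
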